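(* Let $n\geqslant 4$ be an integer and let $A$ be a complex abelian variety endowed with a group of automorphisms $G$ isomorphic to the generalized quaternion group $Q(2^n)$. Then the isotypical decomposition of $A$ with respect to $G$ is given by $$A \sim A_{G} \times \prod_{i=1}^3 \mathrm{Prym}(A_{N_i}/A_{G}) \times \mathrm{Prym}(A/A_{Z}) \times \prod_{i=2}^{n-2}\mathrm{Prym}(A_{K_i}/A_{K_{i+1}}).$$ Moreover, two group algebra decompositions of $A$ with respect to $G$ are given by $$A \sim A_{G} \times \prod_{i=1}^3 \mathrm{Prym}(A_{N_i}/A_{G}) \times \mathrm{Prym}(A/A_{Z}) \times \prod_{j=2}^{n-2}\mathrm{Prym}(A_{H_j}/A_{H_{j+1}})^2$$ and $$A \sim A_{G} \times \prod_{i=1}^3 \mathrm{Prym}(A_{N_i}/A_{G}) \times \mathrm{Prym}(A/A_{Z}) \times \prod_{j=2}^{n-2}\mathrm{Prym}(A_{\tilde H_j}/A_{\tilde H_{j+1}})^2.$$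
   Context: $Q(2^n)=\langle x,y : x^{2^{n-1}}=1,\ y^2x^{2^{n-2}}=1,\ yxy^{-1}x=1\rangle$, a group of order $2^n$. Identify $G$ with $Q(2^n)$ and consider its subgroups $K_i=\langle x^{2^{n-i}}\rangle$ for $2\leqslant i\leqslant n$, $H_j=\langle x^{2^{n-j}},y\rangle$ and $\tilde H_j=\langle x^{2^{n-j}},xy\rangle$ for $2\leqslant j\leqslant n-1$. Put $Z=K_2=\langle y^2\rangle$, $N_1=K_n=\langle x\rangle$, $N_2=H_{n-1}=\langle x^2,y\rangle$, $N_3=\tilde H_{n-1}=\langle x^2,xy\rangle$. A group of automorphisms $G$ of $A$ means a finite subgroup of the group of automorphisms of the abelian variety $A$ (fixing the origin). It induces a $\mathbb{Q}$-algebra homomorphism $\Xi:\mathbb{Q}[G]\to \mathrm{End}_{\mathbb{Q}}(A)=\mathrm{End}(A)\otimes_{\mathbb Z}\mathbb{Q}$. For a subgroup $K\leqslant G$ put $p_K=\sum_{k\in K}k$ and $A_K=\mathrm{Im}(\Xi(p_K))$, an abelian subvariety of $A$ (on which $K$ acts trivially). If $K_1\leqslant K_2\leqslant G$ then $A_{K_2}\subseteq A_{K_1}$ and there is an abelian subvariety $P$ of $A_{K_1}$ with $A_{K_1}\sim P\times A_{K_2}$; this complement is denoted $\mathrm{Prym}(A_{K_1}/A_{K_2})$ (all statements are up to isogeny). The symbol $\sim$ denotes isogeny. Isotypical decomposition: let $W_1,\dots,W_r$ be the rational irreducible representations of $G$, $V_l$ a complex irreducible representation of $G$ associated to (i.e.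 a constituent of $W_l\otimes\mathbb{C}$) $W_l$, with degree $d_{V_l}$, character $\chi_{V_l}$, character field $K_{V_l}$ and Schur index $s_{V_l}$. Let $e_l=\frac{d_{V_l}}{|G|}\sum_{g\in G}\mathrm{tr}_{K_{V_l}|\mathbb{Q}}(\chi_{V_l}(g^{-1}))\,g$ and $A_l=\mathrm{Im}\,\Xi(\alpha_l e_l)$, with $\alpha_l$ a positive integer such that $\alpha_le_l\in\mathbb{Z}[G]$. The isogeny $A\sim A_1\times\cdots\times A_r$ is the isotypical decomposition of $A$ with respect to $G$. Group algebra decomposition: write each $e_l=f_{l1}+\cdots+f_{ln_l}$ as a sum of $n_l=d_{V_l}/s_{V_l}$ orthogonal primitive idempotents of $\mathbb{Q}[G]$; the images in $A$ of (integer multiples of) $f_{l1},\dots,f_{ln_l}$ are pairwise isogenous abelian subvarieties, and if $B_l$ is one of them then $A_l\sim B_l^{n_l}$. The isogeny $A\sim B_1^{n_1}\times\cdots\times B_r^{n_r}$ is called a group algebra decomposition of $A$ with respect to $G$. Factors (isotypical or $B_l$) are considered up to isogeny and may be zero-dimensional. *)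

theory Defs
  imports
    Complex_Main
    "HOL-Library.Function_Algebras"
    "HOL-Algebra.Bij"
    "HOL-Algebra.Generated_Groups"
    "Jordan_Normal_Form.Matrix"
begin

section \<open>Complex vector spaces\<close>

class complex_vs = ab_group_add +
  fixes scaleC :: "complex \<Rightarrow> 'a \<Rightarrow> 'a"  (infixr "*\<^sub>C" 75)
  assumes scaleC_add_right: "a *\<^sub>C (x + y) = a *\<^sub>C x + a *\<^sub>C y"
    and scaleC_add_left: "(a + b) *\<^sub>C x = a *\<^sub>C x + b *\<^sub>C x"
    and scaleC_scaleC: "a *\<^sub>C (b *\<^sub>C x) = (a * b) *\<^sub>C x"
    and scaleC_one: "1 *\<^sub>C x = x"

instantiation "fun" :: (type, complex_vs) complex_vs
begin

definition scaleC_fun :: "complex \<Rightarrow> ('a \<Rightarrow> 'b) \<Rightarrow> 'a \<Rightarrow> 'b" where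
  "scaleC_fun c f = (\<lambda>i. c *\<^sub>C f i)"

instance
  by standard
    (simp_all add: scaleC_fun_def plus_fun_def fun_eq_iff scaleC_add_right scaleC_add_left
      scaleC_scaleC scaleC_one)

end

interpretation cvs: vector_space "(*\<^sub>C) :: complex \<Rightarrow> 'a \<Rightarrow> 'a::complex_vs"
  by standard (simp_all add: scaleC_add_right scaleC_add_left scaleC_scaleC scaleC_one)

interpretation rvs: vector_space "\<lambda>(r::real) (x::'a::complex_vs). complex_of_real r *\<^sub>C x"
  by standard (simp_all add: scaleC_add_right scaleC_add_left scaleC_scaleC scaleC_one)


section \<open>Complex tori and abelian varieties\<close>

text \<open>The complex torus \<open>V / \<Lambda>\<close> is represented by the pair \<open>(V, \<Lambda>)\<close>, where \<open>V\<close> is a complex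
  linear subspace of an ambient type. A homomorphism of tori (holomorphic group homomorphism)
  is represented by its analytic representation, i.e. the unique linear lift \<open>V \<rightarrow> V'\<close>, which
  maps \<open>\<Lambda>\<close> into \<open>\<Lambda>'\<close>.\<close>

record 'v torus =
  cover :: "'v set"
  period_lat :: "'v set"

definition complex_torus :: "'v::complex_vs torus \<Rightarrow> bool" where
  "complex_torus X \<longleftrightarrow> cvs.subspace (cover X) \<and>
     (\<exists>B. finite B \<and> rvs.independent B \<and> rvs.span B = cover X \<and>
        period_lat X = {\<Sum>b\<in>B. complex_of_int (c b) *\<^sub>C b | c :: 'v \<Rightarrow> int. True})"

text \<open>A polarization: a positive definite Hermitian form on \<open>V\<close> whose imaginary part is integral
  on \<open>\<Lambda>\<close>.\<close>

definition polarization :: "'v::complex_vs torus \<Rightarrow> ('v \<Rightarrow> 'v \<Rightarrow> complex) \<Rightarrow> bool" where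
  "polarization X H \<longleftrightarrow>
     (\<forall>u\<in>cover X. \<forall>v\<in>cover X. \<forall>w\<in>cover X. H (u + v) w = H u w + H v w) \<and>
     (\<forall>c. \<forall>v\<in>cover X. \<forall>w\<in>cover X. H (c *\<^sub>C v) w = c * H v w) \<and>
     (\<forall>v\<in>cover X. \<forall>w\<in>cover X. H w v = cnj (H v w)) \<and>
     (\<forall>v\<in>cover X. v \<noteq> 0 \<longrightarrow> Re (H v v) > 0) \<and>
     (\<forall>v\<in>period_lat X. \<forall>w\<in>period_lat X. Im (H v w) \<in> \<int>)"

definition abelian_variety :: "'v::complex_vs torus \<Rightarrow> bool" where
  "abelian_variety X \<longleftrightarrow> complex_torus X \<and> (\<exists>H. polarization X H)"

definition abelian_subvariety :: "'v::complex_vs torus \<Rightarrow> 'v torus \<Rightarrow> bool" where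
  "abelian_subvariety Y X \<longleftrightarrow> abelian_variety Y \<and> cover Y \<subseteq> cover X \<and>
     period_lat Y = cover Y \<inter> period_lat X"

definition torus_hom :: "'v::complex_vs torus \<Rightarrow> 'w::complex_vs torus \<Rightarrow> ('v \<Rightarrow> 'w) \<Rightarrow> bool" where
  "torus_hom X Y f \<longleftrightarrow> f ` cover X \<subseteq> cover Y \<and> f ` period_lat X \<subseteq> period_lat Y \<and>
     (\<forall>u\<in>cover X. \<forall>v\<in>cover X. f (u + v) = f u + f v) \<and>
     (\<forall>c. \<forall>v\<in>cover X. f (c *\<^sub>C v) = c *\<^sub>C f v)"

text \<open>The second and third clauses are surjectivity and finiteness of the kernel of the induced
  map \<open>V / \<Lambda> \<rightarrow> V' / \<Lambda>'\<close>.\<close>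

definition isogeny :: "'v::complex_vs torus \<Rightarrow> 'w::complex_vs torus \<Rightarrow> ('v \<Rightarrow> 'w) \<Rightarrow> bool" where
  "isogeny X Y f \<longleftrightarrow> torus_hom X Y f \<and>
     (\<forall>w\<in>cover Y. \<exists>v\<in>cover X. f v - w \<in> period_lat Y) \<and>
     (let N = {v\<in>cover X. f v \<in> period_lat Y}
      in finite (N // {(u, v). u \<in> N \<and> v \<in> N \<and> u - v \<in> period_lat X}))"

definition isogenous :: "'v::complex_vs torus \<Rightarrow> 'w::complex_vs torus \<Rightarrow> bool"
    (infix "\<sim>\<^sub>i" 50) where
  "X \<sim>\<^sub>i Y \<longleftrightarrow> (\<exists>f. isogeny X Y f)"

text \<open>The product \<open>X\<^sub>0 \<times> \<dots> \<times> X\<^sub>r\<^sub>-\<^sub>1\<close> of a list of tori; tuples are functions vanishing from \<open>r\<close> on.\<close>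

definition prod_torus :: "'v::complex_vs torus list \<Rightarrow> (nat \<Rightarrow> 'v) torus" where
  "prod_torus Xs =
     \<lparr>cover = {f. (\<forall>i<length Xs. f i \<in> cover (Xs ! i)) \<and> (\<forall>i\<ge>length Xs. f i = 0)},
      period_lat = {f. (\<forall>i<length Xs. f i \<in> period_lat (Xs ! i)) \<and> (\<forall>i\<ge>length Xs. f i = 0)}\<rparr>"

definition torus_image :: "'v::complex_vs torus \<Rightarrow> ('v \<Rightarrow> 'v) \<Rightarrow> 'v torus" where
  "torus_image X f = \<lparr>cover = f ` cover X, period_lat = f ` cover X \<inter> period_lat X\<rparr>"

text \<open>\<open>Prym(X/Y)\<close> is determined up to isogeny only; one representative is chosen.\<close>

definition Prym :: "'v::complex_vs torus \<Rightarrow> 'v torus \<Rightarrow> 'v torus" where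
  "Prym X Y = (SOME P. abelian_subvariety P X \<and> X \<sim>\<^sub>i prod_torus [P, Y])"

definition aut_group :: "'v::complex_vs torus \<Rightarrow> ('v \<Rightarrow> 'v) monoid" where
  "aut_group X = BijGroup (cover X)
     \<lparr>carrier := {f \<in> Bij (cover X). torus_hom X X f \<and> torus_hom X X (inv_into (cover X) f)}\<rparr>"


section \<open>Generalized quaternion groups by generators and relations\<close>

text \<open>A letter \<open>(a, True)\<close> stands for the generator \<open>a\<close> and \<open>(a, False)\<close> for its inverse.\<close>

inductive word_eq :: "('a \<times> bool) list set \<Rightarrow> ('a \<times> bool) list \<Rightarrow> ('a \<times> bool) list \<Rightarrow> bool"
  for R where
  refl: "word_eq R u u"
| sym: "word_eq R u v \<Longrightarrow> word_eq R v u"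
| trans: "word_eq R u v \<Longrightarrow> word_eq R v w \<Longrightarrow> word_eq R u w"
| cancel: "word_eq R (u @ [(a, b), (a, \<not> b)] @ v) (u @ v)"
| relator: "r \<in> R \<Longrightarrow> word_eq R (u @ r @ v) (u @ v)"

definition word_class :: "('a \<times> bool) list set \<Rightarrow> ('a \<times> bool) list \<Rightarrow> ('a \<times> bool) list set" where
  "word_class R u = {v. word_eq R u v}"

definition presented_group :: "('a \<times> bool) list set \<Rightarrow> ('a \<times> bool) list set monoid" where
  "presented_group R =
     \<lparr>carrier = range (word_class R),
      monoid.mult = (\<lambda>U V. \<Union>u\<in>U. \<Union>v\<in>V. word_class R (u @ v)),
      monoid.one = word_class R []\<rparr>"

datatype qgen = gen_x | gen_y

text \<open>The relators are \<open>x^(2^(n-1))\<close>, \<open>y^2 x^(2^(n-2))\<close> and \<open>y x y^(-1) x\<close>.\<close>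

definition quat_relators :: "nat \<Rightarrow> (qgen \<times> bool) list set" where
  "quat_relators n =
     {replicate (2 ^ (n - 1)) (gen_x, True),
      replicate 2 (gen_y, True) @ replicate (2 ^ (n - 2)) (gen_x, True),
      [(gen_y, True), (gen_x, True), (gen_y, False), (gen_x, True)]}"

definition quat_group :: "nat \<Rightarrow> (qgen \<times> bool) list set monoid" where
  "quat_group n = presented_group (quat_relators n)"

definition quat_x :: "nat \<Rightarrow> (qgen \<times> bool) list set" where
  "quat_x n = word_class (quat_relators n) [(gen_x, True)]"

definition quat_y :: "nat \<Rightarrow> (qgen \<times> bool) list set" where
  "quat_y n = word_class (quat_relators n) [(gen_y, True)]"

definition K_sub :: "('g, 'b) monoid_scheme \<Rightarrow> 'g \<Rightarrow> nat \<Rightarrow> nat \<Rightarrow> 'g set" where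
  "K_sub G x n i = generate G {x [^]\<^bsub>G\<^esub> ((2::nat) ^ (n - i))}"

definition H_sub :: "('g, 'b) monoid_scheme \<Rightarrow> 'g \<Rightarrow> 'g \<Rightarrow> nat \<Rightarrow> nat \<Rightarrow> 'g set" where
  "H_sub G x y n j = generate G {x [^]\<^bsub>G\<^esub> ((2::nat) ^ (n - j)), y}"

definition Ht_sub :: "('g, 'b) monoid_scheme \<Rightarrow> 'g \<Rightarrow> 'g \<Rightarrow> nat \<Rightarrow> nat \<Rightarrow> 'g set" where
  "Ht_sub G x y n j = generate G {x [^]\<^bsub>G\<^esub> ((2::nat) ^ (n - j)), x \<otimes>\<^bsub>G\<^esub> y}"


section \<open>Matrix representations and characters\<close>

text \<open>A representation of degree \<open>d\<close> is a pair \<open>(d, \<rho>)\<close> with \<open>\<rho>\<close> mapping group elements to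
  \<open>d \<times> d\<close> matrices.\<close>

type_synonym ('g, 'k) rep = "nat \<times> ('g \<Rightarrow> 'k mat)"

definition representation :: "('g, 'b) monoid_scheme \<Rightarrow> ('g, 'k::field) rep \<Rightarrow> bool" where
  "representation G V \<longleftrightarrow>
     (\<forall>g\<in>carrier G. snd V g \<in> carrier_mat (fst V) (fst V)) \<and>
     snd V \<one>\<^bsub>G\<^esub> = 1\<^sub>m (fst V) \<and>
     (\<forall>g\<in>carrier G. \<forall>h\<in>carrier G. snd V (g \<otimes>\<^bsub>G\<^esub> h) = snd V g * snd V h)"

definition invariant_subspace ::
    "('g, 'b) monoid_scheme \<Rightarrow> ('g, 'k::field) rep \<Rightarrow> 'k vec set \<Rightarrow> bool" where
  "invariant_subspace G V U \<longleftrightarrow> U \<subseteq> carrier_vec (fst V) \<and> 0\<^sub>v (fst V) \<in> U \<and>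
     (\<forall>u\<in>U. \<forall>v\<in>U. u + v \<in> U) \<and> (\<forall>c. \<forall>u\<in>U. c \<cdot>\<^sub>v u \<in> U) \<and>
     (\<forall>g\<in>carrier G. \<forall>u\<in>U. snd V g *\<^sub>v u \<in> U)"

definition irreducible_rep :: "('g, 'b) monoid_scheme \<Rightarrow> ('g, 'k::field) rep \<Rightarrow> bool" where
  "irreducible_rep G V \<longleftrightarrow> representation G V \<and> fst V > 0 \<and>
     (\<forall>U. invariant_subspace G V U \<longrightarrow> U = {0\<^sub>v (fst V)} \<or> U = carrier_vec (fst V))"

definition intertwiner ::
    "('g, 'b) monoid_scheme \<Rightarrow> ('g, 'k::field) rep \<Rightarrow> ('g, 'k) rep \<Rightarrow> 'k mat \<Rightarrow> bool" where
  "intertwiner G V W M \<longleftrightarrow> M \<in> carrier_mat (fst W) (fst V) \<and>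
     (\<forall>g\<in>carrier G. M * snd V g = snd W g * M)"

definition rep_iso :: "('g, 'b) monoid_scheme \<Rightarrow> ('g, 'k::field) rep \<Rightarrow> ('g, 'k) rep \<Rightarrow> bool" where
  "rep_iso G V W \<longleftrightarrow> (\<exists>M. intertwiner G V W M \<and> invertible_mat M)"

definition complexify :: "('g, rat) rep \<Rightarrow> ('g, complex) rep" where
  "complexify W = (fst W, \<lambda>g. map_mat of_rat (snd W g))"

text \<open>The complex irreducible representation \<open>V\<close> is isomorphic to a subrepresentation of
  \<open>W \<otimes> \<complex>\<close>.\<close>

definition associated :: "('g, 'b) monoid_scheme \<Rightarrow> ('g, rat) rep \<Rightarrow> ('g, complex) rep \<Rightarrow> bool" where
  "associated G W V \<longleftrightarrow> irreducible_rep G V \<and>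
     (\<exists>M. intertwiner G V (complexify W) M \<and>
        (\<forall>v\<in>carrier_vec (fst V). M *\<^sub>v v = 0\<^sub>v (fst W) \<longrightarrow> v = 0\<^sub>v (fst V)))"

definition rational_irreps :: "('g, 'b) monoid_scheme \<Rightarrow> ('g, rat) rep list \<Rightarrow> bool" where
  "rational_irreps G Ws \<longleftrightarrow>
     (\<forall>W\<in>set Ws. irreducible_rep G W) \<and>
     (\<forall>k<length Ws. \<forall>l<length Ws. rep_iso G (Ws ! k) (Ws ! l) \<longrightarrow> k = l) \<and>
     (\<forall>W. irreducible_rep G W \<longrightarrow> (\<exists>l<length Ws. rep_iso G W (Ws ! l)))"

definition character :: "('g, complex) rep \<Rightarrow> 'g \<Rightarrow> complex" where
  "character V g = (\<Sum>i<fst V. snd V g $$ (i, i))"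

definition char_inner :: "('g, 'b) monoid_scheme \<Rightarrow> ('g \<Rightarrow> complex) \<Rightarrow> ('g \<Rightarrow> complex) \<Rightarrow> complex" where
  "char_inner G \<chi> \<psi> = (\<Sum>g\<in>carrier G. \<chi> g * cnj (\<psi> g)) / of_nat (order G)"

text \<open>The Schur index over \<open>\<rat>\<close> of \<open>V\<close> is the multiplicity of \<open>\<chi>\<^sub>V\<close> as a constituent of the
  character of the irreducible rational representation \<open>W\<close> to which \<open>V\<close> is associated
  (Isaacs, Character Theory of Finite Groups, Definition 10.1).\<close>

definition schur_index :: "('g, 'b) monoid_scheme \<Rightarrow> ('g, rat) rep \<Rightarrow> ('g, complex) rep \<Rightarrow> nat" where
  "schur_index G W V =
     (THE s. of_nat s = char_inner G (character (complexify W)) (character V))"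

definition complex_subfield :: "complex set \<Rightarrow> bool" where
  "complex_subfield K \<longleftrightarrow> 1 \<in> K \<and>
     (\<forall>a\<in>K. \<forall>b\<in>K. a - b \<in> K \<and> a * b \<in> K) \<and> (\<forall>a\<in>K. inverse a \<in> K)"

definition character_field :: "('g, 'b) monoid_scheme \<Rightarrow> ('g, complex) rep \<Rightarrow> complex set" where
  "character_field G V = \<Inter>{K. complex_subfield K \<and> character V ` carrier G \<subseteq> K}"

definition field_embeddings :: "complex set \<Rightarrow> (complex \<Rightarrow> complex) set" where
  "field_embeddings K = {\<sigma> \<in> extensional K. \<sigma> 1 = 1 \<and>
     (\<forall>a\<in>K. \<forall>b\<in>K. \<sigma> (a + b) = \<sigma> a + \<sigma> b \<and> \<sigma> (a * b) = \<sigma> a * \<sigma> b)}"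

text \<open>The trace of a number field \<open>K \<subseteq> \<complex>\<close> over \<open>\<rat>\<close>: the sum over all embeddings \<open>K \<rightarrow> \<complex>\<close>, which is
  a rational number.\<close>

definition field_trace :: "complex set \<Rightarrow> complex \<Rightarrow> rat" where
  "field_trace K z = (THE q. of_rat q = (\<Sum>\<sigma>\<in>field_embeddings K. \<sigma> z))"


section \<open>The rational group algebra and its action\<close>

text \<open>Elements of \<open>\<rat>[G]\<close> are rational functions on the type that vanish outside the carrier.\<close>

definition group_alg :: "('g, 'b) monoid_scheme \<Rightarrow> ('g \<Rightarrow> rat) set" where
  "group_alg G = {a. \<forall>g. g \<notin> carrier G \<longrightarrow> a g = 0}"

definition ga_mult :: "('g, 'b) monoid_scheme \<Rightarrow> ('g \<Rightarrow> rat) \<Rightarrow> ('g \<Rightarrow> rat) \<Rightarrow> 'g \<Rightarrow> rat" where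
  "ga_mult G a b = (\<lambda>g. if g \<in> carrier G
     then \<Sum>h\<in>carrier G. a h * b (inv\<^bsub>G\<^esub> h \<otimes>\<^bsub>G\<^esub> g) else 0)"

definition ga_idempotent :: "('g, 'b) monoid_scheme \<Rightarrow> ('g \<Rightarrow> rat) \<Rightarrow> bool" where
  "ga_idempotent G f \<longleftrightarrow> f \<in> group_alg G \<and> ga_mult G f f = f"

definition ga_orthogonal :: "('g, 'b) monoid_scheme \<Rightarrow> ('g \<Rightarrow> rat) \<Rightarrow> ('g \<Rightarrow> rat) \<Rightarrow> bool" where
  "ga_orthogonal G f f' \<longleftrightarrow> ga_mult G f f' = (\<lambda>_. 0) \<and> ga_mult G f' f = (\<lambda>_. 0)"

definition primitive_idempotent :: "('g, 'b) monoid_scheme \<Rightarrow> ('g \<Rightarrow> rat) \<Rightarrow> bool" where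
  "primitive_idempotent G f \<longleftrightarrow> ga_idempotent G f \<and> f \<noteq> (\<lambda>_. 0) \<and>
     (\<forall>f1 f2. ga_idempotent G f1 \<and> ga_idempotent G f2 \<and> ga_orthogonal G f1 f2 \<and>
        f = (\<lambda>g. f1 g + f2 g) \<longrightarrow> f1 = (\<lambda>_. 0) \<or> f2 = (\<lambda>_. 0))"

text \<open>The element \<open>e\<^sub>l\<close> attached to the complex irreducible representation \<open>V = V\<^sub>l\<close>.\<close>

definition central_idempotent :: "('g, 'b) monoid_scheme \<Rightarrow> ('g, complex) rep \<Rightarrow> 'g \<Rightarrow> rat" where
  "central_idempotent G V = (\<lambda>g. if g \<in> carrier G
     then of_nat (fst V) / of_nat (order G) *
       field_trace (character_field G V) (character V (inv\<^bsub>G\<^esub> g)) else 0)"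

text \<open>In the following, \<open>G\<close> is a group of automorphisms of a torus, so its elements are themselves
  linear maps. \<open>\<Xi>(a)\<close> is represented by its analytic representation, a linear map of the covering
  space.\<close>

definition ga_act :: "('v::complex_vs \<Rightarrow> 'v, 'b) monoid_scheme \<Rightarrow> (('v \<Rightarrow> 'v) \<Rightarrow> rat) \<Rightarrow> 'v \<Rightarrow> 'v" where
  "ga_act G a = (\<lambda>v. \<Sum>g\<in>carrier G. of_rat (a g) *\<^sub>C g v)"

text \<open>The image in \<open>A\<close> of a positive integer multiple \<open>\<alpha> a \<in> \<int>[G]\<close> of \<open>a \<in> \<rat>[G]\<close>. The least
  such \<open>\<alpha>\<close> is taken; the image does not depend on it.\<close>

definition clear_denom :: "('g \<Rightarrow> rat) \<Rightarrow> nat" where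
  "clear_denom a = (LEAST m. m > 0 \<and> (\<forall>g. of_nat m * a g \<in> \<int>))"

definition ga_image ::
    "'v::complex_vs torus \<Rightarrow> ('v \<Rightarrow> 'v, 'b) monoid_scheme \<Rightarrow> (('v \<Rightarrow> 'v) \<Rightarrow> rat) \<Rightarrow> 'v torus" where
  "ga_image A G a = torus_image A (ga_act G (\<lambda>g. of_nat (clear_denom a) * a g))"

text \<open>\<open>A\<^sub>K = Im \<Xi>(p\<^sub>K)\<close> with \<open>p\<^sub>K\<close> the sum of the elements of \<open>K\<close>.\<close>

definition sub_image ::
    "'v::complex_vs torus \<Rightarrow> ('v \<Rightarrow> 'v, 'b) monoid_scheme \<Rightarrow> ('v \<Rightarrow> 'v) set \<Rightarrow> 'v torus" where
  "sub_image A G K = torus_image A (ga_act G (\<lambda>g. if g \<in> K then 1 else 0))"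


section \<open>Isotypical and group algebra decompositions\<close>

text \<open>The list \<open>Fs\<close> is, factor by factor up to isogeny, the list of isotypical factors
  \<open>A\<^sub>1, \<dots>, A\<^sub>r\<close> for a suitable enumeration \<open>W\<^sub>1, \<dots>, W\<^sub>r\<close> of the rational irreducible
  representations.\<close>

definition isotypical_decomposition ::
    "'v::complex_vs torus \<Rightarrow> ('v \<Rightarrow> 'v, 'b) monoid_scheme \<Rightarrow> 'v torus list \<Rightarrow> bool" where
  "isotypical_decomposition A G Fs \<longleftrightarrow>
     A \<sim>\<^sub>i prod_torus Fs \<and>
     (\<exists>Ws. rational_irreps G Ws \<and> length Ws = length Fs \<and>
        (\<forall>l<length Ws. \<forall>V. associated G (Ws ! l) V \<longrightarrow>
           ga_image A G (central_idempotent G V) \<sim>\<^sub>i Fs ! l))"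

text \<open>The list consists of the pairs \<open>(B\<^sub>l, n\<^sub>l)\<close>; the condition \<open>n\<^sub>l s\<^sub>l = d\<^sub>l\<close> says
  \<open>n\<^sub>l = d\<^sub>l / s\<^sub>l\<close>, and \<open>fs\<close> is the list \<open>f\<^sub>l\<^sub>1, \<dots>, f\<^sub>l\<^sub>n\<close> of primitive idempotents.\<close>

definition group_algebra_decomposition ::
    "'v::complex_vs torus \<Rightarrow> ('v \<Rightarrow> 'v, 'b) monoid_scheme \<Rightarrow> ('v torus \<times> nat) list \<Rightarrow> bool" where
  "group_algebra_decomposition A G Bs \<longleftrightarrow>
     A \<sim>\<^sub>i prod_torus (concat (map (\<lambda>(B, m). replicate m B) Bs)) \<and>
     (\<exists>Ws. rational_irreps G Ws \<and> length Ws = length Bs \<and>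
        (\<forall>l<length Ws. \<forall>V. associated G (Ws ! l) V \<longrightarrow>
           snd (Bs ! l) * schur_index G (Ws ! l) V = fst V \<and>
           (\<exists>fs. length fs = snd (Bs ! l) \<and>
              (\<forall>f\<in>set fs. primitive_idempotent G f) \<and>
              (\<forall>i<length fs. \<forall>j<length fs. i \<noteq> j \<longrightarrow> ga_orthogonal G (fs ! i) (fs ! j)) \<and>
              central_idempotent G V = (\<lambda>g. \<Sum>f\<leftarrow>fs. f g) \<and>
              (\<forall>f\<in>set fs. ga_image A G f \<sim>\<^sub>i fst (Bs ! l)))))"

end

theory Submission
  imports
    Defs
    "HOL-Analysis.Continuum_Not_Denumerable"
    "HOL-Computational_Algebra.Computational_Algebra"
    "HOL-Computational_Algebra.Field_as_Ring"
    "Jordan_Normal_Form.Char_Poly"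
    "Jordan_Normal_Form.Spectral_Radius"
begin

text \<open>Up to isogeny a complex torus is its covering space together with the rational span of the lattice,
  and a polarization makes every rational subspace a direct summand, with cancellation; hence \<open>Prym\<close> is unique
  up to isogeny, and orthogonal idempotents of \<open>\<rat>[G]\<close> summing to 1 split \<open>A\<close>.
  With \<open>p\<^sub>K\<close> the average over \<open>K\<close>, the image of \<open>p\<^sub>K - p\<^sub>L\<close> is \<open>Prym(A\<^sub>K/A\<^sub>L)\<close> for \<open>K \<le> L\<close>. It remains to see that
  the central idempotents of \<open>\<rat>[G]\<close> are such differences of averages over subgroups of \<open>\<langle>x\<rangle>\<close> (or of index at most 2),
  and that those of the dihedral blocks are sums of two conjugate primitive idempotents, one of them
  \<open>p\<^sub>H - p\<^sub>L\<close> for two consecutive groups \<open>H\<^sub>j\<close>. Both are read off the Fourier transform of \<open>\<rat>[G]\<close>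
  at roots of unity \<open>w\<close>, where \<open>x\<close> acts by \<open>w\<close> and \<open>1/w\<close>.
  The third decomposition is the second one for the generators \<open>x, xy\<close>.\<close>

section \<open>Complex tori up to isogeny\<close>

text \<open>\<open>Prym\<close> picks any subvariety P with X abstractly isogenous to P x Y. Nothing
  ties P to the given embedding of Y, so its uniqueness is a cancellation law and not a statement
  about complements of one subspace. On the algebraic side the rational irreducible representations
  must be exhibited with their Schur indices. All are induced from characters with values 1 and -1.
  Such a character of S with kernel T of index 2 has idempotent p_T - p_S, so the same differences
  give Prym varieties and representations, and Frobenius reciprocity turns a Schur index into a sum
  over that idempotent. Simplicity of the left ideals rests on positivity: b* b takes a nonzero
  value |U|^2 + |W|^2 at a primitive root. Irreducibility of X^(2^r) + 1 makes this value invertible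
  in the field of that root and carries identities from one primitive root to all others. In the
  faithful block y^2 acts as -1, which removes the off-diagonal part of b* b; the block is a
  division algebra and contributes one factor instead of two.\<close>

interpretation zmod: Modules.module "\<lambda>(k::int) (x::'a::complex_vs). complex_of_int k *\<^sub>C x"
  by standard (simp_all add: scaleC_add_right scaleC_add_left scaleC_scaleC scaleC_one)

text \<open>Covers are subspaces of an ambient type and a lift is a total function, so linearity is
  imposed on the subspace only.\<close>

definition clin :: "'v::complex_vs set \<Rightarrow> ('v \<Rightarrow> 'w::complex_vs) \<Rightarrow> bool" where
  "clin U f \<longleftrightarrow> (\<forall>u\<in>U. \<forall>v\<in>U. f (u + v) = f u + f v) \<and> (\<forall>c. \<forall>v\<in>U. f (c *\<^sub>C v) = c *\<^sub>C f v)"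

text \<open>The lattice tensored with Q inside the cover: the vectors lying over torsion points. An
  isogeny may map the lattice onto a proper sublattice, but it maps this set bijectively.\<close>

definition rational_pts :: "'v::complex_vs torus \<Rightarrow> 'v set" where
  "rational_pts X = {v \<in> cover X. \<exists>m::int. m \<noteq> 0 \<and> of_int m *\<^sub>C v \<in> period_lat X}"

text \<open>An isomorphism in the isogeny category: it respects the rational structures, and no
  integrality is left.\<close>

definition qiso :: "'v::complex_vs torus \<Rightarrow> 'w::complex_vs torus \<Rightarrow> ('v \<Rightarrow> 'w) \<Rightarrow> bool" where
  "qiso X Y f \<longleftrightarrow> clin (cover X) f \<and> bij_betw f (cover X) (cover Y) \<and>
     f ` rational_pts X = rational_pts Y"

text \<open>A finitely generated, hence countable lattice suffices to compare isogenies with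
  \<open>qiso\<close>. This notion passes to products without assembling a real basis of the
  product.\<close>

definition fg_torus :: "'v::complex_vs torus \<Rightarrow> bool" where
  "fg_torus X \<longleftrightarrow> cvs.subspace (cover X) \<and>
     (\<exists>B. finite B \<and> B \<subseteq> cover X \<and> period_lat X = zmod.span B)"

lemma cvs_zmod_subspace: "cvs.subspace U \<Longrightarrow> zmod.subspace U"
  by (auto simp: cvs.subspace_def zmod.subspace_def)

lemma cvs_rvs_subspace: "cvs.subspace U \<Longrightarrow> rvs.subspace U"
  by (auto simp: cvs.subspace_def rvs.subspace_def)

lemma rvs_zmod_subspace: "rvs.subspace U \<Longrightarrow> zmod.subspace U"
  unfolding rvs.subspace_def zmod.subspace_def by (metis of_real_of_int_eq)

lemma zmod_span_finite:
  "finite B \<Longrightarrow> zmod.span B = {\<Sum>b\<in>B. complex_of_int (c b) *\<^sub>C b | c. True}"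
  by (auto simp: zmod.span_finite)

lemma complex_torus_fg:
  assumes "complex_torus X" shows "fg_torus X"
proof -
  obtain B where B: "finite B" "rvs.span B = cover X"
    "period_lat X = {\<Sum>b\<in>B. complex_of_int (c b) *\<^sub>C b | c. True}"
    using assms unfolding complex_torus_def by blast
  show ?thesis unfolding fg_torus_def B(3) zmod_span_finite[OF B(1), symmetric]
    using assms B(1) B(2)[symmetric] rvs.span_superset[of B] unfolding complex_torus_def by auto
qed

lemma clinD:
  assumes "clin U f"
  shows clin_add: "u \<in> U \<Longrightarrow> v \<in> U \<Longrightarrow> f (u + v) = f u + f v"
    and clin_scale: "v \<in> U \<Longrightarrow> f (c *\<^sub>C v) = c *\<^sub>C f v"
  using assms by (auto simp: clin_def)

lemma clin_zero: "clin U f \<Longrightarrow> cvs.subspace U \<Longrightarrow> f 0 = 0"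
  using clin_scale[of U f 0 0] by (simp add: cvs.subspace_def)

lemma clin_diff:
  assumes "clin U f" "cvs.subspace U" "u \<in> U" "v \<in> U"
  shows "f (u - v) = f u - f v"
  using clin_add[OF assms(1), of "u - v" v] assms cvs.subspace_diff[of U u v] by simp

lemma clin_sum:
  assumes "clin U f" "cvs.subspace U" "\<And>i. i \<in> I \<Longrightarrow> g i \<in> U"
  shows "f (\<Sum>i\<in>I. g i) = (\<Sum>i\<in>I. f (g i))"
  using assms(3)
proof (induction I rule: infinite_finite_induct)
  case (insert x F)
  then have "(\<Sum>i\<in>F. g i) \<in> U" using assms(2) cvs.subspace_sum by blast
  then show ?case using insert clin_add[OF assms(1)] by simp
qed (use clin_zero[OF assms(1,2)] in auto)

lemma clin_image_subspace:
  assumes "clin U f" "cvs.subspace U" shows "cvs.subspace (f ` U)"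
  unfolding cvs.subspace_def
proof (intro conjI ballI allI)
  show "0 \<in> f ` U" using clin_zero[OF assms] assms(2) cvs.subspace_0 by (metis imageI)
next
  fix x y assume "x \<in> f ` U" "y \<in> f ` U"
  then show "x + y \<in> f ` U" using clin_add[OF assms(1)] cvs.subspace_add[OF assms(2)]
    by (smt (verit, ccfv_threshold) imageE imageI)
next
  fix c x assume "x \<in> f ` U"
  then show "c *\<^sub>C x \<in> f ` U" using clin_scale[OF assms(1)] cvs.subspace_scale[OF assms(2)]
    by (smt (verit, ccfv_threshold) imageE imageI)
qed

lemma clin_comp: "clin U f \<Longrightarrow> f ` U \<subseteq> W \<Longrightarrow> clin W g \<Longrightarrow> clin U (\<lambda>v. g (f v))"
  by (auto simp: clin_def image_subset_iff)

lemma clin_inv_into: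
  assumes "clin U f" "cvs.subspace U" "bij_betw f U W"
  shows "clin W (inv_into U f)"
  unfolding clin_def
proof (intro conjI ballI allI)
  note b = bij_betw_inv_into_left[OF assms(3)] bij_betw_inv_into_right[OF assms(3)]
  have i: "w \<in> W \<Longrightarrow> inv_into U f w \<in> U" for w
    using assms(3) by (metis bij_betw_imp_surj_on inv_into_into)
  fix u v assume "u \<in> W" "v \<in> W"
  then show "inv_into U f (u + v) = inv_into U f u + inv_into U f v"
    using b i clin_add[OF assms(1)] cvs.subspace_add[OF assms(2)]
    by (smt (verit, ccfv_threshold))
next
  note b = bij_betw_inv_into_left[OF assms(3)] bij_betw_inv_into_right[OF assms(3)]
  have i: "w \<in> W \<Longrightarrow> inv_into U f w \<in> U" for w
    using assms(3) by (metis bij_betw_imp_surj_on inv_into_into)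
  fix c v assume "v \<in> W"
  then show "inv_into U f (c *\<^sub>C v) = c *\<^sub>C inv_into U f v"
    using b i clin_scale[OF assms(1)] cvs.subspace_scale[OF assms(2)]
    by (smt (verit, ccfv_threshold))
qed

lemma fg_torusD:
  assumes "fg_torus X"
  shows "cvs.subspace (cover X)" "period_lat X \<subseteq> cover X" "zmod.subspace (period_lat X)"
    "countable (period_lat X)"
proof -
  obtain B where B: "finite B" "B \<subseteq> cover X" "period_lat X = zmod.span B"
    and s: "cvs.subspace (cover X)" using assms by (auto simp: fg_torus_def)
  show "cvs.subspace (cover X)" by fact
  show "period_lat X \<subseteq> cover X" using B zmod.span_minimal[OF B(2) cvs_zmod_subspace[OF s]] by simp
  show "zmod.subspace (period_lat X)" using B by (simp add: zmod.subspace_span)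
  show "countable (period_lat X)" unfolding B(3) using B(1)
  proof (induction B)
    case (insert a B)
    have "zmod.span (insert a B) = (\<Union>k. (\<lambda>y. y + complex_of_int k *\<^sub>C a) ` zmod.span B)"
      by (auto simp: zmod.span_insert image_iff) (metis diff_add_cancel, metis add_diff_cancel_right')
    then show ?case using insert by simp
  qed auto
qed

text \<open>Stands in for discreteness of the lattice: the real multiples of v form an uncountable
  line, which therefore cannot be exhausted by countably many translates of the lattice.\<close>

lemma countable_line:
  fixes v :: "'v::complex_vs"
  assumes "v \<noteq> 0" "countable L"
  shows "countable {r::real. complex_of_real r *\<^sub>C v \<in> L}" (is "countable ?S")
proof -
  have "inj_on (\<lambda>r. complex_of_real r *\<^sub>C v) ?S"
    using assms(1) by (auto simp: inj_on_def)
  moreover have "countable ((\<lambda>r. complex_of_real r *\<^sub>C v) ` ?S)"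
    using assms(2) by (rule countable_subset[rotated]) auto
  ultimately show ?thesis by (rule countable_image_inj_on[rotated])
qed

lemma period_lat_rational: "fg_torus X \<Longrightarrow> period_lat X \<subseteq> rational_pts X"
  using fg_torusD(2)[of X] unfolding rational_pts_def
  by (auto intro!: exI[of _ 1] simp: scaleC_one)

text \<open>The definition gives surjectivity modulo the lattice only. Lifting every real multiple r
  w leaves errors in a countable lattice, so two different reals r and s share their error. The
  difference of the two lifts maps to (r - s) w and is then rescaled.\<close>

lemma isogeny_surj:
  assumes X: "fg_torus X" and Y: "fg_torus Y" and f: "isogeny X Y f"
  shows "f ` cover X = cover Y"
proof
  have h: "torus_hom X Y f" and s: "\<And>w. w \<in> cover Y \<Longrightarrow> \<exists>v\<in>cover X. f v - w \<in> period_lat Y"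
    using f by (auto simp: isogeny_def)
  have cl: "clin (cover X) f" using h by (auto simp: torus_hom_def clin_def)
  show "f ` cover X \<subseteq> cover Y" using h by (simp add: torus_hom_def)
  show "cover Y \<subseteq> f ` cover X"
  proof
    fix w assume w: "w \<in> cover Y"
    have "\<forall>r::real. \<exists>v\<in>cover X. f v - complex_of_real r *\<^sub>C w \<in> period_lat Y"
      using s cvs.subspace_scale[OF fg_torusD(1)[OF Y] w] by blast
    then obtain g where g: "\<And>r::real. g r \<in> cover X"
      "\<And>r. f (g r) - complex_of_real r *\<^sub>C w \<in> period_lat Y" by metis
    have "\<not> inj (\<lambda>r. f (g r) - complex_of_real r *\<^sub>C w)"
    proof
      assume "inj (\<lambda>r. f (g r) - complex_of_real r *\<^sub>C w)"
      moreover have "countable (range (\<lambda>r. f (g r) - complex_of_real r *\<^sub>C w))"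
        using fg_torusD(4)[OF Y] by (rule countable_subset[rotated]) (use g in auto)
      ultimately have "countable (UNIV::real set)" by (rule countable_image_inj_on[rotated])
      then show False using uncountable_UNIV_real by blast
    qed
    then obtain r s where rs: "r \<noteq> s"
      "f (g r) - complex_of_real r *\<^sub>C w = f (g s) - complex_of_real s *\<^sub>C w"
      by (auto simp: inj_def)
    have "f (g r) - f (g s) = complex_of_real (r - s) *\<^sub>C w"
      using rs(2) by (simp add: cvs.scale_left_diff_distrib algebra_simps)
    then have "f (g r - g s) = complex_of_real (r - s) *\<^sub>C w"
      using clin_diff[OF cl fg_torusD(1)[OF X] g(1) g(1)] by simp
    then have "f (complex_of_real (1 / (r - s)) *\<^sub>C (g r - g s)) = w"
      using clin_scale[OF cl] cvs.subspace_diff[OF fg_torusD(1)[OF X] g(1) g(1)] rs(1)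
      by simp
    then show "w \<in> f ` cover X"
      using cvs.subspace_scale[OF fg_torusD(1)[OF X] cvs.subspace_diff[OF fg_torusD(1)[OF X] g(1) g(1)]]
      by blast
  qed
qed

text \<open>Both halves are pigeonhole arguments on the finite kernel. A nonzero v with f v = 0
  would put a whole real line into \<open>N\<close>, too large for finitely many classes. For a
  rational w, the integer multiples of a lift fall twice into one class, so a nonzero multiple of
  the lift is a period.\<close>

lemma isogeny_imp_qiso:
  assumes X: "fg_torus X" and Y: "fg_torus Y" and f: "isogeny X Y f"
  shows "qiso X Y f"
proof -
  have h: "torus_hom X Y f" using f by (auto simp: isogeny_def)
  have cl: "clin (cover X) f" using h by (auto simp: torus_hom_def clin_def)
  define N where "N = {v\<in>cover X. f v \<in> period_lat Y}"
  define R where "R = {(u, v). u \<in> N \<and> v \<in> N \<and> u - v \<in> period_lat X}"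
  have fin: "finite (N // R)" using f by (simp add: isogeny_def N_def R_def)
  note sX = fg_torusD(1)[OF X]
  have same: "u - v \<in> period_lat X" if "u \<in> N" "v \<in> N" "R `` {u} = R `` {v}" for u v
  proof -
    have "v \<in> R `` {v}" using that fg_torusD(3)[OF X] by (auto simp: R_def zmod.subspace_0)
    then have "(u, v) \<in> R" using that(3) by blast
    then show ?thesis by (simp add: R_def)
  qed
  have inj: "inj_on f (cover X)"
  proof (rule inj_onI, rule ccontr)
    fix a b assume ab: "a \<in> cover X" "b \<in> cover X" "f a = f b" "a \<noteq> b"
    define v where "v = a - b"
    have v: "v \<in> cover X" "v \<noteq> 0" "f v = 0"
      unfolding v_def using clin_diff[OF cl sX ab(1,2)] cvs.subspace_diff[OF sX ab(1,2)] ab(3,4)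
      by simp_all
    have rN: "complex_of_real r *\<^sub>C v \<in> N" for r
      using v clin_scale[OF cl v(1)] cvs.subspace_scale[OF sX v(1)] zmod.subspace_0[OF fg_torusD(3)[OF Y]]
      by (simp add: N_def)
    define cls where "cls r = R `` {complex_of_real r *\<^sub>C v}" for r
    have "countable {s. cls s = C}" for C
    proof (cases "\<exists>r. cls r = C")
      case True
      then obtain r where r: "cls r = C" by blast
      have "{s. cls s = C} \<subseteq> (\<lambda>t. t + r) ` {t. complex_of_real t *\<^sub>C v \<in> period_lat X}"
      proof
        fix s assume "s \<in> {s. cls s = C}"
        then have "complex_of_real s *\<^sub>C v - complex_of_real r *\<^sub>C v \<in> period_lat X"
          using same[OF rN rN] r by (simp add: cls_def)
        then show "s \<in> (\<lambda>t. t + r) ` {t. complex_of_real t *\<^sub>C v \<in> period_lat X}"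
          by (intro image_eqI[of _ _ "s - r"]) (auto simp: cvs.scale_left_diff_distrib)
      qed
      then show ?thesis
        using countable_line[OF v(2) fg_torusD(4)[OF X]] by (meson countable_image countable_subset)
    qed auto
    \<comment> \<open>Finitely many classes, each containing r v for countably many r only, would
      exhaust the real line.\<close>
    moreover have "(UNIV::real set) = (\<Union>C\<in>N // R. {s. cls s = C})"
      using rN by (auto simp: cls_def quotient_def)
    ultimately have "countable (UNIV::real set)"
      using fin by (metis (no_types, lifting) countable_UN countable_finite)
    then show False using uncountable_UNIV_real by blast
  qed
  have "rational_pts Y \<subseteq> f ` rational_pts X"
  proof
    fix w assume "w \<in> rational_pts Y"
    then obtain m :: int where w: "w \<in> cover Y" "m \<noteq> 0" "of_int m *\<^sub>C w \<in> period_lat Y"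
      by (auto simp: rational_pts_def)
    obtain v where v: "v \<in> cover X" "f v = w"
      using w(1) unfolding isogeny_surj[OF X Y f, symmetric] by (auto elim: imageE)
    have iN: "of_int (i * m) *\<^sub>C v \<in> N" for i
    proof -
      have "f (of_int (i * m) *\<^sub>C v) = of_int (i * m) *\<^sub>C w"
        using clin_scale[OF cl v(1)] v(2) by metis
      also have "\<dots> = of_int i *\<^sub>C of_int m *\<^sub>C w" by simp
      also have "\<dots> \<in> period_lat Y" by (rule zmod.subspace_scale[OF fg_torusD(3)[OF Y] w(3)])
      finally show ?thesis using cvs.subspace_scale[OF sX v(1)] by (simp add: N_def)
    qed
    have "(\<lambda>i. R `` {of_int (i * m) *\<^sub>C v}) ` (UNIV::int set) \<subseteq> N // R"
      using iN by (auto simp: quotient_def)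
    then have "\<not> inj (\<lambda>i::int. R `` {of_int (i * m) *\<^sub>C v})"
      using fin finite_imageD finite_subset infinite_UNIV_int by blast
    then obtain i j :: int where ij: "i \<noteq> j"
      "R `` {of_int (i * m) *\<^sub>C v} = R `` {of_int (j * m) *\<^sub>C v}" by (auto simp: inj_def)
    have "of_int (i * m) *\<^sub>C v - of_int (j * m) *\<^sub>C v \<in> period_lat X"
      by (rule same[OF iN iN ij(2)])
    then have "of_int ((i - j) * m) *\<^sub>C v \<in> period_lat X"
      by (simp add: cvs.scale_left_diff_distrib left_diff_distrib)
    then show "w \<in> f ` rational_pts X"
      using v w ij by (intro image_eqI[of _ _ v]) (auto simp: rational_pts_def intro!: exI[of _ "(i - j) * m"])
  qed
  moreover have "f ` rational_pts X \<subseteq> rational_pts Y"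
  proof
    fix w assume "w \<in> f ` rational_pts X"
    then obtain v m where v: "v \<in> cover X" "w = f v" "(m::int) \<noteq> 0" "of_int m *\<^sub>C v \<in> period_lat X"
      by (auto simp: rational_pts_def)
    then have "of_int m *\<^sub>C w \<in> period_lat Y" using h clin_scale[OF cl v(1)] 
      by (metis image_subset_iff torus_hom_def)
    then show "w \<in> rational_pts Y" using v h by (auto simp: rational_pts_def torus_hom_def)
  qed
  ultimately show ?thesis
    using cl inj isogeny_surj[OF X Y f] by (auto simp: qiso_def bij_betw_def)
qed

text \<open>The product of the denominators of the finitely many generators works for the whole
  lattice. It is applied to an isomorphism and to its inverse in
  \<open>qiso_imp_isogenous\<close>.\<close>

lemma common_denominator:
  fixes g :: "'v::complex_vs \<Rightarrow> 'w::complex_vs"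
  assumes "clin U g" "cvs.subspace U" "finite B" "B \<subseteq> U" "zmod.subspace L"
    and "\<And>b. b \<in> B \<Longrightarrow> \<exists>m::int. m \<noteq> 0 \<and> of_int m *\<^sub>C g b \<in> L"
  shows "\<exists>m::int. m \<noteq> 0 \<and> (\<forall>x\<in>zmod.span B. of_int m *\<^sub>C g x \<in> L)"
proof -
  have "\<exists>m::int. m \<noteq> 0 \<and> (\<forall>b\<in>B. of_int m *\<^sub>C g b \<in> L)"
    using assms(3,6)
  proof (induction B)
    case (insert b B)
    then obtain m k :: int where m: "m \<noteq> 0" "\<forall>b\<in>B. of_int m *\<^sub>C g b \<in> L" and
      k: "k \<noteq> 0" "of_int k *\<^sub>C g b \<in> L" by (metis insertCI)
    have "of_int (m * k) *\<^sub>C g x \<in> L" if "x \<in> insert b B" for x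
      using that m k zmod.subspace_scale[OF assms(5), of "of_int m *\<^sub>C g x" k]
        zmod.subspace_scale[OF assms(5), of "of_int k *\<^sub>C g x" m]
      by (auto simp: mult.commute)
    then show ?case using m k by (intro exI[of _ "m * k"]) auto
  qed (auto intro: exI[of _ 1])
  then obtain m :: int where m: "m \<noteq> 0" "\<forall>b\<in>B. of_int m *\<^sub>C g b \<in> L" by blast
  have sc: "of_int m *\<^sub>C c *\<^sub>C w = c *\<^sub>C of_int m *\<^sub>C w" for c and w :: 'w
    by (simp add: mult.commute)
  have "zmod.subspace {x \<in> U. of_int m *\<^sub>C g x \<in> L}"
    using assms(2,5) clin_zero[OF assms(1,2)] clin_add[OF assms(1)] clin_scale[OF assms(1)]
      zmod.subspace_scale[OF assms(5)]
    unfolding zmod.subspace_def cvs.subspace_def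
    by (auto simp only: mem_Collect_eq cvs.scale_zero_right cvs.scale_right_distrib sc)
  then have "zmod.span B \<subseteq> {x \<in> U. of_int m *\<^sub>C g x \<in> L}"
    by (intro zmod.span_minimal) (use m(2) assms(4) in auto)
  then show ?thesis using m(1) by blast
qed

text \<open>Clearing denominators makes m f a homomorphism of tori. If k clears the denominators of
  the inverse, then k m times any kernel vector is a period, so the kernel lies in the lattice
  divided by k m and has finitely many classes modulo the lattice.\<close>

lemma qiso_imp_isogenous:
  assumes X: "fg_torus X" and Y: "fg_torus Y" and f: "qiso X Y f"
  shows "X \<sim>\<^sub>i Y"
proof -
  obtain B where B: "finite B" "B \<subseteq> cover X" "period_lat X = zmod.span B"
    using X by (auto simp: fg_torus_def)
  obtain C where C: "finite C" "C \<subseteq> cover Y" "period_lat Y = zmod.span C"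
    using Y by (auto simp: fg_torus_def)
  have cl: "clin (cover X) f" and bij: "bij_betw f (cover X) (cover Y)"
    and rp: "f ` rational_pts X = rational_pts Y" using f by (auto simp: qiso_def)
  note sX = fg_torusD(1)[OF X]
  define g where "g = inv_into (cover X) f"
  have clg: "clin (cover Y) g" unfolding g_def by (rule clin_inv_into[OF cl sX bij])
  have "\<exists>m::int. m \<noteq> 0 \<and> (\<forall>x\<in>period_lat X. of_int m *\<^sub>C f x \<in> period_lat Y)"
    unfolding B(3)
  proof (rule common_denominator[OF cl sX B(1,2) fg_torusD(3)[OF Y]])
    fix b assume "b \<in> B"
    then have "f b \<in> rational_pts Y"
      using B(3) zmod.span_base period_lat_rational[OF X] rp by blast
    then show "\<exists>m::int. m \<noteq> 0 \<and> of_int m *\<^sub>C f b \<in> period_lat Y" by (auto simp: rational_pts_def)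
  qed
  then obtain m :: int where m: "m \<noteq> 0" "\<And>x. x \<in> period_lat X \<Longrightarrow> of_int m *\<^sub>C f x \<in> period_lat Y"
    by blast
  have "\<exists>m::int. m \<noteq> 0 \<and> (\<forall>x\<in>period_lat Y. of_int m *\<^sub>C g x \<in> period_lat X)"
    unfolding C(3)
  proof (rule common_denominator[OF clg fg_torusD(1)[OF Y] C(1,2) fg_torusD(3)[OF X]])
    fix b assume b: "b \<in> C"
    then have "b \<in> f ` rational_pts X"
      using C(3) zmod.span_base period_lat_rational[OF Y] rp by blast
    then obtain v where v: "v \<in> rational_pts X" "b = f v" by blast
    then have "g b = v" unfolding g_def using bij
      by (simp add: bij_betw_inv_into_left rational_pts_def)
    then show "\<exists>m::int. m \<noteq> 0 \<and> of_int m *\<^sub>C g b \<in> period_lat X"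
      using v by (auto simp: rational_pts_def)
  qed
  then obtain k :: int where k: "k \<noteq> 0" "\<And>x. x \<in> period_lat Y \<Longrightarrow> of_int k *\<^sub>C g x \<in> period_lat X"
    by blast
  define F where "F v = of_int m *\<^sub>C f v" for v
  have gf: "g (f v) = v" if "v \<in> cover X" for v
    unfolding g_def using bij that by (rule bij_betw_inv_into_left)
  have fY: "f v \<in> cover Y" if "v \<in> cover X" for v using bij that by (auto simp: bij_betw_def)
  have clF: "clin (cover X) F"
    using cl by (auto simp: clin_def F_def cvs.scale_right_distrib mult.commute)
  have hom: "torus_hom X Y F"
    using m clF fY cvs.subspace_scale[OF fg_torusD(1)[OF Y]]
    by (auto simp: torus_hom_def clin_def F_def)
  define N where "N = {v\<in>cover X. F v \<in> period_lat Y}"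
  define R where "R = {(u, v). u \<in> N \<and> v \<in> N \<and> u - v \<in> period_lat X}"
  define d where "d = k * m"
  have d: "d \<noteq> 0" using k m by (simp add: d_def)
  have "of_int d *\<^sub>C v \<in> period_lat X" if "v \<in> N" for v
  proof -
    have v: "v \<in> cover X" "F v \<in> period_lat Y" using that by (auto simp: N_def)
    have "of_int k *\<^sub>C g (F v) \<in> period_lat X" by (rule k(2)[OF v(2)])
    moreover have "g (F v) = of_int m *\<^sub>C v"
      using clin_scale[OF clg fY[OF v(1)]] gf[OF v(1)] by (simp add: F_def)
    ultimately show ?thesis by (simp add: d_def)
  qed
  then have "\<forall>v\<in>N. \<exists>c. of_int d *\<^sub>C v = (\<Sum>b\<in>B. complex_of_int (c b) *\<^sub>C b)"
    unfolding B(3) zmod_span_finite[OF B(1)] by auto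
  then obtain c where c: "\<And>v. v \<in> N \<Longrightarrow> of_int d *\<^sub>C v = (\<Sum>b\<in>B. complex_of_int (c v b) *\<^sub>C b)"
    by metis
  \<comment> \<open>The coordinates of d v modulo |d|. The generators may be dependent, so the
    coordinates are a choice; equal residues still force equal classes.\<close>
  define \<kappa> where "\<kappa> v = restrict (\<lambda>b. c v b mod \<bar>d\<bar>) B" for v
  have "\<kappa> ` N \<subseteq> PiE B (\<lambda>_. {0..<\<bar>d\<bar>})" using d by (auto simp: \<kappa>_def)
  then have fin: "finite (\<kappa> ` N)" by (rule finite_subset) (use B in \<open>auto intro: finite_PiE\<close>)
  have same: "R `` {u} = R `` {v}" if uv: "u \<in> N" "v \<in> N" "\<kappa> u = \<kappa> v" for u v
  proof -
    have "\<exists>e. c u b - c v b = d * e" if "b \<in> B" for b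
    proof -
      have "c u b mod \<bar>d\<bar> = c v b mod \<bar>d\<bar>" using that uv(3) by (metis \<kappa>_def restrict_apply')
      then show ?thesis by (metis abs_dvd_iff dvdE mod_eq_dvd_iff)
    qed
    then obtain e where e: "\<And>b. b \<in> B \<Longrightarrow> c u b - c v b = d * e b" by metis
    have "of_int d *\<^sub>C (u - v) = (\<Sum>b\<in>B. complex_of_int (c u b - c v b) *\<^sub>C b)"
      using c[OF uv(1)] c[OF uv(2)]
      by (simp add: cvs.scale_right_diff_distrib sum_subtractf cvs.scale_left_diff_distrib)
    also have "\<dots> = of_int d *\<^sub>C (\<Sum>b\<in>B. complex_of_int (e b) *\<^sub>C b)"
      using e by (simp add: cvs.scale_sum_right)
    finally have "u - v = (\<Sum>b\<in>B. complex_of_int (e b) *\<^sub>C b)" using d by simp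
    then have "u - v \<in> period_lat X" unfolding B(3) zmod_span_finite[OF B(1)] by auto
    then have "v - w \<in> period_lat X \<longleftrightarrow> u - w \<in> period_lat X" for w
      using zmod.subspace_diff[OF fg_torusD(3)[OF X], of "u - w" "u - v"]
        zmod.subspace_add[OF fg_torusD(3)[OF X], of "v - w" "u - v"] by auto
    then show ?thesis using uv by (auto simp: R_def)
  qed
  have "N // R = (\<lambda>v. R `` {v}) ` N" by (auto simp: quotient_def)
  \<comment> \<open>One representative for each residue vector already meets every class.\<close>
  also have "\<dots> \<subseteq> (\<lambda>j. R `` {inv_into N \<kappa> j}) ` (\<kappa> ` N)"
  proof
    fix C assume "C \<in> (\<lambda>v. R `` {v}) ` N"
    then obtain v where v: "v \<in> N" "C = R `` {v}" by auto
    then have "R `` {inv_into N \<kappa> (\<kappa> v)} = C"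
      using same[of "inv_into N \<kappa> (\<kappa> v)" v] by (simp add: f_inv_into_f inv_into_into)
    then show "C \<in> (\<lambda>j. R `` {inv_into N \<kappa> j}) ` (\<kappa> ` N)" using v by blast
  qed
  finally have "finite (N // R)" using fin finite_subset by blast
  moreover have "\<exists>v\<in>cover X. F v - w \<in> period_lat Y" if w: "w \<in> cover Y" for w
  proof -
    obtain v where v: "v \<in> cover X" "f v = w"
      using w unfolding bij_betw_imp_surj_on[OF bij, symmetric] by (auto elim: imageE)
    have "F ((1 / of_int m) *\<^sub>C v) = w"
      using clin_scale[OF cl v(1)] v(2) m(1) by (simp add: F_def scaleC_one)
    then show ?thesis using cvs.subspace_scale[OF sX v(1)] zmod.subspace_0[OF fg_torusD(3)[OF Y]]
      by (metis diff_self)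
  qed
  ultimately have "isogeny X Y F" using hom by (simp add: isogeny_def N_def R_def Let_def)
  then show ?thesis by (auto simp: isogenous_def)
qed

lemma isogenous_iff_qiso:
  "fg_torus X \<Longrightarrow> fg_torus Y \<Longrightarrow> X \<sim>\<^sub>i Y \<longleftrightarrow> (\<exists>f. qiso X Y f)"
  using isogeny_imp_qiso qiso_imp_isogenous by (metis isogenous_def)

lemma qiso_sym:
  assumes "fg_torus X" "qiso X Y f" shows "qiso Y X (inv_into (cover X) f)"
proof -
  have b: "bij_betw f (cover X) (cover Y)" using assms by (simp add: qiso_def)
  have "inv_into (cover X) f ` f ` rational_pts X = rational_pts X"
    by (rule inv_into_image_cancel) (use b in \<open>auto simp: bij_betw_def rational_pts_def\<close>)
  then show ?thesis
    using assms clin_inv_into[OF _ fg_torusD(1)[OF assms(1)] b] bij_betw_inv_into[OF b]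
    by (simp add: qiso_def)
qed

lemma qiso_trans:
  assumes "qiso X Y f" "qiso Y Z g" shows "qiso X Z (\<lambda>v. g (f v))"
proof -
  have "f ` cover X = cover Y" using assms(1) by (auto simp: qiso_def bij_betw_def)
  moreover have "(\<lambda>v. g (f v)) ` rational_pts X = rational_pts Z"
    using assms by (metis image_image qiso_def)
  ultimately show ?thesis
    using assms clin_comp[of "cover X" f "cover Y" g] bij_betw_trans[of f "cover X" "cover Y" g "cover Z"]
    by (simp add: qiso_def comp_def)
qed

section \<open>Subtori, sublattices and rational linear systems\<close>

interpretation qvs: vector_space "\<lambda>(q::rat) (x::'a::complex_vs). of_rat q *\<^sub>C x"
  by standard (simp_all add: scaleC_add_right scaleC_add_left scaleC_scaleC scaleC_one of_rat_add of_rat_mult)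

lemma complex_of_rat_eq: "(of_rat q :: complex) = complex_of_real (of_rat q)"
  by (cases q) (simp add: of_rat_rat)

definition subt :: "'v::complex_vs torus \<Rightarrow> 'v set \<Rightarrow> 'v torus" where
  "subt X U = \<lparr>cover = U, period_lat = U \<inter> period_lat X\<rparr>"

lemma subt_simps [simp]: "cover (subt X U) = U" "period_lat (subt X U) = U \<inter> period_lat X"
  by (simp_all add: subt_def)

lemma rational_pts_subt:
  "cvs.subspace U \<Longrightarrow> U \<subseteq> cover X \<Longrightarrow> rational_pts (subt X U) = U \<inter> rational_pts X"
  by (auto simp: rational_pts_def cvs.subspace_scale)

text \<open>Induction splits off one basis vector b. The coefficients of b that occur in S form an
  ideal of the integers; its least positive member d is attained at some s, and s extends a basis of
  the part of S that lies in the span of the remaining vectors.\<close>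

lemma sublattice_basis:
  assumes "finite B" "rvs.independent B" "zmod.subspace S" "S \<subseteq> zmod.span B"
  shows "\<exists>C. finite C \<and> rvs.independent C \<and> zmod.span C = S"
  using assms
proof (induction B arbitrary: S)
  case empty
  then have "S = {0}" using zmod.subspace_0 by auto
  then show ?case by (intro exI[of _ "{}"]) (auto simp: rvs.dependent_def)
next
  case (insert b B)
  note S = insert.prems(2)
  have bB: "b \<notin> rvs.span B" "rvs.independent B"
    using insert by (auto simp: rvs.independent_insert)
  have zr: "zmod.span B \<subseteq> rvs.span B"
    by (intro zmod.span_minimal rvs.span_superset rvs_zmod_subspace rvs.subspace_span)
  define S0 where "S0 = S \<inter> zmod.span B"
  have "zmod.subspace S0" unfolding S0_def using S by (intro zmod.subspace_inter) auto
  then obtain C0 where C0: "finite C0" "rvs.independent C0" "zmod.span C0 = S0"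
    using insert.IH[OF bB(2)] S0_def by blast
  define D where "D = {c::int. \<exists>t\<in>zmod.span B. of_int c *\<^sub>C b + t \<in> S}"
  have split: "\<exists>k\<in>D. \<exists>t\<in>zmod.span B. x = of_int k *\<^sub>C b + t" if x: "x \<in> S" for x
  proof -
    obtain k where "x - of_int k *\<^sub>C b \<in> zmod.span B"
      using x insert.prems(3) by (auto simp: zmod.span_insert)
    moreover have "x = of_int k *\<^sub>C b + (x - of_int k *\<^sub>C b)" by simp
    ultimately show ?thesis using x unfolding D_def by (metis (mono_tags, lifting) mem_Collect_eq)
  qed
  show ?case
  proof (cases "D \<subseteq> {0}")
    case True
    have "S \<subseteq> zmod.span B"
    proof
      fix x assume "x \<in> S"
      then obtain k t where "k \<in> D" "t \<in> zmod.span B" "x = of_int k *\<^sub>C b + t" using split by blast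
      then show "x \<in> zmod.span B" using True by auto
    qed
    then show ?thesis using C0 by (auto simp: S0_def Int_absorb2)
  next
    case False
    then obtain c where c: "c \<in> D" "c \<noteq> 0" by blast
    have "- c \<in> D"
    proof -
      obtain t where "t \<in> zmod.span B" "of_int c *\<^sub>C b + t \<in> S" using c D_def by blast
      then have "- t \<in> zmod.span B" "- (of_int c *\<^sub>C b + t) \<in> S"
        using zmod.span_neg zmod.subspace_neg[OF S] by blast+
      moreover have "of_int (- c) *\<^sub>C b + - t = - (of_int c *\<^sub>C b + t)" by simp
      ultimately show ?thesis unfolding D_def by (metis (mono_tags, lifting) mem_Collect_eq)
    qed
    then have "\<exists>d::nat. d > 0 \<and> int d \<in> D"
      using c by (intro exI[of _ "nat \<bar>c\<bar>"]) (auto simp: abs_if)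
    then obtain d where d: "d > 0" "int d \<in> D" and least: "\<And>e. e > 0 \<Longrightarrow> int e \<in> D \<Longrightarrow> d \<le> e"
      using exists_least_iff[of "\<lambda>d::nat. d > 0 \<and> int d \<in> D"] by (metis not_le)
    obtain t where t: "t \<in> zmod.span B" "of_int (int d) *\<^sub>C b + t \<in> S" using d D_def by blast
    define s where "s = of_int (int d) *\<^sub>C b + t"
    have sS: "s \<in> S" using t by (simp add: s_def)
    have "zmod.span (insert s C0) \<subseteq> S"
      using sS C0(3) zmod.span_superset[of C0] S by (intro zmod.span_minimal) (auto simp: S0_def)
    moreover have "S \<subseteq> zmod.span (insert s C0)"
    proof
      fix x assume x: "x \<in> S"
      then obtain k t' where k: "k \<in> D" "t' \<in> zmod.span B" "x = of_int k *\<^sub>C b + t'" using split by blast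
      \<comment> \<open>Division with remainder: subtracting q s leaves a coefficient r below d that
        still occurs in S, so r = 0 by minimality of d.\<close>
      define q where "q = k div int d"
      define r where "r = k mod int d"
      have r: "0 \<le> r" "r < int d" using d by (auto simp: r_def)
      have kq: "k = q * int d + r" by (simp add: q_def r_def)
      have y: "x - of_int q *\<^sub>C s = of_int r *\<^sub>C b + (t' - of_int q *\<^sub>C t)"
        unfolding k(3) s_def kq by (simp add: cvs.scale_right_distrib cvs.scale_left_distrib algebra_simps)
      have tt: "t' - of_int q *\<^sub>C t \<in> zmod.span B" using k t by (intro zmod.span_diff zmod.span_scale)
      have yS: "x - of_int q *\<^sub>C s \<in> S" using x sS S by (intro zmod.subspace_diff zmod.subspace_scale)
      then have "r \<in> D" using y tt unfolding D_def by auto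
      then have "r = 0" using least[of "nat r"] r by (cases "r = 0") auto
      then have "x - of_int q *\<^sub>C s \<in> zmod.span C0" using y tt yS C0(3) by (simp add: S0_def)
      then show "x \<in> zmod.span (insert s C0)" by (auto simp: zmod.span_insert)
    qed
    moreover have "rvs.independent (insert s C0)"
    proof (rule rvs.independent_insertI[OF _ C0(2)])
    show "s \<notin> rvs.span C0"
    proof
      assume "s \<in> rvs.span C0"
      moreover have "C0 \<subseteq> rvs.span B" using C0(3) zmod.span_superset[of C0] zr by (auto simp: S0_def)
      ultimately have "s \<in> rvs.span B" using rvs.span_minimal[OF _ rvs.subspace_span] by blast
      moreover have "t \<in> rvs.span B" using t zr by blast
      ultimately have "s - t \<in> rvs.span B" by (rule rvs.span_diff)
      then have "complex_of_real (real d) *\<^sub>C b \<in> rvs.span B" by (simp add: s_def)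
      then have "complex_of_real (1 / real d) *\<^sub>C complex_of_real (real d) *\<^sub>C b \<in> rvs.span B"
        by (rule rvs.span_scale)
      then show False using bB(1) d(1) by (simp add: scaleC_one)
    qed
    qed
    ultimately show ?thesis using C0(1) by (intro exI[of _ "insert s C0"]) auto
  qed
qed

lemma complex_torus_subt:
  assumes X: "complex_torus X" and U: "cvs.subspace U" "U \<subseteq> rvs.span (U \<inter> period_lat X)"
  shows "complex_torus (subt X U)"
proof -
  obtain B where B: "finite B" "rvs.independent B" "rvs.span B = cover X"
    "period_lat X = {\<Sum>b\<in>B. complex_of_int (c b) *\<^sub>C b | c. True}"
    using X unfolding complex_torus_def by blast
  have pl: "period_lat X = zmod.span B" using B(4) zmod_span_finite[OF B(1)] by simp
  obtain C where C: "finite C" "rvs.independent C" "zmod.span C = U \<inter> period_lat X"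
    using sublattice_basis[OF B(1,2), of "U \<inter> period_lat X"] cvs_zmod_subspace[OF U(1)]
    by (auto simp: pl zmod.subspace_inter)
  have "rvs.span C = U"
  proof
    show "rvs.span C \<subseteq> U"
      using C(3) zmod.span_superset[of C] cvs_rvs_subspace[OF U(1)] by (intro rvs.span_minimal) auto
    have "zmod.span C \<subseteq> rvs.span C"
      by (intro zmod.span_minimal rvs.span_superset rvs_zmod_subspace rvs.subspace_span)
    then show "U \<subseteq> rvs.span C"
      using U(2) C(3) rvs.span_minimal[OF _ rvs.subspace_span] by blast
  qed
  then show ?thesis using C U(1) zmod_span_finite[OF C(1)] by (auto simp: complex_torus_def)
qed

text \<open>Elimination of one equation with a pivot j. Over the rationals it later provides the
  coefficients of an orthogonal projection, from a mere count of unknowns against equations.\<close>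

lemma homogeneous_system:
  fixes a :: "'i \<Rightarrow> 'c \<Rightarrow> 'k::field"
  assumes "finite C" "finite I" "card I > card C"
  shows "\<exists>x. (\<exists>i\<in>I. x i \<noteq> 0) \<and> (\<forall>c\<in>C. (\<Sum>i\<in>I. x i * a i c) = 0)"
  using assms
proof (induction C arbitrary: I a)
  case empty
  then show ?case by (intro exI[of _ "\<lambda>_. 1"]) (auto simp: card_gt_0_iff)
next
  case (insert c C)
  show ?case
  proof (cases "\<forall>i\<in>I. a i c = 0")
    case True
    have "\<exists>x. (\<exists>i\<in>I. x i \<noteq> 0) \<and> (\<forall>d\<in>C. (\<Sum>i\<in>I. x i * a i d) = 0)"
      by (rule insert.IH) (use insert in auto)
    then obtain x where "\<exists>i\<in>I. x i \<noteq> 0" "\<forall>d\<in>C. (\<Sum>i\<in>I. x i * a i d) = 0"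
      by blast
    then show ?thesis using True by (intro exI[of _ x]) auto
  next
    case False
    then obtain j where j: "j \<in> I" "a j c \<noteq> 0" by blast
    have "card C < card (I - {j})" using insert j by auto
    then obtain x where x: "\<exists>i\<in>I - {j}. x i \<noteq> 0"
      "\<forall>d\<in>C. (\<Sum>i\<in>I - {j}. x i * (a i d - a i c / a j c * a j d)) = 0"
      using insert.IH[of "I - {j}" "\<lambda>i d. a i d - a i c / a j c * a j d"] insert.prems by auto
    define s where "s = (\<Sum>i\<in>I - {j}. x i * a i c)"
    \<comment> \<open>The pivot unknown takes the value dictated by the eliminated equation
      c.\<close>
    define z where "z = x(j := - s / a j c)"
    have sum: "(\<Sum>i\<in>I. z i * a i d) = (\<Sum>i\<in>I - {j}. x i * a i d) - s / a j c * a j d" for d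
    proof -
      have "(\<Sum>i\<in>I. z i * a i d) = z j * a j d + (\<Sum>i\<in>I - {j}. z i * a i d)"
        using insert.prems j by (simp add: sum.remove)
      also have "(\<Sum>i\<in>I - {j}. z i * a i d) = (\<Sum>i\<in>I - {j}. x i * a i d)"
        by (rule sum.cong) (auto simp: z_def)
      finally show ?thesis by (simp add: z_def)
    qed
    have "(\<Sum>i\<in>I. z i * a i d) = 0" if "d \<in> C" for d
    proof -
      have "(\<Sum>i\<in>I - {j}. x i * a i d) - s / a j c * a j d
         = (\<Sum>i\<in>I - {j}. x i * (a i d - a i c / a j c * a j d))"
        unfolding s_def by (simp add: algebra_simps sum_subtractf sum_distrib_left sum_divide_distrib)
      then show ?thesis using sum x(2) that by simp
    qed
    moreover have "(\<Sum>i\<in>I. z i * a i c) = 0" using sum[of c] j by (simp add: s_def)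
    moreover have "\<exists>i\<in>I. z i \<noteq> 0" using x(1) by (auto simp: z_def)
    ultimately show ?thesis by blast
  qed
qed

definition ssum :: "'v::ab_group_add set \<Rightarrow> 'v set \<Rightarrow> 'v set" where
  "ssum U W = {x + y | x y. x \<in> U \<and> y \<in> W}"

section \<open>Poincare reducibility for a polarized torus\<close>

locale polarized_torus =
  fixes X :: "'v::complex_vs torus" and H :: "'v \<Rightarrow> 'v \<Rightarrow> complex"
  assumes torus: "complex_torus X" and pol: "polarization X H"
begin

abbreviation "V \<equiv> cover X"
abbreviation "Q \<equiv> rational_pts X"

text \<open>These are the covers of abelian subvarieties.\<close>

definition good :: "'v set \<Rightarrow> bool" where
  "good U \<longleftrightarrow> cvs.subspace U \<and> U \<subseteq> V \<and> U \<subseteq> rvs.span (U \<inter> Q)"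

text \<open>On complex subspaces this agrees with the complement for the alternating form Im H. That
  form takes rational values on rational vectors, which is what makes the complement
  rational.\<close>

definition perp :: "'v set \<Rightarrow> 'v set" where
  "perp U = {v \<in> V. \<forall>u\<in>U. H v u = 0}"

lemma sV: "cvs.subspace V" using fg_torusD(1)[OF complex_torus_fg[OF torus]] .

lemmas V_closed = cvs.subspace_add[OF sV] cvs.subspace_scale[OF sV] cvs.subspace_diff[OF sV]
  cvs.subspace_0[OF sV] cvs.subspace_neg[OF sV]

lemma fgX: "fg_torus X" by (rule complex_torus_fg[OF torus])

lemma H_add1: "u \<in> V \<Longrightarrow> v \<in> V \<Longrightarrow> w \<in> V \<Longrightarrow> H (u + v) w = H u w + H v w"
  and H_scale1: "v \<in> V \<Longrightarrow> w \<in> V \<Longrightarrow> H (c *\<^sub>C v) w = c * H v w"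
  and H_cnj: "v \<in> V \<Longrightarrow> w \<in> V \<Longrightarrow> H w v = cnj (H v w)"
  and H_pos: "v \<in> V \<Longrightarrow> v \<noteq> 0 \<Longrightarrow> Re (H v v) > 0"
  and H_int: "v \<in> period_lat X \<Longrightarrow> w \<in> period_lat X \<Longrightarrow> Im (H v w) \<in> \<int>"
  using pol unfolding polarization_def by blast+

lemma H_add2: "u \<in> V \<Longrightarrow> v \<in> V \<Longrightarrow> w \<in> V \<Longrightarrow> H w (u + v) = H w u + H w v"
  using H_cnj H_add1 V_closed by (metis complex_cnj_add)

lemma H_scale2: "v \<in> V \<Longrightarrow> w \<in> V \<Longrightarrow> H w (c *\<^sub>C v) = cnj c * H w v"
  using H_cnj H_scale1 V_closed by (metis complex_cnj_mult)

lemma H_zero1: "w \<in> V \<Longrightarrow> H 0 w = 0"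
  using H_scale1[of 0 w 0] V_closed by simp

lemma H_zero2: "w \<in> V \<Longrightarrow> H w 0 = 0"
  using H_scale2[of 0 w 0] V_closed by simp

lemma H_sum1: "(\<And>i. i \<in> I \<Longrightarrow> g i \<in> V) \<Longrightarrow> w \<in> V \<Longrightarrow> H (\<Sum>i\<in>I. g i) w = (\<Sum>i\<in>I. H (g i) w)"
proof (induction I rule: infinite_finite_induct)
  case (insert x F)
  then have "(\<Sum>i\<in>F. g i) \<in> V" using sV cvs.subspace_sum by blast
  then show ?case using insert H_add1 by simp
qed (auto simp: H_zero1)

lemma H_definite: "v \<in> V \<Longrightarrow> H v v = 0 \<Longrightarrow> v = 0"
  using H_pos[of v] by force

lemma Q_sub: "Q \<subseteq> V" by (auto simp: rational_pts_def)

lemma Q_subspace: "qvs.subspace Q"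
  unfolding qvs.subspace_def
proof (intro conjI ballI allI)
  note sL = fg_torusD(3)[OF fgX]
  show "0 \<in> Q" using V_closed zmod.subspace_0[OF sL] by (auto simp: rational_pts_def intro!: exI[of _ 1])
  fix x assume "x \<in> Q"
  then obtain m where x: "x \<in> V" "(m::int) \<noteq> 0" "of_int m *\<^sub>C x \<in> period_lat X" by (auto simp: rational_pts_def)
  { fix y assume "y \<in> Q"
    then obtain k where y: "y \<in> V" "(k::int) \<noteq> 0" "of_int k *\<^sub>C y \<in> period_lat X" by (auto simp: rational_pts_def)
    have "of_int k *\<^sub>C of_int m *\<^sub>C x + of_int m *\<^sub>C of_int k *\<^sub>C y \<in> period_lat X"
      by (intro zmod.subspace_add[OF sL] zmod.subspace_scale[OF sL] x y)
    then have "of_int (m * k) *\<^sub>C (x + y) \<in> period_lat X"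
      by (simp add: cvs.scale_right_distrib mult.commute)
    then show "x + y \<in> Q" using x y V_closed unfolding rational_pts_def
      by (intro CollectI conjI exI[of _ "m * k"]) auto }
  fix q :: rat
  obtain a b where ab: "q = of_int a / of_int b" "b \<noteq> 0" 
    by (cases q) (auto simp: Fract_of_int_quotient)
  have "of_int a *\<^sub>C of_int m *\<^sub>C x \<in> period_lat X" by (intro zmod.subspace_scale[OF sL] x)
  moreover have "of_int (b * m) *\<^sub>C of_rat q *\<^sub>C x = of_int a *\<^sub>C of_int m *\<^sub>C x"
    using ab by (simp add: of_rat_divide)
  ultimately have "of_int (b * m) *\<^sub>C of_rat q *\<^sub>C x \<in> period_lat X" by (simp only:)
  then show "of_rat q *\<^sub>C x \<in> Q" using x(1,2) ab(2) V_closed(2) unfolding rational_pts_def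
    by (intro CollectI conjI exI[of _ "b * m"]) auto
qed

lemma V_span: "V \<subseteq> rvs.span Q" "finite B \<Longrightarrow> True"
proof -
  obtain B where B: "finite B" "rvs.span B = V" "period_lat X = {\<Sum>b\<in>B. complex_of_int (c b) *\<^sub>C b | c. True}"
    using torus unfolding complex_torus_def by blast
  have "B \<subseteq> period_lat X" using B(1,3) zmod_span_finite[OF B(1)] zmod.span_superset[of B] by simp
  then have "B \<subseteq> Q" using period_lat_rational[OF fgX] by blast
  then show "V \<subseteq> rvs.span Q" using B(2) rvs.span_mono by blast
qed auto

lemma fin_span: obtains B where "finite B" "Q \<subseteq> qvs.span B" "V \<subseteq> cvs.span B"
proof -
  obtain B where B: "finite B" "rvs.span B = V" "period_lat X = {\<Sum>b\<in>B. complex_of_int (c b) *\<^sub>C b | c. True}"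
    using torus unfolding complex_torus_def by blast
  have "Q \<subseteq> qvs.span B"
  proof
    fix v assume "v \<in> Q"
    then obtain m c where m: "(m::int) \<noteq> 0" "of_int m *\<^sub>C v = (\<Sum>b\<in>B. complex_of_int (c b) *\<^sub>C b)"
      using B(3) by (auto simp: rational_pts_def)
    have "(\<Sum>b\<in>B. of_rat (of_int (c b)) *\<^sub>C b) \<in> qvs.span B"
      by (intro qvs.span_sum qvs.span_scale qvs.span_base)
    then have "of_rat (1 / of_int m) *\<^sub>C (\<Sum>b\<in>B. of_rat (of_int (c b)) *\<^sub>C b) \<in> qvs.span B"
      by (rule qvs.span_scale)
    moreover have "(\<Sum>b\<in>B. of_rat (of_int (c b)) *\<^sub>C b) = of_int m *\<^sub>C v" using m(2) by simp
    ultimately have "of_rat (1 / of_int m) *\<^sub>C of_int m *\<^sub>C v \<in> qvs.span B" by (simp only:)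
    then show "v \<in> qvs.span B" using m(1) by (simp add: of_rat_divide scaleC_one)
  qed
  moreover have "rvs.span B \<subseteq> cvs.span B"
    by (intro rvs.span_minimal cvs.span_superset cvs_rvs_subspace cvs.subspace_span)
  ultimately show ?thesis using that B by blast
qed

lemma E_rat: assumes "u \<in> Q" "v \<in> Q" shows "Im (H u v) \<in> \<rat>"
proof -
  obtain m k where x: "u \<in> V" "(m::int) \<noteq> 0" "of_int m *\<^sub>C u \<in> period_lat X"
    and y: "v \<in> V" "(k::int) \<noteq> 0" "of_int k *\<^sub>C v \<in> period_lat X"
    using assms by (auto simp: rational_pts_def)
  have "Im (H (of_int m *\<^sub>C u) (of_int k *\<^sub>C v)) \<in> \<int>" using H_int x y by blast
  moreover have "H (of_int m *\<^sub>C u) (of_int k *\<^sub>C v) = of_int (m * k) * H u v"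
    using x y V_closed by (simp add: H_scale1 H_scale2)
  ultimately have "of_int (m * k) * Im (H u v) \<in> \<int>"
    by (metis Im_complex_of_real Re_complex_of_real of_real_of_int_eq mult_zero_left add_0 add.right_neutral times_complex.simps(2))
  then obtain j where "of_int (m * k) * Im (H u v) = of_int j" by (auto elim: Ints_cases)
  then have "Im (H u v) = of_int j / of_int (m * k)" using x y by (simp add: field_simps)
  then show ?thesis by auto
qed

text \<open>Replacing u by i u exchanges the real and imaginary parts of \<open>H v u\<close> up to
  sign, so the alternating form alone decides orthogonality to a complex subspace.\<close>

lemma E_to_H:
  assumes "cvs.subspace U" "U \<subseteq> V" "v \<in> V" "\<forall>u\<in>U. Im (H v u) = 0" "u \<in> U"
  shows "H v u = 0"
proof -
  have "Im (H v (\<i> *\<^sub>C u)) = 0" using assms cvs.subspace_scale by blast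
  then have "Re (H v u) = 0" using assms by (simp add: H_scale2 subset_iff)
  then show ?thesis using assms by (simp add: complex_eq_iff)
qed

lemma span_zero_E:
  assumes "N \<subseteq> V" "v \<in> V" "\<forall>m\<in>N. Im (H v m) = 0" "u \<in> rvs.span N"
  shows "Im (H v u) = 0"
proof -
  have "rvs.subspace {u \<in> V. Im (H v u) = 0}"
    unfolding rvs.subspace_def using assms V_closed by (auto simp: H_zero2 H_add2 H_scale2)
  then have "rvs.span N \<subseteq> {u \<in> V. Im (H v u) = 0}"
    by (intro rvs.span_minimal) (use assms in auto)
  then show ?thesis using assms(4) by blast
qed

text \<open>The core of Poincare reducibility. With a rational basis C of N, asking that a
  combination of u and C be orthogonal to C is a rational system with one more unknown than
  equations. Positivity of H keeps the coefficient of u away from zero, so the relation can be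
  solved for u.\<close>

lemma rational_projection:
  assumes N: "qvs.subspace N" "N \<subseteq> Q" and U: "cvs.subspace U" "U \<subseteq> V" "N \<subseteq> U" "U \<subseteq> rvs.span N"
    and u: "u \<in> Q"
  shows "\<exists>l\<in>N. u - l \<in> perp U"
proof (cases "u \<in> N")
  case True
  then show ?thesis using U H_zero1 V_closed by (intro bexI[of _ u]) (auto simp: perp_def)
next
  case False
  have NV: "N \<subseteq> V" using N Q_sub by blast
  \<comment> \<open>Vanishing of Im H on N passes to the real span of N, which contains U, and from
    there to H itself.\<close>
  have toperp: "v \<in> perp U" if v: "v \<in> V" "\<forall>m\<in>N. Im (H v m) = 0" for v
    using span_zero_E[OF NV v] E_to_H[OF U(1,2) v(1)] U(4) v(1) unfolding perp_def by blast
  have nondeg: "n = 0" if "n \<in> N" "\<forall>m\<in>N. Im (H n m) = 0" for n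
    using toperp[of n] that NV U(3) H_definite unfolding perp_def by blast
  obtain C where C: "C \<subseteq> N" "qvs.independent C" "N \<subseteq> qvs.span C"
    using qvs.maximal_independent_subset by blast
  obtain B where B: "finite B" "Q \<subseteq> qvs.span B" by (rule fin_span)
  have finC: "finite C" using qvs.independent_span_bound[OF B(1) C(2)] C(1) N(2) B(2) by blast
  \<comment> \<open>Rational representatives of the real numbers Im H i c, so that the system can be
    solved over the rationals.\<close>
  define a where "a i c = (SOME q::rat. real_of_rat q = Im (H i c))" for i c
  have a: "real_of_rat (a i c) = Im (H i c)" if "i \<in> Q" "c \<in> Q" for i c
    unfolding a_def by (rule someI_ex) (use E_rat[OF that] in \<open>auto elim: Rats_cases\<close>)
  have uC: "u \<notin> C" using False C by blast
  \<comment> \<open>One equation for each member of C, and u as the additional unknown.\<close>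
  have "\<exists>x. (\<exists>i\<in>insert u C. x i \<noteq> 0) \<and> (\<forall>c\<in>C. (\<Sum>i\<in>insert u C. x i * a i c) = 0)"
    by (rule homogeneous_system) (use finC uC in auto)
  then obtain x where x: "\<exists>i\<in>insert u C. x i \<noteq> 0" "\<forall>c\<in>C. (\<Sum>i\<in>insert u C. x i * a i c) = 0"
    by blast
  have CQ: "insert u C \<subseteq> Q" using u C N by blast
  define w where "w = (\<Sum>i\<in>insert u C. of_rat (x i) *\<^sub>C i)"
  have wV: "w \<in> V" unfolding w_def using CQ Q_sub by (intro cvs.subspace_sum[OF sV] V_closed) auto
  have wC: "Im (H w c) = 0" if c: "c \<in> C" for c
  proof -
    have "H w c = (\<Sum>i\<in>insert u C. of_rat (x i) * H i c)"
      unfolding w_def using CQ Q_sub c by (subst H_sum1) (auto intro!: V_closed sum.cong H_scale1)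
    then have "Im (H w c) = (\<Sum>i\<in>insert u C. Im (of_rat (x i) * H i c))" by simp
    also have "\<dots> = (\<Sum>i\<in>insert u C. of_rat (x i * a i c))"
    proof (rule sum.cong)
      fix i assume "i \<in> insert u C"
      then have "real_of_rat (a i c) = Im (H i c)" using a CQ c by blast
      moreover have "(of_rat (x i) :: complex) = complex_of_real (of_rat (x i))"
        by (rule complex_of_rat_eq)
      ultimately show "Im (of_rat (x i) * H i c) = of_rat (x i * a i c)"
        by (simp add: of_rat_mult)
    qed simp
    also have "\<dots> = of_rat (\<Sum>i\<in>insert u C. x i * a i c)" by (simp only: of_rat_sum)
    also have "\<dots> = 0" using x(2) c by simp
    finally show ?thesis .
  qed
  have wN: "Im (H w m) = 0" if "m \<in> N" for m
  proof -
    have "qvs.subspace {m \<in> V. Im (H w m) = 0}"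
    proof -
      have "Im (H w (of_rat q *\<^sub>C m)) = 0" if "m \<in> V" "Im (H w m) = 0" for q m
      proof -
        have "(of_rat q :: complex) = complex_of_real (of_rat q)" by (rule complex_of_rat_eq)
        then show ?thesis using that wV by (simp add: H_scale2)
      qed
      then show ?thesis unfolding qvs.subspace_def using V_closed wV by (auto simp: H_zero2 H_add2)
    qed
    then have "qvs.span C \<subseteq> {m \<in> V. Im (H w m) = 0}"
      by (intro qvs.span_minimal) (use C NV wC in auto)
    then show ?thesis using C that by blast
  qed
  have wsplit: "w = of_rat (x u) *\<^sub>C u + (\<Sum>i\<in>C. of_rat (x i) *\<^sub>C i)"
    unfolding w_def using finC uC by simp
  have sC: "(\<Sum>i\<in>C. of_rat (x i) *\<^sub>C i) \<in> N"
    using C(1) N(1) by (intro qvs.subspace_sum qvs.subspace_scale) auto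
  \<comment> \<open>Otherwise the combination would be a vector of N orthogonal to N, hence zero by
    positivity, against the independence of C.\<close>
  have xu: "x u \<noteq> 0"
  proof
    assume 0: "x u = 0"
    then have "w = (\<Sum>i\<in>C. of_rat (x i) *\<^sub>C i)" using wsplit by simp
    then have "(\<Sum>i\<in>C. of_rat (x i) *\<^sub>C i) = 0" using nondeg sC wN by metis
    moreover obtain i where "i \<in> C" "x i \<noteq> 0" using x(1) 0 by auto
    ultimately show False using C(2) finC qvs.dependent_finite[of C] by blast
  qed
  define l where "l = of_rat (- 1 / x u) *\<^sub>C (\<Sum>i\<in>C. of_rat (x i) *\<^sub>C i)"
  have lN: "l \<in> N" unfolding l_def by (intro qvs.subspace_scale N sC)
  have "u - l = of_rat (1 / x u) *\<^sub>C w"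
    using xu unfolding l_def wsplit
    by (simp add: cvs.scale_right_distrib of_rat_divide of_rat_minus scaleC_one)
  moreover have "of_rat (1 / x u) *\<^sub>C w \<in> perp U"
    using toperp[OF wV] wN wV U V_closed by (auto simp: perp_def H_scale1 subset_iff)
  ultimately have "u - l \<in> perp U" by simp
  then show ?thesis using lN by blast
qed

end

text \<open>Supplies the decreasing measure for the induction in
  \<open>cancellation\<close>.\<close>

lemma (in vector_space) dim_psubset:
  assumes "finite B" "T \<subseteq> span B" "subspace S" "S \<subset> T"
  shows "dim S < dim T"
proof -
  obtain C where C: "C \<subseteq> S" "independent C" "S \<subseteq> span C" "card C = dim S"
    using basis_exists by blast
  obtain x where x: "x \<in> T" "x \<notin> S" using assms(4) by blast
  have "span C \<subseteq> S" using C(1) assms(3) by (rule span_minimal)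
  then have ind: "independent (insert x C)" using C(2) x(2) by (intro independent_insertI) auto
  obtain D where D: "insert x C \<subseteq> D" "D \<subseteq> T" "independent D" "T \<subseteq> span D"
  proof -
    have "insert x C \<subseteq> T" using C(1) assms(4) x(1) by auto
    then show ?thesis using maximal_independent_subset_extend[OF _ ind] that by metis
  qed
  have finD: "finite D" using independent_span_bound[OF assms(1) D(3)] D(2) assms(2) by blast
  have "card (insert x C) \<le> dim T"
    using card_mono[OF finD D(1)] basis_card_eq_dim[OF D(2,4,3)] by simp
  moreover have "card (insert x C) = Suc (card C)"
  proof -
    have "x \<notin> C" using x(2) C(1) by blast
    moreover have "finite C" using finite_subset[OF D(1) finD] by simp
    ultimately show ?thesis by simp
  qed
  ultimately show ?thesis using C(4) by simp
qed

lemma clin_dim_le: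
  fixes f :: "'v::complex_vs \<Rightarrow> 'v"
  assumes f: "clin S f" "inj_on f S" and S: "cvs.subspace S" and B: "finite B" "S \<subseteq> cvs.span B" "f ` S \<subseteq> cvs.span B"
  shows "cvs.dim S \<le> cvs.dim (f ` S)"
proof -
  obtain C where C: "C \<subseteq> S" "cvs.independent C" "S \<subseteq> cvs.span C" "card C = cvs.dim S"
    using cvs.basis_exists by blast
  have finC: "finite C" using cvs.independent_span_bound[OF B(1) C(2)] C(1) B(2) by blast
  have inj: "inj_on f C" using f(2) C(1) inj_on_subset by blast
  have "cvs.independent (f ` C)"
  proof
    assume "cvs.dependent (f ` C)"
    then obtain u where u: "\<exists>v\<in>f ` C. u v \<noteq> 0" "(\<Sum>v\<in>f ` C. u v *\<^sub>C v) = 0"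
      using cvs.dependent_finite[of "f ` C"] finC by auto
    have sum: "(\<Sum>v\<in>C. u (f v) *\<^sub>C v) \<in> S"
      using C(1) S by (intro cvs.subspace_sum cvs.subspace_scale) auto
    have "f (\<Sum>v\<in>C. u (f v) *\<^sub>C v) = (\<Sum>v\<in>C. f (u (f v) *\<^sub>C v))"
      using C(1) S by (intro clin_sum[OF f(1) S] cvs.subspace_scale) auto
    also have "\<dots> = (\<Sum>v\<in>C. u (f v) *\<^sub>C f v)"
      using C(1) by (intro sum.cong refl clin_scale[OF f(1)]) auto
    also have "\<dots> = 0" using u(2) by (simp add: sum.reindex[OF inj])
    finally have "f (\<Sum>v\<in>C. u (f v) *\<^sub>C v) = f 0" using clin_zero[OF f(1) S] by simp
    then have "(\<Sum>v\<in>C. u (f v) *\<^sub>C v) = 0"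
      using f(2) sum cvs.subspace_0[OF S] by (meson inj_onD)
    moreover obtain v where "v \<in> C" "u (f v) \<noteq> 0" using u(1) by blast
    ultimately have "cvs.dependent C"
      unfolding cvs.dependent_finite[OF finC] by (intro exI[of _ "\<lambda>v. u (f v)"]) auto
    then show False using C(2) by blast
  qed
  moreover have "f ` C \<subseteq> f ` S" using C(1) by blast
  ultimately obtain D where D: "f ` C \<subseteq> D" "D \<subseteq> f ` S" "cvs.independent D" "f ` S \<subseteq> cvs.span D"
    using cvs.maximal_independent_subset_extend by blast
  have finD: "finite D" using cvs.independent_span_bound[OF B(1) D(3)] D(2) B(3) by blast
  have "card (f ` C) \<le> cvs.dim (f ` S)"
    using card_mono[OF finD D(1)] cvs.basis_card_eq_dim[OF D(2,4,3)] by simp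
  then show ?thesis using C(4) card_image[OF inj] by simp
qed

lemma subspace_ssum: "cvs.subspace U \<Longrightarrow> cvs.subspace W \<Longrightarrow> cvs.subspace (ssum U W)"
  unfolding ssum_def by (rule cvs.subspace_sums)

lemma ssum_sup:
  assumes "cvs.subspace U" "cvs.subspace W" shows "U \<subseteq> ssum U W \<and> W \<subseteq> ssum U W"
proof (intro conjI subsetI)
  fix u assume "u \<in> U"
  then have "u = u + 0 \<and> u \<in> U \<and> 0 \<in> W" using cvs.subspace_0[OF assms(2)] by simp
  then show "u \<in> ssum U W" unfolding ssum_def by blast
next
  fix w assume "w \<in> W"
  then have "w = 0 + w \<and> 0 \<in> U \<and> w \<in> W" using cvs.subspace_0[OF assms(1)] by simp
  then show "w \<in> ssum U W" unfolding ssum_def by blast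
qed

lemma ssum_assoc: "ssum (ssum U W) Z = ssum U (ssum W (Z :: 'a::ab_group_add set))"
proof
  show "ssum (ssum U W) Z \<subseteq> ssum U (ssum W Z)" unfolding ssum_def by (force simp: add.assoc)
  show "ssum U (ssum W Z) \<subseteq> ssum (ssum U W) Z"
  proof
    fix x assume "x \<in> ssum U (ssum W Z)"
    then obtain u w z where "u \<in> U" "w \<in> W" "z \<in> Z" "x = (u + w) + z"
      unfolding ssum_def by (auto simp: add.assoc)
    then show "x \<in> ssum (ssum U W) Z" unfolding ssum_def by blast
  qed
qed

lemma direct_unique:
  assumes "cvs.subspace U" "cvs.subspace W" "U \<inter> W = {0}"
    "u \<in> U" "u' \<in> U" "w \<in> W" "w' \<in> W" "u + w = u' + w'"
  shows "u = u' \<and> w = w'"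
proof -
  have e: "u - u' = w' - w" using assms(8) by (simp add: algebra_simps)
  have "u - u' \<in> U" using assms by (intro cvs.subspace_diff)
  moreover have "u - u' \<in> W" unfolding e using assms by (intro cvs.subspace_diff)
  ultimately have "u - u' = 0" using assms(3) by blast
  then show ?thesis using e by auto
qed

context polarized_torus
begin

lemma goodD: "good U \<Longrightarrow> cvs.subspace U" "good U \<Longrightarrow> U \<subseteq> V" "good U \<Longrightarrow> U \<subseteq> rvs.span (U \<inter> Q)"
  by (auto simp: good_def)

lemma QU_subspace: "good U \<Longrightarrow> qvs.subspace (U \<inter> Q)"
  using Q_subspace by (auto simp: good_def qvs.subspace_def cvs.subspace_def)

lemma perp_subspace: "U \<subseteq> V \<Longrightarrow> cvs.subspace (perp U)"
  unfolding cvs.subspace_def perp_def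
  using V_closed by (auto simp: H_zero1 H_add1 H_scale1 subset_iff)

lemma perp_Int: "cvs.subspace U \<Longrightarrow> U \<subseteq> V \<Longrightarrow> U \<inter> perp U = {0}"
proof -
  assume U: "cvs.subspace U" "U \<subseteq> V"
  have "0 \<in> U \<inter> perp U" using cvs.subspace_0[OF U(1)] cvs.subspace_0[OF perp_subspace[OF U(2)]] by simp
  moreover have "v = 0" if "v \<in> U \<inter> perp U" for v
    using that H_definite[of v] U(2) by (auto simp: perp_def)
  ultimately show ?thesis by blast
qed

lemma good_projection:
  assumes "good U" "u \<in> Q" obtains l where "l \<in> U \<inter> Q" "u - l \<in> perp U \<inter> Q"
proof -
  have "\<exists>l\<in>U \<inter> Q. u - l \<in> perp U"
    by (rule rational_projection) (use assms QU_subspace goodD in auto)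
  then show ?thesis using that assms qvs.subspace_diff[OF Q_subspace] by blast
qed

text \<open>Rational projections write V as U plus the real span of the rational vectors of the
  complement. Comparison with the direct sum of U and the full complement shows that this span is
  the whole complement.\<close>

lemma good_perp_split:
  assumes "good U" shows "ssum U (rvs.span (perp U \<inter> Q)) = V" "ssum U (perp U) = V" "good (perp U)"
proof -
  note U = goodD[OF assms]
  note sp = perp_subspace[OF U(2)]
  have pV: "perp U \<subseteq> V" by (auto simp: perp_def)
  have span: "rvs.span (perp U \<inter> Q) \<subseteq> perp U"
    by (intro rvs.span_minimal cvs_rvs_subspace sp) auto
  have "rvs.subspace (ssum U (rvs.span (perp U \<inter> Q)))"
    unfolding ssum_def by (intro rvs.subspace_sums cvs_rvs_subspace U rvs.subspace_span)
  moreover have "Q \<subseteq> ssum U (rvs.span (perp U \<inter> Q))"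
  proof
    fix u assume "u \<in> Q"
    then obtain l where l: "l \<in> U \<inter> Q" "u - l \<in> perp U \<inter> Q" using good_projection[OF assms] by blast
    then have "u = l + (u - l)" "u - l \<in> rvs.span (perp U \<inter> Q)"
      using rvs.span_base[OF l(2)] by simp_all
    then show "u \<in> ssum U (rvs.span (perp U \<inter> Q))" unfolding ssum_def using l by blast
  qed
  ultimately have "V \<subseteq> ssum U (rvs.span (perp U \<inter> Q))"
    using V_span(1) rvs.span_minimal by blast
  moreover have "ssum U (perp U) \<subseteq> V" using U(2) pV V_closed(1) unfolding ssum_def by blast
  moreover have "ssum U (rvs.span (perp U \<inter> Q)) \<subseteq> ssum U (perp U)" using span unfolding ssum_def by blast
  ultimately show 1: "ssum U (rvs.span (perp U \<inter> Q)) = V" "ssum U (perp U) = V" by blast+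
  have "perp U \<subseteq> rvs.span (perp U \<inter> Q)"
  proof
    fix w assume w: "w \<in> perp U"
    then obtain a b where ab: "a \<in> U" "b \<in> rvs.span (perp U \<inter> Q)" "w = a + b"
      using 1(1) pV unfolding ssum_def by blast
    have "0 + w = a + b" using ab by simp
    then have "w = b" using direct_unique[OF U(1) sp perp_Int[OF U(1,2)], of 0 a w b]
        cvs.subspace_0[OF U(1)] ab span w by blast
    then show "w \<in> rvs.span (perp U \<inter> Q)" using ab by simp
  qed
  then show "good (perp U)" using sp pV by (simp add: good_def)
qed

lemma perp_sym: "U \<subseteq> V \<Longrightarrow> u \<in> U \<Longrightarrow> v \<in> perp U \<Longrightarrow> H u v = 0"
  unfolding perp_def using H_cnj[of v u] by auto

lemma perp_perp: assumes "good U" shows "perp (perp U) = U"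
proof
  note U = goodD[OF assms]
  show "U \<subseteq> perp (perp U)" using perp_sym[OF U(2)] U(2) unfolding perp_def[of "perp U"] by auto
  show "perp (perp U) \<subseteq> U"
  proof
    fix v assume v: "v \<in> perp (perp U)"
    then have "v \<in> V" by (simp add: perp_def)
    then obtain a b where ab: "a \<in> U" "b \<in> perp U" "v = a + b"
      using good_perp_split(2)[OF assms] unfolding ssum_def by blast
    have b: "b \<in> V" using ab by (simp add: perp_def)
    have "H v b = 0" using v ab by (simp add: perp_def)
    moreover have "H v b = H a b + H b b" using ab b U by (auto simp: H_add1)
    ultimately have "H b b = 0" using perp_sym[OF U(2) ab(1,2)] by simp
    then have "b = 0" using H_definite b by blast
    then show "v \<in> U" using ab by simp
  qed
qed

lemma good_ssum: assumes "good U" "good W" shows "good (ssum U W)"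
proof -
  note U = goodD[OF assms(1)] and W = goodD[OF assms(2)]
  have "U \<union> W \<subseteq> ssum U W" using ssum_sup[OF U(1) W(1)] by blast
  then have "rvs.span (U \<inter> Q) \<subseteq> rvs.span (ssum U W \<inter> Q)" "rvs.span (W \<inter> Q) \<subseteq> rvs.span (ssum U W \<inter> Q)"
    by (auto intro!: rvs.span_mono)
  then have "U \<subseteq> rvs.span (ssum U W \<inter> Q)" "W \<subseteq> rvs.span (ssum U W \<inter> Q)" using U W by blast+
  then have "ssum U W \<subseteq> rvs.span (ssum U W \<inter> Q)"
    using rvs.span_add unfolding ssum_def by blast
  moreover have "ssum U W \<subseteq> V" using U(2) W(2) V_closed(1) unfolding ssum_def by blast
  ultimately show ?thesis using subspace_ssum[OF U(1) W(1)] by (simp add: good_def)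
qed

text \<open>Rationality of a sum is immediate, that of an intersection is not. Taking complements
  turns the intersection into the complement of a sum.\<close>

lemma good_Int: assumes "good U" "good W" shows "good (U \<inter> W)"
proof -
  note U = goodD[OF assms(1)] and W = goodD[OF assms(2)]
  note pU = goodD[OF good_perp_split(3)[OF assms(1)]] and pW = goodD[OF good_perp_split(3)[OF assms(2)]]
  have "perp (ssum (perp U) (perp W)) = perp (perp U) \<inter> perp (perp W)"
  proof
    show "perp (ssum (perp U) (perp W)) \<subseteq> perp (perp U) \<inter> perp (perp W)"
      using ssum_sup[OF pU(1) pW(1)] unfolding perp_def[of "ssum _ _"] perp_def[of "perp _"] by blast
    show "perp (perp U) \<inter> perp (perp W) \<subseteq> perp (ssum (perp U) (perp W))"
    proof
      fix t assume t: "t \<in> perp (perp U) \<inter> perp (perp W)"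
      then have tV: "t \<in> V" and "\<And>u. u \<in> perp U \<Longrightarrow> H t u = 0" "\<And>u. u \<in> perp W \<Longrightarrow> H t u = 0"
        by (auto simp: perp_def[of "perp U"] perp_def[of "perp W"])
      then have "H t (a + b) = 0" if "a \<in> perp U" "b \<in> perp W" for a b
        using that pU(2) pW(2) by (simp add: H_add2 subset_iff)
      then have "\<forall>x\<in>ssum (perp U) (perp W). H t x = 0" by (auto simp: ssum_def)
      then show "t \<in> perp (ssum (perp U) (perp W))"
        using tV by (simp add: perp_def[of "ssum (perp U) (perp W)"])
    qed
  qed
  then have "U \<inter> W = perp (ssum (perp U) (perp W))" using perp_perp assms by simp
  then show ?thesis using assms by (simp add: good_perp_split good_ssum)
qed

lemma relative_complement:
  assumes "good D" "good U" "D \<subseteq> U"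
  shows "good (U \<inter> perp D)" "ssum D (U \<inter> perp D) = U" "D \<inter> (U \<inter> perp D) = {0}"
proof -
  note D = goodD[OF assms(1)] and U = goodD[OF assms(2)]
  show "good (U \<inter> perp D)" using assms by (simp add: good_perp_split good_Int)
  show "D \<inter> (U \<inter> perp D) = {0}" using perp_Int[OF D(1,2)] assms(3) by blast
  have "ssum D (U \<inter> perp D) \<subseteq> U" using assms(3) cvs.subspace_add[OF U(1)] by (auto simp: ssum_def)
  moreover have "U \<subseteq> ssum D (U \<inter> perp D)"
  proof
    fix u assume u: "u \<in> U"
    then obtain a b where ab: "a \<in> D" "b \<in> perp D" "u = a + b"
      using good_perp_split(2)[OF assms(1)] U(2) unfolding ssum_def by blast
    have "b = u - a" using ab by simp
    then have "b \<in> U" using cvs.subspace_diff[OF U(1)] u ab assms(3) by blast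
    then show "u \<in> ssum D (U \<inter> perp D)" using ab unfolding ssum_def by blast
  qed
  ultimately show "ssum D (U \<inter> perp D) = U" by blast
qed

text \<open>Sums of rational vectors of U and of W span U + W over the reals. By
  \<open>rational_projection\<close> the vector u + w differs from such a sum by a vector of U + W
  orthogonal to U + W, which is zero; uniqueness of the splitting does the rest.\<close>

lemma split_rational:
  assumes "good U" "good W" "U \<inter> W = {0}" "u \<in> U" "w \<in> W" "u + w \<in> Q"
  shows "u \<in> Q \<and> w \<in> Q"
proof -
  note U = goodD[OF assms(1)] and W = goodD[OF assms(2)] and S = goodD[OF good_ssum[OF assms(1,2)]]
  define N where "N = {a + b | a b. a \<in> U \<inter> Q \<and> b \<in> W \<inter> Q}"
  have sN: "qvs.subspace N" unfolding N_def using assms by (intro qvs.subspace_sums QU_subspace)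
  have NQ: "N \<subseteq> Q" unfolding N_def using qvs.subspace_add[OF Q_subspace] by blast
  have NS: "N \<subseteq> ssum U W" unfolding N_def ssum_def by blast
  have "U \<inter> Q \<subseteq> N" "W \<inter> Q \<subseteq> N" unfolding N_def
    using qvs.subspace_0[OF QU_subspace[OF assms(1)]] qvs.subspace_0[OF QU_subspace[OF assms(2)]]
    by (force intro: exI[of _ 0])+
  then have "U \<subseteq> rvs.span N" "W \<subseteq> rvs.span N" using U W rvs.span_mono by blast+
  then have "ssum U W \<subseteq> rvs.span N" using rvs.span_add unfolding ssum_def by blast
  then obtain l where l: "l \<in> N" "u + w - l \<in> perp (ssum U W)"
    using rational_projection[OF sN NQ S(1,2) NS _ assms(6)] by blast
  have "u + w \<in> ssum U W" using assms unfolding ssum_def by blast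
  then have "u + w - l \<in> ssum U W" using l NS S(1) cvs.subspace_diff by blast
  then have "u + w - l = 0" using perp_Int[OF S(1,2)] l(2) by blast
  then obtain a b where ab: "a \<in> U \<inter> Q" "b \<in> W \<inter> Q" "u + w = a + b"
    using l(1) unfolding N_def by auto
  then have "u = a \<and> w = b"
    using direct_unique[OF U(1) W(1) assms(3,4) _ assms(5)] by blast
  then show ?thesis using ab by blast
qed

section \<open>Isomorphisms between subvarieties, and cancellation\<close>

definition iso :: "'v set \<Rightarrow> 'v set \<Rightarrow> bool" where
  "iso U W \<longleftrightarrow> (\<exists>f. qiso (subt X U) (subt X W) f)"

lemma good_torus: "good U \<Longrightarrow> complex_torus (subt X U)"
proof (rule complex_torus_subt[OF torus])
  assume g: "good U"
  show "cvs.subspace U" using goodD[OF g] by blast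
  have "U \<inter> Q \<subseteq> rvs.span (U \<inter> period_lat X)"
  proof
    fix u assume u: "u \<in> U \<inter> Q"
    then obtain m where m: "(m::int) \<noteq> 0" "of_int m *\<^sub>C u \<in> period_lat X" by (auto simp: rational_pts_def)
    then have "of_int m *\<^sub>C u \<in> U \<inter> period_lat X" using u goodD(1)[OF g] cvs.subspace_scale by blast
    then have "complex_of_real (1 / of_int m) *\<^sub>C of_int m *\<^sub>C u \<in> rvs.span (U \<inter> period_lat X)"
      by (intro rvs.span_scale rvs.span_base)
    then show "u \<in> rvs.span (U \<inter> period_lat X)" using m(1) by (simp add: scaleC_one)
  qed
  then show "U \<subseteq> rvs.span (U \<inter> period_lat X)"
    using goodD(3)[OF g] rvs.span_minimal[OF _ rvs.subspace_span] by blast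
qed

lemma iso_iff:
  assumes "good U" "good W"
  shows "qiso (subt X U) (subt X W) f \<longleftrightarrow> clin U f \<and> bij_betw f U W \<and> f ` (U \<inter> Q) = W \<inter> Q"
  using goodD[OF assms(1)] goodD[OF assms(2)] by (simp add: qiso_def rational_pts_subt)

lemma iso_sym: "good U \<Longrightarrow> iso U W \<Longrightarrow> iso W U"
  unfolding iso_def using qiso_sym[OF complex_torus_fg[OF good_torus]] by blast

lemma iso_trans: "iso U W \<Longrightarrow> iso W Z \<Longrightarrow> iso U Z"
  unfolding iso_def using qiso_trans by blast

text \<open>The isomorphisms below are natural as graphs, for instance as congruence modulo a
  subspace. This turns such a graph into a map.\<close>

lemma iso_of_relation:
  assumes g: "good U" "good W"
    and ex: "\<And>u. u \<in> U \<Longrightarrow> \<exists>w\<in>W. R u w" "\<And>w. w \<in> W \<Longrightarrow> \<exists>u\<in>U. R u w"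
    and un: "\<And>u w w'. u \<in> U \<Longrightarrow> w \<in> W \<Longrightarrow> w' \<in> W \<Longrightarrow> R u w \<Longrightarrow> R u w' \<Longrightarrow> w = w'"
      "\<And>u u' w. u \<in> U \<Longrightarrow> u' \<in> U \<Longrightarrow> w \<in> W \<Longrightarrow> R u w \<Longrightarrow> R u' w \<Longrightarrow> u = u'"
    and add: "\<And>u u' w w'. u \<in> U \<Longrightarrow> u' \<in> U \<Longrightarrow> w \<in> W \<Longrightarrow> w' \<in> W \<Longrightarrow> R u w \<Longrightarrow> R u' w' \<Longrightarrow> R (u + u') (w + w')"
    and scale: "\<And>c u w. u \<in> U \<Longrightarrow> w \<in> W \<Longrightarrow> R u w \<Longrightarrow> R (c *\<^sub>C u) (c *\<^sub>C w)"
    and rat: "\<And>u w. u \<in> U \<Longrightarrow> w \<in> W \<Longrightarrow> R u w \<Longrightarrow> u \<in> Q \<longleftrightarrow> w \<in> Q"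
  shows "iso U W"
proof -
  obtain f where f: "\<And>u. u \<in> U \<Longrightarrow> f u \<in> W \<and> R u (f u)" using ex(1) by metis
  have fI: "f u = w" if "u \<in> U" "w \<in> W" "R u w" for u w using un(1) f that by blast
  note sU = goodD(1)[OF g(1)] and sW = goodD(1)[OF g(2)]
  have "clin U f"
    unfolding clin_def
    using f add scale cvs.subspace_add[OF sU] cvs.subspace_add[OF sW]
      cvs.subspace_scale[OF sU] cvs.subspace_scale[OF sW] by (auto intro!: fI)
  moreover have "bij_betw f U W"
    unfolding bij_betw_def
  proof
    show "inj_on f U" using f un(2) by (metis inj_onI)
    show "f ` U = W" using f ex(2) fI by (metis image_eqI image_subsetI subsetI subset_antisym)
  qed
  moreover have "f ` (U \<inter> Q) = W \<inter> Q"
  proof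
    show "f ` (U \<inter> Q) \<subseteq> W \<inter> Q" using f rat by blast
    show "W \<inter> Q \<subseteq> f ` (U \<inter> Q)"
    proof
      fix w assume w: "w \<in> W \<inter> Q"
      then obtain u where "u \<in> U" "R u w" using ex(2) by blast
      then show "w \<in> f ` (U \<inter> Q)" using w fI rat by (intro image_eqI[of _ _ u]) auto
    qed
  qed
  ultimately show ?thesis unfolding iso_def using iso_iff[OF g] by blast
qed

text \<open>Both complements project isomorphically onto the quotient by S; congruence modulo S is
  the graph of the resulting map. Rational vectors correspond because splittings of rational vectors
  are rational.\<close>

lemma iso_complements:
  assumes "good S" "good U" "good W" "S \<inter> U = {0}" "S \<inter> W = {0}" "ssum S U = ssum S W"
  shows "iso U W"
proof -
  note S = goodD[OF assms(1)] and U = goodD[OF assms(2)] and W = goodD[OF assms(3)]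
  have key: "u = w" if "u \<in> T" "w \<in> T" "u - x \<in> S" "w - x \<in> S" "S \<inter> T = {0}" "cvs.subspace T" for u w x T
  proof -
    have "(u - x) - (w - x) \<in> S" by (rule cvs.subspace_diff[OF S(1) that(3,4)])
    moreover have "u - w \<in> T" by (rule cvs.subspace_diff[OF that(6,1,2)])
    moreover have "(u - x) - (w - x) = u - w" by simp
    ultimately have "u - w \<in> S \<inter> T" by simp
    then show ?thesis using that(5) by simp
  qed
  have ex: "\<exists>w\<in>B. u - w \<in> S" if "u \<in> A" "ssum S A = ssum S B" "cvs.subspace A" for u A B
  proof -
    have "u \<in> ssum S B" using that ssum_sup[OF S(1) that(3)] by blast
    then obtain s w where "s \<in> S" "w \<in> B" "u = s + w" unfolding ssum_def by blast
    then show ?thesis by (auto intro!: bexI[of _ w])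
  qed
  have neg: "u - w \<in> S \<longleftrightarrow> w - u \<in> S" for u w using cvs.subspace_neg[OF S(1)] by (metis minus_diff_eq)
  show ?thesis
  proof (rule iso_of_relation[OF assms(2,3), where R = "\<lambda>u w. u - w \<in> S"])
    show "\<exists>w\<in>W. u - w \<in> S" if "u \<in> U" for u using ex[OF that assms(6) U(1)] .
    show "\<exists>u\<in>U. u - w \<in> S" if "w \<in> W" for w using ex[OF that assms(6)[symmetric] W(1)] neg by blast
    show "w = w'" if "w \<in> W" "w' \<in> W" "u - w \<in> S" "u - w' \<in> S" for u w w'
      using key[OF that(1,2) _ _ assms(5) W(1)] that neg by blast
    show "u = u'" if "u \<in> U" "u' \<in> U" "u - w \<in> S" "u' - w \<in> S" for u u' w
      using key[OF that assms(4) U(1)] .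
    show "u + u' - (w + w') \<in> S" if "u - w \<in> S" "u' - w' \<in> S" for u u' w w'
      using cvs.subspace_add[OF S(1) that] by (simp add: algebra_simps)
    show "c *\<^sub>C u - c *\<^sub>C w \<in> S" if "u - w \<in> S" for c u w
      using cvs.subspace_scale[OF S(1) that, of c] by (simp add: cvs.scale_right_diff_distrib)
    show "u \<in> Q \<longleftrightarrow> w \<in> Q" if "u \<in> U" "w \<in> W" "u - w \<in> S" for u w
    proof
      assume "u \<in> Q"
      then have "(u - w) + w \<in> Q" by simp
      then show "w \<in> Q" using split_rational[OF assms(1,3,5) that(3,2)] by blast
    next
      assume "w \<in> Q"
      then have "(w - u) + u \<in> Q" by simp
      then show "u \<in> Q" using split_rational[OF assms(1,2,4) _ that(1)] that(3) neg by blast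
    qed
  qed
qed

text \<open>The given isomorphism is extended by the identity on the common summand C.\<close>

lemma iso_glue:
  assumes g: "good U" "good W" "good C" and d: "U \<inter> C = {0}" "W \<inter> C = {0}" and i: "iso U W"
  shows "iso (ssum U C) (ssum W C)"
proof -
  obtain f where f: "clin U f" "bij_betw f U W" "f ` (U \<inter> Q) = W \<inter> Q"
    using i iso_iff[OF g(1,2)] unfolding iso_def by blast
  note U = goodD[OF g(1)] and W = goodD[OF g(2)] and C = goodD[OF g(3)]
  have fW: "f u \<in> W" if "u \<in> U" for u using f(2) that by (auto simp: bij_betw_def)
  have fQ: "u \<in> Q \<longleftrightarrow> f u \<in> Q" if u: "u \<in> U" for u
  proof
    assume "f u \<in> Q"
    then obtain v where "v \<in> U \<inter> Q" "f u = f v" using f(3) fW[OF u] by blast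
    then show "u \<in> Q" using f(2) u by (metis IntD1 IntD2 bij_betw_imp_inj_on inj_onD)
  qed (use f(3) u in blast)
  have Qadd: "a \<in> Q \<Longrightarrow> b \<in> Q \<Longrightarrow> a + b \<in> Q" for a b using Q_subspace by (rule qvs.subspace_add)
  define R where "R z z' \<longleftrightarrow> (\<exists>u\<in>U. \<exists>c\<in>C. z = u + c \<and> z' = f u + c)" for z z'
  show ?thesis
  proof (rule iso_of_relation[OF good_ssum[OF g(1,3)] good_ssum[OF g(2,3)], where R = R])
    show "\<exists>w\<in>ssum W C. R u w" if "u \<in> ssum U C" for u
      using that fW unfolding R_def ssum_def by blast
    show "\<exists>u\<in>ssum U C. R u w" if w: "w \<in> ssum W C" for w
    proof -
      obtain a c where ac: "a \<in> W" "c \<in> C" "w = a + c" using w unfolding ssum_def by blast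
      obtain u where "u \<in> U" "f u = a" using ac(1) bij_betw_imp_surj_on[OF f(2)] by blast
      then show ?thesis using ac unfolding R_def ssum_def by blast
    qed
    show "w = w'" if "R u w" "R u w'" for u w w'
    proof -
      obtain a c a' c' where "a \<in> U" "c \<in> C" "u = a + c" "w = f a + c" "a' \<in> U" "c' \<in> C" "u = a' + c'" "w' = f a' + c'"
        using \<open>R u w\<close> \<open>R u w'\<close> unfolding R_def by blast
      then show ?thesis using direct_unique[OF U(1) C(1) d(1), of a a' c c'] by simp
    qed
    show "u = u'" if "R u w" "R u' w" for u u' w
    proof -
      obtain a c a' c' where *: "a \<in> U" "c \<in> C" "u = a + c" "w = f a + c" "a' \<in> U" "c' \<in> C" "u' = a' + c'" "w = f a' + c'"
        using \<open>R u w\<close> \<open>R u' w\<close> unfolding R_def by blast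
      then have "f a = f a'" "c = c'" using direct_unique[OF W(1) C(1) d(2), of "f a" "f a'" c c'] fW by simp_all
      then show ?thesis using * f(2) by (metis bij_betw_imp_inj_on inj_onD)
    qed
    show "R (u + u') (w + w')" if "R u w" "R u' w'" for u u' w w'
    proof -
      obtain a c a' c' where "a \<in> U" "c \<in> C" "u = a + c" "w = f a + c" "a' \<in> U" "c' \<in> C" "u' = a' + c'" "w' = f a' + c'"
        using \<open>R u w\<close> \<open>R u' w'\<close> unfolding R_def by blast
      then show ?thesis unfolding R_def
        using clin_add[OF f(1)] cvs.subspace_add[OF U(1)] cvs.subspace_add[OF C(1)]
        by (intro bexI[of _ "a + a'"] bexI[of _ "c + c'"]) (auto simp: algebra_simps)
    qed
    show "R (k *\<^sub>C u) (k *\<^sub>C w)" if "R u w" for k u w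
    proof -
      obtain a c where "a \<in> U" "c \<in> C" "u = a + c" "w = f a + c"
        using \<open>R u w\<close> unfolding R_def by blast
      then show ?thesis unfolding R_def
        using clin_scale[OF f(1)] cvs.subspace_scale[OF U(1)] cvs.subspace_scale[OF C(1)]
        by (intro bexI[of _ "k *\<^sub>C a"] bexI[of _ "k *\<^sub>C c"]) (auto simp: cvs.scale_right_distrib)
    qed
    show "u \<in> Q \<longleftrightarrow> w \<in> Q" if r: "R u w" for u w
    proof -
      obtain a c where ac: "a \<in> U" "c \<in> C" "u = a + c" "w = f a + c" using r unfolding R_def by blast
      then show ?thesis
        using split_rational[OF g(1,3) d(1) ac(1,2)] split_rational[OF g(2,3) d(2) fW[OF ac(1)] ac(2)]
          fQ[OF ac(1)] Qadd by blast
    qed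
  qed
qed

lemma iso_image:
  assumes g: "good U" "good W" "good D" "D \<subseteq> U" and f: "qiso (subt X U) (subt X W) f"
  shows "good (f ` D)" "iso D (f ` D)"
proof -
  have f: "clin U f" "bij_betw f U W" "f ` (U \<inter> Q) = W \<inter> Q" using f iso_iff[OF g(1,2)] by blast+
  note D = goodD[OF g(3)] and U = goodD[OF g(1)] and W = goodD[OF g(2)]
  have cl: "clin D f" using f(1) g(4) unfolding clin_def by blast
  have sub: "cvs.subspace (f ` D)" by (rule clin_image_subspace[OF cl D(1)])
  have fDW: "f ` D \<subseteq> W" using f(2) g(4) by (auto simp: bij_betw_def)
  have img: "f ` (D \<inter> Q) = f ` D \<inter> Q"
  proof
    show "f ` (D \<inter> Q) \<subseteq> f ` D \<inter> Q" using f(3) g(4) by blast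
    show "f ` D \<inter> Q \<subseteq> f ` (D \<inter> Q)"
    proof
      fix w assume w: "w \<in> f ` D \<inter> Q"
      then obtain d where d: "d \<in> D" "w = f d" by blast
      obtain u where u: "u \<in> U \<inter> Q" "w = f u" using f(3) fDW w by blast
      then have "u = d" using d f(2) g(4) by (metis IntD1 bij_betw_imp_inj_on inj_onD subsetD)
      then show "w \<in> f ` (D \<inter> Q)" using u d by blast
    qed
  qed
  have "rvs.subspace {x \<in> D. f x \<in> rvs.span (f ` D \<inter> Q)}"
    unfolding rvs.subspace_def
    using clin_zero[OF cl D(1)] clin_add[OF cl] clin_scale[OF cl] D(1)
      rvs.span_add rvs.span_scale rvs.span_zero
    by (auto simp: cvs.subspace_def)
  then have "rvs.span (D \<inter> Q) \<subseteq> {x \<in> D. f x \<in> rvs.span (f ` D \<inter> Q)}"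
    by (intro rvs.span_minimal) (use img in \<open>auto intro: rvs.span_base\<close>)
  then have "f ` D \<subseteq> rvs.span (f ` D \<inter> Q)" using D(3) by blast
  then show good: "good (f ` D)" using sub fDW W(2) by (auto simp: good_def)
  have "bij_betw f D (f ` D)" using f(2) g(4) by (meson bij_betw_def bij_betw_subset)
  then have "qiso (subt X D) (subt X (f ` D)) f" using iso_iff[OF g(3) good] cl img by blast
  then show "iso D (f ` D)" unfolding iso_def by blast
qed

lemma iso_dim:
  assumes "good U" "good W" "iso U W" shows "cvs.dim U = cvs.dim W"
proof -
  have le: "cvs.dim A \<le> cvs.dim B" if g: "good A" "good B" "iso A B" for A B
  proof -
    obtain f where f: "clin A f" "bij_betw f A B" using g iso_iff[OF g(1,2)] unfolding iso_def by blast
    obtain C where "finite C" "V \<subseteq> cvs.span C" by (rule fin_span)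
    then have "cvs.dim A \<le> cvs.dim (f ` A)"
      using clin_dim_le[OF f(1) bij_betw_imp_inj_on[OF f(2)] goodD(1)[OF g(1)]]
        bij_betw_imp_surj_on[OF f(2)] goodD(2)[OF g(1)] goodD(2)[OF g(2)] by blast
    then show ?thesis using bij_betw_imp_surj_on[OF f(2)] by simp
  qed
  show ?thesis using le[OF assms] le[OF assms(2,1) iso_sym[OF assms(1,3)]] by simp
qed

lemma dim_less: assumes "good U" "good W" "U \<subset> W" shows "cvs.dim U < cvs.dim W"
proof -
  obtain C where "finite C" "V \<subseteq> cvs.span C" by (rule fin_span)
  then show ?thesis using cvs.dim_psubset[of C W U] assms goodD by blast
qed

text \<open>Induction on the dimension of I, with D the intersection of I and J. If D = I then I =
  J, and U and W are complements of one subspace. Otherwise write I = D + I1 and J = D + J1. The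
  isomorphism carries the first splitting to a splitting of J whose first summand is isomorphic to
  D, and D is smaller than I; so by induction I1 and J1 are isomorphic. Finally I + J equals both I
  + J1 and J + I1. With C a complement of I + J in the whole sum, U is isomorphic to J1 + C and W to
  I1 + C.\<close>

lemma cancellation:
  assumes "good I" "good J" "good U" "good W" "I \<inter> U = {0}" "J \<inter> W = {0}"
    "ssum I U = ssum J W" "iso I J"
  shows "iso U W"
  using assms
proof (induction "cvs.dim I" arbitrary: I J U W rule: less_induct)
  case less
  note g = less.prems(1-4)
  define D where "D = I \<inter> J"
  have gD: "good D" unfolding D_def using g by (simp add: good_Int)
  show ?case
  proof (cases "D = I")
    case True
    then have "I \<subseteq> J" unfolding D_def by blast
    then have "I = J" using dim_less[OF g(1,2)] iso_dim[OF g(1,2) less.prems(8)] by auto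
    then show ?thesis using iso_complements[OF g(1,3,4)] less.prems by simp
  next
    case False
    have DI: "D \<subseteq> I" and DJ: "D \<subseteq> J" by (auto simp: D_def)
    define I1 where "I1 = I \<inter> perp D"
    define J1 where "J1 = J \<inter> perp D"
    note I1 = relative_complement[OF gD g(1) DI, folded I1_def]
    note J1 = relative_complement[OF gD g(2) DJ, folded J1_def]
    note s = goodD(1)
    obtain f where f: "qiso (subt X I) (subt X J) f" using less.prems(8) unfolding iso_def by blast
    then have f': "clin I f" "bij_betw f I J" "f ` (I \<inter> Q) = J \<inter> Q" using iso_iff[OF g(1,2)] by blast+
    have I1I: "I1 \<subseteq> I" by (auto simp: I1_def)
    note fD = iso_image[OF g(1,2) gD DI f] and fI1 = iso_image[OF g(1,2) I1(1) I1I f]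
    have dimfD: "cvs.dim (f ` D) < cvs.dim I"
      using iso_dim[OF gD fD] dim_less[OF gD g(1)] False DI by auto
    have "f ` D \<inter> f ` I1 = f ` (D \<inter> I1)"
      using inj_on_image_Int[OF bij_betw_imp_inj_on[OF f'(2)] DI I1I] by simp
    then have "f ` D \<inter> f ` I1 = {0}" using I1(3) clin_zero[OF f'(1) s[OF g(1)]] by simp
    moreover have "ssum (f ` D) (f ` I1) = f ` (ssum D I1)"
    proof
      show "ssum (f ` D) (f ` I1) \<subseteq> f ` ssum D I1"
      proof
        fix x assume "x \<in> ssum (f ` D) (f ` I1)"
        then obtain a b where ab: "a \<in> D" "b \<in> I1" "x = f a + f b" unfolding ssum_def by blast
        then have "x = f (a + b)" using clin_add[OF f'(1)] DI I1I by (metis subsetD)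
        then show "x \<in> f ` ssum D I1" using ab unfolding ssum_def by blast
      qed
      show "f ` ssum D I1 \<subseteq> ssum (f ` D) (f ` I1)"
      proof
        fix x assume "x \<in> f ` ssum D I1"
        then obtain a b where ab: "a \<in> D" "b \<in> I1" "x = f (a + b)" unfolding ssum_def by blast
        then have "x = f a + f b" using clin_add[OF f'(1)] DI I1I by (metis subsetD)
        then show "x \<in> ssum (f ` D) (f ` I1)" using ab unfolding ssum_def by blast
      qed
    qed
    \<comment> \<open>The induction hypothesis is used on two splittings of J: by the images of D
      and I1, and by D and J1.\<close>
    ultimately have "iso (f ` I1) J1"
      using less.hyps[OF dimfD fD(1) gD fI1(1) J1(1)] J1(2,3) I1(2) bij_betw_imp_surj_on[OF f'(2)]
        iso_sym[OF gD fD(2)] by simp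
    then have i: "iso J1 I1" using iso_trans[OF fI1(2)] iso_sym[OF I1(1)] by blast
    define S where "S = ssum I J"
    have gS: "good S" unfolding S_def using g by (simp add: good_ssum)
    define Z where "Z = ssum I U"
    have gZ: "good Z" unfolding Z_def using g by (simp add: good_ssum)
    have ZJ: "Z = ssum J W" unfolding Z_def using less.prems(7) .
    have "I \<subseteq> Z" "J \<subseteq> Z" using ssum_sup[OF s s] g unfolding Z_def less.prems(7) 
      by (metis Z_def ZJ ssum_sup s)+
    then have SZ: "S \<subseteq> Z" unfolding S_def ssum_def using cvs.subspace_add[OF s[OF gZ]] by blast
    define C where "C = Z \<inter> perp S"
    note C = relative_complement[OF gS gZ SZ, folded C_def]
    have SI: "S = ssum I J1"
    proof
      show "ssum I J1 \<subseteq> S" unfolding S_def ssum_def J1_def by blast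
      show "S \<subseteq> ssum I J1"
      proof
        fix x assume "x \<in> S"
        then obtain a b where ab: "a \<in> I" "b \<in> J" "x = a + b" unfolding S_def ssum_def by blast
        then obtain d j where "d \<in> D" "j \<in> J1" "b = d + j" using J1(2) unfolding ssum_def by blast
        then have "x = (a + d) + j" "a + d \<in> I" using ab DI cvs.subspace_add[OF s[OF g(1)]] by (auto simp: add.assoc)
        then show "x \<in> ssum I J1" using \<open>j \<in> J1\<close> unfolding ssum_def by blast
      qed
    qed
    have SJ: "S = ssum J I1"
    proof
      show "ssum J I1 \<subseteq> S" unfolding S_def ssum_def I1_def by (auto simp: add.commute) (metis add.commute)
      show "S \<subseteq> ssum J I1"
      proof
        fix x assume "x \<in> S"
        then obtain a b where ab: "a \<in> I" "b \<in> J" "x = a + b" unfolding S_def ssum_def by blast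
        then obtain d j where "d \<in> D" "j \<in> I1" "a = d + j" using I1(2) unfolding ssum_def by blast
        then have "x = (b + d) + j" "b + d \<in> J" using ab DJ cvs.subspace_add[OF s[OF g(2)]] by (auto simp: algebra_simps)
        then show "x \<in> ssum J I1" using \<open>j \<in> I1\<close> unfolding ssum_def by blast
      qed
    qed
    \<comment> \<open>Used with (A, T, B) equal to (U, I, J1) and to (W, J, I1): A and B + C are
      both complements of T in Z.\<close>
    have part: "iso A (ssum B C) \<and> B \<inter> C = {0}"
      if "good A" "good T" "good B" "T \<inter> A = {0}" "T \<inter> B = {0}" "S = ssum T B" "Z = ssum T A" for A B T
    proof -
      have BS: "B \<subseteq> S" "T \<subseteq> S" using ssum_sup[OF s[OF that(2)] s[OF that(3)]] that by auto
      have BC: "B \<inter> C = {0}"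
        using C(3) BS cvs.subspace_0[OF s[OF that(3)]] cvs.subspace_0[OF s[OF C(1)]] by blast
      have "T \<inter> ssum B C = {0}"
      proof
        show "T \<inter> ssum B C \<subseteq> {0}"
        proof
          fix x assume x: "x \<in> T \<inter> ssum B C"
          then obtain b c where bc: "b \<in> B" "c \<in> C" "x = b + c" unfolding ssum_def by blast
          have "x - b \<in> S" using x bc BS by (intro cvs.subspace_diff[OF s[OF gS]]) auto
          then have "c = 0" using bc C(3) by auto
          then show "x \<in> {0}" using x bc that(5) by auto
        qed
      qed (use cvs.subspace_0[OF s[OF that(2)]] cvs.subspace_0[OF s[OF good_ssum[OF that(3) C(1)]]] in blast)
      moreover have "ssum T A = ssum T (ssum B C)"
        using C(2) that(6,7) ssum_assoc by metis
      ultimately show ?thesis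
        using iso_complements[OF that(2,1) good_ssum[OF that(3) C(1)] that(4)] BC by blast
    qed
    have IJ1: "I \<inter> J1 = {0}"
    proof -
      have "I \<inter> J1 = D \<inter> J1" using J1_def D_def by blast
      then show ?thesis using J1(3) by simp
    qed
    have JI1: "J \<inter> I1 = {0}"
    proof -
      have "J \<inter> I1 = D \<inter> I1" using I1_def D_def by blast
      then show ?thesis using I1(3) by simp
    qed
    have 1: "iso U (ssum J1 C)" "J1 \<inter> C = {0}"
      using part[OF g(3,1) J1(1) less.prems(5) IJ1 SI Z_def] by auto
    have 2: "iso W (ssum I1 C)" "I1 \<inter> C = {0}"
      using part[OF g(4,2) I1(1) less.prems(6) JI1 SJ ZJ] by auto
    have "iso (ssum J1 C) (ssum I1 C)" by (rule iso_glue[OF J1(1) I1(1) C(1) 1(2) 2(2) i])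
    then show ?thesis using 1(1) iso_sym[OF g(4) 2(1)] iso_trans by blast
  qed
qed

end

section \<open>Finite products of tori\<close>

definition tuple_single :: "nat \<Rightarrow> 'v::zero \<Rightarrow> nat \<Rightarrow> 'v" where
  "tuple_single i v = (\<lambda>j. if j = i then v else 0)"

lemma scaleC_fun_apply: "(c *\<^sub>C f) i = c *\<^sub>C (f i)"
  by (simp add: scaleC_fun_def)

lemma sum_fun_apply: "(\<Sum>i\<in>I. f i) x = (\<Sum>i\<in>I. f i x)"
  by (induction I rule: infinite_finite_induct) auto

lemma sum_tuple_single:
  assumes "\<forall>i\<ge>r. f i = 0" shows "(\<Sum>i<r. tuple_single i (f i)) = (f :: nat \<Rightarrow> 'v::ab_group_add)"
proof
  fix j
  have "(\<Sum>i<r. tuple_single i (f i)) j = (\<Sum>i<r. if i = j then f i else 0)"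
    unfolding sum_fun_apply tuple_single_def by (intro sum.cong) auto
  then show "(\<Sum>i<r. tuple_single i (f i)) j = f j" using assms by (simp add: sum.delta)
qed

lemma clin_tuple_single: "clin UNIV (tuple_single i)"
  by (auto simp: clin_def tuple_single_def fun_eq_iff scaleC_fun_apply)

lemma prod_torus_simps:
  "cover (prod_torus Xs) = {f. (\<forall>i<length Xs. f i \<in> cover (Xs ! i)) \<and> (\<forall>i\<ge>length Xs. f i = 0)}"
  "period_lat (prod_torus Xs) = {f. (\<forall>i<length Xs. f i \<in> period_lat (Xs ! i)) \<and> (\<forall>i\<ge>length Xs. f i = 0)}"
  by (simp_all add: prod_torus_def)

lemma fg_prod_torus:
  assumes fg: "\<And>i. i < length Xs \<Longrightarrow> fg_torus (Xs ! i)"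
  shows "fg_torus (prod_torus Xs)"
proof -
  let ?P = "prod_torus Xs"
  have "\<forall>i\<in>{..<length Xs}. \<exists>B. finite B \<and> B \<subseteq> cover (Xs ! i) \<and> period_lat (Xs ! i) = zmod.span B"
    using fg by (auto simp: fg_torus_def)
  then obtain B where B: "\<And>i. i < length Xs \<Longrightarrow> finite (B i)" "\<And>i. i < length Xs \<Longrightarrow> B i \<subseteq> cover (Xs ! i)"
    "\<And>i. i < length Xs \<Longrightarrow> period_lat (Xs ! i) = zmod.span (B i)" by (metis lessThan_iff)
  define C where "C = (\<Union>i<length Xs. tuple_single i ` B i)"
  note s = fg_torusD(1)[OF fg] and l = fg_torusD(3)[OF fg]
  have sub: "cvs.subspace (cover ?P)"
    unfolding cvs.subspace_def prod_torus_simps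
    using cvs.subspace_0[OF s] cvs.subspace_add[OF s] cvs.subspace_scale[OF s]
    by (auto simp: scaleC_fun_apply)
  have subl: "zmod.subspace (period_lat ?P)"
    unfolding zmod.subspace_def prod_torus_simps
    using zmod.subspace_0[OF l] zmod.subspace_add[OF l] zmod.subspace_scale[OF l]
    by (auto simp: scaleC_fun_apply)
  have single: "tuple_single i v \<in> period_lat ?P" if "i < length Xs" "v \<in> period_lat (Xs ! i)" for i v
    using that zmod.subspace_0[OF l] by (auto simp: prod_torus_simps tuple_single_def)
  have CP: "C \<subseteq> period_lat ?P"
    unfolding C_def using single B(3) zmod.span_base by blast
  moreover have "period_lat ?P \<subseteq> cover ?P"
    using fg_torusD(2)[OF fg] by (auto simp: prod_torus_simps)
  ultimately have "C \<subseteq> cover ?P" by blast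
  moreover have "finite C" unfolding C_def using B(1) by auto
  moreover have "zmod.span C \<subseteq> period_lat ?P" using CP subl by (rule zmod.span_minimal)
  moreover have "period_lat ?P \<subseteq> zmod.span C"
  proof
    fix f assume f: "f \<in> period_lat ?P"
    have "tuple_single i (f i) \<in> zmod.span C" if i: "i < length Xs" for i
    proof -
      have "zmod.subspace {v. tuple_single i v \<in> zmod.span C}"
        unfolding zmod.subspace_def
        using zmod.span_zero zmod.span_add zmod.span_scale
        by (auto simp: clin_add[OF clin_tuple_single] clin_scale[OF clin_tuple_single]
          clin_zero[OF clin_tuple_single cvs.subspace_UNIV])
      then have "zmod.span (B i) \<subseteq> {v. tuple_single i v \<in> zmod.span C}"
        by (intro zmod.span_minimal) (use i in \<open>auto simp: C_def intro: zmod.span_base\<close>)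
      moreover have "f i \<in> zmod.span (B i)" using f i B(3) by (auto simp: prod_torus_simps)
      ultimately show ?thesis by blast
    qed
    then have "(\<Sum>i<length Xs. tuple_single i (f i)) \<in> zmod.span C" by (intro zmod.span_sum) auto
    then show "f \<in> zmod.span C" using f sum_tuple_single[of "length Xs" f] by (simp add: prod_torus_simps)
  qed
  ultimately show ?thesis using sub by (auto simp: fg_torus_def)
qed

lemma rational_pts_prod:
  assumes fg: "\<And>i. i < length Xs \<Longrightarrow> fg_torus (Xs ! i)"
  shows "rational_pts (prod_torus Xs) =
    {f. (\<forall>i<length Xs. f i \<in> rational_pts (Xs ! i)) \<and> (\<forall>i\<ge>length Xs. f i = 0)}"
proof
  show "rational_pts (prod_torus Xs) \<subseteq> {f. (\<forall>i<length Xs. f i \<in> rational_pts (Xs ! i)) \<and> (\<forall>i\<ge>length Xs. f i = 0)}"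
    by (auto simp: rational_pts_def prod_torus_simps scaleC_fun_apply)
  show "{f. (\<forall>i<length Xs. f i \<in> rational_pts (Xs ! i)) \<and> (\<forall>i\<ge>length Xs. f i = 0)} \<subseteq> rational_pts (prod_torus Xs)"
  proof safe
    fix f :: "nat \<Rightarrow> 'a" assume f: "\<forall>i<length Xs. f i \<in> rational_pts (Xs ! i)" "\<forall>i\<ge>length Xs. f i = 0"
    then have "\<forall>i\<in>{..<length Xs}. \<exists>m::int. m \<noteq> 0 \<and> of_int m *\<^sub>C f i \<in> period_lat (Xs ! i)"
      by (auto simp: rational_pts_def)
    then obtain m :: "nat \<Rightarrow> int" where m: "\<And>i. i < length Xs \<Longrightarrow> m i \<noteq> 0 \<and> of_int (m i) *\<^sub>C f i \<in> period_lat (Xs ! i)"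
      by (metis lessThan_iff)
    \<comment> \<open>One denominator for all components at once.\<close>
    define k where "k = (\<Prod>i<length Xs. m i)"
    have "of_int k *\<^sub>C f i \<in> period_lat (Xs ! i)" if i: "i < length Xs" for i
    proof -
      have "k = (\<Prod>j\<in>{..<length Xs} - {i}. m j) * m i"
        unfolding k_def using i by (simp add: prod.remove mult.commute)
      then have "of_int k *\<^sub>C f i = of_int (\<Prod>j\<in>{..<length Xs} - {i}. m j) *\<^sub>C of_int (m i) *\<^sub>C f i" by simp
      also have "\<dots> \<in> period_lat (Xs ! i)"
        using m[OF i] by (intro zmod.subspace_scale[OF fg_torusD(3)[OF fg[OF i]], of "of_int (m i) *\<^sub>C f i"]) simp
      finally show ?thesis .
    qed
    moreover have "k \<noteq> 0" unfolding k_def using m by auto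
    ultimately show "f \<in> rational_pts (prod_torus Xs)"
      using f unfolding rational_pts_def prod_torus_simps
      by (auto simp: scaleC_fun_apply rational_pts_def intro!: exI[of _ k])
  qed
qed

section \<open>Uniqueness of complements, and splitting by idempotents\<close>

context polarized_torus
begin

text \<open>The lattice of Y spans its cover over the reals, and the inverse of f carries this
  property back to U.\<close>

lemma good_of_qiso:
  assumes U: "cvs.subspace U" "U \<subseteq> V" and Y: "complex_torus Y" and f: "qiso (subt X U) Y f"
  shows "good U"
proof -
  obtain B where B: "rvs.span B = cover Y"
    "B \<subseteq> period_lat Y"
  proof -
    obtain B where B: "finite B" "rvs.span B = cover Y"
      "period_lat Y = {\<Sum>b\<in>B. complex_of_int (c b) *\<^sub>C b | c. True}"
      using Y unfolding complex_torus_def by blast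
    have "B \<subseteq> period_lat Y" using B(3) zmod_span_finite[OF B(1)] zmod.span_superset[of B] by simp
    then show ?thesis using that B(2) by blast
  qed
  have f': "clin U f" "bij_betw f U (cover Y)" "f ` (U \<inter> Q) = rational_pts Y"
    using f U by (simp_all add: qiso_def rational_pts_subt)
  define g where "g = inv_into U f"
  have g: "clin (cover Y) g" unfolding g_def by (rule clin_inv_into[OF f'(1) U(1) f'(2)])
  note sY = fg_torusD(1)[OF complex_torus_fg[OF Y]]
  have "B \<subseteq> {y \<in> cover Y. g y \<in> rvs.span (U \<inter> Q)}"
  proof
    fix b assume "b \<in> B"
    then have "b \<in> rational_pts Y" using B(2) period_lat_rational[OF complex_torus_fg[OF Y]] by blast
    then obtain u where u: "u \<in> U \<inter> Q" "b = f u" using f'(3) by blast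
    then have "g b = u" unfolding g_def using f'(2) by (simp add: bij_betw_inv_into_left)
    then show "b \<in> {y \<in> cover Y. g y \<in> rvs.span (U \<inter> Q)}"
      using rvs.span_base[OF u(1)] \<open>b \<in> rational_pts Y\<close> by (simp add: rational_pts_def)
  qed
  moreover have "rvs.subspace {y \<in> cover Y. g y \<in> rvs.span (U \<inter> Q)}"
    unfolding rvs.subspace_def
    using clin_zero[OF g sY] clin_add[OF g] clin_scale[OF g] sY rvs.span_add rvs.span_scale rvs.span_zero
    by (auto simp: cvs.subspace_def)
  ultimately have sp: "cover Y \<subseteq> {y \<in> cover Y. g y \<in> rvs.span (U \<inter> Q)}"
    using B(1) rvs.span_minimal by metis
  have "U \<subseteq> rvs.span (U \<inter> Q)"
  proof
    fix u assume u: "u \<in> U"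
    then have "f u \<in> cover Y" using f'(2) by (auto simp: bij_betw_def)
    moreover have "g (f u) = u" unfolding g_def using f'(2) u by (simp add: bij_betw_inv_into_left)
    ultimately show "u \<in> rvs.span (U \<inter> Q)" using sp by force
  qed
  then show ?thesis using U by (simp add: good_def)
qed

text \<open>Makes an abstract product decomposition internal: the i-th factor is realized by the
  vectors whose other coordinates under F vanish.\<close>

lemma prod_components:
  assumes Y: "\<And>i. i < length Ys \<Longrightarrow> complex_torus (Ys ! i)" and F: "qiso X (prod_torus Ys) F"
    and i: "i < length Ys"
  defines "U \<equiv> {v \<in> V. \<forall>j. j \<noteq> i \<longrightarrow> F v j = 0}"
  shows "good U" "qiso (subt X U) (Ys ! i) (\<lambda>v. F v i)"
proof -
  have F': "clin V F" "bij_betw F V (cover (prod_torus Ys))" "F ` Q = rational_pts (prod_torus Ys)"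
    using F by (simp_all add: qiso_def)
  note rp = rational_pts_prod[OF complex_torus_fg[OF Y]]
  note sY = fg_torusD(1)[OF complex_torus_fg[OF Y]]
  have UV: "U \<subseteq> V" by (auto simp: U_def)
  have sU: "cvs.subspace U"
    unfolding U_def cvs.subspace_def
    using clin_zero[OF F'(1) sV] clin_add[OF F'(1)] clin_scale[OF F'(1)] V_closed
    by (auto simp: scaleC_fun_apply)
  have FU: "F v = tuple_single i (F v i)" if "v \<in> U" for v
    using that by (auto simp: U_def tuple_single_def)
  have sgl: "tuple_single i y \<in> cover (prod_torus Ys)" if "y \<in> cover (Ys ! i)" for y
    using that i cvs.subspace_0[OF sY] by (auto simp: prod_torus_simps tuple_single_def)
  have cl: "clin U (\<lambda>v. F v i)"
    using F'(1) UV by (auto simp: clin_def scaleC_fun_apply subset_iff)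
  have ex: "\<exists>v\<in>U. F v i = y" if y: "y \<in> cover (Ys ! i)" for y
  proof -
    obtain v where v: "v \<in> V" "F v = tuple_single i y"
      using sgl[OF y] unfolding bij_betw_imp_surj_on[OF F'(2), symmetric] by (auto elim: imageE)
    then show ?thesis by (intro bexI[of _ v]) (auto simp: U_def tuple_single_def)
  qed
  have bij: "bij_betw (\<lambda>v. F v i) U (cover (Ys ! i))"
    unfolding bij_betw_def
  proof
    show "inj_on (\<lambda>v. F v i) U"
    proof (rule inj_onI)
      fix u v assume "u \<in> U" "v \<in> U" "F u i = F v i"
      then have "F u = F v" using FU by metis
      then show "u = v" using F'(2) \<open>u \<in> U\<close> \<open>v \<in> U\<close> UV by (metis bij_betw_imp_inj_on inj_onD subsetD)
    qed
    show "(\<lambda>v. F v i) ` U = cover (Ys ! i)"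
    proof
      show "(\<lambda>v. F v i) ` U \<subseteq> cover (Ys ! i)"
      proof
        fix y assume "y \<in> (\<lambda>v. F v i) ` U"
        then obtain v where v: "v \<in> U" "y = F v i" by blast
        then have "F v \<in> cover (prod_torus Ys)" using F'(2) UV by (auto simp: bij_betw_def)
        then show "y \<in> cover (Ys ! i)" using i v by (simp add: prod_torus_simps)
      qed
      show "cover (Ys ! i) \<subseteq> (\<lambda>v. F v i) ` U" using ex by blast
    qed
  qed
  have rat: "(\<lambda>v. F v i) ` (U \<inter> Q) = rational_pts (Ys ! i)"
  proof
    show "(\<lambda>v. F v i) ` (U \<inter> Q) \<subseteq> rational_pts (Ys ! i)"
    proof
      fix y assume "y \<in> (\<lambda>v. F v i) ` (U \<inter> Q)"
      then obtain v where v: "v \<in> Q" "y = F v i" by blast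
      then have "F v \<in> rational_pts (prod_torus Ys)" using F'(3) by blast
      then show "y \<in> rational_pts (Ys ! i)" using v i rp by auto
    qed
    show "rational_pts (Ys ! i) \<subseteq> (\<lambda>v. F v i) ` (U \<inter> Q)"
    proof
      fix y assume y: "y \<in> rational_pts (Ys ! i)"
      have "0 \<in> rational_pts (Ys ! j)" if "j < length Ys" for j
        using period_lat_rational[OF complex_torus_fg[OF Y[OF that]]]
          zmod.subspace_0[OF fg_torusD(3)[OF complex_torus_fg[OF Y[OF that]]]] by blast
      then have "tuple_single i y \<in> rational_pts (prod_torus Ys)"
        using y i rp by (auto simp: tuple_single_def)
      then obtain v where v: "v \<in> Q" "F v = tuple_single i y" unfolding F'(3)[symmetric] by (auto elim: imageE)
      then have "v \<in> U \<inter> Q" using Q_sub by (auto simp: U_def tuple_single_def)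
      then show "y \<in> (\<lambda>v. F v i) ` (U \<inter> Q)" using v by (intro image_eqI[of _ _ v]) (auto simp: tuple_single_def)
    qed
  qed
  show q: "qiso (subt X U) (Ys ! i) (\<lambda>v. F v i)"
    using cl bij rat by (simp add: qiso_def rational_pts_subt[OF sU UV])
  show "good U" by (rule good_of_qiso[OF sU UV Y[OF i] q])
qed

text \<open>Each of the two isogenies embeds its own copy of Y in X, and the copies may be different
  subspaces. They are isomorphic, so \<open>cancellation\<close> applies to their complements. This
  makes the arbitrary choice in \<open>Prym\<close> harmless up to isogeny.\<close>

lemma complement_unique:
  assumes P: "complex_torus P" "complex_torus P'" "complex_torus Y"
    and XP: "X \<sim>\<^sub>i prod_torus [P, Y]" "X \<sim>\<^sub>i prod_torus [P', Y]"
  shows "P \<sim>\<^sub>i P'"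
proof -
  have comp: "\<exists>U W f g. good U \<and> good W \<and> U \<inter> W = {0} \<and> ssum U W = V \<and>
      qiso (subt X U) Y f \<and> qiso (subt X W) R g"
    if R: "complex_torus R" and iso: "X \<sim>\<^sub>i prod_torus [R, Y]" for R
  proof -
    have t: "complex_torus ([R, Y] ! i)" if "i < length [R, Y]" for i
      using that R P(3) by (cases i) auto
    obtain F where F: "qiso X (prod_torus [R, Y]) F"
      using iso isogenous_iff_qiso[OF fgX fg_prod_torus[OF complex_torus_fg[OF t]]] by blast
    define U where "U i = {v \<in> V. \<forall>j. j \<noteq> i \<longrightarrow> F v j = 0}" for i :: nat
    have UV: "U i \<subseteq> V" for i by (auto simp: U_def)
    have c: "i < 2 \<Longrightarrow> good (U i)" "i < 2 \<Longrightarrow> qiso (subt X (U i)) ([R, Y] ! i) (\<lambda>v. F v i)" for i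
      using prod_components[OF t F, of i] unfolding U_def by auto
    have F': "clin V F" "bij_betw F V (cover (prod_torus [R, Y]))" using F by (simp_all add: qiso_def)
    have "v = 0" if "v \<in> U 1 \<inter> U 0" for v
    proof -
      have "F v j = 0" for j using that by (cases "j = 0") (auto simp: U_def)
      then have "F v = F 0" using clin_zero[OF F'(1) sV] by (simp add: fun_eq_iff)
      then show ?thesis using F'(2) that V_closed(4) unfolding U_def bij_betw_def by (auto dest: inj_onD)
    qed
    then have "U 1 \<inter> U 0 = {0}"
      using cvs.subspace_0[OF goodD(1)[OF c(1)], of 1] cvs.subspace_0[OF goodD(1)[OF c(1)], of 0] by auto
    moreover have "ssum (U 1) (U 0) = V"
    proof
      show "ssum (U 1) (U 0) \<subseteq> V" using UV V_closed(1) unfolding ssum_def by blast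
      show "V \<subseteq> ssum (U 1) (U 0)"
      proof
        fix v assume v: "v \<in> V"
        then have "F v \<in> cover (prod_torus [R, Y])" using F'(2) by (auto simp: bij_betw_def)
        then have Fv: "F v 0 \<in> cover R" "F v 1 \<in> cover Y" "\<forall>j\<ge>2. F v j = 0"
          by (auto simp: prod_torus_simps numeral_2_eq_2)
        obtain a where a: "a \<in> U 0" "F a 0 = F v 0"
          using Fv(1) c(2)[of 0] unfolding qiso_def bij_betw_def by (force simp: image_iff)
        obtain b where b: "b \<in> U 1" "F b 1 = F v 1"
          using Fv(2) c(2)[of 1] unfolding qiso_def bij_betw_def by (force simp: image_iff)
        have Fba: "F (b + a) = F v"
        proof
          fix j
          have "F (b + a) j = F b j + F a j" using clin_add[OF F'(1), of b a] a b UV by (auto simp: subset_iff)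
          moreover have "j = 0 \<or> j = 1 \<or> j \<ge> 2" by linarith
          ultimately show "F (b + a) j = F v j" using a b Fv(3) by (auto simp: U_def)
        qed
        have "b + a \<in> V" using a(1) b(1) UV by (intro V_closed(1)) auto
        then have "b + a = v" using inj_onD[OF bij_betw_imp_inj_on[OF F'(2)] Fba _ v] by simp
        then show "v \<in> ssum (U 1) (U 0)" using a(1) b(1) unfolding ssum_def by auto
      qed
    qed
    \<comment> \<open>The common factor Y sits in coordinate 1, so \<open>U 1\<close> is the summand
      to be cancelled.\<close>
    ultimately show ?thesis using c[of 0] c[of 1]
      by (intro exI[of _ "U 1"] exI[of _ "U 0"] exI[of _ "\<lambda>v. F v 1"] exI[of _ "\<lambda>v. F v 0"]) simp
  qed
  obtain U W f g where 1: "good U" "good W" "U \<inter> W = {0}" "ssum U W = V" "qiso (subt X U) Y f" "qiso (subt X W) P g"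
    using comp[OF P(1) XP(1)] by blast
  obtain U' W' f' g' where 2: "good U'" "good W'" "U' \<inter> W' = {0}" "ssum U' W' = V" "qiso (subt X U') Y f'" "qiso (subt X W') P' g'"
    using comp[OF P(2) XP(2)] by blast
  note fg = complex_torus_fg[OF good_torus]
  have "iso U U'" unfolding iso_def using qiso_trans[OF 1(5) qiso_sym[OF fg[OF 2(1)] 2(5)]] by fast
  then have "iso W W'" using cancellation[OF 1(1) 2(1) 1(2) 2(2) 1(3) 2(3)] 1(4) 2(4) by simp
  then obtain h where "qiso (subt X W) (subt X W') h" unfolding iso_def by blast
  then have "\<exists>k. qiso P P' k" using qiso_trans[OF qiso_trans[OF qiso_sym[OF fg[OF 1(2)] 1(6)]] 2(6)] by fast
  then show ?thesis using isogenous_iff_qiso[OF complex_torus_fg[OF P(1)] complex_torus_fg[OF P(2)]] by blast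
qed

lemma good_image:
  assumes p: "clin V p" "p ` V \<subseteq> V" "p ` Q \<subseteq> Q" shows "good (p ` V)"
proof -
  have "rvs.subspace {v \<in> V. p v \<in> rvs.span (p ` V \<inter> Q)}"
    unfolding rvs.subspace_def
    using clin_zero[OF p(1) sV] clin_add[OF p(1)] clin_scale[OF p(1)] V_closed
      rvs.span_add rvs.span_scale rvs.span_zero by auto
  moreover have "Q \<subseteq> {v \<in> V. p v \<in> rvs.span (p ` V \<inter> Q)}"
    using p(3) Q_sub by (auto intro!: rvs.span_base)
  ultimately have "rvs.span Q \<subseteq> {v \<in> V. p v \<in> rvs.span (p ` V \<inter> Q)}" by (metis rvs.span_minimal)
  then have "p ` V \<subseteq> rvs.span (p ` V \<inter> Q)" using V_span(1) by blast
  then show ?thesis using clin_image_subspace[OF p(1) sV] p(2) by (simp add: good_def)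
qed

lemma good_abelian:
  assumes "good U" shows "abelian_subvariety (subt X U) X"
proof -
  have "polarization (subt X U) H"
    using pol goodD(2)[OF assms] unfolding polarization_def subt_simps
    by (meson IntD2 subsetD)
  then show ?thesis using good_torus[OF assms] goodD(2)[OF assms]
    by (auto simp: abelian_subvariety_def abelian_variety_def)
qed

text \<open>The i-th coordinate of v is p i v, transported to \<open>Ys ! i\<close>. That each p i
  is idempotent is a consequence of the sum and orthogonality conditions.\<close>

lemma idempotent_decomposition:
  assumes p: "\<And>i. i < r \<Longrightarrow> clin V (p i)" "\<And>i. i < r \<Longrightarrow> p i ` V \<subseteq> V" "\<And>i. i < r \<Longrightarrow> p i ` Q \<subseteq> Q"
    and sum: "\<And>v. v \<in> V \<Longrightarrow> (\<Sum>i<r. p i v) = v"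
    and orth: "\<And>i j v. i < r \<Longrightarrow> j < r \<Longrightarrow> i \<noteq> j \<Longrightarrow> v \<in> V \<Longrightarrow> p i (p j v) = 0"
    and len: "length Ys = r" and fg: "\<And>i. i < r \<Longrightarrow> fg_torus (Ys ! i)"
    and iso: "\<And>i. i < r \<Longrightarrow> subt X (p i ` V) \<sim>\<^sub>i Ys ! i"
  shows "X \<sim>\<^sub>i prod_torus Ys"
proof -
  have good: "good (p i ` V)" if "i < r" for i using good_image p that by blast
  have "\<forall>i\<in>{..<r}. \<exists>f. qiso (subt X (p i ` V)) (Ys ! i) f"
    using iso isogenous_iff_qiso[OF complex_torus_fg[OF good_torus[OF good]] fg] by blast
  then obtain g where g: "\<And>i. i < r \<Longrightarrow> qiso (subt X (p i ` V)) (Ys ! i) (g i)" by (metis lessThan_iff)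
  have g': "clin (p i ` V) (g i)" "bij_betw (g i) (p i ` V) (cover (Ys ! i))"
    "g i ` (p i ` V \<inter> Q) = rational_pts (Ys ! i)" if "i < r" for i
    using g[OF that] goodD[OF good[OF that]] by (simp_all add: qiso_def rational_pts_subt)
  have idem: "p i (p i v) = p i v" if "i < r" "v \<in> V" for i v
  proof -
    have "p i v = p i (\<Sum>j<r. p j v)" using sum[OF that(2)] by simp
    also have "\<dots> = (\<Sum>j<r. p i (p j v))" using p that by (intro clin_sum[OF p(1) sV]) auto
    also have "\<dots> = (\<Sum>j<r. if j = i then p i (p i v) else 0)"
      using orth that by (intro sum.cong) auto
    finally show ?thesis using that by simp
  qed
  define F where "F v = (\<lambda>i. if i < r then g i (p i v) else 0)" for v
  have cl: "clin V F"
    unfolding clin_def F_def fun_eq_iff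
    using clin_add[OF p(1)] clin_scale[OF p(1)] clin_add[OF g'(1)] clin_scale[OF g'(1)]
    by (auto simp: scaleC_fun_apply)
  \<comment> \<open>Prescribed components are realized by their sum; rationality is tracked so that
    the same witness settles the rational points.\<close>
  have comb: "\<exists>v\<in>V. (\<forall>i<r. p i v = a i) \<and> ((\<forall>i<r. a i \<in> Q) \<longrightarrow> v \<in> Q)" if a: "\<And>i. i < r \<Longrightarrow> a i \<in> p i ` V" for a
  proof -
    have aV: "a i \<in> V" if "i < r" for i using a[OF that] p(2)[OF that] by blast
    have fix_a: "p i (a j) = (if j = i then a i else 0)" if ij: "i < r" "j < r" for i j
    proof -
      obtain v where "v \<in> V" "a j = p j v" using a[OF ij(2)] by blast
      then show ?thesis using orth idem ij by auto
    qed
    have "p i (\<Sum>j<r. a j) = a i" if "i < r" for i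
    proof -
      have "p i (\<Sum>j<r. a j) = (\<Sum>j<r. p i (a j))" using p that aV by (intro clin_sum[OF p(1) sV]) auto
      also have "\<dots> = (\<Sum>j<r. if j = i then a i else 0)" using fix_a that by (intro sum.cong) auto
      finally show ?thesis using that by simp
    qed
    moreover have "(\<Sum>j<r. a j) \<in> V" using aV by (intro cvs.subspace_sum[OF sV]) auto
    moreover have "(\<forall>i<r. a i \<in> Q) \<longrightarrow> (\<Sum>j<r. a j) \<in> Q" using qvs.subspace_sum[OF Q_subspace, of "{..<r}" a] by simp
    ultimately show ?thesis by blast
  qed
  have FY: "F v \<in> cover (prod_torus Ys)" if v: "v \<in> V" for v
    using g'(2) v len by (auto simp: prod_torus_simps F_def bij_betw_def)
  have bij: "bij_betw F V (cover (prod_torus Ys))"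
    unfolding bij_betw_def
  proof
    show "inj_on F V"
    proof (rule inj_onI)
      fix u v assume uv: "u \<in> V" "v \<in> V" "F u = F v"
      have "p i u = p i v" if i: "i < r" for i
      proof -
        have "g i (p i u) = g i (p i v)" using fun_cong[OF uv(3), of i] i by (simp add: F_def)
        then show ?thesis using g'(2)[OF i] uv by (auto simp: bij_betw_def inj_on_def)
      qed
      then have "(\<Sum>i<r. p i u) = (\<Sum>i<r. p i v)" by simp
      then show "u = v" using sum uv by simp
    qed
    show "F ` V = cover (prod_torus Ys)"
    proof
      show "F ` V \<subseteq> cover (prod_torus Ys)" using FY by blast
      show "cover (prod_torus Ys) \<subseteq> F ` V"
      proof
        fix y assume y: "y \<in> cover (prod_torus Ys)"
        have "\<exists>a\<in>p i ` V. g i a = y i" if i: "i < r" for i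
        proof -
          have "y i \<in> g i ` (p i ` V)"
            using y i len unfolding bij_betw_imp_surj_on[OF g'(2)[OF i]] by (simp add: prod_torus_simps)
          then show ?thesis by auto
        qed
        then obtain a where a: "\<And>i. i < r \<Longrightarrow> a i \<in> p i ` V" "\<And>i. i < r \<Longrightarrow> g i (a i) = y i" by metis
        obtain v where "v \<in> V" "\<forall>i<r. p i v = a i" using comb[OF a(1)] by blast
        moreover have "F v = y" using calculation a y len by (auto simp: F_def fun_eq_iff prod_torus_simps)
        ultimately show "y \<in> F ` V" by blast
      qed
    qed
  qed
  have rp: "rational_pts (prod_torus Ys) =
    {f. (\<forall>i<length Ys. f i \<in> rational_pts (Ys ! i)) \<and> (\<forall>i\<ge>length Ys. f i = 0)}"
    by (rule rational_pts_prod) (use fg len in auto)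
  have "F ` Q = rational_pts (prod_torus Ys)"
  proof
    show "F ` Q \<subseteq> rational_pts (prod_torus Ys)"
      using g'(3) p(3) Q_sub len unfolding rp F_def by fastforce
    show "rational_pts (prod_torus Ys) \<subseteq> F ` Q"
    proof
      fix y assume y: "y \<in> rational_pts (prod_torus Ys)"
      have "\<exists>a\<in>p i ` V \<inter> Q. g i a = y i" if i: "i < r" for i
      proof -
        have "y i \<in> g i ` (p i ` V \<inter> Q)" using y i len unfolding rp g'(3)[OF i] by simp
        then show ?thesis by (auto elim: imageE)
      qed
      then obtain a where a: "\<And>i. i < r \<Longrightarrow> a i \<in> p i ` V \<inter> Q" "\<And>i. i < r \<Longrightarrow> g i (a i) = y i" by metis
      obtain v where "v \<in> V" "\<forall>i<r. p i v = a i" "v \<in> Q" using comb[of a] a(1) by blast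
      moreover have "F v = y" using calculation a y len unfolding rp by (auto simp: F_def fun_eq_iff)
      ultimately show "y \<in> F ` Q" by blast
    qed
  qed
  then have "qiso X (prod_torus Ys) F" using cl bij by (simp add: qiso_def)
  moreover have "fg_torus (prod_torus Ys)" by (rule fg_prod_torus) (use fg len in auto)
  ultimately show ?thesis using qiso_imp_isogenous[OF fgX] by blast
qed

end

section \<open>Cyclotomic fields\<close>

interpretation of_rat_poly_hom: map_poly_comm_ring_hom "of_rat :: rat \<Rightarrow> complex" ..

definition rpoly :: "rat poly \<Rightarrow> complex \<Rightarrow> complex" where
  "rpoly p z = poly (map_poly of_rat p) z"

lemma rpoly_simps [simp]:
  "rpoly 0 z = 0" "rpoly 1 z = 1" "rpoly (p + q) z = rpoly p z + rpoly q z"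
  "rpoly (p * q) z = rpoly p z * rpoly q z" "rpoly (p - q) z = rpoly p z - rpoly q z"
  "rpoly (monom c k) z = of_rat c * z ^ k"
  by (simp_all add: rpoly_def hom_distribs poly_monom)

lemma rpoly_sum: "rpoly (\<Sum>i\<in>I. f i) z = (\<Sum>i\<in>I. rpoly (f i) z)"
  by (induction I rule: infinite_finite_induct) auto

text \<open>Eisenstein at 2. At the first index i where G has an odd coefficient, the coefficient of
  the product is congruent to that coefficient times the odd constant term of H. The index is below
  N because the degree of G is.\<close>

lemma eisenstein_2:
  fixes G H :: "int poly"
  assumes "even (coeff G 0)" "odd (coeff H 0)" "degree G < N" "\<And>i. i < N \<Longrightarrow> even (coeff (G * H) i)"
    "odd (lead_coeff G)"
  shows False
proof -
  define i where "i = (LEAST i. odd (coeff G i))"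
  have i: "odd (coeff G i)" unfolding i_def by (rule LeastI_ex) (use assms(5) in blast)
  have least: "even (coeff G j)" if "j < i" for j using that not_less_Least unfolding i_def by blast
  have iN: "i < N" using assms(3,5) Least_le[of "\<lambda>i. odd (coeff G i)" "degree G"] unfolding i_def by simp
  have "coeff (G * H) i = coeff G i * coeff H 0 + (\<Sum>j<i. coeff G j * coeff H (i - j))"
    by (simp add: coeff_mult lessThan_Suc_atMost[symmetric] add.commute)
  moreover have "even (\<Sum>j<i. coeff G j * coeff H (i - j))" using least by (intro dvd_sum) auto
  ultimately have "odd (coeff (G * H) i)" using i assms(2) by simp
  then show False using assms(4)[OF iN] by simp
qed

text \<open>The Frobenius map modulo 2, by repeated squaring.\<close>

lemma pow2_shift: "\<exists>u. [:1, 1:] ^ (2 ^ r) = monom 1 (2 ^ r) + 1 + 2 * (u :: int poly)"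
proof (induction r)
  case 0
  show ?case by (intro exI[of _ 0]) (simp add: monom_Suc one_pCons numeral_2_eq_2)
next
  case (Suc r)
  then obtain u :: "int poly" where u: "[:1, 1:] ^ (2 ^ r) = monom 1 (2 ^ r) + 1 + 2 * u" by blast
  define A where "A = monom (1::int) (2 ^ r)"
  have AA: "A * A = monom 1 (2 ^ Suc r)" by (simp add: A_def mult_monom mult_2)
  have "[:1, 1:] ^ (2 ^ Suc r) = [:1, 1::int:] ^ (2 ^ r) * [:1, 1:] ^ (2 ^ r)"
    by (simp add: mult_2 power_add)
  also have "\<dots> = A * A + 1 + 2 * (A + 2 * u * A + 2 * u + 2 * u * u)"
    unfolding u A_def[symmetric] by (simp add: algebra_simps)
  finally show ?case unfolding AA by blast
qed

lemma int_poly_denom: "\<exists>d g'. d \<noteq> 0 \<and> smult (of_int d) (g :: rat poly) = map_poly of_int g'"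
proof (induction g)
  case 0
  show ?case by (intro exI[of _ 1] exI[of _ 0]) simp
next
  case (pCons a g)
  then obtain d :: int and g' where d: "d \<noteq> 0" "smult (of_int d) g = map_poly of_int g'" by blast
  obtain b c where a: "a = of_int b / of_int c" "c \<noteq> 0" by (cases a) (auto simp: Fract_of_int_quotient)
  have "smult (of_int (c * d)) (pCons a g) = pCons (of_int (c * d) * a) (smult (of_int c) (smult (of_int d) g))"
    by simp
  also have "\<dots> = map_poly of_int (pCons (b * d) (smult c g'))"
    unfolding d(2) using a by (simp add: map_poly_pCons hom_distribs)
  finally show ?case using d a by (intro exI[of _ "c * d"] exI[of _ "pCons (b * d) (smult c g')"]) auto
qed

lemma pcompose_monom_1: "pcompose (monom 1 N) q = (q :: 'a::comm_semiring_1 poly) ^ N"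
  by (induction N) (simp_all add: monom_0 monom_Suc pcompose_pCons one_pCons)

text \<open>Substituting X + 1 for X makes Eisenstein applicable: modulo 2 only the leading power
  survives, and the constant term is 2 up to sign. The negative sign is allowed because primitive
  parts determine a factorization only up to a unit.\<close>

lemma irreducible_int:
  fixes G H :: "int poly"
  assumes "G * H = monom 1 (2 ^ r) + 1 \<or> G * H = - (monom 1 (2 ^ r) + 1)"
  shows "degree G = 0 \<or> degree H = 0"
proof (rule ccontr)
  assume n: "\<not> ?thesis"
  define N where "N = (2::nat) ^ r"
  define P where "P = monom (1::int) N + 1"
  define G' where "G' = pcompose G [:1, 1:]"
  define H' where "H' = pcompose H [:1, 1:]"
  obtain e where e: "G * H = smult e P" "e = 1 \<or> e = -1"
    using assms unfolding P_def N_def by (metis smult_1_left smult_minus_left)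
  have cP: "pcompose P [:1, 1:] = [:1, 1:] ^ N + 1"
    unfolding P_def by (simp add: pcompose_add pcompose_monom_1)
  obtain u where u: "[:1, 1:] ^ N = monom 1 N + 1 + 2 * (u :: int poly)"
    using pow2_shift unfolding N_def by blast
  have GH': "G' * H' = smult e (monom 1 N + 2 * (1 + u))"
    unfolding G'_def H'_def pcompose_mult[symmetric] e(1) pcompose_smult cP u by (simp add: algebra_simps)
  have N0: "N > 0" by (simp add: N_def)
  have c0: "coeff (G' * H') 0 = e * 2"
  proof -
    have "coeff (pcompose P [:1, 1:]) 0 = 2" unfolding cP by (simp add: coeff_0_power)
    moreover have "G' * H' = smult e (pcompose P [:1, 1:])"
      unfolding G'_def H'_def pcompose_mult[symmetric] e(1) pcompose_smult ..
    ultimately show ?thesis by simp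
  qed
  have ev: "even (coeff (G' * H') i)" if "i < N" for i
    unfolding GH' using that by (simp add: numeral_poly)
  have dP: "degree P = N" "lead_coeff P = 1"
  proof -
    show "degree P = N" unfolding P_def using N0 by (subst degree_add_eq_left) (auto simp: degree_monom_eq)
    then show "lead_coeff P = 1" unfolding P_def using N0 by simp
  qed
  have G0: "G \<noteq> 0" "H \<noteq> 0" using n by auto
  have "degree G + degree H = N"
    using degree_mult_eq[OF G0] e dP by auto
  then have deg: "degree G' < N" "degree H' < N" using n unfolding G'_def H'_def by auto
  have "lead_coeff G * lead_coeff H = e" using arg_cong[OF e(1), of lead_coeff] dP(2)
    by (simp add: lead_coeff_mult)
  then have "odd (lead_coeff G * lead_coeff H)" using e(2) by auto
  then have "odd (lead_coeff G)" "odd (lead_coeff H)" by simp_all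
  moreover have lc: "lead_coeff G' = lead_coeff G" "lead_coeff H' = lead_coeff H"
    unfolding G'_def H'_def by (subst lead_coeff_comp; simp)+
  ultimately have odd: "odd (lead_coeff G')" "odd (lead_coeff H')" unfolding lc by blast+
  have prod: "coeff G' 0 * coeff H' 0 = e * 2" using c0 by (simp add: coeff_mult)
  \<comment> \<open>The product of the constant terms is not divisible by 4, so exactly one of them
    is even.\<close>
  then have "\<not> (even (coeff G' 0) \<and> even (coeff H' 0))"
  proof -
    have "\<not> 4 dvd e * 2" using e(2) by auto
    then show ?thesis using prod mult_dvd_mono[of 2 "coeff G' 0" 2 "coeff H' 0"] by auto
  qed
  moreover have "even (coeff G' 0 * coeff H' 0)" using prod by simp
  ultimately consider "even (coeff G' 0)" "odd (coeff H' 0)" | "even (coeff H' 0)" "odd (coeff G' 0)" by auto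
  then show False
  proof cases
    case 1
    then show False using eisenstein_2[OF 1 deg(1) ev odd(1)] by blast
  next
    case 2
    then show False using eisenstein_2[OF 2 deg(2) _ odd(2)] ev by (metis mult.commute)
  qed
qed

text \<open>Gauss's lemma: after clearing denominators in both factors, comparing contents shows
  that the primitive parts multiply to the integral polynomial up to sign.\<close>

lemma irreducible_cyclotomic: "irreducible (monom 1 (2 ^ r) + 1 :: rat poly)"
proof (rule irreducibleI)
  define P where "P = monom (1::int) (2 ^ r) + 1"
  define p where "p = monom (1::rat) (2 ^ r) + 1"
  have pP: "p = map_poly of_int P" by (simp add: p_def P_def hom_distribs)
  have dp: "degree p = 2 ^ r" unfolding p_def by (subst degree_add_eq_left) (auto simp: degree_monom_eq)
  have lP: "degree P = 2 ^ r" "lead_coeff P = 1"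
  proof -
    show "degree P = 2 ^ r" unfolding P_def by (subst degree_add_eq_left) (auto simp: degree_monom_eq)
    then show "lead_coeff P = 1" unfolding P_def by simp
  qed
  show "monom 1 (2 ^ r) + 1 \<noteq> (0 :: rat poly)" using dp unfolding p_def by auto
  show "\<not> is_unit (monom 1 (2 ^ r) + 1 :: rat poly)" using dp unfolding p_def by (auto simp: is_unit_iff_degree)
  fix a b :: "rat poly" assume ab: "monom 1 (2 ^ r) + 1 = a * b"
  then have pab: "p = a * b" by (simp add: p_def)
  have ab0: "a \<noteq> 0" "b \<noteq> 0" using pab dp by auto
  obtain c a' where a': "(c::int) \<noteq> 0" "smult (of_int c) a = map_poly of_int a'" using int_poly_denom by blast
  obtain d b' where b': "(d::int) \<noteq> 0" "smult (of_int d) b = map_poly of_int b'" using int_poly_denom by blast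
  have "map_poly rat_of_int (a' * b') = smult (of_int c) a * smult (of_int d) b"
    by (simp add: a' b' hom_distribs)
  also have "\<dots> = map_poly rat_of_int (smult (c * d) P)"
    unfolding mult_smult_left mult_smult_right smult_smult pab[symmetric] pP by (simp add: hom_distribs mult.commute)
  finally have e: "a' * b' = smult (c * d) P" by simp
  have contP: "content P = 1"
  proof -
    have "content P dvd lead_coeff P" by (rule content_dvd_coeff)
    then show ?thesis using lP(2) by (metis is_unit_content_iff)
  qed
  \<comment> \<open>Contents are multiplicative, and the monic integral polynomial has content
    1.\<close>
  have cont: "content a' * content b' = \<bar>c * d\<bar>"
    using arg_cong[OF e, of content] contP by (simp add: content_mult content_smult abs_mult)
  have "smult (content a' * content b') (primitive_part a' * primitive_part b') = a' * b'"
    using content_times_primitive_part[of a'] content_times_primitive_part[of b']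
    by (metis mult_smult_left mult_smult_right smult_smult)
  then have "smult \<bar>c * d\<bar> (primitive_part a' * primitive_part b') = smult (c * d) P"
    using e cont by simp
  then have "primitive_part a' * primitive_part b' = P \<or> primitive_part a' * primitive_part b' = - P"
  proof (cases "c * d \<ge> 0")
    case True
    then have "smult (c * d) (primitive_part a' * primitive_part b') = smult (c * d) P"
      using \<open>smult \<bar>c * d\<bar> _ = _\<close> by simp
    then show ?thesis using a'(1) b'(1) by (metis mult_eq_0_iff smult_cancel)
  next
    case False
    then have "smult (c * d) (- (primitive_part a' * primitive_part b')) = smult (c * d) P"
      using \<open>smult \<bar>c * d\<bar> _ = _\<close> by (simp add: abs_of_neg del: abs_mult)
    then have "- (primitive_part a' * primitive_part b') = P" using a'(1) b'(1) by (metis mult_eq_0_iff smult_cancel)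
    then show ?thesis by (metis minus_minus)
  qed
  then have "degree (primitive_part a') = 0 \<or> degree (primitive_part b') = 0"
    unfolding P_def by (rule irreducible_int)
  then have "degree a' = 0 \<or> degree b' = 0" by simp
  moreover have "degree a = degree a'" "degree b = degree b'"
    using arg_cong[OF a'(2), of degree] arg_cong[OF b'(2), of degree] a'(1) b'(1) by simp_all
  ultimately show "is_unit a \<or> is_unit b" using ab0 by (auto simp: is_unit_iff_degree)
qed

lemma cyclotomic_bezout:
  assumes "\<not> (monom 1 (2 ^ r) + 1) dvd (p :: rat poly)"
  obtains s t where "s * p + t * (monom 1 (2 ^ r) + 1) = 1"
proof -
  define P where "P = monom (1::rat) (2 ^ r) + 1"
  have "gcd p P dvd P" by simp
  moreover have "\<not> P dvd gcd p P" using assms unfolding P_def by auto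
  ultimately have "is_unit (gcd p P)" using irreducible_cyclotomic[of r] irreducibleD' unfolding P_def by blast
  then have "gcd p P = 1" by (simp only: is_unit_gcd coprime_imp_gcd_eq_1)
  then have "fst (bezout_coefficients p P) * p + snd (bezout_coefficients p P) * P = 1"
    using bezout_coefficients_fst_snd[of p P] by simp
  then show ?thesis using that unfolding P_def by blast
qed

text \<open>All roots of X^(2^r) + 1 share this irreducible polynomial. The lemma stands in for the
  Galois group of the cyclotomic field.\<close>

lemma conjugate_root:
  assumes "z ^ (2 ^ r) = -1" "w ^ (2 ^ r) = -1" "rpoly p z = 0"
  shows "rpoly p w = 0"
proof (cases "(monom 1 (2 ^ r) + 1) dvd p")
  case True
  then obtain q where "p = (monom 1 (2 ^ r) + 1) * q" by blast
  then show ?thesis using assms(2) by simp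
next
  case False
  then obtain s t where "s * p + t * (monom 1 (2 ^ r) + 1) = 1" by (rule cyclotomic_bezout)
  then have "rpoly (s * p + t * (monom 1 (2 ^ r) + 1)) z = rpoly 1 z" by simp
  then show ?thesis using assms by simp
qed

text \<open>A Bezout relation with X^(2^r) + 1, evaluated at z: the values of rational polynomials
  at z form a field.\<close>

lemma rpoly_inverse:
  assumes "z ^ (2 ^ r) = -1" "rpoly p z \<noteq> 0"
  obtains q where "rpoly q z * rpoly p z = 1"
proof (cases "(monom 1 (2 ^ r) + 1) dvd p")
  case True
  then obtain q where "p = (monom 1 (2 ^ r) + 1) * q" by blast
  then show ?thesis using assms by simp
next
  case False
  then obtain s t where "s * p + t * (monom 1 (2 ^ r) + 1) = 1" by (rule cyclotomic_bezout)
  then have "rpoly (s * p + t * (monom 1 (2 ^ r) + 1)) z = rpoly 1 z" by simp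
  then show ?thesis using assms that[of s] by simp
qed

section \<open>Power sums of roots of unity, and traces of character fields\<close>

lemma sum_roots_unity_power:
  assumes "n > 0"
  shows "(\<Sum>w | w ^ n = 1. w ^ j) = (if n dvd j then of_nat n else (0::complex))"
proof (cases "n dvd j")
  case True
  then obtain m where "j = n * m" by blast
  have "(\<Sum>w\<in>{w::complex. w ^ n = 1}. w ^ j) = (\<Sum>w\<in>{w::complex. w ^ n = 1}. 1)"
  proof (rule sum.cong[OF HOL.refl])
    fix x :: complex assume x: "x \<in> {w. w ^ n = 1}"
    show "x ^ j = 1" unfolding \<open>j = n * m\<close> power_mult using x by simp
  qed
  then show ?thesis using True card_roots_unity_eq[OF assms] by simp
next
  case False
  define v where "v = cis (2 * pi / real n)"
  have vn: "v ^ n = 1" using assms by (simp add: v_def DeMoivre)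
  have v0: "v \<noteq> 0" by (simp add: v_def)
  have "v ^ j \<noteq> 1"
  proof -
    define i where "i = j mod n"
    have i: "0 < i" "i < n" using False assms by (auto simp: i_def mod_greater_zero_iff_not_dvd)
    have "v ^ j = v ^ i" unfolding i_def
      by (metis vn mod_mult_div_eq mult.commute power_add power_mult power_one mult_1_right)
    moreover have "v ^ i \<noteq> 1"
    proof
      assume "v ^ i = 1"
      then have "cis (2 * pi * real i / real n) = cis (2 * pi * real 0 / real n)"
        by (simp add: v_def DeMoivre mult_ac)
      then show False
        using inj_onD[OF bij_betw_imp_inj_on[OF bij_betw_roots_unity[OF assms]], of i 0] i by auto
    qed
    ultimately show ?thesis by simp
  qed
  \<comment> \<open>Multiplication by v permutes the roots, so the sum equals v^j times
    itself.\<close>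
  have "(\<Sum>w | w ^ n = 1. w ^ j) = (\<Sum>w | w ^ n = 1. (v * w) ^ j)"
    by (rule sum.reindex_bij_witness[of _ "\<lambda>w. v * w" "\<lambda>w. w / v"])
      (use vn v0 in \<open>auto simp: power_mult_distrib power_divide\<close>)
  also have "\<dots> = v ^ j * (\<Sum>w | w ^ n = 1. w ^ j)" by (simp add: power_mult_distrib sum_distrib_left)
  finally show ?thesis using \<open>v ^ j \<noteq> 1\<close> False by (simp add: algebra_simps) 
qed

lemma finite_minus_roots: "N > 0 \<Longrightarrow> finite {w::complex. w ^ N = -1}"
  by (rule finite_nth_roots)

text \<open>The roots of w^N = -1 are the 2N-th roots of unity that are not N-th roots of
  unity.\<close>

lemma sum_minus_roots_power:
  assumes "N > 0"
  shows "(\<Sum>w | w ^ N = -1. w ^ j) =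
    (if 2 * N dvd j then of_nat (2 * N) else 0) - (if N dvd j then of_nat N else (0::complex))"
proof -
  have u: "{w::complex. w ^ (2 * N) = 1} = {w. w ^ N = 1} \<union> {w. w ^ N = -1}"
    by (auto simp: power_mult power2_eq_1_iff mult.commute[of 2 N])
  have "(\<Sum>w | w ^ (2 * N) = 1. w ^ j) = (\<Sum>w | w ^ N = 1. w ^ j) + (\<Sum>w::complex | w ^ N = -1. w ^ j)"
    unfolding u by (rule sum.union_disjoint) (use assms finite_minus_roots finite_roots_unity[of N] in auto)
  then show ?thesis using sum_roots_unity_power[of N j] sum_roots_unity_power[of "2 * N" j] assms by simp
qed

text \<open>The elements on which two embeddings agree form a subfield, and K is the least subfield
  containing S.\<close>

lemma field_embeddings_eqI:
  assumes K: "K = \<Inter>{K. complex_subfield K \<and> S \<subseteq> K}" and s: "\<sigma> \<in> field_embeddings K" "\<tau> \<in> field_embeddings K"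
    and eq: "\<And>z. z \<in> S \<Longrightarrow> \<sigma> z = \<tau> z"
  shows "\<sigma> = \<tau>"
proof -
  have sub: "complex_subfield K" "S \<subseteq> K" unfolding K by (auto simp: complex_subfield_def)
  have K0: "0 \<in> K" using sub(1) unfolding complex_subfield_def by (metis diff_self)
  have hom: "\<rho> 1 = 1" "\<And>a b. a \<in> K \<Longrightarrow> b \<in> K \<Longrightarrow> \<rho> (a - b) = \<rho> a - \<rho> b"
    "\<And>a b. a \<in> K \<Longrightarrow> b \<in> K \<Longrightarrow> \<rho> (a * b) = \<rho> a * \<rho> b" "\<And>a. a \<in> K \<Longrightarrow> \<rho> (inverse a) = inverse (\<rho> a)"
    if r: "\<rho> \<in> field_embeddings K" for \<rho>
  proof -
    have r': "\<rho> 1 = 1" "\<And>a b. a \<in> K \<Longrightarrow> b \<in> K \<Longrightarrow> \<rho> (a + b) = \<rho> a + \<rho> b"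
      "\<And>a b. a \<in> K \<Longrightarrow> b \<in> K \<Longrightarrow> \<rho> (a * b) = \<rho> a * \<rho> b" using r by (auto simp: field_embeddings_def)
    show "\<rho> 1 = 1" "\<And>a b. a \<in> K \<Longrightarrow> b \<in> K \<Longrightarrow> \<rho> (a * b) = \<rho> a * \<rho> b" by fact+
    show d: "\<rho> (a - b) = \<rho> a - \<rho> b" if "a \<in> K" "b \<in> K" for a b
    proof -
      have "a - b \<in> K" using sub(1) that unfolding complex_subfield_def by blast
      then show ?thesis using r'(2)[of "a - b" b] that by simp
    qed
    show "\<rho> (inverse a) = inverse (\<rho> a)" if a: "a \<in> K" for a
    proof (cases "a = 0")
      case True
      have "\<rho> 0 = 0" using d[OF K0 K0] by simp
      then show ?thesis using True by simp
    next
      case False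
      have "inverse a \<in> K" using sub(1) a unfolding complex_subfield_def by blast
      then have "\<rho> a * \<rho> (inverse a) = 1" using r'(3)[OF a] r'(1) False by (metis right_inverse)
      then show ?thesis by (metis inverse_unique)
    qed
  qed
  define E where "E = {z \<in> K. \<sigma> z = \<tau> z}"
  have "complex_subfield E"
    using sub(1) hom[OF s(1)] hom[OF s(2)] unfolding complex_subfield_def E_def by auto
  moreover have "S \<subseteq> E" using sub(2) eq by (auto simp: E_def)
  ultimately have "K \<subseteq> E" unfolding K by blast
  then have "\<And>z. z \<in> K \<Longrightarrow> \<sigma> z = \<tau> z" by (auto simp: E_def)
  then show ?thesis using s by (auto simp: field_embeddings_def intro: extensionalityI)
qed

text \<open>A field generated by integers has the inclusion as its only embedding, so the trace does
  nothing. This covers the characters of degree 1.\<close>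

lemma field_trace_rational:
  assumes K: "K = \<Inter>{K. complex_subfield K \<and> S \<subseteq> K}" and S: "S \<subseteq> \<int>" and z: "z \<in> S" "z = of_rat q"
  shows "field_trace K z = q"
proof -
  have sub: "complex_subfield K" "S \<subseteq> K" unfolding K by (auto simp: complex_subfield_def)
  have fixZ: "\<sigma> (of_int k) = of_int k" if s: "\<sigma> \<in> field_embeddings K" for \<sigma> and k :: int
  proof -
    have h: "\<sigma> 1 = 1" "\<And>a b. a \<in> K \<Longrightarrow> b \<in> K \<Longrightarrow> \<sigma> (a + b) = \<sigma> a + \<sigma> b"
      using s by (auto simp: field_embeddings_def)
    have K1: "1 \<in> K" "\<And>a b. a \<in> K \<Longrightarrow> b \<in> K \<Longrightarrow> a - b \<in> K" using sub(1) by (auto simp: complex_subfield_def)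
    have K0: "0 \<in> K" using K1 by (metis diff_self)
    have Kn: "of_nat m \<in> K" for m
    proof (induction m)
      case (Suc m)
      have "of_nat m - (0 - 1) \<in> K" using Suc K1 K0 by blast
      then show ?case by (simp add: add.commute)
    qed (use K0 in simp)
    have n: "\<sigma> (of_nat m) = of_nat m" for m
    proof (induction m)
      case 0
      show ?case using h(2)[OF K0 K0] by simp
    next
      case (Suc m)
      then show ?case using h(2)[OF K1(1) Kn[of m]] h(1) by simp
    qed
    show ?thesis
    proof (cases "k \<ge> 0")
      case True
      then show ?thesis using n[of "nat k"] by simp
    next
      case False
      have m: "- of_nat (nat (- k)) = (of_int k :: complex)" using False by simp
      have "- of_nat (nat (- k)) \<in> K" using K1(2)[OF K0 Kn] by simp
      then have "\<sigma> (- of_nat (nat (- k)) + of_nat (nat (- k))) = \<sigma> (- of_nat (nat (- k))) + of_nat (nat (- k))"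
        using h(2)[OF \<open>- of_nat (nat (- k)) \<in> K\<close> Kn[of "nat (- k)"]] n[of "nat (- k)"] by metis
      then have "\<sigma> (- of_nat (nat (- k))) = - of_nat (nat (- k))"
        using n[of 0] by (simp add: eq_neg_iff_add_eq_0)
      then show ?thesis unfolding m .
    qed
  qed
  define \<iota> where "\<iota> = restrict id K"
  have "\<iota> \<in> field_embeddings K"
  proof -
    have "a + b \<in> K" if "a \<in> K" "b \<in> K" for a b
    proof -
      have "a - ((a - a) - b) \<in> K" using that sub(1) unfolding complex_subfield_def by blast
      then show ?thesis by simp
    qed
    then show ?thesis using sub(1) unfolding field_embeddings_def \<iota>_def complex_subfield_def by auto
  qed
  moreover have "\<sigma> = \<iota>" if s: "\<sigma> \<in> field_embeddings K" for \<sigma>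
  proof (rule field_embeddings_eqI[OF K s \<open>\<iota> \<in> field_embeddings K\<close>])
    fix w assume w: "w \<in> S"
    then obtain k where "w = of_int k" using S by (auto elim: Ints_cases)
    then show "\<sigma> w = \<iota> w" using fixZ[OF s] w sub(2) by (auto simp: \<iota>_def)
  qed
  ultimately have "field_embeddings K = {\<iota>}" by blast
  then have "(\<Sum>\<sigma>\<in>field_embeddings K. \<sigma> z) = of_rat q" using z sub(2) by (auto simp: \<iota>_def)
  then show ?thesis unfolding field_trace_def by (auto intro!: the_equality)
qed

text \<open>K is the real subfield generated by z + 1/z. Its embeddings correspond to the roots of
  w^N = -1 up to inversion, represented by those in the upper half plane, so the trace of z^j +
  z^(-j) is the sum of w^j over all these roots. The condition r \<ge> 1 excludes N = 1, where the
  root -1 is its own inverse.\<close>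

lemma field_trace_cyclotomic:
  assumes K: "K = \<Inter>{K. complex_subfield K \<and> S \<subseteq> K}" and r: "r \<ge> 1" and N: "N = 2 ^ r" and z: "z ^ N = -1"
    and S1: "\<And>s. s \<in> S \<Longrightarrow> s = 0 \<or> (\<exists>j::nat. s = z ^ j + 1 / z ^ j)"
    and S2: "\<And>j::nat. z ^ j + 1 / z ^ j \<in> S"
  shows "field_trace K (z ^ j + 1 / z ^ j) =
      (if 2 * N dvd j then of_nat (2 * N) else 0) - (if N dvd j then of_nat N else 0)"
    and "field_trace K 0 = 0"
proof -
  have sub: "complex_subfield K" "S \<subseteq> K" unfolding K by (auto simp: complex_subfield_def)
  have N0: "N > 0" "even N" using r N by auto
  have zN: "z ^ (2 ^ r) = -1" using z N by simp
  have nz: "w \<noteq> 0" if "w ^ N = -1" for w :: complex using that N0 by (auto simp: power_0_left)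
  \<comment> \<open>Since w^(2N) = 1, inverse powers are powers with a nonnegative exponent; this
    makes w^k + 1/w^k a polynomial value.\<close>
  have invr: "1 / w ^ k = w ^ (2 * N * k - k)" if w: "w ^ N = -1" for w :: complex and k
  proof -
    have "w ^ (2 * N * k - k) * w ^ k = w ^ (2 * N * k)" using N0 by (simp flip: power_add)
    also have "\<dots> = 1" using w by (simp add: power_mult mult.commute[of 2 N])
    finally show ?thesis using nz[OF w] by (simp add: divide_eq_eq)
  qed
  define F where "F = range (\<lambda>p. rpoly p z)"
  have F: "complex_subfield F"
    unfolding complex_subfield_def
  proof (intro conjI ballI)
    show "1 \<in> F" unfolding F_def by (rule range_eqI[of _ _ 1]) simp
    fix a assume "a \<in> F"
    then obtain p where p: "a = rpoly p z" unfolding F_def by blast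
    show "inverse a \<in> F"
    proof (cases "a = 0")
      case True
      then show ?thesis unfolding F_def by (intro range_eqI[of _ _ 0]) simp
    next
      case False
      then obtain q where "rpoly q z * rpoly p z = 1" using rpoly_inverse[OF zN, of p] p by blast
      then have "inverse a = rpoly q z" unfolding p by (metis inverse_unique mult.commute)
      then show ?thesis unfolding F_def by blast
    qed
    fix b assume "b \<in> F"
    then obtain q where "b = rpoly q z" unfolding F_def by blast
    then show "a - b \<in> F" "a * b \<in> F" unfolding F_def p
      by (auto intro: range_eqI[of _ _ "p - q"] range_eqI[of _ _ "p * q"])
  qed
  have SF: "S \<subseteq> F"
  proof
    fix s assume "s \<in> S"
    then consider "s = 0" | k where "s = z ^ k + 1 / z ^ k" using S1 by blast
    then show "s \<in> F"
    proof cases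
      case 1
      then show ?thesis unfolding F_def by (intro range_eqI[of _ _ 0]) simp
    next
      case 2
      then show ?thesis unfolding F_def invr[OF z]
        by (intro range_eqI[of _ _ "monom 1 k + monom 1 (2 * N * k - k)"]) simp
    qed
  qed
  have KF: "K \<subseteq> F" unfolding K using F SF by blast
  \<comment> \<open>Choose a polynomial that represents a at z and evaluate it at w. By
    \<open>conjugate_root\<close> the result does not depend on the choice.\<close>
  define conj where "conj w = restrict (\<lambda>a. rpoly (SOME p. rpoly p z = a) w) K" for w
  have conj_rpoly: "conj w (rpoly p z) = rpoly p w" if w: "w ^ N = -1" and p: "rpoly p z \<in> K" for w p
  proof -
    define q where "q = (SOME q. rpoly q z = rpoly p z)"
    have "rpoly q z = rpoly p z" unfolding q_def by (rule someI) simp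
    then have "rpoly (q - p) w = 0" using conjugate_root[OF zN, of w "q - p"] w N by simp
    then show ?thesis using p by (simp add: conj_def q_def)
  qed
  have conj_emb: "conj w \<in> field_embeddings K" if w: "w ^ N = -1" for w
  proof -
    have add: "conj w (a + b) = conj w a + conj w b \<and> conj w (a * b) = conj w a * conj w b"
      if ab: "a \<in> K" "b \<in> K" for a b
    proof -
      obtain p q where pq: "a = rpoly p z" "b = rpoly q z" using ab KF unfolding F_def by blast
      have "a - ((a - a) - b) \<in> K" "a * b \<in> K" using ab sub(1) unfolding complex_subfield_def by blast+
      then have "rpoly (p + q) z \<in> K" "rpoly (p * q) z \<in> K" using pq by auto
      then have "conj w (rpoly (p + q) z) = rpoly (p + q) w" "conj w (rpoly (p * q) z) = rpoly (p * q) w"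
        using conj_rpoly[OF w] by blast+
      then show ?thesis using conj_rpoly[OF w] ab pq by simp
    qed
    have "conj w (rpoly 1 z) = rpoly 1 w" using conj_rpoly[OF w, of 1] sub(1) by (auto simp: complex_subfield_def)
    then show ?thesis using add by (auto simp: field_embeddings_def conj_def)
  qed
  have conj_val: "conj w (z ^ k + 1 / z ^ k) = w ^ k + 1 / w ^ k" if w: "w ^ N = -1" for w k
  proof -
    have "z ^ k + 1 / z ^ k = rpoly (monom 1 k + monom 1 (2 * N * k - k)) z" using invr[OF z] by simp
    moreover have "z ^ k + 1 / z ^ k \<in> K" using S2 sub(2) by blast
    ultimately have "conj w (z ^ k + 1 / z ^ k) = rpoly (monom 1 k + monom 1 (2 * N * k - k)) w"
      using conj_rpoly[OF w] by metis
    then show ?thesis using invr[OF w] by simp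
  qed
  have K0: "0 \<in> K" using sub(1) unfolding complex_subfield_def by (metis diff_self)
  have emb0: "\<sigma> 0 = 0" if "\<sigma> \<in> field_embeddings K" for \<sigma>
  proof -
    have "\<sigma> (0 + 0) = \<sigma> 0 + \<sigma> 0" using that K0 unfolding field_embeddings_def by blast
    then show ?thesis by simp
  qed
  \<comment> \<open>One representative of each pair w, 1/w: on these roots inversion is complex
    conjugation, and none of them is real.\<close>
  define A where "A = {w::complex. w ^ N = -1 \<and> Im w > 0}"
  have finA: "finite A" unfolding A_def using finite_minus_roots[OF N0(1)] by (rule finite_subset[rotated]) auto
  have unit: "norm w = 1" if "w ^ N = -1" for w :: complex
  proof -
    have "norm w ^ N = 1 ^ N" using arg_cong[OF that, of norm] by (simp add: norm_power)
    then show ?thesis using power_eq_imp_eq_base[OF _ norm_ge_zero zero_le_one N0(1)] by blast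
  qed
  have cnj_inv: "1 / w = cnj w" if "w ^ N = -1" for w :: complex
  proof -
    have "w * cnj w = 1" using unit[OF that] complex_norm_square[of w] by simp
    then show ?thesis using nz[OF that] by (simp add: field_simps)
  qed
  have Im0: "Im w \<noteq> 0" if w: "w ^ N = -1" for w :: complex
  proof
    assume "Im w = 0"
    then have "w = of_real (Re w)" by (simp add: complex_eq_iff)
    then have "of_real (Re w ^ N) = (-1 :: complex)" using w by (metis of_real_power)
    then have "Re w ^ N = -1" by (metis of_real_1 of_real_eq_iff of_real_minus)
    moreover have "Re w ^ N \<ge> 0" using N0(2) by (rule zero_le_even_power)
    ultimately show False by simp
  qed
  have inj: "inj_on conj A"
  proof (rule inj_onI)
    fix u w assume uw: "u \<in> A" "w \<in> A" "conj u = conj w"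
    then have "u + 1 / u = w + 1 / w" using conj_val[of u 1] conj_val[of w 1] by (auto simp: A_def)
    then have "u + cnj u = w + cnj w" using cnj_inv uw by (simp add: A_def)
    then have re: "Re u = Re w" by (simp add: complex_add_cnj)
    moreover have "(Re u)\<^sup>2 + (Im u)\<^sup>2 = 1" "(Re w)\<^sup>2 + (Im w)\<^sup>2 = 1"
      using unit[of u] unit[of w] uw by (auto simp: A_def cmod_def)
    ultimately have "(Im u)\<^sup>2 = (Im w)\<^sup>2" by simp
    then have "Im u = Im w" using uw by (auto simp: A_def intro: power2_eq_imp_eq)
    then show "u = w" using re by (simp add: complex_eq_iff)
  qed
  have surj: "\<exists>w\<in>A. \<sigma> = conj w" if s: "\<sigma> \<in> field_embeddings K" for \<sigma>
  proof -
    have h: "\<sigma> 1 = 1" "\<And>a b. a \<in> K \<Longrightarrow> b \<in> K \<Longrightarrow> \<sigma> (a + b) = \<sigma> a + \<sigma> b"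
      "\<And>a b. a \<in> K \<Longrightarrow> b \<in> K \<Longrightarrow> \<sigma> (a * b) = \<sigma> a * \<sigma> b"
      using s by (auto simp: field_embeddings_def)
    define c where "c = \<sigma> (z + 1 / z)"
    \<comment> \<open>A root of X^2 - c X + 1, so that w + 1/w is the image of z + 1/z.\<close>
    define w where "w = (c + csqrt (c\<^sup>2 - 4)) / 2"
    have q: "w * w - c * w + 1 = 0"
    proof -
      define s where "s = csqrt (c\<^sup>2 - 4)"
      have s: "s * s = c * c - 4" unfolding s_def by (metis power2_csqrt power2_eq_square)
      have "w * w - c * w + 1 = (s * s - c * c + 4) / 4"
        unfolding w_def s_def[symmetric] by (simp add: field_simps)
      then show ?thesis using s by simp
    qed
    have w0: "w \<noteq> 0" using q by auto
    have wc: "w + 1 / w = c" using q w0 by (simp add: field_simps)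
    define t where "t k = z ^ k + 1 / z ^ k" for k
    have tK: "t k \<in> K" for k using S2 sub(2) unfolding t_def by blast
    \<comment> \<open>The three-term recurrence of Chebyshev type: the image of z + 1/z determines
      the images of all z^k + z^(-k).\<close>
    have rec: "x ^ Suc (Suc k) + 1 / x ^ Suc (Suc k) + (x ^ k + 1 / x ^ k) = (x ^ Suc k + 1 / x ^ Suc k) * (x + 1 / x)"
      if "x \<noteq> 0" for x :: complex and k
    proof -
      define y where "y = 1 / x"
      have "(x ^ Suc k + y ^ Suc k) * (x + y) = x ^ Suc (Suc k) + y ^ Suc (Suc k) + (x * y) * (x ^ k + y ^ k)"
        by (simp add: algebra_simps)
      moreover have "x * y = 1" using that by (simp add: y_def)
      ultimately show ?thesis by (simp add: y_def power_divide)
    qed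
    have "\<sigma> (t k) = w ^ k + 1 / w ^ k \<and> \<sigma> (t (Suc k)) = w ^ Suc k + 1 / w ^ Suc k" for k
    proof (induction k)
      case 0
      have "1 \<in> K" using sub(1) by (auto simp: complex_subfield_def)
      then have "\<sigma> (1 + 1) = 2" using h(1) h(2)[of 1 1] by simp
      then show ?case using wc by (simp add: t_def c_def)
    next
      case (Suc k)
      have "t (Suc (Suc k)) + t k = t (Suc k) * t 1"
        using rec[OF nz[OF z], of k] by (simp add: t_def)
      then have "\<sigma> (t (Suc (Suc k)) + t k) = \<sigma> (t (Suc k) * t 1)" by simp
      moreover have "\<sigma> (t 1) = c" by (simp add: t_def c_def)
      ultimately have "\<sigma> (t (Suc (Suc k))) + \<sigma> (t k) = \<sigma> (t (Suc k)) * c"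
        using h(2)[OF tK[of "Suc (Suc k)"] tK[of k]] h(3)[OF tK[of "Suc k"] tK[of 1]] by simp
      then have "\<sigma> (t (Suc (Suc k))) = (w ^ Suc k + 1 / w ^ Suc k) * (w + 1 / w) - (w ^ k + 1 / w ^ k)"
        using Suc wc by (simp add: algebra_simps)
      also have "\<dots> = w ^ Suc (Suc k) + 1 / w ^ Suc (Suc k)"
        unfolding rec[OF w0, of k, symmetric] by simp
      finally show ?case using Suc by blast
    qed
    then have val: "\<sigma> (t k) = w ^ k + 1 / w ^ k" for k by blast
    have "t N = - 1 - 1" by (simp add: t_def z)
    moreover have "\<sigma> (- 1 - 1) = - 2"
    proof -
      have K1: "1 \<in> K" using sub(1) unfolding complex_subfield_def by blast
      have "0 - 1 \<in> K" using sub(1) K0 K1 unfolding complex_subfield_def by blast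
      then have K2: "- 1 \<in> K" by simp
      have "\<sigma> (-1 + 1) = \<sigma> (-1) + 1" using h(2)[OF K2 K1] h(1) by simp
      then have "\<sigma> (-1) = -1" using emb0[OF s] by (simp add: eq_neg_iff_add_eq_0)
      then show ?thesis using h(2)[OF K2 K2] by simp
    qed
    ultimately have "w ^ N + 1 / w ^ N = - 2" using val[of N] by simp
    \<comment> \<open>Multiplying w^N + 1/w^N = -2 by w^N completes a square.\<close>
    then have "(w ^ N + 1) * (w ^ N + 1) = 0"
    proof -
      assume a: "w ^ N + 1 / w ^ N = - 2"
      have "(w ^ N + 1) * (w ^ N + 1) = w ^ N * (w ^ N + 1 / w ^ N + 2)"
        using w0 by (simp add: algebra_simps)
      then show ?thesis using a by simp
    qed
    then have "w ^ N + 1 = 0" by simp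
    then have wN: "w ^ N = -1" by (rule eq_neg_iff_add_eq_0[THEN iffD2])
    \<comment> \<open>Inversion does not change w^k + w^(-k), so w may be replaced by its
      representative in the upper half plane.\<close>
    define u where "u = (if Im w > 0 then w else 1 / w)"
    have uN: "u ^ N = -1" using wN by (simp add: u_def power_divide)
    have "Im u > 0" using Im0[OF wN] cnj_inv[OF wN] by (auto simp: u_def)
    then have uA: "u \<in> A" using uN by (simp add: A_def)
    have "\<sigma> = conj u"
    proof (rule field_embeddings_eqI[OF K s conj_emb[OF uN]])
      fix x assume "x \<in> S"
      then consider "x = 0" | k where "x = t k" using S1 unfolding t_def by blast
      then show "\<sigma> x = conj u x"
      proof cases
        case 1
        then show ?thesis using emb0[OF s] emb0[OF conj_emb[OF uN]] by simp
      next
        case 2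
        have "w ^ k + 1 / w ^ k = u ^ k + 1 / u ^ k" using w0 by (simp add: u_def power_divide)
        then show ?thesis using 2 val conj_val[OF uN] by (simp add: t_def)
      qed
    qed
    then show ?thesis using uA by blast
  qed
  have emb: "field_embeddings K = conj ` A"
    using surj conj_emb by (auto simp: A_def)
  \<comment> \<open>The inverses of the roots in A are the roots in the lower half plane, so summing
    w^j + w^(-j) over A runs through all roots.\<close>
  have sumval: "(\<Sum>\<sigma>\<in>field_embeddings K. \<sigma> (z ^ j + 1 / z ^ j)) = (\<Sum>w | w ^ N = -1. w ^ j)"
  proof -
    have "(\<Sum>\<sigma>\<in>field_embeddings K. \<sigma> (z ^ j + 1 / z ^ j)) = (\<Sum>w\<in>A. w ^ j + 1 / w ^ j)"
      unfolding emb sum.reindex[OF inj] using conj_val by (intro sum.cong) (auto simp: A_def)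
    also have "\<dots> = (\<Sum>w\<in>A. w ^ j) + (\<Sum>w\<in>A. (1 / w) ^ j)" by (simp add: sum.distrib power_divide)
    also have "(\<Sum>w\<in>A. (1 / w) ^ j) = (\<Sum>w\<in>(\<lambda>w. 1 / w) ` A. w ^ j)"
    proof -
      have "inj_on (\<lambda>w. 1 / w) A" by (auto simp: inj_on_def)
      then show ?thesis by (simp add: sum.reindex)
    qed
    also have "(\<lambda>w. 1 / w) ` A = {w. w ^ N = -1 \<and> Im w < 0}"
    proof
      show "(\<lambda>w. 1 / w) ` A \<subseteq> {w. w ^ N = -1 \<and> Im w < 0}"
      proof
        fix v assume "v \<in> (\<lambda>w. 1 / w) ` A"
        then obtain w where w: "v = 1 / w" "w ^ N = -1" "Im w > 0" by (auto simp: A_def)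
        have "v ^ N = -1" unfolding w(1) by (simp add: power_divide w(2))
        moreover have "Im v < 0" unfolding w(1) cnj_inv[OF w(2)] using w(3) by simp
        ultimately show "v \<in> {w. w ^ N = -1 \<and> Im w < 0}" by simp
      qed
      show "{w. w ^ N = -1 \<and> Im w < 0} \<subseteq> (\<lambda>w. 1 / w) ` A"
      proof
        fix w :: complex assume "w \<in> {w. w ^ N = -1 \<and> Im w < 0}"
        then have w: "w ^ N = -1" "Im w < 0" by auto
        have "(1 / w) ^ N = -1" by (simp add: power_divide w(1))
        moreover have "Im (1 / w) > 0" unfolding cnj_inv[OF w(1)] using w(2) by simp
        ultimately have "1 / w \<in> A" "w = 1 / (1 / w)" by (simp_all add: A_def)
        then show "w \<in> (\<lambda>w. 1 / w) ` A" by blast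
      qed
    qed
    also have "(\<Sum>w\<in>A. w ^ j) + (\<Sum>w | w ^ N = -1 \<and> Im w < 0. w ^ j) = (\<Sum>w\<in>A \<union> {w. w ^ N = -1 \<and> Im w < 0}. w ^ j)"
      by (intro sum.union_disjoint[symmetric] finA finite_subset[OF _ finite_minus_roots[OF N0(1)]]) (auto simp: A_def)
    also have "A \<union> {w. w ^ N = -1 \<and> Im w < 0} = {w. w ^ N = -1}"
      using Im0 unfolding A_def by (auto simp: neq_iff)
    finally show ?thesis .
  qed
  show "field_trace K (z ^ j + 1 / z ^ j) =
      (if 2 * N dvd j then of_nat (2 * N) else 0) - (if N dvd j then of_nat N else 0)"
  proof -
    have "(if 2 * N dvd j then of_nat (2 * N) else 0) - (if N dvd j then of_nat N else 0) =
        (of_rat ((if 2 * N dvd j then of_nat (2 * N) else 0) - (if N dvd j then of_nat N else 0)) :: complex)"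
      by (simp add: of_rat_diff of_rat_mult)
    then show ?thesis
      unfolding field_trace_def sumval sum_minus_roots_power[OF N0(1)] by simp
  qed
  have "(\<Sum>\<sigma>\<in>field_embeddings K. \<sigma> 0) = 0" using emb0 by (intro sum.neutral) blast
  then show "field_trace K 0 = 0" unfolding field_trace_def by (intro the_equality) auto
qed

section \<open>Group algebras and induced representations\<close>

lemma sum_indicator:
  fixes F :: "'b \<Rightarrow> 'c::semiring_1"
  assumes "finite A" "x \<in> A"
  shows "(\<Sum>h\<in>A. (if h = x then 1 else 0) * F h) = F x" "(\<Sum>h\<in>A. F h * (if h = x then 1 else 0)) = F x"
proof -
  have "(\<Sum>h\<in>A. (if h = x then 1 else 0) * F h) = (\<Sum>h\<in>A. if h = x then F h else 0)"
    "(\<Sum>h\<in>A. F h * (if h = x then 1 else 0)) = (\<Sum>h\<in>A. if h = x then F h else 0)"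
    by (auto intro!: sum.cong)
  then show "(\<Sum>h\<in>A. (if h = x then 1 else 0) * F h) = F x" "(\<Sum>h\<in>A. F h * (if h = x then 1 else 0)) = F x"
    using assms by simp_all
qed

lemma mult_mat_unit_vec:
  fixes A :: "'k::semiring_1 mat"
  shows "A \<in> carrier_mat n m \<Longrightarrow> j < m \<Longrightarrow> A *\<^sub>v unit_vec m j = col A j"
  by (intro eq_vecI) (auto simp: scalar_prod_right_unit)

locale fin_group = group G for G (structure) +
  assumes fin: "finite (carrier G)"
begin

abbreviation gam (infixl "\<star>" 70) where "a \<star> b \<equiv> ga_mult G a b"

definition delta :: "'a \<Rightarrow> 'a \<Rightarrow> rat" where
  "delta g = (\<lambda>h. if h = g then 1 else 0)"

text \<open>For a subgroup K this is p_K normalized to an idempotent; the scaling does not change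
  images in the torus.\<close>

definition avg :: "'a set \<Rightarrow> 'a \<Rightarrow> rat" where
  "avg K = (\<lambda>g. if g \<in> K then 1 / of_nat (card K) else 0)"

text \<open>The substitution g = h k in a convolution. T is any additive function of the
  coefficient, so the rule serves vectors of the torus, matrix entries and coefficients
  alike.\<close>

lemma ga_sum_additive:
  fixes T :: "rat \<Rightarrow> 'a \<Rightarrow> 'm::comm_monoid_add"
  assumes add: "\<And>p q g. T (p + q) g = T p g + T q g" and zero: "\<And>g. T 0 g = 0"
  shows "(\<Sum>g\<in>carrier G. T ((a \<star> b) g) g) = (\<Sum>h\<in>carrier G. \<Sum>k\<in>carrier G. T (a h * b k) (h \<otimes> k))"
proof -
  have sum: "T (\<Sum>h\<in>A. f h) g = (\<Sum>h\<in>A. T (f h) g)" for f :: "'a \<Rightarrow> rat" and g A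
    by (induction A rule: infinite_finite_induct) (simp_all add: add zero)
  have "(\<Sum>g\<in>carrier G. T ((a \<star> b) g) g) = (\<Sum>g\<in>carrier G. \<Sum>h\<in>carrier G. T (a h * b (inv h \<otimes> g)) g)"
    by (simp add: ga_mult_def sum)
  also have "\<dots> = (\<Sum>h\<in>carrier G. \<Sum>g\<in>carrier G. T (a h * b (inv h \<otimes> g)) g)"
    by (rule sum.swap)
  also have "\<dots> = (\<Sum>h\<in>carrier G. \<Sum>k\<in>carrier G. T (a h * b k) (h \<otimes> k))"
  proof (rule sum.cong[OF HOL.refl])
    fix h assume h: "h \<in> carrier G"
    show "(\<Sum>g\<in>carrier G. T (a h * b (inv h \<otimes> g)) g) = (\<Sum>k\<in>carrier G. T (a h * b k) (h \<otimes> k))"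
      by (rule sum.reindex_bij_witness[of _ "\<lambda>k. h \<otimes> k" "\<lambda>g. inv h \<otimes> g"])
        (use h in \<open>auto simp: m_assoc[symmetric]\<close>)
  qed
  finally show ?thesis .
qed

lemma ga_sum_vec:
  fixes F :: "'a \<Rightarrow> 'v::complex_vs"
  shows "(\<Sum>g\<in>carrier G. of_rat ((a \<star> b) g) *\<^sub>C F g) =
    (\<Sum>h\<in>carrier G. \<Sum>k\<in>carrier G. (of_rat (a h) * of_rat (b k)) *\<^sub>C F (h \<otimes> k))"
  using ga_sum_additive[of "\<lambda>q g. of_rat q *\<^sub>C F g" a b] by (simp add: of_rat_add of_rat_mult scaleC_add_left)

lemma ga_sum:
  fixes F :: "'a \<Rightarrow> 'k::field_char_0"
  shows "(\<Sum>g\<in>carrier G. of_rat ((a \<star> b) g) * F g) =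
    (\<Sum>h\<in>carrier G. \<Sum>k\<in>carrier G. of_rat (a h) * of_rat (b k) * F (h \<otimes> k))"
  using ga_sum_additive[of "\<lambda>q g. of_rat q * F g" a b] by (simp add: of_rat_add of_rat_mult distrib_right)

lemma of_rat_rat: "(of_rat q :: rat) = q"
  by (cases q) (simp add: of_rat_rat Fract_of_int_quotient)

lemma ga_sum_rat:
  fixes F :: "'a \<Rightarrow> rat"
  shows "(\<Sum>g\<in>carrier G. (a \<star> b) g * F g) = (\<Sum>h\<in>carrier G. \<Sum>k\<in>carrier G. a h * b k * F (h \<otimes> k))"
  using ga_sum[of a b F] by (simp add: of_rat_rat)

lemma ga_mult_apply:
  assumes "x \<in> carrier G"
  shows "(a \<star> b) x = (\<Sum>h\<in>carrier G. \<Sum>k\<in>carrier G. a h * b k * (if h \<otimes> k = x then 1 else 0))"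
  unfolding ga_sum_rat[of a b "\<lambda>g. if g = x then 1 else 0", symmetric]
  by (rule sum_indicator(2)[OF fin assms, symmetric])

lemma ga_closed [simp]: "a \<star> b \<in> group_alg G"
  by (simp add: group_alg_def ga_mult_def)

lemma ga_eqI: "a \<in> group_alg G \<Longrightarrow> b \<in> group_alg G \<Longrightarrow> (\<And>x. x \<in> carrier G \<Longrightarrow> a x = b x) \<Longrightarrow> a = b"
  by (rule ext) (metis (mono_tags, lifting) group_alg_def mem_Collect_eq)

lemma ga_assoc: "(a \<star> b) \<star> c = a \<star> (b \<star> c)"
proof (rule ga_eqI)
  fix x assume x: "x \<in> carrier G"
  have "((a \<star> b) \<star> c) x = (\<Sum>h\<in>carrier G. (a \<star> b) h * (\<Sum>k\<in>carrier G. c k * (if h \<otimes> k = x then 1 else 0)))"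
    unfolding ga_mult_apply[OF x] by (simp add: sum_distrib_left mult.assoc)
  also have "\<dots> = (\<Sum>h\<in>carrier G. \<Sum>l\<in>carrier G. a h * b l * (\<Sum>k\<in>carrier G. c k * (if h \<otimes> l \<otimes> k = x then 1 else 0)))"
    by (rule ga_sum_rat)
  also have "\<dots> = (\<Sum>h\<in>carrier G. a h * (\<Sum>l\<in>carrier G. \<Sum>k\<in>carrier G. b l * c k * (if h \<otimes> (l \<otimes> k) = x then 1 else 0)))"
    by (simp add: sum_distrib_left mult.assoc m_assoc)
  also have "\<dots> = (\<Sum>h\<in>carrier G. a h * (\<Sum>g\<in>carrier G. (b \<star> c) g * (if h \<otimes> g = x then 1 else 0)))"
    by (simp only: ga_sum_rat)
  also have "\<dots> = (a \<star> (b \<star> c)) x"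
    unfolding ga_mult_apply[OF x, of a "b \<star> c"] by (simp add: sum_distrib_left mult.assoc)
  finally show "((a \<star> b) \<star> c) x = (a \<star> (b \<star> c)) x" .
qed auto

lemma ga_add_left: "(a + b) \<star> c = a \<star> c + b \<star> c"
  by (auto simp: ga_mult_def fun_eq_iff distrib_right sum.distrib)

lemma ga_add_right: "a \<star> (b + c) = a \<star> b + a \<star> c"
  by (auto simp: ga_mult_def fun_eq_iff distrib_left sum.distrib)

lemma ga_diff_left: "(a - b) \<star> c = a \<star> c - b \<star> c"
  by (auto simp: ga_mult_def fun_eq_iff left_diff_distrib sum_subtractf)

lemma ga_diff_right: "a \<star> (b - c) = a \<star> b - a \<star> c"
  by (auto simp: ga_mult_def fun_eq_iff right_diff_distrib sum_subtractf)

lemma ga_zero [simp]: "0 \<star> a = 0" "a \<star> 0 = 0"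
  by (auto simp: ga_mult_def fun_eq_iff)

lemma ga_scale_left: "(\<lambda>g. c * a g) \<star> b = (\<lambda>g. c * (a \<star> b) g)"
  by (auto simp: ga_mult_def fun_eq_iff sum_distrib_left mult.assoc)

lemma group_alg_closed:
  "a \<in> group_alg G \<Longrightarrow> b \<in> group_alg G \<Longrightarrow> a + b \<in> group_alg G"
  "a \<in> group_alg G \<Longrightarrow> b \<in> group_alg G \<Longrightarrow> a - b \<in> group_alg G"
  "0 \<in> group_alg G" "a \<in> group_alg G \<Longrightarrow> (\<lambda>g. c * a g) \<in> group_alg G"
  "g \<in> carrier G \<Longrightarrow> delta g \<in> group_alg G" "K \<subseteq> carrier G \<Longrightarrow> avg K \<in> group_alg G"
  by (auto simp: group_alg_def delta_def avg_def)

lemma delta_left: "g \<in> carrier G \<Longrightarrow> x \<in> carrier G \<Longrightarrow> (delta g \<star> a) x = a (inv g \<otimes> x)"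
  using sum_indicator(1)[OF fin, of g "\<lambda>h. a (inv h \<otimes> x)"] by (simp add: ga_mult_def delta_def)

lemma delta_right: assumes "g \<in> carrier G" "x \<in> carrier G" shows "(a \<star> delta g) x = a (x \<otimes> inv g)"
proof -
  have "(inv h \<otimes> x = g) = (h = x \<otimes> inv g)" if "h \<in> carrier G" for h
    using that assms by (metis inv_closed inv_equality inv_solve_left m_closed inv_solve_right inv_inv)
  then have "(a \<star> delta g) x = (\<Sum>h\<in>carrier G. if h = x \<otimes> inv g then a h else 0)"
    using assms(2) unfolding ga_mult_def delta_def by (auto intro!: sum.cong)
  then show ?thesis using assms fin by simp
qed

lemma delta_one: "a \<in> group_alg G \<Longrightarrow> delta \<one> \<star> a = a" "a \<in> group_alg G \<Longrightarrow> a \<star> delta \<one> = a"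
  by (auto intro!: ga_eqI simp: delta_left delta_right)

lemma delta_mult: "g \<in> carrier G \<Longrightarrow> h \<in> carrier G \<Longrightarrow> delta g \<star> delta h = delta (g \<otimes> h)"
proof (rule ga_eqI)
  fix x assume a: "g \<in> carrier G" "h \<in> carrier G" "x \<in> carrier G"
  then have "(inv g \<otimes> x = h) = (x = g \<otimes> h)" by (metis inv_solve_left' inv_closed m_closed inv_solve_left)
  then show "(delta g \<star> delta h) x = delta (g \<otimes> h) x" using a by (simp add: delta_left) (simp add: delta_def)
qed (simp_all add: group_alg_closed)

text \<open>Translation by an element of K permutes L. In consequence p_K - p_L is an idempotent
  orthogonal to p_L.\<close>

lemma avg_mult:
  assumes K: "subgroup K G" and L: "subgroup L G" and KL: "K \<subseteq> L"
  shows "avg K \<star> avg L = avg L" "avg L \<star> avg K = avg L"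
proof -
  note KG = subgroup.subset[OF K] and LG = subgroup.subset[OF L]
  have finK: "finite K" "finite L" using KG LG fin finite_subset by blast+
  have cK: "card K \<noteq> 0" using finK subgroup.one_closed[OF K] by auto
  show "avg K \<star> avg L = avg L"
  proof (rule ga_eqI)
    fix x assume x: "x \<in> carrier G"
    have "(avg K \<star> avg L) x = (\<Sum>h\<in>carrier G. avg K h * avg L (inv h \<otimes> x))" using x by (simp add: ga_mult_def)
    also have "\<dots> = (\<Sum>h\<in>K. avg K h * avg L (inv h \<otimes> x))"
      by (rule sum.mono_neutral_right) (use fin KG in \<open>auto simp: avg_def\<close>)
    also have "\<dots> = (\<Sum>h\<in>K. 1 / of_nat (card K) * avg L x)"
    proof (rule sum.cong[OF HOL.refl])
      fix h assume h: "h \<in> K"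
      then have hL: "h \<in> L" "h \<in> carrier G" using KL KG by auto
      have "inv h \<otimes> x \<in> L \<longleftrightarrow> x \<in> L"
      proof
        assume "inv h \<otimes> x \<in> L"
        then have "h \<otimes> (inv h \<otimes> x) \<in> L" using subgroup.m_closed[OF L hL(1)] by blast
        then show "x \<in> L" using hL x by (simp add: m_assoc[symmetric])
      next
        assume "x \<in> L"
        then show "inv h \<otimes> x \<in> L"
          by (rule subgroup.m_closed[OF L subgroup.m_inv_closed[OF L hL(1)]])
      qed
      then show "avg K h * avg L (inv h \<otimes> x) = 1 / of_nat (card K) * avg L x" using h by (simp add: avg_def)
    qed
    also have "\<dots> = avg L x" using cK by simp
    finally show "(avg K \<star> avg L) x = avg L x" .
  qed (use LG in \<open>simp_all add: group_alg_closed\<close>)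
  show "avg L \<star> avg K = avg L"
  proof (rule ga_eqI)
    fix x assume x: "x \<in> carrier G"
    have e: "x \<otimes> inv (inv h \<otimes> x) = h" "inv (x \<otimes> inv h) \<otimes> x = h" if "h \<in> carrier G" for h
      using x that by (simp add: inv_mult_group m_assoc[symmetric], simp add: inv_mult_group m_assoc)
    have "(avg L \<star> avg K) x = (\<Sum>h\<in>carrier G. avg L h * avg K (inv h \<otimes> x))" using x by (simp add: ga_mult_def)
    also have "\<dots> = (\<Sum>k\<in>carrier G. avg L (x \<otimes> inv k) * avg K k)"
      by (rule sum.reindex_bij_witness[of _ "\<lambda>k. x \<otimes> inv k" "\<lambda>h. inv h \<otimes> x"])
        (use x e in \<open>auto\<close>)
    also have "\<dots> = (\<Sum>k\<in>K. avg L (x \<otimes> inv k) * avg K k)"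
      by (rule sum.mono_neutral_right) (use fin KG in \<open>auto simp: avg_def\<close>)
    also have "\<dots> = (\<Sum>h\<in>K. avg L x * (1 / of_nat (card K)))"
    proof (rule sum.cong[OF HOL.refl])
      fix h assume h: "h \<in> K"
      then have hL: "h \<in> L" "h \<in> carrier G" using KL KG by auto
      have "x \<otimes> inv h \<in> L \<longleftrightarrow> x \<in> L"
      proof
        assume "x \<otimes> inv h \<in> L"
        then have "(x \<otimes> inv h) \<otimes> h \<in> L" using subgroup.m_closed[OF L _ hL(1)] by blast
        then show "x \<in> L" using hL x by (simp add: m_assoc)
      next
        assume "x \<in> L"
        then show "x \<otimes> inv h \<in> L"
          by (rule subgroup.m_closed[OF L _ subgroup.m_inv_closed[OF L hL(1)]])
      qed
      then show "avg L (x \<otimes> inv h) * avg K h = avg L x * (1 / of_nat (card K))" using h by (simp add: avg_def)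
    qed
    also have "\<dots> = avg L x" using cK by simp
    finally show "(avg L \<star> avg K) x = avg L x" .
  qed (use LG in \<open>simp_all add: group_alg_closed\<close>)
qed

lemma avg_idem: "subgroup K G \<Longrightarrow> avg K \<star> avg K = avg K"
  by (rule avg_mult) auto

text \<open>The extension of V to the rational group algebra. The coefficient field stays general
  because rational and complex representations both occur.\<close>

definition ract :: "('a, 'k::field_char_0) rep \<Rightarrow> ('a \<Rightarrow> rat) \<Rightarrow> 'k mat" where
  "ract V a = mat (fst V) (fst V) (\<lambda>(i, j). \<Sum>g\<in>carrier G. of_rat (a g) * snd V g $$ (i, j))"

lemma ract_carrier [simp]: "ract V a \<in> carrier_mat (fst V) (fst V)"
  by (simp add: ract_def)

lemma ract_dim [simp]: "dim_row (ract V a) = fst V" "dim_col (ract V a) = fst V"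
  by (simp_all add: ract_def)

lemma repD:
  assumes "representation G V"
  shows "g \<in> carrier G \<Longrightarrow> snd V g \<in> carrier_mat (fst V) (fst V)" "snd V \<one> = 1\<^sub>m (fst V)"
    "g \<in> carrier G \<Longrightarrow> h \<in> carrier G \<Longrightarrow> snd V (g \<otimes> h) = snd V g * snd V h"
  using assms by (auto simp: representation_def)

lemma mat_mult_index: "A \<in> carrier_mat n m \<Longrightarrow> B \<in> carrier_mat m k \<Longrightarrow> i < n \<Longrightarrow> j < k \<Longrightarrow>
  (A * B) $$ (i, j) = (\<Sum>l<m. A $$ (i, l) * (B $$ (l, j) :: 'k::semiring_0))"
  by (auto simp: scalar_prod_def atLeast0LessThan intro!: sum.cong)

lemma mat_vec_index: "A \<in> carrier_mat n m \<Longrightarrow> v \<in> carrier_vec m \<Longrightarrow> i < n \<Longrightarrow>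
  (A *\<^sub>v v) $ i = (\<Sum>l<m. A $$ (i, l) * (v $ l :: 'k::semiring_0))"
  by (auto simp: scalar_prod_def atLeast0LessThan intro!: sum.cong)

lemma ract_mult:
  fixes V :: "('a, 'k::field_char_0) rep"
  assumes V: "representation G V"
  shows "ract V (a \<star> b) = ract V a * ract V b"
proof (rule eq_matI)
  fix i j assume ij: "i < dim_row (ract V a * ract V b)" "j < dim_col (ract V a * ract V b)"
  then have ij: "i < fst V" "j < fst V" by simp_all
  note c = repD(1)[OF V]
  have "ract V (a \<star> b) $$ (i, j) = (\<Sum>h\<in>carrier G. \<Sum>k\<in>carrier G. of_rat (a h) * of_rat (b k) * snd V (h \<otimes> k) $$ (i, j))"
    using ij by (simp add: ract_def ga_sum)
  also have "\<dots> = (\<Sum>h\<in>carrier G. \<Sum>k\<in>carrier G. \<Sum>l<fst V. (of_rat (a h) * snd V h $$ (i, l)) * (of_rat (b k) * snd V k $$ (l, j)))"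
    using repD(3)[OF V] mat_mult_index[OF c c ij] by (simp add: sum_distrib_left mult_ac)
  also have "\<dots> = (\<Sum>l<fst V. \<Sum>h\<in>carrier G. \<Sum>k\<in>carrier G. (of_rat (a h) * snd V h $$ (i, l)) * (of_rat (b k) * snd V k $$ (l, j)))"
    by (simp only: sum.swap[of _ "{..<fst V}"])
  also have "\<dots> = (\<Sum>l<fst V. ract V a $$ (i, l) * ract V b $$ (l, j))"
    using ij by (simp add: ract_def sum_product)
  also have "\<dots> = (ract V a * ract V b) $$ (i, j)"
    by (rule mat_mult_index[symmetric, OF ract_carrier ract_carrier ij])
  finally show "ract V (a \<star> b) $$ (i, j) = (ract V a * ract V b) $$ (i, j)" .
qed simp_all

lemma ract_delta:
  assumes V: "representation G V" and g: "g \<in> carrier G"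
  shows "ract V (delta g) = snd V g"
proof (rule eq_matI)
  fix i j assume "i < dim_row (snd V g)" "j < dim_col (snd V g)"
  then have ij: "i < fst V" "j < fst V" using repD(1)[OF V g] by auto
  have "ract V (delta g) $$ (i, j) = (\<Sum>h\<in>carrier G. if h = g then snd V h $$ (i, j) else 0)"
    using ij unfolding ract_def delta_def by (auto intro!: sum.cong)
  then show "ract V (delta g) $$ (i, j) = snd V g $$ (i, j)" using g fin by simp
qed (use repD(1)[OF V g] in auto)

lemma ract_add: "ract V (a + b) = ract V a + ract V b"
  by (rule eq_matI) (auto simp: ract_def of_rat_add distrib_right sum.distrib)

lemma ract_zero: "ract V 0 = 0\<^sub>m (fst V) (fst V)"
  by (rule eq_matI) (auto simp: ract_def)

lemma ract_intertwiner:
  fixes V W :: "('a, 'k::field_char_0) rep"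
  assumes V: "representation G V" and W: "representation G W" and M: "intertwiner G V W M"
  shows "M * ract V a = ract W a * M"
proof (rule eq_matI)
  have Mc: "M \<in> carrier_mat (fst W) (fst V)" using M by (simp add: intertwiner_def)
  fix i j assume "i < dim_row (ract W a * M)" "j < dim_col (ract W a * M)"
  then have ij: "i < fst W" "j < fst V" using Mc by auto
  note c = repD(1)[OF V] repD(1)[OF W]
  have "(M * ract V a) $$ (i, j) = (\<Sum>l<fst V. M $$ (i, l) * ract V a $$ (l, j))"
    by (rule mat_mult_index[OF Mc ract_carrier ij])
  also have "\<dots> = (\<Sum>l<fst V. \<Sum>g\<in>carrier G. of_rat (a g) * (M $$ (i, l) * snd V g $$ (l, j)))"
    using ij by (simp add: ract_def sum_distrib_left mult_ac)
  also have "\<dots> = (\<Sum>g\<in>carrier G. of_rat (a g) * (M * snd V g) $$ (i, j))"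
    using mat_mult_index[OF Mc c(1) ij] by (subst sum.swap) (simp add: sum_distrib_left)
  also have "\<dots> = (\<Sum>g\<in>carrier G. of_rat (a g) * (snd W g * M) $$ (i, j))"
    using M by (intro sum.cong) (auto simp: intertwiner_def)
  also have "\<dots> = (\<Sum>l<fst W. \<Sum>g\<in>carrier G. of_rat (a g) * (snd W g $$ (i, l) * M $$ (l, j)))"
    using mat_mult_index[OF c(2) Mc ij] by (subst sum.swap) (simp add: sum_distrib_left)
  also have "\<dots> = (\<Sum>l<fst W. ract W a $$ (i, l) * M $$ (l, j))"
    using ij by (simp add: ract_def sum_distrib_right mult_ac)
      (simp add: sum_distrib_left mult_ac)
  also have "\<dots> = (ract W a * M) $$ (i, j)" by (rule mat_mult_index[symmetric, OF ract_carrier Mc ij])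
  finally show "(M * ract V a) $$ (i, j) = (ract W a * M) $$ (i, j)" .
qed (use M in \<open>auto simp: intertwiner_def\<close>)

lemma trace_commute:
  fixes A B :: "'k::comm_ring_1 mat"
  assumes "A \<in> carrier_mat n m" "B \<in> carrier_mat m n"
  shows "(\<Sum>i<n. (A * B) $$ (i, i)) = (\<Sum>j<m. (B * A) $$ (j, j))"
proof -
  have "(\<Sum>i<n. (A * B) $$ (i, i)) = (\<Sum>i<n. \<Sum>l<m. A $$ (i, l) * B $$ (l, i))"
    by (intro sum.cong HOL.refl mat_mult_index[OF assms]) auto
  also have "\<dots> = (\<Sum>l<m. \<Sum>i<n. B $$ (l, i) * A $$ (i, l))" by (subst sum.swap) (simp add: mult.commute)
  also have "\<dots> = (\<Sum>j<m. (B * A) $$ (j, j))"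
    by (intro sum.cong HOL.refl mat_mult_index[OF assms(2,1), symmetric]) auto
  finally show ?thesis .
qed

lemma mat_eq_one:
  fixes A :: "'k::field mat"
  assumes "A \<in> carrier_mat n n" "\<And>v. v \<in> carrier_vec n \<Longrightarrow> A *\<^sub>v v = v"
  shows "A = 1\<^sub>m n"
proof (rule eq_matI)
  fix i j assume ij: "i < dim_row (1\<^sub>m n :: 'k mat)" "j < dim_col (1\<^sub>m n :: 'k mat)"
  then have "col A j = A *\<^sub>v unit_vec n j" using assms(1) by (simp add: mult_mat_unit_vec)
  also have "\<dots> = unit_vec n j" by (rule assms(2)) simp
  finally have "col A j $ i = unit_vec n j $ i" by simp
  then show "A $$ (i, j) = 1\<^sub>m n $$ (i, j)" using assms(1) ij by (auto simp: unit_vec_def)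
qed (use assms in auto)

text \<open>Kernel and image of M are invariant, and M is not zero. The degrees agree because M B
  and B M, two identity matrices, have the same trace in characteristic zero.\<close>

lemma schur:
  fixes V W :: "('a, 'k::field_char_0) rep"
  assumes V: "irreducible_rep G V" and W: "irreducible_rep G W" and M: "intertwiner G V W M"
    and M0: "M \<noteq> 0\<^sub>m (fst W) (fst V)"
  obtains B where "fst V = fst W" "B \<in> carrier_mat (fst V) (fst W)" "M * B = 1\<^sub>m (fst W)" "B * M = 1\<^sub>m (fst V)"
    "rep_iso G V W"
proof -
  have rV: "representation G V" and rW: "representation G W" using V W by (auto simp: irreducible_rep_def)
  have Mc: "M \<in> carrier_mat (fst W) (fst V)" and Mi: "\<And>g. g \<in> carrier G \<Longrightarrow> M * snd V g = snd W g * M"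
    using M by (auto simp: intertwiner_def)
  note c = repD(1)[OF rV] repD(1)[OF rW]
  define K where "K = {v \<in> carrier_vec (fst V). M *\<^sub>v v = 0\<^sub>v (fst W)}"
  have "invariant_subspace G V K"
    unfolding invariant_subspace_def
  proof (intro conjI ballI allI)
    show "K \<subseteq> carrier_vec (fst V)" by (auto simp: K_def)
    show "0\<^sub>v (fst V) \<in> K" using Mc by (auto simp: K_def)
    show "u + v \<in> K" if "u \<in> K" "v \<in> K" for u v using that Mc by (auto simp: K_def mult_add_distrib_mat_vec)
    show "k \<cdot>\<^sub>v u \<in> K" if "u \<in> K" for k u using that Mc by (auto simp: K_def mult_mat_vec)
    show "snd V g *\<^sub>v u \<in> K" if g: "g \<in> carrier G" and u: "u \<in> K" for g u
    proof -
      have "M *\<^sub>v (snd V g *\<^sub>v u) = (M * snd V g) *\<^sub>v u"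
        using u Mc c(1)[OF g] by (intro assoc_mult_mat_vec[symmetric]) (auto simp: K_def)
      also have "\<dots> = snd W g *\<^sub>v (M *\<^sub>v u)"
        unfolding Mi[OF g] using u Mc c(2)[OF g] by (intro assoc_mult_mat_vec) (auto simp: K_def)
      also have "\<dots> = 0\<^sub>v (fst W)" using u c(2)[OF g] by (auto simp: K_def)
      finally show ?thesis using u c(1)[OF g] by (auto simp: K_def)
    qed
  qed
  then have K: "K = {0\<^sub>v (fst V)} \<or> K = carrier_vec (fst V)" using V by (simp add: irreducible_rep_def)
  define R where "R = (\<lambda>v. M *\<^sub>v v) ` carrier_vec (fst V)"
  have "invariant_subspace G W R"
    unfolding invariant_subspace_def
  proof (intro conjI ballI allI)
    show "R \<subseteq> carrier_vec (fst W)" using Mc by (auto simp: R_def)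
    show "0\<^sub>v (fst W) \<in> R" unfolding R_def using Mc by (intro image_eqI[of _ _ "0\<^sub>v (fst V)"]) auto
    show "x + y \<in> R" if xy: "x \<in> R" "y \<in> R" for x y
    proof -
      obtain u v where "u \<in> carrier_vec (fst V)" "v \<in> carrier_vec (fst V)" "x = M *\<^sub>v u" "y = M *\<^sub>v v"
        using xy unfolding R_def by blast
      then show ?thesis unfolding R_def using Mc
        by (intro image_eqI[of _ _ "u + v"]) (auto simp: mult_add_distrib_mat_vec)
    qed
    show "k \<cdot>\<^sub>v x \<in> R" if x: "x \<in> R" for k x
    proof -
      obtain u where "u \<in> carrier_vec (fst V)" "x = M *\<^sub>v u" using x unfolding R_def by blast
      then show ?thesis unfolding R_def using Mc
        by (intro image_eqI[of _ _ "k \<cdot>\<^sub>v u"]) (auto simp: mult_mat_vec)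
    qed
    show "snd W g *\<^sub>v x \<in> R" if g: "g \<in> carrier G" and x: "x \<in> R" for g x
    proof -
      obtain u where u: "u \<in> carrier_vec (fst V)" "x = M *\<^sub>v u" using x unfolding R_def by blast
      have "snd W g *\<^sub>v x = (snd W g * M) *\<^sub>v u"
        unfolding u(2) using u Mc c(2)[OF g] by (intro assoc_mult_mat_vec[symmetric]) auto
      also have "\<dots> = M *\<^sub>v (snd V g *\<^sub>v u)"
        unfolding Mi[OF g, symmetric] using u Mc c(1)[OF g] by (intro assoc_mult_mat_vec) auto
      finally show ?thesis unfolding R_def using u c(1)[OF g] by (intro image_eqI[of _ _ "snd V g *\<^sub>v u"]) auto
    qed
  qed
  then have R: "R = {0\<^sub>v (fst W)} \<or> R = carrier_vec (fst W)" using W by (simp add: irreducible_rep_def)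
  have ex: "\<exists>v\<in>carrier_vec (fst V). M *\<^sub>v v \<noteq> 0\<^sub>v (fst W)"
  proof (rule ccontr)
    assume n: "\<not> ?thesis"
    have "M = 0\<^sub>m (fst W) (fst V)"
    proof (rule eq_matI)
      fix i j assume ij: "i < dim_row (0\<^sub>m (fst W) (fst V) :: 'k mat)" "j < dim_col (0\<^sub>m (fst W) (fst V) :: 'k mat)"
      then have "col M j = M *\<^sub>v unit_vec (fst V) j" using Mc by (simp add: mult_mat_unit_vec)
      also have "\<dots> = 0\<^sub>v (fst W)" using n ij by auto
      finally have "col M j $ i = 0" using ij by simp
      then show "M $$ (i, j) = 0\<^sub>m (fst W) (fst V) $$ (i, j)" using Mc ij by auto
    qed (use Mc in auto)
    then show False using M0 by simp
  qed
  then have "K \<noteq> carrier_vec (fst V)" by (auto simp: K_def)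
  then have inj: "K = {0\<^sub>v (fst V)}" using K by simp
  have "R \<noteq> {0\<^sub>v (fst W)}" using ex by (auto simp: R_def)
  then have surj: "R = carrier_vec (fst W)" using R by simp
  have "\<exists>v\<in>carrier_vec (fst V). M *\<^sub>v v = unit_vec (fst W) j" for j
  proof -
    have "unit_vec (fst W) j \<in> R" unfolding surj by simp
    then show ?thesis unfolding R_def by (auto elim: imageE)
  qed
  then obtain b where b: "\<And>j. b j \<in> carrier_vec (fst V)" "\<And>j. M *\<^sub>v b j = unit_vec (fst W) j" by metis
  define B where "B = mat (fst V) (fst W) (\<lambda>(i, j). b j $ i)"
  have Bc: "B \<in> carrier_mat (fst V) (fst W)" by (simp add: B_def)
  have colB: "col B j = b j" if "j < fst W" for j using that b(1)[of j] by (auto simp: B_def intro!: eq_vecI)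
  have MB: "M * B = 1\<^sub>m (fst W)"
  proof (rule eq_matI)
    fix i j assume ij: "i < dim_row (1\<^sub>m (fst W) :: 'k mat)" "j < dim_col (1\<^sub>m (fst W) :: 'k mat)"
    have "col (M * B) j = M *\<^sub>v b j" using Mc Bc ij colB by (simp add: col_mult2)
    then have "col (M * B) j $ i = unit_vec (fst W) j $ i" using b(2) by simp
    then show "(M * B) $$ (i, j) = 1\<^sub>m (fst W) $$ (i, j)" using Mc Bc ij by (auto simp: unit_vec_def)
  qed (use Mc Bc in auto)
  have BM: "B * M = 1\<^sub>m (fst V)"
  proof (rule mat_eq_one)
    fix v :: "'k vec" assume v: "v \<in> carrier_vec (fst V)"
    have w: "(B * M) *\<^sub>v v \<in> carrier_vec (fst V)" using Bc Mc v by auto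
    have "M *\<^sub>v ((B * M) *\<^sub>v v) = (M * B) *\<^sub>v (M *\<^sub>v v)"
      using Mc Bc v by (simp add: assoc_mult_mat_vec[of _ "fst W" "fst V"] assoc_mult_mat_vec[of _ "fst V" "fst W"])
    also have "\<dots> = M *\<^sub>v v" unfolding MB using Mc v by auto
    finally have "M *\<^sub>v ((B * M) *\<^sub>v v - v) = 0\<^sub>v (fst W)"
      using Mc v w by (simp add: mult_minus_distrib_mat_vec)
    then have "(B * M) *\<^sub>v v - v \<in> K" using v w by (simp add: K_def)
    then have d: "(B * M) *\<^sub>v v - v = 0\<^sub>v (fst V)" using inj by simp
    show "(B * M) *\<^sub>v v = v"
    proof (rule eq_vecI)
      fix i assume i: "i < dim_vec v"
      have "((B * M) *\<^sub>v v - v) $ i = 0" using d v i by simp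
      then show "((B * M) *\<^sub>v v) $ i = v $ i" using v w i by simp
    qed (use v w Bc in auto)
  qed (use Bc Mc in auto)
  have "(\<Sum>i<fst W. (M * B) $$ (i, i)) = (\<Sum>j<fst V. (B * M) $$ (j, j))" by (rule trace_commute[OF Mc Bc])
  then have "of_nat (fst W) = (of_nat (fst V) :: 'k)" unfolding MB BM by simp
  then have dim: "fst V = fst W" by simp
  have "invertible_mat M" unfolding invertible_mat_def inverts_mat_def square_mat.simps
    using Mc Bc MB BM dim by (intro conjI exI[of _ B]) auto
  then have "rep_iso G V W" using M by (auto simp: rep_iso_def)
  then show ?thesis using that dim Bc MB BM by blast
qed

lemma schur_character:
  fixes V W :: "('a, complex) rep"
  assumes V: "irreducible_rep G V" and W: "irreducible_rep G W" and M: "intertwiner G V W M"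
    and M0: "M \<noteq> 0\<^sub>m (fst W) (fst V)"
  shows "fst V = fst W" "g \<in> carrier G \<Longrightarrow> character V g = character W g"
proof -
  obtain B where B: "fst V = fst W" "B \<in> carrier_mat (fst V) (fst W)" "M * B = 1\<^sub>m (fst W)" "B * M = 1\<^sub>m (fst V)"
    using schur[OF assms] by blast
  show "fst V = fst W" by fact
  assume g: "g \<in> carrier G"
  have rV: "representation G V" and rW: "representation G W" using V W by (auto simp: irreducible_rep_def)
  have Mc: "M \<in> carrier_mat (fst W) (fst V)" and Mi: "M * snd V g = snd W g * M"
    using M g by (auto simp: intertwiner_def)
  note c = repD(1)[OF rV g] repD(1)[OF rW g]
  have "snd V g = (B * M) * snd V g" unfolding B(4) using c by simp
  also have "\<dots> = B * (snd W g * M)" using B(2) Mc c Mi by (simp add: assoc_mult_mat[of _ "fst V" "fst W"])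
  finally have e: "snd V g = B * (snd W g * M)" .
  have "character V g = (\<Sum>i<fst V. (B * (snd W g * M)) $$ (i, i))" unfolding character_def by (subst e) simp
  also have "\<dots> = (\<Sum>i<fst W. ((snd W g * M) * B) $$ (i, i))" by (rule trace_commute) (use B Mc c in auto)
  also have "(snd W g * M) * B = snd W g" using B(2,3) Mc c by (simp add: assoc_mult_mat[of _ "fst W" "fst W"])
  finally show "character V g = character W g" by (simp add: character_def)
qed

end

section \<open>Representations induced from sign characters\<close>

context fin_group
begin

lemma cancel_inv [simp]:
  "a \<in> carrier G \<Longrightarrow> g \<in> carrier G \<Longrightarrow> inv a \<otimes> (a \<otimes> g) = g"
  "a \<in> carrier G \<Longrightarrow> g \<in> carrier G \<Longrightarrow> a \<otimes> (inv a \<otimes> g) = g"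
  by (simp_all add: m_assoc[symmetric])

text \<open>A homomorphism from S to {1, -1}. Extension by zero makes each entry of an induced
  matrix a single value of lam.\<close>

definition lchar :: "'a set \<Rightarrow> ('a \<Rightarrow> rat) \<Rightarrow> bool" where
  "lchar S lam \<longleftrightarrow> subgroup S G \<and> (\<forall>g. g \<notin> S \<longrightarrow> lam g = 0) \<and> (\<forall>s\<in>S. lam s = 1 \<or> lam s = -1) \<and>
     (\<forall>s\<in>S. \<forall>t\<in>S. lam (s \<otimes> t) = lam s * lam t)"

text \<open>The idempotent of the character lam; the values are their own inverses, so no inversion
  of g appears.\<close>

definition chi_idem :: "'a set \<Rightarrow> ('a \<Rightarrow> rat) \<Rightarrow> 'a \<Rightarrow> rat" where
  "chi_idem S lam = (\<lambda>g. lam g / of_nat (card S))"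

text \<open>Representatives of the left cosets, as a list that indexes a basis. Entry 0 is the unit,
  so basis vector 0 transforms by lam under S.\<close>

definition transversal :: "'a set \<Rightarrow> 'a list \<Rightarrow> bool" where
  "transversal S ts \<longleftrightarrow> ts \<noteq> [] \<and> ts ! 0 = \<one> \<and> set ts \<subseteq> carrier G \<and>
     (\<forall>g\<in>carrier G. \<exists>!r. r < length ts \<and> inv (ts ! r) \<otimes> g \<in> S)"

text \<open>The monomial matrices of the induced representation, which are rational from the
  outset.\<close>

definition ind :: "('a \<Rightarrow> rat) \<Rightarrow> 'a list \<Rightarrow> ('a, rat) rep" where
  "ind lam ts = (length ts, \<lambda>g. mat (length ts) (length ts) (\<lambda>(r, c). lam (inv (ts ! r) \<otimes> g \<otimes> ts ! c)))"

text \<open>Simplicity of the left ideal of f, in the form of a generator recovered from any nonzero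
  element.\<close>

definition minimal_left :: "('a \<Rightarrow> rat) \<Rightarrow> bool" where
  "minimal_left f \<longleftrightarrow> (\<forall>a\<in>group_alg G. a \<star> f \<noteq> 0 \<longrightarrow> (\<exists>c\<in>group_alg G. c \<star> (a \<star> f) = f))"

lemma lcharD:
  assumes "lchar S lam"
  shows "subgroup S G" "g \<notin> S \<Longrightarrow> lam g = 0" "s \<in> S \<Longrightarrow> lam s * lam s = 1"
    "s \<in> S \<Longrightarrow> t \<in> S \<Longrightarrow> lam (s \<otimes> t) = lam s * lam t" "lam \<one> = 1" "S \<subseteq> carrier G" "finite S" "card S > 0"
proof -
  show S: "subgroup S G" and "g \<notin> S \<Longrightarrow> lam g = 0" using assms by (auto simp: lchar_def)
  show sq: "lam s * lam s = 1" if "s \<in> S" for s using assms that unfolding lchar_def by force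
  show mult: "lam (s \<otimes> t) = lam s * lam t" if "s \<in> S" "t \<in> S" for s t using assms that by (auto simp: lchar_def)
  have "\<one> \<in> S" using S by (rule subgroup.one_closed)
  then show "lam \<one> = 1" using mult[of \<one> \<one>] sq[of \<one>] by simp
  show "S \<subseteq> carrier G" using S by (rule subgroup.subset)
  then show "finite S" using fin finite_subset by blast
  then show "card S > 0" using \<open>\<one> \<in> S\<close> by (auto simp: card_gt_0_iff)
qed

lemma subgroup_cancel:
  assumes "subgroup S G" "s \<in> S" "g \<in> carrier G"
  shows "g \<otimes> s \<in> S \<longleftrightarrow> g \<in> S" "s \<otimes> g \<in> S \<longleftrightarrow> g \<in> S"
proof -
  have sG: "s \<in> carrier G" using assms subgroup.subset by blast
  have si: "inv s \<in> S" using assms by (simp add: subgroup.m_inv_closed)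
  show "g \<otimes> s \<in> S \<longleftrightarrow> g \<in> S"
  proof
    assume "g \<otimes> s \<in> S"
    then have "g \<otimes> s \<otimes> inv s \<in> S" using si subgroup.m_closed[OF assms(1)] by blast
    then show "g \<in> S" using assms sG by (simp add: m_assoc)
  qed (use assms subgroup.m_closed[OF assms(1)] in blast)
  show "s \<otimes> g \<in> S \<longleftrightarrow> g \<in> S"
  proof
    assume "s \<otimes> g \<in> S"
    then have "inv s \<otimes> (s \<otimes> g) \<in> S" using si subgroup.m_closed[OF assms(1)] by blast
    then show "g \<in> S" using assms sG by (simp add: m_assoc[symmetric])
  qed (use assms subgroup.m_closed[OF assms(1)] in blast)
qed

lemma lam_mult:
  assumes "lchar S lam" "s \<in> S" "g \<in> carrier G"
  shows "lam (g \<otimes> s) = lam g * lam s" "lam (s \<otimes> g) = lam s * lam g"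
  using subgroup_cancel[OF lcharD(1)[OF assms(1)] assms(2,3)] lcharD(2,4)[OF assms(1)] assms(2)
  by (cases "g \<in> S"; simp)+

text \<open>A choice function that is constant on left cosets, overridden on S to give the
  unit.\<close>

lemma transversal_exists:
  assumes S: "subgroup S G" shows "\<exists>ts. transversal S ts"
proof -
  note SG = subgroup.subset[OF S]
  define P where "P g h \<longleftrightarrow> h \<in> carrier G \<and> inv g \<otimes> h \<in> S" for g h
  have Psym: "P h g" if "P g h" "g \<in> carrier G" for g h
  proof -
    have "inv (inv g \<otimes> h) \<in> S" using that subgroup.m_inv_closed[OF S] by (simp add: P_def)
    then show ?thesis using that by (simp add: P_def inv_mult_group)
  qed
  have Ptrans: "P g k" if "P g h" "P h k" "g \<in> carrier G" for g h k
  proof -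
    have "(inv g \<otimes> h) \<otimes> (inv h \<otimes> k) \<in> S" using that subgroup.m_closed[OF S] by (auto simp: P_def)
    moreover have "(inv g \<otimes> h) \<otimes> (inv h \<otimes> k) = inv g \<otimes> k"
      using that by (simp add: P_def m_assoc)
    ultimately show ?thesis using that by (simp add: P_def)
  qed
  have Pself: "P g g" if "g \<in> carrier G" for g using that subgroup.one_closed[OF S] by (simp add: P_def)
  define rep where "rep g = (if g \<in> S then \<one> else SOME h. P g h)" for g
  have rep: "P g (rep g)" if g: "g \<in> carrier G" for g
  proof (cases "g \<in> S")
    case True
    then show ?thesis using subgroup.m_inv_closed[OF S] g by (simp add: rep_def P_def)
  next
    case False
    then show ?thesis using someI[of "P g" g] Pself[OF g] by (simp add: rep_def)
  qed
  have rep_eq: "rep g = rep h" if "P g h" "g \<in> carrier G" for g h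
  proof -
    have hG: "h \<in> carrier G" using that by (simp add: P_def)
    have "g \<in> S \<longleftrightarrow> h \<in> S"
    proof
      assume "g \<in> S"
      then show "h \<in> S" using that subgroup_cancel(2)[OF S, of "inv g" h] subgroup.m_inv_closed[OF S] hG
        by (simp add: P_def)
    next
      assume "h \<in> S"
      then have "inv g \<in> S" using that subgroup_cancel(1)[OF S, of h "inv g"] by (simp add: P_def)
      then show "g \<in> S" using subgroup.m_inv_closed[OF S, of "inv g"] that by simp
    qed
    moreover have "P g = P h" using Ptrans[OF that(1) _ that(2)] Ptrans[OF Psym[OF that] _ hG] by blast
    ultimately show ?thesis by (simp add: rep_def)
  qed
  define R where "R = rep ` carrier G"
  have finR: "finite R" using fin by (simp add: R_def)
  obtain us where us: "set us = R - {\<one>}" "distinct us" using finite_distinct_list[of "R - {\<one>}"] finR by auto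
  define ts where "ts = \<one> # us"
  have "\<one> \<in> R" unfolding R_def using subgroup.one_closed[OF S] by (intro image_eqI[of _ _ \<one>]) (auto simp: rep_def)
  then have ts: "set ts = R" "distinct ts" using us by (auto simp: ts_def)
  have RG: "R \<subseteq> carrier G" unfolding R_def using rep by (auto simp: P_def)
  have uniq: "\<exists>!r. r \<in> R \<and> inv r \<otimes> g \<in> S" if g: "g \<in> carrier G" for g
  proof (rule ex1I[of _ "rep g"])
    show "rep g \<in> R \<and> inv (rep g) \<otimes> g \<in> S" using Psym[OF rep[OF g] g] g by (auto simp: R_def P_def)
    fix r assume r: "r \<in> R \<and> inv r \<otimes> g \<in> S"
    then obtain h where h: "h \<in> carrier G" "r = rep h" by (auto simp: R_def)
    have "P h g" using Ptrans[OF rep[OF h(1)] _ h(1), of g] r h g by (simp add: P_def)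
    then show "r = rep g" using rep_eq[OF _ h(1)] h by simp
  qed
  have "\<exists>!i. i < length ts \<and> inv (ts ! i) \<otimes> g \<in> S" if g: "g \<in> carrier G" for g
  proof -
    obtain r where r: "r \<in> R" "inv r \<otimes> g \<in> S" and u: "\<And>r'. r' \<in> R \<Longrightarrow> inv r' \<otimes> g \<in> S \<Longrightarrow> r' = r"
      using uniq[OF g] by blast
    obtain i where i: "i < length ts" "ts ! i = r" using r(1) ts(1) by (metis in_set_conv_nth)
    show ?thesis
    proof (rule ex1I[of _ i])
      show "i < length ts \<and> inv (ts ! i) \<otimes> g \<in> S" using i r by simp
      fix j assume j: "j < length ts \<and> inv (ts ! j) \<otimes> g \<in> S"
      then have "ts ! j = ts ! i" using u ts(1) nth_mem i(2) by blast
      then show "j = i" using nth_eq_iff_index_eq[OF ts(2)] i(1) j by blast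
    qed
  qed
  then have "transversal S ts" unfolding transversal_def using ts RG by (auto simp: ts_def)
  then show ?thesis by blast
qed

lemma transversalD:
  assumes "transversal S ts"
  shows "length ts > 0" "ts ! 0 = \<one>" "r < length ts \<Longrightarrow> ts ! r \<in> carrier G"
    "g \<in> carrier G \<Longrightarrow> \<exists>!r. r < length ts \<and> inv (ts ! r) \<otimes> g \<in> S"
  using assms by (auto simp: transversal_def)

lemma ind_simps [simp]:
  "fst (ind lam ts) = length ts"
  "r < length ts \<Longrightarrow> c < length ts \<Longrightarrow> snd (ind lam ts) g $$ (r, c) = lam (inv (ts ! r) \<otimes> g \<otimes> ts ! c)"
  by (simp_all add: ind_def)

context
  fixes S lam ts
  assumes L: "lchar S lam" and T: "transversal S ts"
begin

text \<open>Only the coset that contains x contributes. This is matrix multiplication for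
  \<open>ind\<close>.\<close>

lemma coset_sum:
  assumes x: "x \<in> carrier G" and A: "A \<in> carrier G"
  shows "(\<Sum>r<length ts. lam (A \<otimes> ts ! r) * lam (inv (ts ! r) \<otimes> x)) = lam (A \<otimes> x)"
proof -
  obtain r where r: "r < length ts" "inv (ts ! r) \<otimes> x \<in> S"
    and u: "\<And>q. q < length ts \<Longrightarrow> inv (ts ! q) \<otimes> x \<in> S \<Longrightarrow> q = r"
    using transversalD(4)[OF T x] by blast
  note tG = transversalD(3)[OF T r(1)]
  have "(\<Sum>q<length ts. lam (A \<otimes> ts ! q) * lam (inv (ts ! q) \<otimes> x)) =
      (\<Sum>q\<in>{r}. lam (A \<otimes> ts ! q) * lam (inv (ts ! q) \<otimes> x))"
  proof (rule sum.mono_neutral_right)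
    show "\<forall>q\<in>{..<length ts} - {r}. lam (A \<otimes> ts ! q) * lam (inv (ts ! q) \<otimes> x) = 0"
    proof
      fix q assume "q \<in> {..<length ts} - {r}"
      then have "inv (ts ! q) \<otimes> x \<notin> S" using u[of q] by auto
      then show "lam (A \<otimes> ts ! q) * lam (inv (ts ! q) \<otimes> x) = 0" using lcharD(2)[OF L] by simp
    qed
  qed (use r(1) in auto)
  also have "\<dots> = lam ((A \<otimes> ts ! r) \<otimes> (inv (ts ! r) \<otimes> x))"
    using lam_mult(1)[OF L r(2), of "A \<otimes> ts ! r"] A tG by simp
  also have "(A \<otimes> ts ! r) \<otimes> (inv (ts ! r) \<otimes> x) = A \<otimes> x"
    using A x tG by (simp add: m_assoc)
  finally show ?thesis .
qed

lemma lam_transversal: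
  assumes "r < length ts" "c < length ts"
  shows "lam (inv (ts ! r) \<otimes> ts ! c) = (if r = c then 1 else 0)"
proof (cases "r = c")
  case True
  then show ?thesis using transversalD(3)[OF T assms(2)] lcharD(5)[OF L] by simp
next
  case False
  have "inv (ts ! c) \<otimes> ts ! c \<in> S" using transversalD(3)[OF T assms(2)] subgroup.one_closed[OF lcharD(1)[OF L]] by simp
  then have "inv (ts ! r) \<otimes> ts ! c \<notin> S"
    using transversalD(4)[OF T transversalD(3)[OF T assms(2)]] assms False by blast
  then show ?thesis using False lcharD(2)[OF L] by simp
qed

lemma ind_rep: "representation G (ind lam ts)"
  unfolding representation_def
proof (intro conjI ballI)
  note tG = transversalD(3)[OF T]
  show "snd (ind lam ts) g \<in> carrier_mat (fst (ind lam ts)) (fst (ind lam ts))" for g by (simp add: ind_def)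
  show "snd (ind lam ts) \<one> = 1\<^sub>m (fst (ind lam ts))"
    by (rule eq_matI) (use tG lam_transversal in \<open>auto simp: ind_def\<close>)
  fix g h assume g: "g \<in> carrier G" and h: "h \<in> carrier G"
  show "snd (ind lam ts) (g \<otimes> h) = snd (ind lam ts) g * snd (ind lam ts) h"
  proof (rule eq_matI)
    fix i j assume "i < dim_row (snd (ind lam ts) g * snd (ind lam ts) h)" "j < dim_col (snd (ind lam ts) g * snd (ind lam ts) h)"
    then have ij: "i < length ts" "j < length ts" by (auto simp: ind_def)
    have "(snd (ind lam ts) g * snd (ind lam ts) h) $$ (i, j) =
        (\<Sum>l<length ts. snd (ind lam ts) g $$ (i, l) * snd (ind lam ts) h $$ (l, j))"
      by (rule mat_mult_index) (use ij in \<open>auto simp: ind_def\<close>)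
    also have "\<dots> = (\<Sum>l<length ts. lam ((inv (ts ! i) \<otimes> g) \<otimes> ts ! l) * lam (inv (ts ! l) \<otimes> (h \<otimes> ts ! j)))"
      using ij tG g h by (intro sum.cong) (auto simp: m_assoc)
    also have "\<dots> = lam ((inv (ts ! i) \<otimes> g) \<otimes> (h \<otimes> ts ! j))"
      using ij tG g h by (intro coset_sum) auto
    also have "\<dots> = snd (ind lam ts) (g \<otimes> h) $$ (i, j)"
      using ij tG g h by (simp add: m_assoc)
    finally show "snd (ind lam ts) (g \<otimes> h) $$ (i, j) = (snd (ind lam ts) g * snd (ind lam ts) h) $$ (i, j)" by simp
  qed (auto simp: ind_def)
qed

lemma ind_unit: "c < length ts \<Longrightarrow> snd (ind lam ts) (ts ! c) *\<^sub>v unit_vec (length ts) 0 = unit_vec (length ts) c"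
proof -
  assume c: "c < length ts"
  have "snd (ind lam ts) (ts ! c) *\<^sub>v unit_vec (length ts) 0 = col (snd (ind lam ts) (ts ! c)) 0"
    by (rule mult_mat_unit_vec[of _ "length ts"]) (use transversalD(1)[OF T] in \<open>auto simp: ind_def\<close>)
  also have "\<dots> = unit_vec (length ts) c"
    using transversalD[OF T] lam_transversal c
    by (intro eq_vecI) (auto simp: ind_def unit_vec_def)
  finally show ?thesis .
qed

lemma chi_idem_unit: "ract (ind lam ts) (chi_idem S lam) *\<^sub>v unit_vec (length ts) 0 = unit_vec (length ts) 0"
proof -
  note tG = transversalD(3)[OF T] and t0 = transversalD(1,2)[OF T]
  have "ract (ind lam ts) (chi_idem S lam) *\<^sub>v unit_vec (length ts) 0 = col (ract (ind lam ts) (chi_idem S lam)) 0"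
    by (rule mult_mat_unit_vec[of _ "length ts"]) (use t0(1) in \<open>auto simp: ract_def\<close>)
  also have "\<dots> = unit_vec (length ts) 0"
  proof (rule eq_vecI)
    fix i assume "i < dim_vec (unit_vec (length ts) 0 :: rat vec)"
    then have i: "i < length ts" by simp
    have "col (ract (ind lam ts) (chi_idem S lam)) 0 $ i =
        (\<Sum>g\<in>carrier G. chi_idem S lam g * lam (inv (ts ! i) \<otimes> g))"
      using i t0 tG by (simp add: ract_def of_rat_rat)
    also have "\<dots> = (\<Sum>s\<in>S. chi_idem S lam s * lam (inv (ts ! i) \<otimes> s))"
      by (rule sum.mono_neutral_right) (use fin lcharD(2,6)[OF L] in \<open>auto simp: chi_idem_def\<close>)
    also have "\<dots> = (\<Sum>s\<in>S. lam (inv (ts ! i)) / of_nat (card S))"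
    proof (rule sum.cong[OF HOL.refl])
      fix s assume s: "s \<in> S"
      have "chi_idem S lam s * lam (inv (ts ! i) \<otimes> s) = (lam s * lam s) * lam (inv (ts ! i)) / of_nat (card S)"
        using lam_mult(1)[OF L s, of "inv (ts ! i)"] tG[OF i] by (simp add: chi_idem_def)
      then show "chi_idem S lam s * lam (inv (ts ! i) \<otimes> s) = lam (inv (ts ! i)) / of_nat (card S)"
        using lcharD(3)[OF L s] by simp
    qed
    also have "\<dots> = lam (inv (ts ! i))" using lcharD(8)[OF L] by simp
    also have "\<dots> = (if i = 0 then 1 else 0)" using lam_transversal[OF i t0(1)] t0(2) tG[OF i] by simp
    finally show "col (ract (ind lam ts) (chi_idem S lam)) 0 $ i = unit_vec (length ts) 0 $ i"
      using i by (simp add: unit_vec_def)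
  qed (simp add: ract_def)
  finally show ?thesis .
qed

end

lemma invariant_ract:
  fixes V :: "('a, 'k::field_char_0) rep"
  assumes V: "representation G V" and U: "invariant_subspace G V U" and u: "u \<in> U"
  shows "ract V a *\<^sub>v u \<in> U"
proof -
  have uc: "u \<in> carrier_vec (fst V)" using U u by (auto simp: invariant_subspace_def)
  have "vec (fst V) (\<lambda>i. \<Sum>g\<in>F. of_rat (a g) * (snd V g *\<^sub>v u) $ i) \<in> U" if "finite F" "F \<subseteq> carrier G" for F
    using that
  proof (induction F)
    case empty
    have "vec (fst V) (\<lambda>i. \<Sum>g\<in>{}. of_rat (a g) * (snd V g *\<^sub>v u) $ i) = 0\<^sub>v (fst V)" by (auto intro!: eq_vecI)
    then show ?case using U by (simp add: invariant_subspace_def)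
  next
    case (insert g F)
    have dr: "dim_row (snd V g) = fst V" using repD(1)[OF V, of g] insert by auto
    have "vec (fst V) (\<lambda>i. \<Sum>g\<in>insert g F. of_rat (a g) * (snd V g *\<^sub>v u) $ i) =
        of_rat (a g) \<cdot>\<^sub>v (snd V g *\<^sub>v u) + vec (fst V) (\<lambda>i. \<Sum>g\<in>F. of_rat (a g) * (snd V g *\<^sub>v u) $ i)"
      using insert dr by (intro eq_vecI) auto
    then show ?case using U u insert by (auto simp: invariant_subspace_def)
  qed
  from this[OF fin subset_refl]
  have "vec (fst V) (\<lambda>i. \<Sum>g\<in>carrier G. of_rat (a g) * (snd V g *\<^sub>v u) $ i) \<in> U" .
  also have "vec (fst V) (\<lambda>i. \<Sum>g\<in>carrier G. of_rat (a g) * (snd V g *\<^sub>v u) $ i) = ract V a *\<^sub>v u"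
  proof (rule eq_vecI)
    fix i assume "i < dim_vec (ract V a *\<^sub>v u)"
    then have i: "i < fst V" by simp
    have "(ract V a *\<^sub>v u) $ i = (\<Sum>l<fst V. ract V a $$ (i, l) * u $ l)"
      by (rule mat_vec_index[OF ract_carrier uc i])
    also have "\<dots> = (\<Sum>l<fst V. \<Sum>g\<in>carrier G. of_rat (a g) * (snd V g $$ (i, l) * u $ l))"
      using i by (simp add: ract_def sum_distrib_right mult_ac) (simp add: sum_distrib_left mult_ac)
    also have "\<dots> = (\<Sum>g\<in>carrier G. of_rat (a g) * (snd V g *\<^sub>v u) $ i)"
      using mat_vec_index[OF repD(1)[OF V] uc i] by (subst sum.swap) (simp add: sum_distrib_left)
    finally show "vec (fst V) (\<lambda>i. \<Sum>g\<in>carrier G. of_rat (a g) * (snd V g *\<^sub>v u) $ i) $ i = (ract V a *\<^sub>v u) $ i"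
      using i by simp
  qed simp
  finally show ?thesis .
qed

lemma ract_mult_vec:
  fixes V :: "('a, 'k::field_char_0) rep"
  assumes "representation G V" "u \<in> carrier_vec (fst V)"
  shows "ract V (a \<star> b) *\<^sub>v u = ract V a *\<^sub>v (ract V b *\<^sub>v u)"
  unfolding ract_mult[OF assms(1)] by (rule assoc_mult_mat_vec) (use assms in auto)

text \<open>Basis vector 0 generates the representation and is fixed by the idempotent f. A nonzero
  u in an invariant subspace is (a f) applied to it for some a, and simplicity of the ideal of f
  leads back from u to basis vector 0.\<close>

lemma ind_irreducible:
  assumes L: "lchar S lam" and T: "transversal S ts" and D: "minimal_left (chi_idem S lam)"
  shows "irreducible_rep G (ind lam ts)"
  unfolding irreducible_rep_def
proof (intro conjI allI impI)
  let ?W = "ind lam ts"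
  let ?d = "length ts"
  let ?f = "chi_idem S lam"
  note R = ind_rep[OF L T] and tG = transversalD(3)[OF T]
  have d0: "?d > 0" by (rule transversalD(1)[OF T])
  show "representation G ?W" by (rule R)
  show "fst ?W > 0" using d0 by simp
  fix U assume U: "invariant_subspace G ?W U"
  have Uc: "U \<subseteq> carrier_vec ?d" "0\<^sub>v ?d \<in> U" "\<And>u v. u \<in> U \<Longrightarrow> v \<in> U \<Longrightarrow> u + v \<in> U" "\<And>c u. u \<in> U \<Longrightarrow> c \<cdot>\<^sub>v u \<in> U"
    "\<And>g u. g \<in> carrier G \<Longrightarrow> u \<in> U \<Longrightarrow> snd ?W g *\<^sub>v u \<in> U"
    using U by (auto simp: invariant_subspace_def)
  let ?e = "unit_vec ?d 0 :: rat vec"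
  show "U = {0\<^sub>v (fst ?W)} \<or> U = carrier_vec (fst ?W)"
  proof (cases "U = {0\<^sub>v ?d}")
    case False
    then obtain u where u: "u \<in> U" "u \<noteq> 0\<^sub>v ?d" using Uc(2) by blast
    have uc: "u \<in> carrier_vec ?d" using u Uc by blast
    \<comment> \<open>The coordinates of u placed on the coset representatives, since
      \<open>ts ! c\<close> moves basis vector 0 to basis vector c.\<close>
    define a where "a = (\<lambda>g. \<Sum>c<?d. u $ c * delta (ts ! c) g)"
    have aG: "a \<in> group_alg G" unfolding a_def group_alg_def using tG by (auto simp: delta_def intro!: sum.neutral)
    have ae: "ract ?W a *\<^sub>v ?e = u"
    proof (rule eq_vecI)
      fix i assume "i < dim_vec u"
      then have i: "i < ?d" using uc by simp
      have "(ract ?W a *\<^sub>v ?e) $ i = ract ?W a $$ (i, 0)"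
        using i d0 by (subst mult_mat_unit_vec[of _ ?d ?d]) (auto simp: ract_def)
      also have "\<dots> = (\<Sum>g\<in>carrier G. (\<Sum>c<?d. u $ c * delta (ts ! c) g) * lam (inv (ts ! i) \<otimes> g))"
        using i d0 tG transversalD(2)[OF T] by (simp add: ract_def a_def of_rat_rat)
      also have "\<dots> = (\<Sum>c<?d. u $ c * (\<Sum>g\<in>carrier G. delta (ts ! c) g * lam (inv (ts ! i) \<otimes> g)))"
        by (simp add: sum_distrib_right sum_distrib_left mult.assoc) (rule sum.swap)
      also have "\<dots> = (\<Sum>c<?d. u $ c * (if c = i then 1 else 0))"
      proof (intro sum.cong HOL.refl)
        fix c assume "c \<in> {..<?d}"
        then have c: "c < ?d" by simp
        have "(\<Sum>g\<in>carrier G. delta (ts ! c) g * lam (inv (ts ! i) \<otimes> g)) = lam (inv (ts ! i) \<otimes> ts ! c)"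
          unfolding delta_def by (rule sum_indicator(1)[OF fin tG[OF c]])
        then show "u $ c * (\<Sum>g\<in>carrier G. delta (ts ! c) g * lam (inv (ts ! i) \<otimes> g)) = u $ c * (if c = i then 1 else 0)"
          using lam_transversal[OF L T i c] by auto
      qed
      also have "\<dots> = u $ i" by (rule sum_indicator(2)) (use i in auto)
      finally show "(ract ?W a *\<^sub>v ?e) $ i = u $ i" .
    qed (use uc in simp)
    have fe: "ract ?W ?f *\<^sub>v ?e = ?e" by (rule chi_idem_unit[OF L T])
    have "ract ?W (a \<star> ?f) *\<^sub>v ?e = u" using ract_mult_vec[OF R, of ?e a ?f] fe ae by simp
    then have "a \<star> ?f \<noteq> 0" using u(2) by (auto simp: ract_zero)
    then obtain c where c: "c \<in> group_alg G" "c \<star> (a \<star> ?f) = ?f" using D aG by (auto simp: minimal_left_def)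
    have "ract ?W c *\<^sub>v u = ?e"
      using ract_mult_vec[OF R, of ?e c "a \<star> ?f"] c(2) fe \<open>ract ?W (a \<star> ?f) *\<^sub>v ?e = u\<close> by simp
    then have "?e \<in> U" using invariant_ract[OF R U u(1), of c] by simp
    then have units: "unit_vec ?d j \<in> U" if "j < ?d" for j
      using Uc(5)[OF tG[OF that]] ind_unit[OF L T that] by metis
    have "v \<in> U" if v: "v \<in> carrier_vec ?d" for v
    proof -
      have "vec ?d (\<lambda>i. if i < k then v $ i else 0) \<in> U" if "k \<le> ?d" for k
        using that
      proof (induction k)
        case 0
        have "vec ?d (\<lambda>i. if i < 0 then v $ i else 0) = 0\<^sub>v ?d" by (intro eq_vecI) auto
        then show ?case using Uc(2) by simp
      next
        case (Suc k)
        have "vec ?d (\<lambda>i. if i < Suc k then v $ i else 0) = vec ?d (\<lambda>i. if i < k then v $ i else 0) + v $ k \<cdot>\<^sub>v unit_vec ?d k"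
          using Suc by (intro eq_vecI) (auto simp: less_Suc_eq)
        then show ?case using Suc Uc(3,4) units[of k] by auto
      qed
      from this[of ?d] have "vec ?d (\<lambda>i. if i < ?d then v $ i else 0) \<in> U" by simp
      moreover have "vec ?d (\<lambda>i. if i < ?d then v $ i else 0) = v" using v by (intro eq_vecI) auto
      ultimately show ?thesis by simp
    qed
    then show ?thesis using Uc(1) by auto
  qed simp
qed

text \<open>If f = f1 + f2 with f1 nonzero, simplicity gives c with c f1 = f. Multiplying by f2 on
  the right gives f2 = f f2 = 0.\<close>

lemma minimal_left_primitive:
  assumes D: "minimal_left f" and f: "ga_idempotent G f" "f \<noteq> (\<lambda>_. 0)"
  shows "primitive_idempotent G f"
  unfolding primitive_idempotent_def
proof (intro conjI allI impI)
  fix f1 f2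
  assume a: "ga_idempotent G f1 \<and> ga_idempotent G f2 \<and> ga_orthogonal G f1 f2 \<and> f = (\<lambda>g. f1 g + f2 g)"
  then have s: "f = f1 + f2" by (auto simp: plus_fun_def)
  have o: "f1 \<star> f2 = 0" "f2 \<star> f1 = 0" "f1 \<star> f1 = f1" "f2 \<star> f2 = f2" "f1 \<in> group_alg G"
    using a by (auto simp: ga_orthogonal_def ga_idempotent_def zero_fun_def)
  have f1: "f1 \<star> f = f1" unfolding s ga_add_right o by simp
  have f2: "f \<star> f2 = f2" unfolding s ga_add_left o by simp
  show "f1 = (\<lambda>_. 0) \<or> f2 = (\<lambda>_. 0)"
  proof (cases "f1 = 0")
    case False
    then obtain c where c: "c \<star> (f1 \<star> f) = f" using D f1 o(5) by (auto simp: minimal_left_def)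
    have "f \<star> f2 = c \<star> (f1 \<star> f2)" using c f1 by (metis ga_assoc)
    then have "f2 = 0" using f2 o(1) by simp
    then show ?thesis by (simp add: zero_fun_def)
  qed (simp add: zero_fun_def)
qed (use f in auto)

definition central :: "('a \<Rightarrow> rat) \<Rightarrow> bool" where
  "central e \<longleftrightarrow> e \<in> group_alg G \<and> (\<forall>g\<in>carrier G. delta g \<star> e = e \<star> delta g)"

text \<open>From e f = f, the element e fixes basis vector 0; being central, it also fixes the
  translates of this vector.\<close>

lemma ind_central_one:
  assumes L: "lchar S lam" and T: "transversal S ts" and e: "central e" "e \<star> chi_idem S lam = chi_idem S lam"
  shows "ract (ind lam ts) e = 1\<^sub>m (length ts)"
proof -
  let ?W = "ind lam ts"
  let ?d = "length ts"
  let ?f = "chi_idem S lam"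
  let ?e = "unit_vec ?d 0 :: rat vec"
  note R = ind_rep[OF L T] and tG = transversalD(3)[OF T]
  have fe: "ract ?W ?f *\<^sub>v ?e = ?e" by (rule chi_idem_unit[OF L T])
  have ee: "ract ?W e *\<^sub>v ?e = ?e" using ract_mult_vec[OF R, of ?e e ?f] fe e(2) by simp
  have "ract ?W e *\<^sub>v unit_vec ?d c = unit_vec ?d c" if c: "c < ?d" for c
  proof -
    have u: "unit_vec ?d c = ract ?W (delta (ts ! c)) *\<^sub>v ?e"
      unfolding ract_delta[OF R tG[OF c]] using ind_unit[OF L T c] by simp
    have "ract ?W e *\<^sub>v unit_vec ?d c = ract ?W (e \<star> delta (ts ! c)) *\<^sub>v ?e"
      unfolding u by (rule ract_mult_vec[OF R, symmetric]) simp
    also have "\<dots> = ract ?W (delta (ts ! c) \<star> e) *\<^sub>v ?e" using e(1) tG[OF c] by (simp add: central_def)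
    also have "\<dots> = ract ?W (delta (ts ! c)) *\<^sub>v ?e" using ract_mult_vec[OF R, of ?e "delta (ts ! c)" e] ee by simp
    finally show ?thesis using u by simp
  qed
  then have "col (ract ?W e) c = unit_vec ?d c" if "c < ?d" for c
    using that mult_mat_unit_vec[of "ract ?W e" ?d ?d c] ract_carrier[of ?W e] by simp
  then show ?thesis
    by (intro mat_col_eqI) (auto simp: ract_def)
qed

text \<open>The universal property of induction: basis vector c is sent to the translate of v by
  \<open>ts ! c\<close>.\<close>

lemma hom_from_ind:
  assumes L: "lchar S lam" and T: "transversal S ts" and V: "representation G V"
    and v: "v \<in> carrier_vec (fst V)" "v \<noteq> 0\<^sub>v (fst V)" "\<And>s. s \<in> S \<Longrightarrow> snd V s *\<^sub>v v = lam s \<cdot>\<^sub>v v"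
  shows "\<exists>M. intertwiner G (ind lam ts) V M \<and> M \<noteq> 0\<^sub>m (fst V) (length ts)"
proof -
  note tG = transversalD(3)[OF T] and t0 = transversalD(1,2)[OF T]
  note c = repD(1)[OF V]
  define M where "M = mat (fst V) (length ts) (\<lambda>(i, c). (snd V (ts ! c) *\<^sub>v v) $ i)"
  have Mc: "M \<in> carrier_mat (fst V) (length ts)" by (simp add: M_def)
  have inter: "M * snd (ind lam ts) g = snd V g * M" if g: "g \<in> carrier G" for g
  proof (rule eq_matI)
    fix i j assume "i < dim_row (snd V g * M)" "j < dim_col (snd V g * M)"
    then have ij: "i < fst V" "j < length ts" using c[OF g] Mc by auto
    have gt: "g \<otimes> ts ! j \<in> carrier G" using g tG[OF ij(2)] by simp
    obtain r where r: "r < length ts" "inv (ts ! r) \<otimes> (g \<otimes> ts ! j) \<in> S"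
      and u: "\<And>q. q < length ts \<Longrightarrow> inv (ts ! q) \<otimes> (g \<otimes> ts ! j) \<in> S \<Longrightarrow> q = r"
      using transversalD(4)[OF T gt] by blast
    define s where "s = inv (ts ! r) \<otimes> (g \<otimes> ts ! j)"
    have sG: "s \<in> carrier G" "s \<in> S" using gt tG[OF r(1)] r(2) by (simp_all add: s_def)
    have gts: "g \<otimes> ts ! j = ts ! r \<otimes> s" unfolding s_def using gt tG[OF r(1)] by (simp add: m_assoc[symmetric])
    have "(M * snd (ind lam ts) g) $$ (i, j) = (\<Sum>l<length ts. M $$ (i, l) * snd (ind lam ts) g $$ (l, j))"
      by (rule mat_mult_index[OF Mc _ ij]) (simp add: ind_def)
    also have "\<dots> = (\<Sum>l<length ts. (snd V (ts ! l) *\<^sub>v v) $ i * lam (inv (ts ! l) \<otimes> (g \<otimes> ts ! j)))"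
      using ij tG g by (intro sum.cong) (auto simp: M_def m_assoc)
    also have "\<dots> = (\<Sum>l\<in>{r}. (snd V (ts ! l) *\<^sub>v v) $ i * lam (inv (ts ! l) \<otimes> (g \<otimes> ts ! j)))"
    proof (rule sum.mono_neutral_right)
      show "\<forall>l\<in>{..<length ts} - {r}. (snd V (ts ! l) *\<^sub>v v) $ i * lam (inv (ts ! l) \<otimes> (g \<otimes> ts ! j)) = 0"
      proof
        fix q assume "q \<in> {..<length ts} - {r}"
        then have "inv (ts ! q) \<otimes> (g \<otimes> ts ! j) \<notin> S" using u[of q] by auto
        then show "(snd V (ts ! q) *\<^sub>v v) $ i * lam (inv (ts ! q) \<otimes> (g \<otimes> ts ! j)) = 0"
          using lcharD(2)[OF L] by simp
      qed
    qed (use r(1) in auto)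
    also have "\<dots> = (snd V (ts ! r) *\<^sub>v v) $ i * lam s" by (simp add: s_def)
    also have "\<dots> = (snd V (ts ! r) *\<^sub>v (lam s \<cdot>\<^sub>v v)) $ i"
      using c[OF tG[OF r(1)]] v(1) ij by (simp add: mult_mat_vec)
    also have "\<dots> = (snd V (ts ! r) *\<^sub>v (snd V s *\<^sub>v v)) $ i" using v(3)[OF sG(2)] by simp
    also have "\<dots> = (snd V (ts ! r \<otimes> s) *\<^sub>v v) $ i"
      using repD(3)[OF V tG[OF r(1)] sG(1)] c[OF tG[OF r(1)]] c[OF sG(1)] v(1) by simp
    also have "\<dots> = (snd V g *\<^sub>v (snd V (ts ! j) *\<^sub>v v)) $ i"
      unfolding gts[symmetric] repD(3)[OF V g tG[OF ij(2)]] using c[OF g] c[OF tG[OF ij(2)]] v(1) by simp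
    also have "snd V (ts ! j) *\<^sub>v v = col M j"
      using ij c[OF tG[OF ij(2)]] by (intro eq_vecI) (auto simp: M_def)
    also have "(snd V g *\<^sub>v col M j) $ i = (snd V g * M) $$ (i, j)" using ij c[OF g] Mc by auto
    finally show "(M * snd (ind lam ts) g) $$ (i, j) = (snd V g * M) $$ (i, j)" .
  qed (use Mc c[OF g] in \<open>auto simp: ind_def\<close>)
  then have "intertwiner G (ind lam ts) V M" using Mc by (simp add: intertwiner_def)
  moreover have "M \<noteq> 0\<^sub>m (fst V) (length ts)"
  proof
    assume M0: "M = 0\<^sub>m (fst V) (length ts)"
    have "v $ i = 0" if i: "i < fst V" for i
    proof -
      have "M $$ (i, 0) = v $ i" using i t0 repD(2)[OF V] v(1) by (simp add: M_def)
      then show ?thesis using M0 i t0 by simp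
    qed
    then have "v = 0\<^sub>v (fst V)" using v(1) by (intro eq_vecI) auto
    then show False using v(2) by simp
  qed
  ultimately show ?thesis by blast
qed

lemma chi_idem_closed: "lchar S lam \<Longrightarrow> chi_idem S lam \<in> group_alg G"
  using lcharD(2,6) by (fastforce simp: group_alg_def chi_idem_def)

lemma delta_chi_idem:
  assumes L: "lchar S lam" and s: "s \<in> S"
  shows "delta s \<star> chi_idem S lam = (\<lambda>g. lam s * chi_idem S lam g)"
proof (rule ga_eqI)
  have sG: "s \<in> carrier G" and si: "inv s \<in> S"
    using lcharD(6)[OF L] s subgroup.m_inv_closed[OF lcharD(1)[OF L] s] by auto
  fix x assume x: "x \<in> carrier G"
  have "lam (inv s) * lam s = 1" using lcharD(4)[OF L si s] lcharD(5)[OF L] sG by simp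
  then have "lam (inv s) * (lam s * lam s) = lam s" by (simp add: mult.assoc[symmetric])
  then have "lam (inv s) = lam s" using lcharD(3)[OF L s] by simp
  then show "(delta s \<star> chi_idem S lam) x = lam s * chi_idem S lam x"
    using delta_left[OF sG x, of "chi_idem S lam"] lam_mult(2)[OF L si x] by (simp add: chi_idem_def)
qed (use chi_idem_closed[OF L] in \<open>auto intro: group_alg_closed\<close>)

lemma ract_scale: "ract V (\<lambda>g. c * a g) = of_rat c \<cdot>\<^sub>m ract V a"
  by (rule eq_matI) (auto simp: ract_def of_rat_mult sum_distrib_left mult.assoc)

text \<open>A nonzero column of the matrix of the idempotent is a vector on which S acts by lam. It
  defines a homomorphism from the induced representation, which is invertible by Schur; its inverse
  is the isomorphism wanted.\<close>

lemma irreducible_iso_ind: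
  assumes L: "lchar S lam" and T: "transversal S ts" and D: "minimal_left (chi_idem S lam)"
    and V: "irreducible_rep G V" and nz: "ract V (chi_idem S lam) \<noteq> 0\<^sub>m (fst V) (fst V)"
  shows "rep_iso G V (ind lam ts)"
proof -
  have R: "representation G V" using V by (simp add: irreducible_rep_def)
  let ?F = "ract V (chi_idem S lam)"
  have "\<exists>j<fst V. col ?F j \<noteq> 0\<^sub>v (fst V)"
  proof (rule ccontr)
    assume n: "\<not> ?thesis"
    have "?F = 0\<^sub>m (fst V) (fst V)"
    proof (rule eq_matI)
      fix i j assume ij: "i < dim_row (0\<^sub>m (fst V) (fst V) :: rat mat)" "j < dim_col (0\<^sub>m (fst V) (fst V) :: rat mat)"
      then have "col ?F j $ i = 0" using n by simp
      then show "?F $$ (i, j) = 0\<^sub>m (fst V) (fst V) $$ (i, j)" using ij by simp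
    qed auto
    then show False using nz by simp
  qed
  then obtain j where j: "j < fst V" "col ?F j \<noteq> 0\<^sub>v (fst V)" by blast
  define v where "v = col ?F j"
  let ?u = "unit_vec (fst V) j :: rat vec"
  have vu: "v = ?F *\<^sub>v ?u" unfolding v_def using mult_mat_unit_vec[OF ract_carrier j(1)] by simp
  have vc: "v \<in> carrier_vec (fst V)"
    unfolding vu by (rule mult_mat_vec_carrier[OF ract_carrier unit_vec_carrier])
  have act: "snd V s *\<^sub>v v = lam s \<cdot>\<^sub>v v" if s: "s \<in> S" for s
  proof -
    have sG: "s \<in> carrier G" using lcharD(6)[OF L] s by blast
    have "snd V s *\<^sub>v v = ract V (delta s \<star> chi_idem S lam) *\<^sub>v ?u"
      unfolding vu ract_mult_vec[OF R unit_vec_carrier] ract_delta[OF R sG] ..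
    also have "\<dots> = lam s \<cdot>\<^sub>v v"
      unfolding delta_chi_idem[OF L s] ract_scale vu of_rat_rat
      by (intro eq_vecI) (auto simp: scalar_prod_def sum_distrib_left mult.assoc)
    finally show ?thesis .
  qed
  obtain M where M: "intertwiner G (ind lam ts) V M" "M \<noteq> 0\<^sub>m (fst V) (length ts)"
    using hom_from_ind[OF L T R vc j(2)[folded v_def] act] by blast
  obtain B where B: "fst (ind lam ts) = fst V" "B \<in> carrier_mat (length ts) (fst V)" "M * B = 1\<^sub>m (fst V)" "B * M = 1\<^sub>m (length ts)"
    using schur[OF ind_irreducible[OF L T D] V M(1)] M(2) by auto
  have Mc: "M \<in> carrier_mat (fst V) (length ts)" using M(1) by (simp add: intertwiner_def)
  have "B * snd V g = snd (ind lam ts) g * B" if g: "g \<in> carrier G" for g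
  proof -
    note cV = repD(1)[OF R g]
    have cW: "snd (ind lam ts) g \<in> carrier_mat (length ts) (length ts)" by (simp add: ind_def)
    have "B * snd V g = (B * snd V g) * (M * B)" unfolding B(3) using B(2) cV by simp
    also have "\<dots> = B * (snd V g * (M * B))"
      by (rule assoc_mult_mat[OF B(2) cV]) (use Mc B(2) in auto)
    also have "snd V g * (M * B) = (snd V g * M) * B" by (rule assoc_mult_mat[symmetric, OF cV Mc B(2)])
    also have "snd V g * M = M * snd (ind lam ts) g" using M(1) g by (simp add: intertwiner_def)
    also have "(M * snd (ind lam ts) g) * B = M * (snd (ind lam ts) g * B)" by (rule assoc_mult_mat[OF Mc cW B(2)])
    also have "B * (M * (snd (ind lam ts) g * B)) = (B * M) * (snd (ind lam ts) g * B)"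
      by (rule assoc_mult_mat[symmetric, OF B(2) Mc]) (use cW B(2) in auto)
    also have "\<dots> = snd (ind lam ts) g * B" unfolding B(4) using cW B(2) by simp
    finally show ?thesis .
  qed
  then have "intertwiner G V (ind lam ts) B" using B(2) by (simp add: intertwiner_def)
  moreover have "invertible_mat B" unfolding invertible_mat_def inverts_mat_def square_mat.simps
    using Mc B by (intro conjI exI[of _ M]) auto
  ultimately show ?thesis by (auto simp: rep_iso_def)
qed

lemma character_class:
  fixes V :: "('a, complex) rep"
  assumes V: "representation G V" and g: "g \<in> carrier G" and t: "t \<in> carrier G"
  shows "character V (t \<otimes> g \<otimes> inv t) = character V g"
proof -
  note c = repD(1)[OF V g] repD(1)[OF V t] repD(1)[OF V inv_closed[OF t]]
  have "snd V (t \<otimes> g \<otimes> inv t) = (snd V t * snd V g) * snd V (inv t)" using g t by (simp add: repD(3)[OF V])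
  then have "character V (t \<otimes> g \<otimes> inv t) = (\<Sum>i<fst V. (snd V (inv t) * (snd V t * snd V g)) $$ (i, i))"
    unfolding character_def using c trace_commute[of "snd V t * snd V g" "fst V" "fst V" "snd V (inv t)"] by simp
  also have "snd V (inv t) * (snd V t * snd V g) = (snd V (inv t) * snd V t) * snd V g" using c by simp
  also have "\<dots> = snd V g" using repD(3)[OF V inv_closed[OF t] t, symmetric] repD(2)[OF V] t c by simp
  finally show ?thesis by (simp add: character_def)
qed

lemma card_transversal:
  assumes S: "subgroup S G" and T: "transversal S ts"
  shows "card (carrier G) = length ts * card S"
proof -
  note tG = transversalD(3)[OF T] and SG = subgroup.subset[OF S]
  have "bij_betw (\<lambda>(r, s). ts ! r \<otimes> s) ({..<length ts} \<times> S) (carrier G)"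
    unfolding bij_betw_def
  proof
    show "inj_on (\<lambda>(r, s). ts ! r \<otimes> s) ({..<length ts} \<times> S)"
    proof (rule inj_onI, clarify)
      fix r s q u assume a: "r < length ts" "q < length ts" "s \<in> S" "u \<in> S" "ts ! r \<otimes> s = ts ! q \<otimes> u"
      then have sG: "s \<in> carrier G" "u \<in> carrier G" using SG by auto
      have "inv (ts ! r) \<otimes> (ts ! r \<otimes> s) \<in> S" using a(3) cancel_inv(1)[OF tG[OF a(1)] sG(1)] by metis
      moreover have "inv (ts ! q) \<otimes> (ts ! r \<otimes> s) \<in> S" unfolding a(5)
        using a(4) cancel_inv(1)[OF tG[OF a(2)] sG(2)] by metis
      moreover have "ts ! r \<otimes> s \<in> carrier G" using tG[OF a(1)] sG by simp
      ultimately have "r = q" using transversalD(4)[OF T, of "ts ! r \<otimes> s"] a(1,2) by blast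
      then show "r = q \<and> s = u" using a tG[OF a(1)] sG by simp
    qed
    show "(\<lambda>(r, s). ts ! r \<otimes> s) ` ({..<length ts} \<times> S) = carrier G"
    proof
      show "(\<lambda>(r, s). ts ! r \<otimes> s) ` ({..<length ts} \<times> S) \<subseteq> carrier G" using tG SG by auto
      show "carrier G \<subseteq> (\<lambda>(r, s). ts ! r \<otimes> s) ` ({..<length ts} \<times> S)"
      proof
        fix g assume g: "g \<in> carrier G"
        obtain r where r: "r < length ts" "inv (ts ! r) \<otimes> g \<in> S" using transversalD(4)[OF T g] by blast
        have "g = ts ! r \<otimes> (inv (ts ! r) \<otimes> g)" using g tG[OF r(1)] by (simp add: m_assoc[symmetric])
        then show "g \<in> (\<lambda>(r, s). ts ! r \<otimes> s) ` ({..<length ts} \<times> S)" using r by (intro image_eqI[of _ _ "(r, inv (ts ! r) \<otimes> g)"]) auto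
      qed
    qed
  qed
  from bij_betw_same_card[OF this] show ?thesis by (simp add: card_cartesian_product)
qed

text \<open>Conjugation by a coset representative does not change the character of V, so all cosets
  contribute the same amount. A Schur index, defined as a multiplicity, thereby becomes a sum over
  the idempotent.\<close>

lemma frobenius_reciprocity:
  fixes V :: "('a, complex) rep"
  assumes L: "lchar S lam" and T: "transversal S ts" and V: "representation G V"
  shows "char_inner G (character (complexify (ind lam ts))) (character V) =
    (\<Sum>g\<in>carrier G. of_rat (chi_idem S lam g) * cnj (character V g))"
proof -
  note tG = transversalD(3)[OF T]
  have chi: "character (complexify (ind lam ts)) g = (\<Sum>r<length ts. of_rat (lam (inv (ts ! r) \<otimes> g \<otimes> ts ! r)))" for g
    unfolding character_def complexify_def by (auto simp: ind_def intro!: sum.cong)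
  have "(\<Sum>g\<in>carrier G. character (complexify (ind lam ts)) g * cnj (character V g)) =
      (\<Sum>r<length ts. \<Sum>g\<in>carrier G. of_rat (lam (inv (ts ! r) \<otimes> g \<otimes> ts ! r)) * cnj (character V g))"
    unfolding chi sum_distrib_right by (rule sum.swap)
  also have "\<dots> = (\<Sum>r<length ts. \<Sum>g\<in>carrier G. of_rat (lam g) * cnj (character V g))"
  proof (rule sum.cong[OF HOL.refl])
    fix r assume "r \<in> {..<length ts}"
    then have t: "ts ! r \<in> carrier G" using tG by simp
    have e: "inv (ts ! r) \<otimes> (ts ! r \<otimes> g \<otimes> inv (ts ! r)) \<otimes> ts ! r = g"
      "ts ! r \<otimes> (inv (ts ! r) \<otimes> g \<otimes> ts ! r) \<otimes> inv (ts ! r) = g" if "g \<in> carrier G" for g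
    proof -
      have "inv (ts ! r) \<otimes> (ts ! r \<otimes> g \<otimes> inv (ts ! r)) \<otimes> ts ! r = (inv (ts ! r) \<otimes> ts ! r) \<otimes> g \<otimes> (inv (ts ! r) \<otimes> ts ! r)"
        using t that by (simp add: m_assoc del: l_inv r_inv)
      then show "inv (ts ! r) \<otimes> (ts ! r \<otimes> g \<otimes> inv (ts ! r)) \<otimes> ts ! r = g" using t that by simp
      have "ts ! r \<otimes> (inv (ts ! r) \<otimes> g \<otimes> ts ! r) \<otimes> inv (ts ! r) = (ts ! r \<otimes> inv (ts ! r)) \<otimes> g \<otimes> (ts ! r \<otimes> inv (ts ! r))"
        using t that by (simp add: m_assoc del: l_inv r_inv)
      then show "ts ! r \<otimes> (inv (ts ! r) \<otimes> g \<otimes> ts ! r) \<otimes> inv (ts ! r) = g" using t that by simp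
    qed
    show "(\<Sum>g\<in>carrier G. of_rat (lam (inv (ts ! r) \<otimes> g \<otimes> ts ! r)) * cnj (character V g)) =
        (\<Sum>g\<in>carrier G. of_rat (lam g) * cnj (character V g))"
      by (rule sum.reindex_bij_witness[of _ "\<lambda>g. ts ! r \<otimes> g \<otimes> inv (ts ! r)" "\<lambda>g. inv (ts ! r) \<otimes> g \<otimes> ts ! r"])
        (use t e character_class[OF V _ t] in \<open>auto\<close>, metis e(2) character_class[OF V _ t] m_closed inv_closed)
  qed
  also have "\<dots> = of_nat (length ts) * (\<Sum>g\<in>carrier G. of_rat (lam g) * cnj (character V g))" by simp
  finally have "char_inner G (character (complexify (ind lam ts))) (character V) =
      of_nat (length ts) * (\<Sum>g\<in>carrier G. of_rat (lam g) * cnj (character V g)) / of_nat (length ts * card S)"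
    unfolding char_inner_def Coset.order_def card_transversal[OF lcharD(1)[OF L] T] by simp
  also have "\<dots> = (\<Sum>g\<in>carrier G. of_rat (lam g) * cnj (character V g)) / of_nat (card S)"
    using transversalD(1)[OF T] by simp
  also have "\<dots> = (\<Sum>g\<in>carrier G. of_rat (chi_idem S lam g) * cnj (character V g))"
    unfolding chi_idem_def by (simp add: of_rat_divide sum_divide_distrib)
  finally show ?thesis .
qed

text \<open>The injective intertwiner into the complexification of W transports the identity action
  of e.\<close>

lemma associated_central:
  assumes A: "associated G W V" and W: "representation G W" and e: "ract W e = 1\<^sub>m (fst W)"
  shows "ract V e = 1\<^sub>m (fst V)"
proof -
  obtain M where M: "intertwiner G V (complexify W) M"
    and inj: "\<And>v. v \<in> carrier_vec (fst V) \<Longrightarrow> M *\<^sub>v v = 0\<^sub>v (fst W) \<Longrightarrow> v = 0\<^sub>v (fst V)"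
    and V: "irreducible_rep G V" using A by (auto simp: associated_def)
  have R: "representation G V" using V by (simp add: irreducible_rep_def)
  have fW: "fst (complexify W) = fst W" by (simp add: complexify_def)
  have cW: "representation G (complexify W)"
    unfolding representation_def fW
  proof (intro conjI ballI)
    show "snd (complexify W) g \<in> carrier_mat (fst W) (fst W)" if "g \<in> carrier G" for g
      using repD(1)[OF W that] by (simp add: complexify_def)
    show "snd (complexify W) \<one> = 1\<^sub>m (fst W)" using repD(2)[OF W] by (auto simp: complexify_def intro!: eq_matI)
    fix g h assume gh: "g \<in> carrier G" "h \<in> carrier G"
    note c = repD(1)[OF W gh(1)] repD(1)[OF W gh(2)]
    show "snd (complexify W) (g \<otimes> h) = snd (complexify W) g * snd (complexify W) h"
      unfolding complexify_def snd_conv repD(3)[OF W gh]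
    proof (rule eq_matI)
      fix i j assume "i < dim_row (map_mat complex_of_rat (snd W g) * map_mat of_rat (snd W h))"
        "j < dim_col (map_mat complex_of_rat (snd W g) * map_mat of_rat (snd W h))"
      then have ij: "i < fst W" "j < fst W" using c by auto
      have "map_mat complex_of_rat (snd W g) \<in> carrier_mat (fst W) (fst W)" "map_mat complex_of_rat (snd W h) \<in> carrier_mat (fst W) (fst W)"
        using c by auto
      from mat_mult_index[OF this ij] mat_mult_index[OF c ij]
      show "map_mat of_rat (snd W g * snd W h) $$ (i, j) = (map_mat complex_of_rat (snd W g) * map_mat of_rat (snd W h)) $$ (i, j)"
        using ij c by (simp add: of_rat_sum of_rat_mult)
    qed (use c in auto)
  qed
  have Mc: "M \<in> carrier_mat (fst W) (fst V)" using M by (simp add: intertwiner_def complexify_def)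
  have "ract (complexify W) e = map_mat of_rat (ract W e)"
  proof (rule eq_matI)
    fix i j assume "i < dim_row (map_mat complex_of_rat (ract W e))" "j < dim_col (map_mat complex_of_rat (ract W e))"
    then have ij: "i < fst W" "j < fst W" by auto
    have "map_mat complex_of_rat (snd W g) $$ (i, j) = of_rat (snd W g $$ (i, j))" if "g \<in> carrier G" for g
      using ij repD(1)[OF W that] by auto
    then show "ract (complexify W) e $$ (i, j) = map_mat complex_of_rat (ract W e) $$ (i, j)"
      using ij by (simp add: ract_def complexify_def of_rat_sum of_rat_mult of_rat_rat)
  qed (auto simp: complexify_def)
  also have "\<dots> = 1\<^sub>m (fst W)" unfolding e by (auto intro!: eq_matI)
  finally have ec: "ract (complexify W) e = 1\<^sub>m (fst W)" .
  have Me: "M * ract V e = M" using ract_intertwiner[OF R cW M, of e] Mc unfolding ec by simp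
  show ?thesis
  proof (rule mat_eq_one[OF ract_carrier])
    fix v :: "complex vec" assume v: "v \<in> carrier_vec (fst V)"
    have w: "ract V e *\<^sub>v v \<in> carrier_vec (fst V)" using ract_carrier v by (rule mult_mat_vec_carrier)
    have "M *\<^sub>v (ract V e *\<^sub>v v) = M *\<^sub>v v"
      using assoc_mult_mat_vec[OF Mc ract_carrier v, of e] unfolding Me by simp
    then have "M *\<^sub>v (ract V e *\<^sub>v v - v) = 0\<^sub>v (fst W)"
      using Mc v w by (simp add: mult_minus_distrib_mat_vec)
    then have d: "ract V e *\<^sub>v v - v = 0\<^sub>v (fst V)" using inj v w by auto
    show "ract V e *\<^sub>v v = v"
    proof (rule eq_vecI)
      fix i assume i: "i < dim_vec v"
      have "(ract V e *\<^sub>v v - v) $ i = 0" using d v i by simp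
      then show "(ract V e *\<^sub>v v) $ i = v $ i" using v w i by simp
    qed (use v w in auto)
  qed
qed

end

section \<open>Simple components of the rational group algebra\<close>

context fin_group
begin

text \<open>The character lam is the sign of S modulo T. That its idempotent is a difference of
  averages is the link between representations and Prym varieties.\<close>

lemma index_two_lchar:
  assumes T: "subgroup T G" and S: "subgroup S G" and TS: "T \<subseteq> S" "card S = 2 * card T"
  defines "lam \<equiv> (\<lambda>g. (if g \<in> T then 2 else 0) - (if g \<in> S then 1 else 0) :: rat)"
  shows "lchar S lam" "chi_idem S lam = avg T - avg S"
proof -
  have SG: "S \<subseteq> carrier G" and finS: "finite S" using subgroup.subset[OF S] fin finite_subset by blast+
  have finT: "finite T" using TS finS finite_subset by blast
  have cT: "card T > 0" using finT subgroup.one_closed[OF T] by (auto simp: card_gt_0_iff)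
  \<comment> \<open>The coset s^(-1) T is disjoint from T and of the same size, so it fills the rest
    of S and contains t.\<close>
  have both: "s \<otimes> t \<in> T" if st: "s \<in> S" "s \<notin> T" "t \<in> S" "t \<notin> T" for s t
  proof -
    have sG: "s \<in> carrier G" "t \<in> carrier G" using st SG by auto
    have si: "inv s \<in> S" using subgroup.m_inv_closed[OF S st(1)] .
    have siT: "inv s \<notin> T" using subgroup.m_inv_closed[OF T, of "inv s"] sG st(2) by auto
    define A where "A = (\<lambda>k. inv s \<otimes> k) ` T"
    have AS: "A \<subseteq> S" unfolding A_def using TS si subgroup.m_closed[OF S] by auto
    have inj: "inj_on (\<lambda>k. inv s \<otimes> k) T"
    proof (rule inj_onI)
      fix a b assume "a \<in> T" "b \<in> T" "inv s \<otimes> a = inv s \<otimes> b"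
      moreover have "a \<in> carrier G" "b \<in> carrier G" using calculation TS SG by auto
      ultimately show "a = b" using sG cancel_inv(2)[of s a] cancel_inv(2)[of s b] by simp
    qed
    have "A \<inter> T = {}"
    proof (rule ccontr)
      assume "A \<inter> T \<noteq> {}"
      then obtain k where k: "k \<in> T" "inv s \<otimes> k \<in> T" by (auto simp: A_def)
      then have "inv s \<in> T" using subgroup_cancel(1)[OF T k(1), of "inv s"] sG by simp
      then show False using siT by simp
    qed
    then have "card (A \<union> T) = card S"
      using TS(2) finT card_image[OF inj] by (subst card_Un_disjoint) (auto simp: A_def)
    then have "A \<union> T = S" using AS TS(1) finS by (intro card_subset_eq) auto
    then obtain k where "k \<in> T" "t = inv s \<otimes> k" using st by (auto simp: A_def)
    then show ?thesis using sG TS SG by auto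
  qed
  have one: "s \<otimes> t \<notin> T" if "s \<in> S" "t \<in> S" "(s \<in> T) \<noteq> (t \<in> T)" for s t
    using that subgroup_cancel[OF T, of s t] subgroup_cancel[OF T, of t s] SG by auto
  show L: "lchar S lam"
    unfolding lchar_def
  proof (intro conjI allI ballI impI S)
    show "lam g = 0" if "g \<notin> S" for g using that TS by (auto simp: lam_def)
    show "lam s = 1 \<or> lam s = -1" if "s \<in> S" for s using that by (auto simp: lam_def)
    show "lam (s \<otimes> t) = lam s * lam t" if st: "s \<in> S" "t \<in> S" for s t
    proof -
      have "s \<otimes> t \<in> S" using st subgroup.m_closed[OF S] by blast
      then show ?thesis using st both one subgroup.m_closed[OF T]
        by (cases "s \<in> T"; cases "t \<in> T") (auto simp: lam_def)
    qed
  qed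
  show "chi_idem S lam = avg T - avg S"
    unfolding chi_idem_def lam_def avg_def fun_diff_def using cT TS(2) by (auto simp: fun_eq_iff field_simps)
qed

lemma trivial_lchar:
  "lchar (carrier G) (\<lambda>g. if g \<in> carrier G then 1 else 0)"
  "chi_idem (carrier G) (\<lambda>g. if g \<in> carrier G then 1 else 0) = avg (carrier G)"
  by (auto simp: lchar_def chi_idem_def avg_def fun_eq_iff subgroup_self)

text \<open>A simple component: e is its central idempotent, f the idempotent of a sign character
  inside it with simple left ideal, d the degree and s the Schur index of its complex constituents.
  The clause on rational V says that f detects the component. The last sum is the multiplicity
  computed in \<open>frobenius_reciprocity\<close>.\<close>

definition block :: "('a \<Rightarrow> rat) \<Rightarrow> ('a \<Rightarrow> rat) \<Rightarrow> nat \<Rightarrow> nat \<Rightarrow> bool" where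
  "block e f d s \<longleftrightarrow> central e \<and> e \<star> e = e \<and> e \<star> f = f \<and> minimal_left f \<and>
     (\<exists>S lam. lchar S lam \<and> chi_idem S lam = f) \<and>
     (\<forall>V :: ('a, rat) rep. representation G V \<longrightarrow> ract V f = 0\<^sub>m (fst V) (fst V) \<longrightarrow> ract V e = 0\<^sub>m (fst V) (fst V)) \<and>
     (\<forall>V :: ('a, complex) rep. irreducible_rep G V \<longrightarrow> ract V e = 1\<^sub>m (fst V) \<longrightarrow>
        fst V = d \<and> central_idempotent G V = e \<and> (\<Sum>g\<in>carrier G. of_rat (f g) * cnj (character V g)) = of_nat s)"

lemma blockD:
  assumes "block e f d s"
  shows "central e" "e \<star> e = e" "e \<star> f = f" "minimal_left f" "\<exists>S lam. lchar S lam \<and> chi_idem S lam = f"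
    and "\<And>V :: ('a, rat) rep. representation G V \<Longrightarrow> ract V f = 0\<^sub>m (fst V) (fst V) \<Longrightarrow> ract V e = 0\<^sub>m (fst V) (fst V)"
    and "\<And>V :: ('a, complex) rep. irreducible_rep G V \<Longrightarrow> ract V e = 1\<^sub>m (fst V) \<Longrightarrow>
      fst V = d \<and> central_idempotent G V = e \<and> (\<Sum>g\<in>carrier G. of_rat (f g) * cnj (character V g)) = of_nat s"
  using assms unfolding block_def by blast+

lemma ract_sum_list:
  "ract V (\<Sum>e\<leftarrow>es. e) = foldr (\<lambda>e A. ract V e + A) es (0\<^sub>m (fst V) (fst V))"
proof (induction es)
  case Nil
  show ?case by (simp only: list.map sum_list.Nil foldr.simps id_apply ract_zero)
next
  case (Cons a es)
  have "ract V (\<Sum>e\<leftarrow>a # es. e) = ract V (a + (\<Sum>e\<leftarrow>es. e))" by (simp only: list.map sum_list.Cons)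
  then show ?case unfolding ract_add Cons by (simp only: foldr.simps comp_apply)
qed

text \<open>Each block yields one induced representation. Orthogonality of the central idempotents
  separates them. Since these sum to the unit, some e acts nontrivially on a given irreducible V;
  then so does f, and V is the representation induced for that block.\<close>

theorem blocks_rational_irreps:
  fixes bs :: "(('a \<Rightarrow> rat) \<times> ('a \<Rightarrow> rat) \<times> nat \<times> nat) list"
  assumes b: "\<And>l. l < length bs \<Longrightarrow> (case bs ! l of (e, f, d, s) \<Rightarrow> block e f d s)"
    and orth: "\<And>k l. k < length bs \<Longrightarrow> l < length bs \<Longrightarrow> k \<noteq> l \<Longrightarrow> fst (bs ! k) \<star> fst (bs ! l) = 0"
    and one: "(\<Sum>e\<leftarrow>map fst bs. e) = delta \<one>"
  shows "\<exists>Ws. rational_irreps G Ws \<and> length Ws = length bs \<and>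
    (\<forall>l<length Ws. \<forall>V. associated G (Ws ! l) V \<longrightarrow>
      (case bs ! l of (e, f, d, s) \<Rightarrow> fst V = d \<and> central_idempotent G V = e \<and> schur_index G (Ws ! l) V = s))"
proof -
  define E where "E l = fst (bs ! l)" for l
  define F where "F l = fst (snd (bs ! l))" for l
  define D where "D l = fst (snd (snd (bs ! l)))" for l
  define I where "I l = snd (snd (snd (bs ! l)))" for l
  have B: "block (E l) (F l) (D l) (I l)" if "l < length bs" for l
    using b[OF that] by (simp add: E_def F_def D_def I_def split: prod.splits)
  have "\<forall>l\<in>{..<length bs}. \<exists>S lam ts. lchar S lam \<and> chi_idem S lam = F l \<and> transversal S ts"
  proof
    fix l assume "l \<in> {..<length bs}"
    then obtain S lam where "lchar S lam" "chi_idem S lam = F l" using blockD(5)[OF B[of l]] by auto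
    then show "\<exists>S lam ts. lchar S lam \<and> chi_idem S lam = F l \<and> transversal S ts"
      using transversal_exists lcharD(1) by blast
  qed
  then obtain S lam ts where st: "\<And>l. l < length bs \<Longrightarrow> lchar (S l) (lam l)"
    "\<And>l. l < length bs \<Longrightarrow> chi_idem (S l) (lam l) = F l" "\<And>l. l < length bs \<Longrightarrow> transversal (S l) (ts l)"
    by (metis lessThan_iff)
  define W where "W l = ind (lam l) (ts l)" for l
  define Ws where "Ws = map W [0..<length bs]"
  have len: "length Ws = length bs" by (simp add: Ws_def)
  have nth: "Ws ! l = W l" if "l < length bs" for l using that by (simp add: Ws_def)
  have irr: "irreducible_rep G (W l)" if "l < length bs" for l
    unfolding W_def using ind_irreducible[OF st(1,3)[OF that]] st(2)[OF that] B[OF that] by (simp add: block_def)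
  have rW: "representation G (W l)" and dW: "fst (W l) > 0" if "l < length bs" for l
    using irr[OF that] by (auto simp: irreducible_rep_def)
  have EW: "ract (W l) (E l) = 1\<^sub>m (fst (W l))" if "l < length bs" for l
    unfolding W_def using ind_central_one[OF st(1,3)[OF that]] st(2)[OF that] B[OF that] by (simp add: block_def)
  have "rational_irreps G Ws"
    unfolding rational_irreps_def
  proof (intro conjI ballI allI impI)
    show "irreducible_rep G V" if "V \<in> set Ws" for V using that irr by (auto simp: Ws_def)
    show "k = l" if kl: "k < length Ws" "l < length Ws" "rep_iso G (Ws ! k) (Ws ! l)" for k l
    proof (rule ccontr)
      assume ne: "k \<noteq> l"
      have k: "k < length bs" and l: "l < length bs" using kl len by auto
      obtain M where M: "intertwiner G (W k) (W l) M" "invertible_mat M"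
        using kl nth k l by (auto simp: rep_iso_def)
      have Mc: "M \<in> carrier_mat (fst (W l)) (fst (W k))" using M by (simp add: intertwiner_def)
      \<comment> \<open>On W l the idempotent of block l acts as 1, so that of block k acts as 0;
        but it acts as 1 on W k, which is supposed isomorphic.\<close>
      have "ract (W l) (E k) * ract (W l) (E l) = ract (W l) 0"
        unfolding ract_mult[OF rW[OF l], symmetric] using orth[OF k l ne] by (simp add: E_def)
      then have "ract (W l) (E k) = 0\<^sub>m (fst (W l)) (fst (W l))" unfolding EW[OF l] ract_zero
        by (simp add: right_mult_one_mat[OF ract_carrier])
      then have "M * ract (W k) (E k) = 0\<^sub>m (fst (W l)) (fst (W k))"
        unfolding ract_intertwiner[OF rW[OF k] rW[OF l] M(1)] using Mc by simp
      then have "M = 0\<^sub>m (fst (W l)) (fst (W k))" unfolding EW[OF k] using Mc by simp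
      moreover obtain C where "C * M = 1\<^sub>m (dim_row C)" "inverts_mat M C" using M(2) by (auto simp: invertible_mat_def inverts_mat_def)
      moreover have "M * C = 1\<^sub>m (fst (W l))" using calculation(3) Mc by (simp add: inverts_mat_def)
      ultimately have "0\<^sub>m (fst (W l)) (fst (W k)) * C = 1\<^sub>m (fst (W l))" by simp
      then have "(0\<^sub>m (fst (W l)) (fst (W k)) * C) $$ (0, 0) = (1 :: rat)" using dW[OF l] by simp
      moreover have "dim_col C = fst (W l)" using arg_cong[OF \<open>M * C = _\<close>, of dim_col] by simp
      moreover have "dim_row C = fst (W k)" using arg_cong[OF \<open>C * M = _\<close>, of dim_col] Mc by simp
      ultimately show False using dW[OF l] by (simp add: scalar_prod_def)
    qed
    fix V :: "('a, rat) rep" assume V: "irreducible_rep G V"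
    then have R: "representation G V" and d: "fst V > 0" by (auto simp: irreducible_rep_def)
    have "\<exists>l<length bs. ract V (E l) \<noteq> 0\<^sub>m (fst V) (fst V)"
    proof (rule ccontr)
      assume n: "\<not> ?thesis"
      have "foldr (\<lambda>e A. ract V e + A) es (0\<^sub>m (fst V) (fst V)) = 0\<^sub>m (fst V) (fst V)" if "set es \<subseteq> set (map fst bs)" for es
        using that
      proof (induction es)
        case (Cons a es)
        then obtain l where "l < length bs" "a = E l" by (auto simp: E_def in_set_conv_nth)
        then show ?case using Cons n by simp
      qed simp
      then have "ract V (delta \<one>) = 0\<^sub>m (fst V) (fst V)" unfolding one[symmetric] ract_sum_list by blast
      then have "1\<^sub>m (fst V) = (0\<^sub>m (fst V) (fst V) :: rat mat)" using ract_delta[OF R one_closed] repD(2)[OF R] by simp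
      then have "(1\<^sub>m (fst V) :: rat mat) $$ (0, 0) = 0\<^sub>m (fst V) (fst V) $$ (0, 0)" by simp
      then show False using d by simp
    qed
    then obtain l where l: "l < length bs" "ract V (E l) \<noteq> 0\<^sub>m (fst V) (fst V)" by blast
    then have "ract V (F l) \<noteq> 0\<^sub>m (fst V) (fst V)" using blockD(6)[OF B[OF l(1)] R] by blast
    then have "rep_iso G V (W l)"
      unfolding W_def using irreducible_iso_ind[OF st(1,3)[OF l(1)] _ V] st(2)[OF l(1)] B[OF l(1)] by (simp add: block_def)
    then show "\<exists>l<length Ws. rep_iso G V (Ws ! l)" using l(1) len nth by auto
  qed
  moreover have "fst V = D l \<and> central_idempotent G V = E l \<and> schur_index G (Ws ! l) V = I l"
    if l: "l < length Ws" and A: "associated G (Ws ! l) V" for l V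
  proof -
    have l': "l < length bs" using l len by simp
    have A': "associated G (W l) V" using A nth[OF l'] by simp
    then have V: "irreducible_rep G V" by (simp add: associated_def)
    have "ract V (E l) = 1\<^sub>m (fst V)" by (rule associated_central[OF A' rW[OF l'] EW[OF l']])
    then have *: "fst V = D l" "central_idempotent G V = E l"
      "(\<Sum>g\<in>carrier G. of_rat (F l g) * cnj (character V g)) = of_nat (I l)"
      using blockD(7)[OF B[OF l'] V] by blast+
    have "char_inner G (character (complexify (W l))) (character V) = of_nat (I l)"
      unfolding W_def using frobenius_reciprocity[OF st(1,3)[OF l']] V * st(2)[OF l'] by (simp add: irreducible_rep_def)
    then have "schur_index G (W l) V = I l" by (simp add: schur_index_def)
    then show ?thesis using * nth[OF l'] by simp
  qed
  then have "\<forall>l<length Ws. \<forall>V. associated G (Ws ! l) V \<longrightarrow>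
      (case bs ! l of (e, f, d, s) \<Rightarrow> fst V = d \<and> central_idempotent G V = e \<and> schur_index G (Ws ! l) V = s)"
    by (auto simp: D_def E_def I_def split: prod.splits)
  ultimately show ?thesis using len by blast
qed

text \<open>The ideal is a line: a f is always a scalar multiple of f.\<close>

lemma linear_minimal_left:
  assumes L: "lchar (carrier G) lam"
  shows "minimal_left (chi_idem (carrier G) lam)"
  unfolding minimal_left_def
proof (intro ballI impI)
  let ?f = "chi_idem (carrier G) lam"
  fix a assume a: "a \<in> group_alg G" "a \<star> ?f \<noteq> 0"
  define c where "c = (\<Sum>h\<in>carrier G. a h * lam h)"
  have af: "a \<star> ?f = (\<lambda>g. c * ?f g)"
  proof (rule ga_eqI)
    fix x assume x: "x \<in> carrier G"
    have "?f (inv h \<otimes> x) = lam h * ?f x" if h: "h \<in> carrier G" for h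
      using delta_left[OF h x, of ?f] delta_chi_idem[OF L h] by metis
    then show "(a \<star> ?f) x = c * ?f x" using x by (simp add: ga_mult_def c_def sum_distrib_right mult.assoc)
  qed (use chi_idem_closed[OF L] in \<open>auto intro: group_alg_closed\<close>)
  then have c0: "c \<noteq> 0" using a(2) by (auto simp: zero_fun_def)
  have "(\<lambda>g. 1 / c * delta \<one> g) \<star> (a \<star> ?f) = ?f"
  proof -
    have "(\<lambda>g. 1 / c * delta \<one> g) \<star> (a \<star> ?f) = (\<lambda>g. 1 / c * (a \<star> ?f) g)"
      unfolding ga_scale_left delta_one(1)[OF ga_closed] ..
    then show ?thesis unfolding af using c0 by simp
  qed
  then show "\<exists>b\<in>group_alg G. b \<star> (a \<star> ?f) = ?f"
    using group_alg_closed(4)[OF group_alg_closed(5)[OF one_closed], of "1 / c"] by blast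
qed

lemma chi_idem_idem:
  assumes L: "lchar S lam" shows "chi_idem S lam \<star> chi_idem S lam = chi_idem S lam"
proof (rule ga_eqI)
  let ?f = "chi_idem S lam"
  fix x assume x: "x \<in> carrier G"
  have "(?f \<star> ?f) x = (\<Sum>h\<in>carrier G. ?f h * ?f (inv h \<otimes> x))" using x by (simp add: ga_mult_def)
  also have "\<dots> = (\<Sum>h\<in>S. ?f h * ?f (inv h \<otimes> x))"
    by (rule sum.mono_neutral_right) (use fin lcharD(2,6)[OF L] in \<open>auto simp: chi_idem_def\<close>)
  also have "\<dots> = (\<Sum>h\<in>S. ?f x / of_nat (card S))"
  proof (rule sum.cong[OF HOL.refl])
    fix h assume h: "h \<in> S"
    then have hG: "h \<in> carrier G" using lcharD(6)[OF L] by blast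
    have "?f (inv h \<otimes> x) = lam h * ?f x" using delta_left[OF hG x, of ?f] delta_chi_idem[OF L h] by metis
    moreover have "?f h = lam h / of_nat (card S)" by (simp add: chi_idem_def)
    ultimately have "?f h * ?f (inv h \<otimes> x) = lam h / of_nat (card S) * (lam h * ?f x)" by (simp only:)
    also have "\<dots> = (lam h * lam h) * ?f x / of_nat (card S)" by simp
    finally show "?f h * ?f (inv h \<otimes> x) = ?f x / of_nat (card S)" unfolding lcharD(3)[OF L h] mult_1 .
  qed
  also have "\<dots> = ?f x" using lcharD(8)[OF L] by simp
  finally show "(?f \<star> ?f) x = ?f x" .
qed (use chi_idem_closed[OF L] in auto)

text \<open>Where e acts as the identity, every g acts by the scalar lam g, so each line is
  invariant and the degree is 1. The character takes the values 1 and -1 only, so its trace is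
  itself.\<close>

lemma linear_block:
  assumes L: "lchar (carrier G) lam"
  shows "block (chi_idem (carrier G) lam) (chi_idem (carrier G) lam) 1 1"
proof -
  let ?e = "chi_idem (carrier G) lam"
  have lm: "lam (g \<otimes> h) = lam g * lam h" if "g \<in> carrier G" "h \<in> carrier G" for g h using lcharD(4)[OF L that] .
  have li: "lam (inv g) = lam g" if g: "g \<in> carrier G" for g
  proof -
    have "lam (inv g) * lam g = 1" using lm[of "inv g" g] lcharD(5)[OF L] g by simp
    then have "lam (inv g) * (lam g * lam g) = lam g" by (simp add: mult.assoc[symmetric])
    then show ?thesis using lcharD(3)[OF L g] by simp
  qed
  have "central ?e"
    unfolding central_def
  proof (intro conjI ballI chi_idem_closed[OF L])
    fix g assume g: "g \<in> carrier G"
    show "delta g \<star> ?e = ?e \<star> delta g"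
      by (rule ga_eqI) (use g in \<open>auto simp: delta_left delta_right chi_idem_def lm li\<close>)
  qed
  moreover have "fst V = 1 \<and> central_idempotent G V = ?e \<and> (\<Sum>g\<in>carrier G. of_rat (?e g) * cnj (character V g)) = of_nat 1"
    if V: "irreducible_rep G V" and e1: "ract V ?e = 1\<^sub>m (fst V)" for V :: "('a, complex) rep"
  proof -
    have R: "representation G V" and d: "fst V > 0" using V by (auto simp: irreducible_rep_def)
    have act: "snd V g = of_rat (lam g) \<cdot>\<^sub>m 1\<^sub>m (fst V)" if g: "g \<in> carrier G" for g
    proof -
      have "snd V g = ract V (delta g) * ract V ?e" unfolding e1 ract_delta[OF R g] using repD(1)[OF R g] by simp
      also have "\<dots> = ract V (delta g \<star> ?e)" by (rule ract_mult[OF R, symmetric])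
      also have "\<dots> = of_rat (lam g) \<cdot>\<^sub>m ract V ?e" unfolding delta_chi_idem[OF L g] ract_scale ..
      also have "\<dots> = of_rat (lam g) \<cdot>\<^sub>m 1\<^sub>m (fst V)" unfolding e1 ..
      finally show ?thesis .
    qed
    have d1: "fst V = 1"
    proof (rule ccontr)
      assume n: "fst V \<noteq> 1"
      define U where "U = {c \<cdot>\<^sub>v unit_vec (fst V) 0 | c :: complex. True}"
      have "invariant_subspace G V U"
        unfolding invariant_subspace_def
      proof (intro conjI ballI allI)
        show "U \<subseteq> carrier_vec (fst V)" by (auto simp: U_def)
        show "0\<^sub>v (fst V) \<in> U" unfolding U_def by (intro CollectI exI[of _ 0] conjI TrueI eq_vecI) auto
        show "u + v \<in> U" if uv: "u \<in> U" "v \<in> U" for u v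
        proof -
          obtain a b where "u = a \<cdot>\<^sub>v unit_vec (fst V) 0" "v = b \<cdot>\<^sub>v unit_vec (fst V) 0" using uv by (auto simp: U_def)
          then have "u + v = (a + b) \<cdot>\<^sub>v unit_vec (fst V) 0" by (simp add: add_smult_distrib_vec)
          then show ?thesis by (auto simp: U_def)
        qed
        show "k \<cdot>\<^sub>v u \<in> U" if "u \<in> U" for k u using that by (auto simp: U_def smult_smult_assoc)
        show "snd V g *\<^sub>v u \<in> U" if g: "g \<in> carrier G" and u: "u \<in> U" for g u
        proof -
          obtain a where a: "u = a \<cdot>\<^sub>v unit_vec (fst V) 0" using u by (auto simp: U_def)
          have "snd V g *\<^sub>v u = (of_rat (lam g) * a) \<cdot>\<^sub>v unit_vec (fst V) 0"
            unfolding act[OF g] a by (intro eq_vecI) (auto simp: scalar_prod_smult_left)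
          then show ?thesis by (auto simp: U_def)
        qed
      qed
      then have "U = {0\<^sub>v (fst V)} \<or> U = carrier_vec (fst V)" using V by (simp add: irreducible_rep_def)
      then show False
      proof
        assume "U = {0\<^sub>v (fst V)}"
        moreover have "1 \<cdot>\<^sub>v unit_vec (fst V) 0 \<in> U" unfolding U_def by blast
        ultimately have "(1 \<cdot>\<^sub>v unit_vec (fst V) 0 :: complex vec) $ 0 = 0\<^sub>v (fst V) $ 0" by simp
        then show False using d by simp
      next
        assume "U = carrier_vec (fst V)"
        then have "unit_vec (fst V) 1 \<in> U" by simp
        then obtain c where "unit_vec (fst V) 1 = c \<cdot>\<^sub>v (unit_vec (fst V) 0 :: complex vec)" by (auto simp: U_def)
        then have "unit_vec (fst V) 1 $ 1 = (c \<cdot>\<^sub>v (unit_vec (fst V) 0 :: complex vec)) $ 1" by simp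
        then show False using d n by simp
      qed
    qed
    have chi: "character V g = of_rat (lam g)" if "g \<in> carrier G" for g
      unfolding character_def act[OF that] d1 by simp
    have pm: "lam g = 1 \<or> lam g = -1" if "g \<in> carrier G" for g using L that by (auto simp: lchar_def)
    have trace: "field_trace (character_field G V) (character V g) = lam g" if g: "g \<in> carrier G" for g
    proof (rule field_trace_rational[OF character_field_def])
      show "character V ` carrier G \<subseteq> \<int>" using chi pm by force
      show "character V g \<in> character V ` carrier G" using g by simp
      show "character V g = of_rat (lam g)" by (rule chi[OF g])
    qed
    have "central_idempotent G V = ?e"
    proof (rule ga_eqI)
      show "central_idempotent G V \<in> group_alg G" by (simp add: central_idempotent_def group_alg_def)
      show "?e \<in> group_alg G" by (rule chi_idem_closed[OF L])
      fix g assume g: "g \<in> carrier G"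
      show "central_idempotent G V g = ?e g"
        using trace[OF inv_closed[OF g]] li[OF g] g d1 by (simp add: central_idempotent_def chi_idem_def Coset.order_def)
    qed
    moreover have "(\<Sum>g\<in>carrier G. of_rat (?e g) * cnj (character V g)) = of_nat 1"
    proof -
      have "of_rat (?e g) * cnj (character V g) = 1 / of_nat (card (carrier G))" if g: "g \<in> carrier G" for g
        using pm[OF g] by (auto simp: chi[OF g] chi_idem_def of_rat_divide of_rat_minus)
      then show ?thesis using lcharD(8)[OF L] by simp
    qed
    ultimately show ?thesis using d1 by simp
  qed
  ultimately show ?thesis
    using chi_idem_idem[OF L] linear_minimal_left[OF L] L unfolding block_def by blast
qed

end

section \<open>The generalized quaternion group\<close>

lemma (in group) inverting_pow:
  assumes xG: "x \<in> carrier G" and yG: "y \<in> carrier G" and yx: "y \<otimes> x = inv x \<otimes> y"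
  shows "y \<otimes> x [^] (m::int) = x [^] (- m) \<otimes> y"
proof -
  have nat: "y \<otimes> x [^] (int k) = x [^] (- int k) \<otimes> y" for k
  proof (induction k)
    case 0
    show ?case by (simp add: yG)
  next
    case (Suc k)
    have "y \<otimes> x [^] int (Suc k) = y \<otimes> (x \<otimes> x [^] int k)" by (simp add: int_pow_mult xG add.commute)
    also have "\<dots> = inv x \<otimes> (y \<otimes> x [^] int k)" using yx xG yG by (simp add: m_assoc[symmetric])
    also have "\<dots> = (inv x \<otimes> x [^] (- int k)) \<otimes> y" unfolding Suc by (simp add: m_assoc xG yG)
    also have "inv x = x [^] (-1::int)" by (simp add: int_pow_neg xG)
    also have "x [^] (-1::int) \<otimes> x [^] (- int k) = x [^] (- int (Suc k))" by (simp add: int_pow_mult[symmetric] xG)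
    finally show ?case .
  qed
  obtain k where "m = int k \<or> m = - int k" by (metis int_cases2)
  then show ?thesis
  proof
    assume m: "m = - int k"
    have "x [^] int k \<otimes> (x [^] (- int k) \<otimes> y) = y"
      using xG yG by (simp add: int_pow_neg m_assoc[symmetric])
    then have "y \<otimes> x [^] m = x [^] int k \<otimes> (x [^] (- int k) \<otimes> y) \<otimes> x [^] (- int k)"
      using m by simp
    also have "\<dots> = x [^] int k \<otimes> (y \<otimes> x [^] int k) \<otimes> x [^] (- int k)" unfolding nat ..
    also have "\<dots> = x [^] int k \<otimes> y \<otimes> (x [^] int k \<otimes> x [^] (- int k))" by (simp add: m_assoc xG yG)
    also have "\<dots> = x [^] (- m) \<otimes> y" using m by (simp add: int_pow_neg xG yG)
    finally show ?thesis .
  qed (use nat in simp)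
qed

text \<open>The group is described by the normal form x^m y^b, with r = n - 2; the presentation is
  tied to it later. The axioms hold for x and x y as well, so both pairs of generators are
  instances.\<close>

locale quat = fin_group G for G (structure) +
  fixes x y :: 'a and r :: nat
  assumes r2: "r \<ge> 2" and xG: "x \<in> carrier G" and yG: "y \<in> carrier G"
    and xM: "x [^] ((2::nat) ^ Suc r) = \<one>" and yy: "y \<otimes> y = x [^] ((2::nat) ^ r)" and yx: "y \<otimes> x = inv x \<otimes> y"
    and el_surj: "\<And>g. g \<in> carrier G \<Longrightarrow> \<exists>m::int. \<exists>b. g = x [^] m \<otimes> (if b then y else \<one>)"
    and el_inj: "\<And>(m::int) b (m'::int) b'. x [^] m \<otimes> (if b then y else \<one>) = x [^] m' \<otimes> (if b' then y else \<one>) \<Longrightarrow>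
      m mod 2 ^ Suc r = m' mod 2 ^ Suc r \<and> b = b'"
begin

text \<open>Half of the order \<open>M\<close> of x; the power x^h = y^2 is the central
  involution.\<close>

definition h :: nat where "h = 2 ^ r"
definition M :: nat where "M = 2 ^ Suc r"

lemma hM: "M = 2 * h" "h > 0" "M > 0" "even h" "int M = 2 * int h" "4 dvd h"
proof -
  show "M = 2 * h" "h > 0" "M > 0" "int M = 2 * int h" by (simp_all add: M_def h_def)
  have "2 ^ 2 dvd (2::nat) ^ r" using r2 by (rule le_imp_power_dvd)
  then show "4 dvd h" by (simp add: h_def)
  then show "even h" by (rule dvd_trans[rotated]) simp
qed

definition el :: "int \<Rightarrow> bool \<Rightarrow> 'a" where
  "el m b = x [^] m \<otimes> (if b then y else \<one>)"

lemma el_closed [simp]: "el m b \<in> carrier G"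
  by (simp add: el_def xG yG)

lemma el_exhaust: "g \<in> carrier G \<Longrightarrow> \<exists>m b. g = el m b"
  using el_surj unfolding el_def by blast

lemma xM': "x [^] (int M) = \<one>" "x [^] (int h) = y \<otimes> y"
  unfolding M_def h_def int_pow_int using xM yy by simp_all

lemma x_period: "m mod int M = m' mod int M \<Longrightarrow> x [^] m = x [^] m'"
proof -
  assume "m mod int M = m' mod int M"
  then obtain k where "m - m' = int M * k" by (auto simp: mod_eq_dvd_iff elim: dvdE)
  then have "m = m' + int M * k" by simp
  then have "x [^] m = x [^] m' \<otimes> (x [^] int M) [^] k" by (simp add: int_pow_mult int_pow_pow xG)
  then show ?thesis using xM'(1) xG by simp
qed

lemma el_eq: "el m b = el m' b' \<longleftrightarrow> m mod int M = m' mod int M \<and> b = b'"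
proof
  assume "el m b = el m' b'"
  then have "m mod 2 ^ Suc r = m' mod 2 ^ Suc r \<and> b = b'" unfolding el_def by (rule el_inj)
  moreover have "int M = 2 ^ Suc r" by (simp add: M_def)
  ultimately show "m mod int M = m' mod int M \<and> b = b'" by (simp only:)
next
  assume "m mod int M = m' mod int M \<and> b = b'"
  then show "el m b = el m' b'" using x_period[of m m'] by (simp add: el_def)
qed

lemmas y_x_pow = inverting_pow[OF xG yG yx]

lemma el_mult: "el k c \<otimes> el l d = el (if c then k - l + (if d then int h else 0) else k + l) (c \<noteq> d)"
proof (cases c)
  case False
  have "x [^] k \<otimes> (x [^] l \<otimes> (if d then y else \<one>)) = x [^] (k + l) \<otimes> (if d then y else \<one>)"
    using xG yG by (simp add: int_pow_mult m_assoc[symmetric])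
  then show ?thesis using False xG yG by (simp add: el_def)
next
  case True
  have 1: "(x [^] k \<otimes> y) \<otimes> x [^] l = x [^] (k - l) \<otimes> y"
  proof -
    have "(x [^] k \<otimes> y) \<otimes> x [^] l = x [^] k \<otimes> (x [^] (- l) \<otimes> y)" using xG yG by (simp add: m_assoc y_x_pow)
    also have "\<dots> = x [^] (k + - l) \<otimes> y" unfolding int_pow_mult[OF xG] using xG yG by (simp add: m_assoc)
    finally show ?thesis by simp
  qed
  have "(x [^] k \<otimes> y) \<otimes> (x [^] l \<otimes> y) = (x [^] k \<otimes> y \<otimes> x [^] l) \<otimes> y" using xG yG by (simp add: m_assoc)
  also have "\<dots> = x [^] (k - l) \<otimes> (y \<otimes> y)" unfolding 1 using xG yG by (simp add: m_assoc)
  also have "\<dots> = x [^] (k - l + int h)" unfolding xM'(2)[symmetric] by (simp add: int_pow_mult xG)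
  finally show ?thesis using True 1 xG yG by (simp add: el_def)
qed

lemma el_one: "el 0 False = \<one>" "el 1 False = x" "el 0 True = y"
  by (simp_all add: el_def xG yG)

lemma el_inv: "inv (el m False) = el (- m) False" "inv (el m True) = el (m + int h) True"
proof -
  show "inv (el m False) = el (- m) False"
    by (rule inv_equality) (simp_all add: el_mult el_one)
  have "el (m + int h) True \<otimes> el m True = \<one>"
    by (simp add: el_mult) (metis el_one(1) el_eq hM(5) mod_self mod_0 mult_2)
  then show "inv (el m True) = el (m + int h) True" by (rule inv_equality) simp_all
qed

lemma carrier_el: "carrier G = (\<lambda>(m, b). el (int m) b) ` ({..<M} \<times> UNIV)"
proof
  show "carrier G \<subseteq> (\<lambda>(m, b). el (int m) b) ` ({..<M} \<times> UNIV)"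
  proof
    fix g assume "g \<in> carrier G"
    then obtain m b where g: "g = el m b" using el_exhaust by blast
    have "el m b = el (int (nat (m mod int M))) b" using hM(3) by (simp add: el_eq)
    moreover have "nat (m mod int M) < M" using hM(3) by (simp add: nat_less_iff)
    ultimately show "g \<in> (\<lambda>(m, b). el (int m) b) ` ({..<M} \<times> UNIV)" using g
      by (intro image_eqI[of _ _ "(nat (m mod int M), b)"]) auto
  qed
qed auto

lemma el_inj_on: "inj_on (\<lambda>(m, b). el (int m) b) ({..<M} \<times> UNIV)"
  by (auto simp: inj_on_def el_eq)

lemma sum_el:
  fixes F :: "'a \<Rightarrow> 'k::comm_monoid_add"
  shows "(\<Sum>g\<in>carrier G. F g) = (\<Sum>m<M. F (el (int m) False) + F (el (int m) True))"
proof -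
  have "(\<Sum>g\<in>carrier G. F g) = (\<Sum>(m, b)\<in>{..<M} \<times> UNIV. F (el (int m) b))"
    unfolding carrier_el by (subst sum.reindex[OF el_inj_on]) (auto intro!: sum.cong)
  also have "\<dots> = (\<Sum>m<M. \<Sum>b\<in>UNIV. F (el (int m) b))" by (rule sum.cartesian_product[symmetric])
  finally show ?thesis by (simp add: UNIV_bool add.commute)
qed

lemma card_G: "card (carrier G) = 2 * M"
  unfolding carrier_el by (subst card_image[OF el_inj_on]) (simp add: card_cartesian_product)

section \<open>The Fourier transform on the quaternion group\<close>

definition fu :: "complex \<Rightarrow> 'a \<Rightarrow> complex" where
  "fu w g = (case (SOME (m, b). g = el m b) of (m, b) \<Rightarrow> if b then 0 else w powi m)"

text \<open>\<open>fu\<close> and \<open>fv\<close> are the entries of the two-dimensional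
  representation in which x has eigenvalues w and 1/w; \<open>fu\<close> lives on the powers of x
  and \<open>fv\<close> on their coset by y. The exponent of a normal form is determined only modulo
  M, hence the choice, which does not matter when w^M = 1.\<close>

definition fv :: "complex \<Rightarrow> 'a \<Rightarrow> complex" where
  "fv w g = (case (SOME (m, b). g = el m b) of (m, b) \<Rightarrow> if b then w powi m else 0)"

lemma root_nz: "w ^ M = 1 \<Longrightarrow> w \<noteq> (0::complex)"
  using hM(3) by (auto simp: power_0_left)

lemma powi_period: "w ^ M = 1 \<Longrightarrow> m mod int M = m' mod int M \<Longrightarrow> w powi m = (w::complex) powi m'"
proof -
  assume w: "w ^ M = 1" and "m mod int M = m' mod int M"
  then obtain k where "m - m' = int M * k" by (auto simp: mod_eq_dvd_iff elim: dvdE)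
  then have "m = m' + int M * k" by simp
  then have "w powi m = w powi m' * (w powi int M) powi k"
    using root_nz[OF w] by (simp add: power_int_add power_int_mult)
  then show ?thesis using w by simp
qed

lemma fuv: 
  assumes w: "w ^ M = 1"
  shows "fu w (el m b) = (if b then 0 else w powi m)" "fv w (el m b) = (if b then w powi m else 0)"
proof -
  define p where "p = (SOME (m', b'). el m b = el m' b')"
  obtain m' b' where p: "p = (m', b')" by (cases p)
  have "case p of (m', b') \<Rightarrow> el m b = el m' b'" unfolding p_def by (rule someI[of _ "(m, b)"]) simp
  then have "m mod int M = m' mod int M" "b = b'" unfolding p by (auto simp: el_eq)
  then show "fu w (el m b) = (if b then 0 else w powi m)" "fv w (el m b) = (if b then w powi m else 0)"
    unfolding fu_def fv_def p_def[symmetric] p using powi_period[OF w, of m m'] by auto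
qed

lemma powi_half: "w ^ M = 1 \<Longrightarrow> w powi int h = (w::complex) ^ h" "w ^ M = 1 \<Longrightarrow> w ^ h * w ^ h = (1::complex)"
  "w ^ M = 1 \<Longrightarrow> (1 / w) ^ h = (w::complex) ^ h" "w ^ M = 1 \<Longrightarrow> (1 / w) ^ M = (1::complex)"
proof -
  assume w: "w ^ M = 1"
  show "w powi int h = w ^ h" by simp
  show s: "w ^ h * w ^ h = 1" using w by (simp add: hM power_add[symmetric] mult_2)
  have "w ^ h \<noteq> 0" using root_nz[OF w] by simp
  then have "1 / w ^ h = w ^ h" using s by (simp add: divide_eq_eq)
  then show "(1 / w) ^ h = w ^ h" by (simp add: power_divide)
  show "(1 / w) ^ M = 1" using w by (simp add: power_divide)
qed

lemma inv_powi: "(1 / w) powi m = (w::complex) powi (- m)"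
  by (simp add: power_int_minus power_int_divide_distrib divide_inverse power_int_inverse)

text \<open>The first row of a product of two matrices \<open>rho w\<close>. The factor w^h comes
  from y^2 = x^h.\<close>

lemma fuv_mult:
  assumes w: "w ^ M = 1" and g: "g \<in> carrier G" "g' \<in> carrier G"
  shows "fu w (g \<otimes> g') = fu w g * fu w g' + w ^ h * fv w g * fv (1 / w) g'"
    "fv w (g \<otimes> g') = fu w g * fv w g' + fv w g * fu (1 / w) g'"
proof -
  obtain k c where k: "g = el k c" using el_exhaust[OF g(1)] by auto
  obtain l d where l: "g' = el l d" using el_exhaust[OF g(2)] by auto
  note e = k l
  note w0 = root_nz[OF w] and w' = powi_half(4)[OF w]
  show "fu w (g \<otimes> g') = fu w g * fu w g' + w ^ h * fv w g * fv (1 / w) g'"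
    "fv w (g \<otimes> g') = fu w g * fv w g' + fv w g * fu (1 / w) g'"
    unfolding e el_mult fuv[OF w] fuv[OF w'] inv_powi
    using w0 by (auto simp: power_int_add power_int_diff power_int_minus field_simps)
qed

lemma fuv_inv:
  assumes w: "w ^ M = 1" and g: "g \<in> carrier G"
  shows "fu w (inv g) = fu (1 / w) g" "fv w (inv g) = w ^ h * fv w g"
proof -
  obtain k c where e: "g = el k c" using el_exhaust[OF g] by auto
  note w0 = root_nz[OF w] and w' = powi_half(4)[OF w]
  show "fu w (inv g) = fu (1 / w) g" "fv w (inv g) = w ^ h * fv w g"
    unfolding e using w0 by (cases c; simp add: el_inv fuv[OF w] fuv[OF w'] inv_powi power_int_add mult.commute)+
qed

text \<open>\<open>U\<close> and \<open>W\<close> carry the first row of the matrix of a at w; the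
  second row is the same data at 1/w.\<close>

definition U :: "('a \<Rightarrow> rat) \<Rightarrow> complex \<Rightarrow> complex" where
  "U a w = (\<Sum>g\<in>carrier G. of_rat (a g) * fu w g)"

definition W :: "('a \<Rightarrow> rat) \<Rightarrow> complex \<Rightarrow> complex" where
  "W a w = (\<Sum>g\<in>carrier G. of_rat (a g) * fv w g)"

lemma UW_mult:
  assumes w: "w ^ M = 1"
  shows "U (a \<star> b) w = U a w * U b w + w ^ h * W a w * W b (1 / w)"
    "W (a \<star> b) w = U a w * W b w + W a w * U b (1 / w)"
proof -
  have "U (a \<star> b) w = (\<Sum>g\<in>carrier G. \<Sum>g'\<in>carrier G. of_rat (a g) * of_rat (b g') * (fu w g * fu w g' + w ^ h * fv w g * fv (1 / w) g'))"
    unfolding U_def ga_sum using fuv_mult(1)[OF w] by (intro sum.cong) auto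
  also have "\<dots> = (\<Sum>g\<in>carrier G. \<Sum>g'\<in>carrier G. (of_rat (a g) * fu w g) * (of_rat (b g') * fu w g'))
      + w ^ h * (\<Sum>g\<in>carrier G. \<Sum>g'\<in>carrier G. (of_rat (a g) * fv w g) * (of_rat (b g') * fv (1 / w) g'))"
    unfolding sum_distrib_left sum.distrib[symmetric]
    by (intro sum.cong HOL.refl) (simp add: distrib_left mult_ac)
  finally show "U (a \<star> b) w = U a w * U b w + w ^ h * W a w * W b (1 / w)"
    by (simp add: U_def W_def sum_product mult.assoc)
  have "W (a \<star> b) w = (\<Sum>g\<in>carrier G. \<Sum>g'\<in>carrier G. of_rat (a g) * of_rat (b g') * (fu w g * fv w g' + fv w g * fu (1 / w) g'))"
    unfolding W_def ga_sum using fuv_mult(2)[OF w] by (intro sum.cong) auto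
  also have "\<dots> = (\<Sum>g\<in>carrier G. \<Sum>g'\<in>carrier G. (of_rat (a g) * fu w g) * (of_rat (b g') * fv w g'))
      + (\<Sum>g\<in>carrier G. \<Sum>g'\<in>carrier G. (of_rat (a g) * fv w g) * (of_rat (b g') * fu (1 / w) g'))"
    unfolding sum.distrib[symmetric]
    by (intro sum.cong HOL.refl) (simp add: distrib_left mult_ac)
  finally show "W (a \<star> b) w = U a w * W b w + W a w * U b (1 / w)"
    by (simp add: U_def W_def sum_product mult.assoc)
qed

lemma UW_linear:
  "U (a + b) w = U a w + U b w" "W (a + b) w = W a w + W b w"
  "U (a - b) w = U a w - U b w" "W (a - b) w = W a w - W b w"
  by (simp_all add: U_def W_def of_rat_add of_rat_diff distrib_right left_diff_distrib sum.distrib sum_subtractf)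

lemma UW_zero: "U 0 w = 0" "W 0 w = 0"
  by (simp_all add: U_def W_def)

lemma UW_delta:
  assumes "w ^ M = 1"
  shows "U (delta (el m b)) w = (if b then 0 else w powi m)" "W (delta (el m b)) w = (if b then w powi m else 0)"
proof -
  have i: "of_rat (delta (el m b) g) * F g = (if g = el m b then 1 else 0) * F g" for F :: "'a \<Rightarrow> complex" and g
    by (simp add: delta_def)
  show "U (delta (el m b)) w = (if b then 0 else w powi m)" "W (delta (el m b)) w = (if b then w powi m else 0)"
    unfolding U_def W_def i sum_indicator(1)[OF fin el_closed[of m b]] by (rule fuv[OF assms])+
qed

lemma UW_coeff:
  assumes w: "w ^ M = 1"
  shows "U a w = (\<Sum>m<M. of_rat (a (el (int m) False)) * w ^ m)" "W a w = (\<Sum>m<M. of_rat (a (el (int m) True)) * w ^ m)"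
  unfolding U_def W_def sum_el by (simp_all add: fuv[OF w])

text \<open>Fourier inversion: summing over all roots against w^(M - j) isolates the coefficient c
  j.\<close>

lemma fourier_coeff:
  fixes c :: "nat \<Rightarrow> complex"
  assumes "\<And>w. w ^ M = 1 \<Longrightarrow> (\<Sum>m<M. c m * w ^ m) = 0" "j < M"
  shows "c j = 0"
proof -
  have "0 = (\<Sum>w | w ^ M = 1. (\<Sum>m<M. c m * w ^ m) * w ^ (M - j))" using assms(1) by simp
  also have "\<dots> = (\<Sum>m<M. c m * (\<Sum>w | w ^ M = 1. w ^ (m + (M - j))))"
    by (simp add: sum_distrib_right sum_distrib_left power_add mult.assoc) (rule sum.swap)
  also have "\<dots> = (\<Sum>m<M. c m * (if m = j then of_nat M else 0))"
  proof (rule sum.cong[OF HOL.refl])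
    fix m assume m: "m \<in> {..<M}"
    \<comment> \<open>The number m + (M - j) lies strictly between 0 and 2 M, so M is the only
      multiple of M it can be.\<close>
    have "M dvd m + (M - j) \<longleftrightarrow> m = j"
    proof
      assume "M dvd m + (M - j)"
      then obtain k where k: "m + (M - j) = M * k" by blast
      have "M * k < M * 2" "M * k > 0" unfolding k[symmetric] using m assms(2) by auto
      then have "k < 2" "k > 0" by auto
      then have "k = 1" by simp
      then show "m = j" using k assms(2) by simp
    qed (use assms(2) in simp)
    then show "c m * (\<Sum>w | w ^ M = 1. w ^ (m + (M - j))) = c m * (if m = j then of_nat M else 0)"
      using sum_roots_unity_power[OF hM(3), of "m + (M - j)"] by simp
  qed
  also have "\<dots> = c j * of_nat M" using assms(2) by (simp add: if_distrib cong: if_cong)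
  finally show ?thesis using hM(3) by simp
qed

text \<open>Reduces identities in the group algebra to computations with \<open>U\<close> and
  \<open>W\<close> at each root of unity. Nearly all identities between idempotents below are
  obtained this way.\<close>

lemma fourier_eqI:
  assumes "a \<in> group_alg G" "b \<in> group_alg G"
    and "\<And>w. w ^ M = 1 \<Longrightarrow> U a w = U b w" "\<And>w. w ^ M = 1 \<Longrightarrow> W a w = W b w"
  shows "a = b"
proof (rule ga_eqI[OF assms(1,2)])
  define c where "c = a - b"
  have "(of_rat (c (el (int j) s)) :: complex) = 0" if j: "j < M" for j s
  proof (rule fourier_coeff[OF _ j])
    fix w :: complex assume w: "w ^ M = 1"
    show "(\<Sum>m<M. of_rat (c (el (int m) s)) * w ^ m) = 0"
      using UW_coeff[OF w, of c] assms(3,4)[OF w] by (cases s) (simp_all add: c_def UW_linear)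
  qed
  then have "c (el (int j) s) = 0" if "j < M" for j s using that by simp
  then show "a g = b g" if "g \<in> carrier G" for g using that unfolding carrier_el by (auto simp: c_def)
qed

text \<open>For d dividing M this is the subgroup generated by x^d; with d = 2^(n - i) it is
  \<open>K_sub\<close> at i.\<close>

definition kk :: "nat \<Rightarrow> 'a set" where
  "kk d = {el m False | m. int d dvd m}"

text \<open>For d dividing h this is the subgroup generated by x^d and y; with d = 2^(n - j) it is
  \<open>H_sub\<close> at j.\<close>

definition hh :: "nat \<Rightarrow> 'a set" where
  "hh d = {el m b | m b. int d dvd m}"

lemma dvd_mod_M: assumes "d dvd M" "m mod int M = m' mod int M" shows "int d dvd m \<longleftrightarrow> int d dvd m'"
proof -
  have dM: "int d dvd int M" using assms(1) by simp
  show ?thesis using dvd_mod_iff[OF dM, of m] dvd_mod_iff[OF dM, of m'] assms(2) by simp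
qed

lemma el_kk: assumes "d dvd M" shows "el m b \<in> kk d \<longleftrightarrow> \<not> b \<and> int d dvd m"
proof
  assume "el m b \<in> kk d"
  then obtain m' where "el m b = el m' False" "int d dvd m'" unfolding kk_def by auto
  then show "\<not> b \<and> int d dvd m" using dvd_mod_M[OF assms, of m m'] by (simp add: el_eq)
qed (auto simp: kk_def)

lemma el_hh: assumes "d dvd M" shows "el m b \<in> hh d \<longleftrightarrow> int d dvd m"
proof
  assume "el m b \<in> hh d"
  then obtain m' b' where "el m b = el m' b'" "int d dvd m'" unfolding hh_def by auto
  then show "int d dvd m" using dvd_mod_M[OF assms, of m m'] by (simp add: el_eq)
qed (auto simp: hh_def)

lemma subgroup_kk: assumes "d dvd M" shows "subgroup (kk d) G"
proof (rule subgroupI)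
  show "kk d \<subseteq> carrier G" by (auto simp: kk_def)
  show "kk d \<noteq> {}" unfolding kk_def by (auto intro: exI[of _ 0])
  show "inv a \<in> kk d" if "a \<in> kk d" for a using that by (auto simp: kk_def el_inv)
  show "a \<otimes> b \<in> kk d" if "a \<in> kk d" "b \<in> kk d" for a b
    using that el_kk[OF assms] unfolding kk_def by (auto simp: el_mult)
qed

lemma dvd_h_M: "d dvd h \<Longrightarrow> d dvd M"
  by (simp add: hM)

text \<open>Closure requires d to divide h and not only M, because y^2 = x^h.\<close>

lemma subgroup_hh: assumes "d dvd h" shows "subgroup (hh d) G"
proof (rule subgroupI)
  have dh: "int d dvd int h" using assms by simp
  show "hh d \<subseteq> carrier G" by (auto simp: hh_def)
  show "hh d \<noteq> {}" unfolding hh_def by (auto intro: exI[of _ 0])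
  show "inv a \<in> hh d" if a: "a \<in> hh d" for a
  proof -
    obtain m b where "a = el m b" "int d dvd m" using a by (auto simp: hh_def)
    then show ?thesis using dh by (cases b) (simp_all add: el_inv el_hh[OF dvd_h_M[OF assms]])
  qed
  show "a \<otimes> b \<in> hh d" if ab: "a \<in> hh d" "b \<in> hh d" for a b
  proof -
    obtain m c where 1: "a = el m c" "int d dvd m" using ab by (auto simp: hh_def)
    obtain k c' where 2: "b = el k c'" "int d dvd k" using ab by (auto simp: hh_def)
    show ?thesis unfolding 1 2 el_mult el_hh[OF dvd_h_M[OF assms]] using 1(2) 2(2) dh by simp
  qed
qed

lemma sum_kk:
  fixes F :: "'a \<Rightarrow> 'k::comm_monoid_add"
  assumes d: "d dvd M"
  shows "(\<Sum>g\<in>kk d. F g) = (\<Sum>j<M div d. F (el (int (d * j)) False))"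
proof -
  have d0: "d > 0" using d hM(3) by (metis dvd_pos_nat)
  have "bij_betw (\<lambda>j. el (int (d * j)) False) {..<M div d} (kk d)"
    unfolding bij_betw_def
  proof
    have lt: "d * j < M" if "j < M div d" for j using that d d0 by (metis dvd_mult_div_cancel mult_less_mono2)
    show "inj_on (\<lambda>j. el (int (d * j)) False) {..<M div d}"
    proof (rule inj_onI)
      fix i j assume a: "i \<in> {..<M div d}" "j \<in> {..<M div d}" "el (int (d * i)) False = el (int (d * j)) False"
      then have "int (d * i) mod int M = int (d * j) mod int M" by (simp add: el_eq del: of_nat_mult)
      then have "d * i = d * j" using lt[of i] lt[of j] a by (simp add: zmod_int[symmetric] del: of_nat_mult)
      then show "i = j" using d0 by simp
    qed
    show "(\<lambda>j. el (int (d * j)) False) ` {..<M div d} = kk d"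
    proof
      show "(\<lambda>j. el (int (d * j)) False) ` {..<M div d} \<subseteq> kk d" unfolding kk_def by auto
      show "kk d \<subseteq> (\<lambda>j. el (int (d * j)) False) ` {..<M div d}"
      proof
        fix g assume "g \<in> kk d"
        then obtain m where m: "g = el m False" "int d dvd m" by (auto simp: kk_def)
        define k where "k = nat (m mod int M)"
        have k: "int k = m mod int M" using hM(3) by (simp add: k_def)
        have "int d dvd int k" unfolding k using m(2) d by (simp add: dvd_mod)
        then obtain j where j: "k = d * j" by auto
        have "k < M" using k hM(3) by (metis of_nat_less_iff pos_mod_bound of_nat_0_less_iff)
        then have "j < M div d" using j d d0 by (metis dvd_mult_div_cancel mult_less_cancel1)
        moreover have "g = el (int (d * j)) False" unfolding m(1) j[symmetric] k by (simp add: el_eq)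
        ultimately show "g \<in> (\<lambda>j. el (int (d * j)) False) ` {..<M div d}" by blast
      qed
    qed
  qed
  from sum.reindex_bij_betw[OF this, of F, symmetric] show ?thesis .
qed

lemma card_kk: assumes "d dvd M" shows "card (kk d) = M div d"
  using sum_kk[OF assms, of "\<lambda>_. 1::nat"] by simp

lemma hh_split: "hh d = kk d \<union> (\<lambda>g. g \<otimes> y) ` kk d" "kk d \<inter> (\<lambda>g. g \<otimes> y) ` kk d = {}" "inj_on (\<lambda>g. g \<otimes> y) (kk d)"
proof -
  have e: "el m False \<otimes> y = el m True" for m using el_mult[of m False 0 True] by (simp add: el_one)
  show "hh d = kk d \<union> (\<lambda>g. g \<otimes> y) ` kk d"
  proof
    show "hh d \<subseteq> kk d \<union> (\<lambda>g. g \<otimes> y) ` kk d"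
    proof
      fix g assume "g \<in> hh d"
      then obtain m b where "g = el m b" "int d dvd m" by (auto simp: hh_def)
      then show "g \<in> kk d \<union> (\<lambda>g. g \<otimes> y) ` kk d"
        using e[of m] by (cases b) (auto simp: kk_def image_iff intro!: exI[of _ "el m False"] exI[of _ m])
    qed
    show "kk d \<union> (\<lambda>g. g \<otimes> y) ` kk d \<subseteq> hh d" using e by (auto simp: kk_def hh_def)
  qed
  show "kk d \<inter> (\<lambda>g. g \<otimes> y) ` kk d = {}" by (auto simp: kk_def e el_eq)
  show "inj_on (\<lambda>g. g \<otimes> y) (kk d)"
  proof (rule inj_onI)
    fix a b assume "a \<in> kk d" "b \<in> kk d" "a \<otimes> y = b \<otimes> y"
    then show "a = b" by (auto simp: kk_def e el_eq)
  qed
qed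

lemma fin_kk: "finite (kk d)" "finite (hh d)"
  by (rule finite_subset[OF _ fin]; auto simp: kk_def hh_def)+

lemma card_hh: "d dvd M \<Longrightarrow> card (hh d) = 2 * (M div d)"
  unfolding hh_split(1)[of d] using hh_split(2)[of d] fin_kk(1)[of d] card_kk[of d]
  by (simp add: card_Un_disjoint card_image[OF hh_split(3)])

lemma U_avg: 
  assumes K: "K \<subseteq> carrier G"
  shows "U (avg K) w = (\<Sum>g\<in>K. fu w g) / of_nat (card K)" "W (avg K) w = (\<Sum>g\<in>K. fv w g) / of_nat (card K)"
proof -
  have "(\<Sum>g\<in>carrier G. of_rat (avg K g) * F g) = (\<Sum>g\<in>K. F g) / of_nat (card K)" for F :: "'a \<Rightarrow> complex"
  proof -
    have "(\<Sum>g\<in>carrier G. of_rat (avg K g) * F g) = (\<Sum>g\<in>K. of_rat (avg K g) * F g)"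
      by (rule sum.mono_neutral_right) (use fin K in \<open>auto simp: avg_def\<close>)
    also have "\<dots> = (\<Sum>g\<in>K. F g / of_nat (card K))" by (intro sum.cong) (auto simp: avg_def of_rat_divide)
    finally show ?thesis by (simp add: sum_divide_distrib)
  qed
  then show "U (avg K) w = (\<Sum>g\<in>K. fu w g) / of_nat (card K)" "W (avg K) w = (\<Sum>g\<in>K. fv w g) / of_nat (card K)"
    unfolding U_def W_def by blast+
qed

lemma sum_kk_fu:
  assumes w: "w ^ M = 1" and d: "d dvd M"
  shows "(\<Sum>g\<in>kk d. fu w g) = (if w ^ d = 1 then of_nat (M div d) else 0)"
proof -
  have "(\<Sum>g\<in>kk d. fu w g) = (\<Sum>j<M div d. (w ^ d) ^ j)"
    unfolding sum_kk[OF d] by (intro sum.cong) (auto simp: fuv[OF w] power_mult simp del: of_nat_mult)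
  moreover have "(w ^ d) ^ (M div d) = 1" using w d by (simp add: power_mult[symmetric])
  ultimately show ?thesis by (simp add: geometric_sum)
qed

text \<open>A geometric sum. Averages over cyclic subgroups become indicators of sets of roots, so
  differences of averages select the roots of one order.\<close>

lemma UW_kk:
  assumes w: "w ^ M = 1" and d: "d dvd M"
  shows "U (avg (kk d)) w = (if w ^ d = 1 then 1 else 0)" "W (avg (kk d)) w = 0"
proof -
  have K: "kk d \<subseteq> carrier G" by (auto simp: kk_def)
  have "M div d > 0" using d hM(3) dvd_imp_le[OF d] dvd_pos_nat[OF hM(3) d] by (simp add: div_greater_zero_iff)
  then show "U (avg (kk d)) w = (if w ^ d = 1 then 1 else 0)"
    unfolding U_avg[OF K] sum_kk_fu[OF w d] card_kk[OF d] by simp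
  have "(\<Sum>g\<in>kk d. fv w g) = 0" by (intro sum.neutral) (auto simp: kk_def fuv[OF w])
  then show "W (avg (kk d)) w = 0" unfolding U_avg[OF K] by simp
qed

lemma UW_hh:
  assumes w: "w ^ M = 1" and d: "d dvd M"
  shows "U (avg (hh d)) w = (if w ^ d = 1 then 1 / 2 else 0)" "W (avg (hh d)) w = (if w ^ d = 1 then 1 / 2 else 0)"
proof -
  have K: "hh d \<subseteq> carrier G" by (auto simp: hh_def)
  have c: "M div d > 0" using d hM(3) dvd_imp_le[OF d] dvd_pos_nat[OF hM(3) d] by (simp add: div_greater_zero_iff)
  have e: "el m False \<otimes> y = el m True" for m using el_mult[of m False 0 True] by (simp add: el_one)
  have s: "(\<Sum>g\<in>hh d. F g) = (\<Sum>g\<in>kk d. F g) + (\<Sum>g\<in>kk d. F (g \<otimes> y))" for F :: "'a \<Rightarrow> complex"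
    unfolding hh_split(1)[of d]
    by (subst sum.union_disjoint) (use fin_kk hh_split(2)[of d] in \<open>auto simp: sum.reindex[OF hh_split(3)]\<close>)
  have "(\<Sum>g\<in>kk d. fu w (g \<otimes> y)) = 0" "(\<Sum>g\<in>kk d. fv w g) = 0" "(\<Sum>g\<in>kk d. fv w (g \<otimes> y)) = (\<Sum>g\<in>kk d. fu w g)"
    by (auto simp: kk_def e fuv[OF w] intro!: sum.neutral sum.cong)
  then show "U (avg (hh d)) w = (if w ^ d = 1 then 1 / 2 else 0)" "W (avg (hh d)) w = (if w ^ d = 1 then 1 / 2 else 0)"
    unfolding U_avg[OF K] s card_hh[OF d] using sum_kk_fu[OF w d] c by simp_all
qed

end

section \<open>Idempotents of the two-dimensional blocks and simplicity of their ideals\<close>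

context quat
begin

text \<open>Selects the roots with w^N = -1; for N a power of 2 these are the primitive 2N-th roots
  of unity, one Galois orbit.\<close>

definition en :: "nat \<Rightarrow> 'a \<Rightarrow> rat" where
  "en N = avg (kk (2 * N)) - avg (kk N)"

text \<open>At a root with w^N = -1 and w^h = 1 this is the projection of rank one onto the vectors
  fixed by y.\<close>

definition fn :: "nat \<Rightarrow> 'a \<Rightarrow> rat" where
  "fn N = avg (hh (2 * N)) - avg (hh N)"

lemma kk_sub: "kk d \<subseteq> carrier G" and hh_sub: "hh d \<subseteq> carrier G"
  by (auto simp: kk_def hh_def)

lemma en_closed: "en N \<in> group_alg G" and fn_closed: "fn N \<in> group_alg G"
  unfolding en_def fn_def by (intro group_alg_closed kk_sub hh_sub)+

lemma square_root_minus: 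
  "w ^ (2 * N) = 1 \<longleftrightarrow> w ^ N = 1 \<or> w ^ N = (-1::complex)"
  by (simp add: power_mult mult.commute[of 2] power2_eq_1_iff)

lemma UW_en:
  assumes "w ^ M = 1" "2 * N dvd M"
  shows "U (en N) w = (if w ^ N = -1 then 1 else 0)" "W (en N) w = 0"
proof -
  have N: "N dvd M" using assms(2) dvd_mult_right by blast
  show "U (en N) w = (if w ^ N = -1 then 1 else 0)" "W (en N) w = 0"
    unfolding en_def UW_linear using UW_kk[OF assms] UW_kk[OF assms(1) N] square_root_minus[of w N] by auto
qed

lemma UW_fn:
  assumes "w ^ M = 1" "2 * N dvd M"
  shows "U (fn N) w = (if w ^ N = -1 then 1 / 2 else 0)" "W (fn N) w = (if w ^ N = -1 then 1 / 2 else 0)"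
proof -
  have N: "N dvd M" using assms(2) dvd_mult_right by blast
  show "U (fn N) w = (if w ^ N = -1 then 1 / 2 else 0)" "W (fn N) w = (if w ^ N = -1 then 1 / 2 else 0)"
    unfolding fn_def UW_linear using UW_hh[OF assms] UW_hh[OF assms(1) N] square_root_minus[of w N] by auto
qed

lemma inv_root: "(1 / w) ^ N = -1 \<longleftrightarrow> w ^ N = (-1::complex)"
  by (simp add: power_divide divide_eq_eq) (metis minus_equation_iff minus_minus mult_minus1 power_eq_0_iff zero_neq_neg_one)

lemma en_left:
  assumes "w ^ M = 1" "2 * N dvd M"
  shows "U (en N \<star> a) w = (if w ^ N = -1 then U a w else 0)" "W (en N \<star> a) w = (if w ^ N = -1 then W a w else 0)"
  unfolding UW_mult[OF assms(1)] UW_en[OF assms] by simp_all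

lemma en_right:
  assumes "w ^ M = 1" "2 * N dvd M"
  shows "U (a \<star> en N) w = (if w ^ N = -1 then U a w else 0)" "W (a \<star> en N) w = (if w ^ N = -1 then W a w else 0)"
  unfolding UW_mult[OF assms(1)] UW_en[OF assms] UW_en[OF powi_half(4)[OF assms(1)] assms(2)] inv_root by simp_all

lemma en_commute: "2 * N dvd M \<Longrightarrow> en N \<star> a = a \<star> en N"
  by (rule fourier_eqI) (simp_all add: en_left en_right)

lemma en_central: "2 * N dvd M \<Longrightarrow> central (en N)"
  unfolding central_def using en_closed en_commute by metis

lemma en_idem: "2 * N dvd M \<Longrightarrow> en N \<star> en N = en N"
  by (rule fourier_eqI) (simp_all add: en_left en_closed UW_en)

lemma en_fn: "2 * N dvd M \<Longrightarrow> en N \<star> fn N = fn N"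
  by (rule fourier_eqI) (simp_all add: en_left fn_closed UW_fn)

lemma fn_idem: "2 * N dvd h \<Longrightarrow> fn N \<star> fn N = fn N"
proof (rule fourier_eqI)
  assume N: "2 * N dvd h"
  note NM = dvd_h_M[OF N]
  fix w :: complex assume w: "w ^ M = 1"
  have wh: "w ^ h = 1" if "w ^ N = -1"
  proof -
    obtain k where "h = 2 * N * k" using N by blast
    then show ?thesis using that by (simp add: power_mult mult.commute[of 2 N])
  qed
  note w' = powi_half(4)[OF w]
  show "U (fn N \<star> fn N) w = U (fn N) w" "W (fn N \<star> fn N) w = W (fn N) w"
    unfolding UW_mult[OF w] UW_fn[OF w NM] UW_fn[OF w' NM] inv_root using wh by auto
qed (simp_all add: fn_closed)

text \<open>The involution that inverts group elements; at every root it becomes the conjugate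
  transpose of the 2x2 matrix.\<close>

definition star :: "('a \<Rightarrow> rat) \<Rightarrow> 'a \<Rightarrow> rat" where
  "star a = (\<lambda>g. if g \<in> carrier G then a (inv g) else 0)"

lemma UW_star:
  assumes w: "w ^ M = 1"
  shows "U (star a) w = U a (1 / w)" "W (star a) w = w ^ h * W a w"
proof -
  have re: "(\<Sum>g\<in>carrier G. of_rat (star a g) * F g) = (\<Sum>g\<in>carrier G. of_rat (a g) * F (inv g))" for F :: "'a \<Rightarrow> complex"
    by (rule sum.reindex_bij_witness[of _ "m_inv G" "m_inv G"]) (auto simp: star_def)
  show "U (star a) w = U a (1 / w)" "W (star a) w = w ^ h * W a w"
    unfolding U_def W_def re sum_distrib_left using fuv_inv[OF w] by (auto intro!: sum.cong simp: mult_ac)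
qed

lemma root_norm: "w ^ M = 1 \<Longrightarrow> norm (w::complex) = 1"
proof -
  assume w: "w ^ M = 1"
  have "norm w ^ M = 1 ^ M" using arg_cong[OF w, of norm] by (simp add: norm_power)
  then show ?thesis using power_eq_imp_eq_base[OF _ norm_ge_zero zero_le_one hM(3)] by blast
qed

lemma root_cnj: "w ^ M = 1 \<Longrightarrow> 1 / w = cnj (w::complex)"
  using complex_norm_square[of w] root_norm[of w] root_nz[of w] by (simp add: divide_eq_eq mult.commute)

lemma UW_cnj: assumes w: "w ^ M = 1" shows "U a (1 / w) = cnj (U a w)" "W a (1 / w) = cnj (W a w)"
  unfolding UW_coeff[OF w] UW_coeff[OF powi_half(4)[OF w]] unfolding root_cnj[OF w]
  by (simp_all add: complex_of_rat_eq)

text \<open>All values lie in the field generated by w, including those at 1/w = w^(M - 1), which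
  are the complex conjugates.\<close>

lemma UW_rpoly:
  assumes w: "w ^ M = 1"
  shows "\<exists>p. U a w = rpoly p w" "\<exists>p. W a w = rpoly p w" "\<exists>p. U a (1 / w) = rpoly p w" "\<exists>p. W a (1 / w) = rpoly p w"
proof -
  have inv: "1 / w = w ^ (M - 1)"
  proof -
    have "w ^ (M - 1) * w = 1" using w hM(3) by (metis One_nat_def Suc_pred power_Suc mult.commute)
    then show ?thesis using root_nz[OF w] by (simp add: divide_eq_eq)
  qed
  show "\<exists>p. U a w = rpoly p w" "\<exists>p. W a w = rpoly p w"
    unfolding UW_coeff[OF w]
    by (intro exI[of _ "\<Sum>m<M. monom (a (el (int m) False)) m"] exI[of _ "\<Sum>m<M. monom (a (el (int m) True)) m"],
        simp add: rpoly_sum)+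
  show "\<exists>p. U a (1 / w) = rpoly p w"
    unfolding UW_coeff[OF powi_half(4)[OF w]] unfolding inv
    by (intro exI[of _ "\<Sum>m<M. monom (a (el (int m) False)) ((M - 1) * m)"]) (simp add: rpoly_sum power_mult)
  show "\<exists>p. W a (1 / w) = rpoly p w"
    unfolding UW_coeff[OF powi_half(4)[OF w]] unfolding inv
    by (intro exI[of _ "\<Sum>m<M. monom (a (el (int m) True)) ((M - 1) * m)"]) (simp add: rpoly_sum power_mult)
qed

text \<open>Combinations of powers of x realize any element of the field of w as a value of
  \<open>U\<close> while \<open>W\<close> vanishes. This supplies the inverse in
  \<open>block_minimal_left\<close>.\<close>

lemma cyclic_elt: "\<exists>a\<in>group_alg G. \<forall>w. w ^ M = 1 \<longrightarrow> U a w = rpoly q w \<and> W a w = 0"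
proof -
  define a where "a = (\<lambda>g. \<Sum>i\<le>degree q. coeff q i * delta (el (int i) False) g)"
  have "a \<in> group_alg G" by (auto simp: a_def group_alg_def delta_def intro!: sum.neutral)
  moreover have "U a w = rpoly q w \<and> W a w = 0" if w: "w ^ M = 1" for w
  proof -
    have s: "(\<Sum>g\<in>carrier G. of_rat (a g) * F g) = (\<Sum>i\<le>degree q. of_rat (coeff q i) * (\<Sum>g\<in>carrier G. of_rat (delta (el (int i) False) g) * F g))"
      for F :: "'a \<Rightarrow> complex"
      unfolding a_def by (simp add: of_rat_sum of_rat_mult sum_distrib_right sum_distrib_left mult.assoc) (rule sum.swap)
    have "U a w = (\<Sum>i\<le>degree q. of_rat (coeff q i) * w ^ i)"
      unfolding U_def s unfolding U_def[symmetric] UW_delta[OF w] by simp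
    moreover have "W a w = 0"
      unfolding W_def s unfolding W_def[symmetric] UW_delta[OF w] by simp
    moreover have "rpoly q w = (\<Sum>i\<le>degree q. of_rat (coeff q i) * w ^ i)"
      unfolding rpoly_def poly_altdef by simp
    ultimately show ?thesis by simp
  qed
  ultimately show ?thesis by blast
qed

context
  fixes N s :: nat and z :: complex
  assumes N: "N = 2 ^ s" and NM: "2 * N dvd M" and z: "z ^ N = -1"
begin

lemma zM: "z ^ M = 1"
proof -
  obtain k where "M = 2 * N * k" using NM by blast
  then show ?thesis using z by (simp add: power_mult mult.commute[of 2 N])
qed

text \<open>An element of the block of \<open>en N\<close> is determined by its image under one primitive root, since the
  images under the other primitive roots are Galois conjugates.\<close>

lemma block_inj:
  assumes a: "a \<in> group_alg G" "en N \<star> a = a" and 0: "U a z = 0" "W a z = 0"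
  shows "a = 0"
proof (rule fourier_eqI[OF a(1) group_alg_closed(3)])
  fix w :: complex assume w: "w ^ M = 1"
  have "U a w = (if w ^ N = -1 then U a w else 0)" "W a w = (if w ^ N = -1 then W a w else 0)"
    using en_left[OF w NM, of a] unfolding a(2) by auto
  moreover have "U a w = 0 \<and> W a w = 0" if wN: "w ^ N = -1"
  proof -
    have c: "rpoly (\<Sum>m<M. monom (a (el (int m) b)) m) w = 0" if "rpoly (\<Sum>m<M. monom (a (el (int m) b)) m) z = 0" for b
      using conjugate_root[of z s w, OF _ _ that] z wN N by simp
    show ?thesis
      using c[of False] c[of True] 0 unfolding UW_coeff[OF w] UW_coeff[OF zM] by (simp add: rpoly_sum)
  qed
  ultimately show "U a w = U 0 w" "W a w = W 0 w" unfolding UW_zero by presburger+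
qed

text \<open>For b = a f nonzero, the value of \<open>U\<close> on b* b is c = |U b|^2 + |W b|^2 > 0,
  and \<open>k2\<close> makes the value of \<open>W\<close> proportional to that of f. So b* b
  agrees at z with k c times f, where k is 1 / \<open>U f z\<close>. The number k c lies in the
  field of z and is nonzero, so some t spanned by powers of x gives t b* b = f at z, and
  \<open>block_inj\<close> lifts this to the group algebra.\<close>

lemma block_minimal_left:
  assumes f: "f \<in> group_alg G" "f \<star> f = f" "en N \<star> f = f"
    and k1: "of_rat k * U f z = 1"
    and k2: "\<And>b. b \<star> f = b \<Longrightarrow> cnj (U b z) * W b z * (1 + z ^ h) = of_rat k * (cnj (U b z) * U b z + cnj (W b z) * W b z) * W f z"
  shows "minimal_left f"
  unfolding minimal_left_def
proof (intro ballI impI)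
  fix a assume "a \<in> group_alg G" and nz: "a \<star> f \<noteq> 0"
  define b where "b = a \<star> f"
  have bf: "b \<star> f = b" by (simp add: b_def ga_assoc f)
  have eb: "en N \<star> b = b"
    unfolding b_def using en_commute[OF NM] f(3) by (metis ga_assoc)
  have "\<not> (U b z = 0 \<and> W b z = 0)" using block_inj[OF _ eb] nz by (auto simp: b_def)
  define c where "c = cnj (U b z) * U b z + cnj (W b z) * W b z"
  have c0: "c \<noteq> 0"
  proof -
    have "c = complex_of_real ((norm (U b z))\<^sup>2 + (norm (W b z))\<^sup>2)"
      unfolding c_def of_real_add complex_norm_square by (simp add: mult.commute)
    moreover have "(norm (U b z))\<^sup>2 + (norm (W b z))\<^sup>2 \<noteq> 0"
      using \<open>\<not> (U b z = 0 \<and> W b z = 0)\<close> by (simp add: sum_power2_eq_zero_iff)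
    ultimately show ?thesis by (metis of_real_eq_0_iff)
  qed
  have k0: "of_rat k \<noteq> (0::complex)" using k1 by auto
  define d where "d = star b \<star> b"
  have Ud: "U d z = c"
    unfolding d_def UW_mult[OF zM] UW_star[OF zM] UW_cnj[OF zM] c_def
    using powi_half(2)[OF zM] by (simp add: mult_ac)
  \<comment> \<open>\<open>W\<close> of b* b consists of the product of the conjugate of
    \<open>U b z\<close> with \<open>W b z\<close>, once plain and once with the factor z^h; this is
    the origin of 1 + z^h in \<open>k2\<close>.\<close>
  have Wd: "W d z = of_rat k * c * W f z"
    using k2[OF bf] unfolding d_def UW_mult[OF zM] UW_star[OF zM] UW_cnj[OF zM] c_def by (simp add: algebra_simps)
  have kc: "\<exists>p. of_rat k * c = rpoly p z"
  proof -
    obtain p1 p2 p3 p4 where "U b z = rpoly p1 z" "W b z = rpoly p2 z" "cnj (U b z) = rpoly p3 z" "cnj (W b z) = rpoly p4 z"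
      using UW_rpoly[OF zM, of b] unfolding UW_cnj[OF zM] by blast
    then have "of_rat k * c = rpoly (monom k 0 * (p3 * p1 + p4 * p2)) z" unfolding c_def by simp
    then show ?thesis by blast
  qed
  then obtain p where p: "of_rat k * c = rpoly p z" by blast
  have "rpoly p z \<noteq> 0" using c0 k0 unfolding p[symmetric] by simp
  then obtain q where q: "rpoly q z * (of_rat k * c) = 1"
    unfolding p using rpoly_inverse[of z s p] z N by metis
  obtain t where t: "t \<in> group_alg G" "U t z = rpoly q z" "W t z = 0" using cyclic_elt[of q] zM by blast
  have "(t \<star> d) - f = 0"
  proof (rule block_inj)
    show "t \<star> d - f \<in> group_alg G" using f(1) by (simp add: group_alg_closed)
    have "en N \<star> (t \<star> d) = t \<star> d"
      unfolding d_def using eb en_commute[OF NM] by (metis ga_assoc)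
    then show "en N \<star> (t \<star> d - f) = t \<star> d - f" by (simp add: ga_diff_right f(3))
    have "rpoly q z * c = U f z"
    proof -
      have "rpoly q z * c = rpoly q z * c * (of_rat k * U f z)" using k1 by simp
      also have "\<dots> = (rpoly q z * (of_rat k * c)) * U f z" by simp
      finally show ?thesis using q by simp
    qed
    then show "U (t \<star> d - f) z = 0" unfolding UW_linear UW_mult[OF zM] t(2,3) Ud by simp
    have "rpoly q z * (of_rat k * c * W f z) = W f z" using q by (simp add: mult.assoc[symmetric])
    then show "W (t \<star> d - f) z = 0" unfolding UW_linear UW_mult[OF zM] t(2,3) Wd by simp
  qed
  then have "t \<star> d = f" by simp
  then have "(t \<star> star b) \<star> (a \<star> f) = f" unfolding d_def b_def[symmetric] by (simp add: ga_assoc)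
  then show "\<exists>c\<in>group_alg G. c \<star> (a \<star> f) = f" by (intro bexI[of _ "t \<star> star b"]) auto
qed

text \<open>Here z^h = 1 and f is a projection of rank one, so b f = b forces W b = t U b, and both
  sides of \<open>k2\<close> become 2 t |U b|^2. The diagonal value 1/2 gives k = 2.\<close>

lemma dihedral_minimal_left:
  assumes Nh: "2 * N dvd h" and f: "f \<in> group_alg G" "f \<star> f = f" "en N \<star> f = f"
    and UW: "U f z = 1 / 2" "W f z = t / 2" and t: "t = 1 \<or> t = -1"
  shows "minimal_left f"
proof (rule block_minimal_left[OF f, where k = 2])
  have zh: "z ^ h = 1"
  proof -
    obtain k where "h = 2 * N * k" using Nh by blast
    then show ?thesis using z by (simp add: power_mult mult.commute[of 2 N])
  qed
  show "of_rat 2 * U f z = 1" unfolding UW(1) by simp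
  fix b assume bf: "b \<star> f = b"
  have ct: "cnj t = t" "t * t = 1" using t by auto
  have "W (b \<star> f) z = U b z * (t / 2) + W b z * cnj (1 / 2)"
    unfolding UW_mult[OF zM] UW_cnj[OF zM] UW ..
  then have "W b z = t * U b z" unfolding bf by (simp add: field_simps)
  then show "cnj (U b z) * W b z * (1 + z ^ h) = of_rat 2 * (cnj (U b z) * U b z + cnj (W b z) * W b z) * W f z"
    unfolding zh UW using ct t by auto
qed

text \<open>Now z^h = -1, so 1 + z^h = 0 and b* b is a scalar at z, the reduced norm of a
  quaternion. Positivity makes every nonzero element of the block invertible.\<close>

lemma faithful_minimal_left:
  assumes Nh: "N = h"
  shows "minimal_left (en N)"
proof (rule block_minimal_left[OF en_closed en_idem[OF NM] en_idem[OF NM], where k = 1])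
  show "of_rat 1 * U (en N) z = 1" using UW_en[OF zM NM] z by simp
  show "cnj (U b z) * W b z * (1 + z ^ h) = of_rat 1 * (cnj (U b z) * U b z + cnj (W b z) * W b z) * W (en N) z" for b
    using UW_en[OF zM NM] z Nh by simp
qed

end

text \<open>Induced from the character of the cyclic group that sends x to w. The entry with w^h
  accounts for y^2 = x^h.\<close>

definition rho :: "complex \<Rightarrow> ('a, complex) rep" where
  "rho w = (2, \<lambda>g. mat 2 2 (\<lambda>(i, j). if i = 0 then (if j = 0 then fu w g else w ^ h * fv w g)
      else (if j = 0 then fv (1 / w) g else fu (1 / w) g)))"

lemma rho_rep: assumes w: "w ^ M = 1" shows "representation G (rho w)"
  unfolding representation_def
proof (intro conjI ballI)
  note w' = powi_half(4)[OF w]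
  show "snd (rho w) g \<in> carrier_mat (fst (rho w)) (fst (rho w))" for g by (simp add: rho_def)
  have "fu w \<one> = 1" "fv w \<one> = 0" "fu (1 / w) \<one> = 1" "fv (1 / w) \<one> = 0"
    using fuv[OF w, of 0 False] fuv[OF w', of 0 False] by (simp_all add: el_one)
  then show "snd (rho w) \<one> = 1\<^sub>m (fst (rho w))" by (auto simp: rho_def intro!: eq_matI)
  fix g g' assume g: "g \<in> carrier G" "g' \<in> carrier G"
  have ww: "w ^ h * w ^ h = 1" by (rule powi_half(2)[OF w])
  note m = fuv_mult[OF w g] fuv_mult[OF w' g]
  show "snd (rho w) (g \<otimes> g') = snd (rho w) g * snd (rho w) g'"
  proof (rule eq_matI)
    fix i j assume "i < dim_row (snd (rho w) g * snd (rho w) g')" "j < dim_col (snd (rho w) g * snd (rho w) g')"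
    then have ij: "i < 2" "j < 2" by (auto simp: rho_def)
    have "(snd (rho w) g * snd (rho w) g') $$ (i, j) = (\<Sum>l<2. snd (rho w) g $$ (i, l) * snd (rho w) g' $$ (l, j))"
      by (rule mat_mult_index[of _ 2 2 _ 2]) (use ij in \<open>auto simp: rho_def\<close>)
    also have "\<dots> = snd (rho w) g $$ (i, 0) * snd (rho w) g' $$ (0, j) + snd (rho w) g $$ (i, 1) * snd (rho w) g' $$ (1, j)"
      by (simp add: numeral_2_eq_2)
    also have "\<dots> = snd (rho w) (g \<otimes> g') $$ (i, j)"
      using ij m powi_half(3)[OF w] by (auto simp: rho_def less_2_cases_iff algebra_simps)
    finally show "snd (rho w) (g \<otimes> g') $$ (i, j) = (snd (rho w) g * snd (rho w) g') $$ (i, j)" by simp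
  qed (auto simp: rho_def)
qed

lemma rho_vec:
  assumes w: "w ^ M = 1" and v: "v \<in> carrier_vec 2"
  shows "snd (rho w) (el m False) *\<^sub>v v = vec 2 (\<lambda>i. if i = 0 then w powi m * v $ 0 else w powi (-m) * v $ 1)"
    "snd (rho w) y *\<^sub>v v = vec 2 (\<lambda>i. if i = 0 then w ^ h * v $ 1 else v $ 0)"
proof -
  note f = fuv[OF w] fuv[OF powi_half(4)[OF w]] inv_powi
  have i: "i < 2 \<Longrightarrow> (snd (rho w) g *\<^sub>v v) $ i = snd (rho w) g $$ (i, 0) * v $ 0 + snd (rho w) g $$ (i, 1) * v $ 1" for g i
    using mat_vec_index[of "snd (rho w) g" 2 2 v i] v by (simp add: rho_def numeral_2_eq_2)
  show "snd (rho w) (el m False) *\<^sub>v v = vec 2 (\<lambda>i. if i = 0 then w powi m * v $ 0 else w powi (-m) * v $ 1)"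
  proof (rule eq_vecI)
    fix j assume "j < dim_vec (vec 2 (\<lambda>i. if i = 0 then w powi m * v $ 0 else w powi (-m) * v $ 1))"
    then have j: "j < 2" by simp
    show "(snd (rho w) (el m False) *\<^sub>v v) $ j = vec 2 (\<lambda>i. if i = 0 then w powi m * v $ 0 else w powi (-m) * v $ 1) $ j"
      unfolding i[OF j] using j by (auto simp: rho_def f less_2_cases_iff)
  qed (simp add: rho_def)
  have yf: "fu w y = 0" "fv w y = 1" "fu (1 / w) y = 0" "fv (1 / w) y = 1"
    using fuv[OF w, of 0 True] fuv[OF powi_half(4)[OF w], of 0 True] by (simp_all add: el_one)
  show "snd (rho w) y *\<^sub>v v = vec 2 (\<lambda>i. if i = 0 then w ^ h * v $ 1 else v $ 0)"
  proof (rule eq_vecI)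
    fix j assume "j < dim_vec (vec 2 (\<lambda>i. if i = 0 then w ^ h * v $ 1 else v $ 0))"
    then have j: "j < 2" by simp
    show "(snd (rho w) y *\<^sub>v v) $ j = vec 2 (\<lambda>i. if i = 0 then w ^ h * v $ 1 else v $ 0) $ j"
      unfolding i[OF j] using j by (auto simp: rho_def yf less_2_cases_iff)
  qed (simp add: rho_def)
qed

text \<open>x has the distinct eigenvalues w and 1/w, and y exchanges the two eigenlines.\<close>

lemma rho_irreducible: assumes w: "w ^ M = 1" and ne: "w \<noteq> 1 / w" shows "irreducible_rep G (rho w)"
  unfolding irreducible_rep_def
proof (intro conjI allI impI)
  show "representation G (rho w)" by (rule rho_rep[OF w])
  have f2: "fst (rho w) = 2" by (simp add: rho_def)
  then show "fst (rho w) > 0" by simp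
  fix S assume S: "invariant_subspace G (rho w) S"
  then have S': "S \<subseteq> carrier_vec 2" "0\<^sub>v 2 \<in> S" "\<And>u v. u \<in> S \<Longrightarrow> v \<in> S \<Longrightarrow> u + v \<in> S" "\<And>c u. u \<in> S \<Longrightarrow> c \<cdot>\<^sub>v u \<in> S"
    "\<And>g u. g \<in> carrier G \<Longrightarrow> u \<in> S \<Longrightarrow> snd (rho w) g *\<^sub>v u \<in> S"
    unfolding invariant_subspace_def f2 by blast+
  show "S = {0\<^sub>v (fst (rho w))} \<or> S = carrier_vec (fst (rho w))"
    unfolding f2
  proof (cases "S = {0\<^sub>v 2}")
    case False
    then obtain v where v: "v \<in> S" "v \<noteq> 0\<^sub>v 2" using S'(2) by blast
    have vc: "v \<in> carrier_vec 2" using v S' by blast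
    have w0: "w \<noteq> 0" "w ^ h \<noteq> 0" using root_nz[OF w] by auto
    have all: "S = carrier_vec 2" if e: "unit_vec 2 0 \<in> S" "unit_vec 2 1 \<in> S"
    proof
      show "carrier_vec 2 \<subseteq> S"
      proof
        fix u :: "complex vec" assume u: "u \<in> carrier_vec 2"
        have "u = u $ 0 \<cdot>\<^sub>v unit_vec 2 0 + u $ 1 \<cdot>\<^sub>v unit_vec 2 1"
          using u by (intro eq_vecI) (auto simp: less_2_cases_iff)
        then show "u \<in> S" using S'(3,4) e by metis
      qed
    qed (rule S')
    have e01: "unit_vec 2 1 \<in> S" if e: "unit_vec 2 0 \<in> S"
    proof -
      have "snd (rho w) y *\<^sub>v unit_vec 2 0 = unit_vec 2 1"
        unfolding rho_vec(2)[OF w unit_vec_carrier] by (intro eq_vecI) (auto simp: less_2_cases_iff)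
      then show ?thesis using S'(5)[OF yG e] by simp
    qed
    have e10: "unit_vec 2 0 \<in> S" if e: "unit_vec 2 1 \<in> S"
    proof -
      have "snd (rho w) y *\<^sub>v unit_vec 2 1 = w ^ h \<cdot>\<^sub>v unit_vec 2 0"
        unfolding rho_vec(2)[OF w unit_vec_carrier] by (intro eq_vecI) (auto simp: less_2_cases_iff)
      then have "(1 / w ^ h) \<cdot>\<^sub>v (w ^ h \<cdot>\<^sub>v unit_vec 2 0) \<in> S" using S'(4)[OF S'(5)[OF yG e], of "1 / w ^ h"] by simp
      then show ?thesis using w0 by (simp add: smult_smult_assoc)
    qed
    have xv: "snd (rho w) (el 1 False) *\<^sub>v v \<in> S" by (rule S'(5)[OF el_closed v(1)])
    have "unit_vec 2 0 \<in> S \<or> unit_vec 2 1 \<in> S"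
    proof (cases "v $ 0 = 0")
      case False
      \<comment> \<open>x - 1/w kills the second coordinate and multiplies the first by a nonzero
        factor.\<close>
      have "(snd (rho w) (el 1 False) *\<^sub>v v) + (- (1 / w)) \<cdot>\<^sub>v v = ((w - 1 / w) * v $ 0) \<cdot>\<^sub>v unit_vec 2 0"
        unfolding rho_vec(1)[OF w vc] using vc
        by (intro eq_vecI) (auto simp: less_2_cases_iff power_int_minus divide_inverse algebra_simps)
      then have "(1 / ((w - 1 / w) * v $ 0)) \<cdot>\<^sub>v (((w - 1 / w) * v $ 0) \<cdot>\<^sub>v unit_vec 2 0) \<in> S"
        using S'(4)[OF S'(3)[OF xv S'(4)[OF v(1), of "- (1 / w)"]]] by metis
      then show ?thesis using False ne by (simp add: smult_smult_assoc)
    next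
      case True
      then have "v $ 1 \<noteq> 0" using v(2) vc by (auto simp: less_2_cases_iff intro!: eq_vecI)
      moreover have "v = v $ 1 \<cdot>\<^sub>v unit_vec 2 1" using True vc by (intro eq_vecI) (auto simp: less_2_cases_iff)
      then have "(1 / v $ 1) \<cdot>\<^sub>v (v $ 1 \<cdot>\<^sub>v unit_vec 2 1) \<in> S" using S'(4)[OF v(1)] by metis
      ultimately show ?thesis by (simp add: smult_smult_assoc)
    qed
    then show "S = {0\<^sub>v 2} \<or> S = carrier_vec 2" using all e01 e10 by blast
  qed simp
qed

lemma rho_character: "character (rho w) g = fu w g + fu (1 / w) g"
  by (simp add: character_def rho_def numeral_2_eq_2)

text \<open>An eigenvector v of x with eigenvalue w, together with y v, defines a homomorphism from
  \<open>rho w\<close>. On the block x^N acts as -1, so w^N = -1; as N is even, w differs from 1/w,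
  and Schur identifies the two representations.\<close>

lemma classify:
  fixes V :: "('a, complex) rep"
  assumes V: "irreducible_rep G V" and NM: "2 * N dvd M" and e: "ract V (en N) = 1\<^sub>m (fst V)"
    and N2: "N \<ge> 2" "even N"
  shows "fst V = 2 \<and> (\<exists>w. w ^ N = -1 \<and> w ^ M = 1 \<and> (\<forall>g\<in>carrier G. character V g = fu w g + fu (1 / w) g))"
proof -
  have R: "representation G V" and d: "fst V > 0" using V by (auto simp: irreducible_rep_def)
  note c = repD(1)[OF R]
  have "\<exists>k v. eigenvector (snd V x) v k"
    using spectrum_non_empty[OF c[OF xG] d] unfolding spectrum_def eigenvalue_def by auto
  then obtain w v where ev: "eigenvector (snd V x) v w" by blast
  then have v: "v \<in> carrier_vec (fst V)" "v \<noteq> 0\<^sub>v (fst V)" "snd V x *\<^sub>v v = w \<cdot>\<^sub>v v"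
    using c[OF xG] unfolding eigenvector_def by auto
  have mv: "snd V (g \<otimes> g') *\<^sub>v u = snd V g *\<^sub>v (snd V g' *\<^sub>v u)" if "g \<in> carrier G" "g' \<in> carrier G" "u \<in> carrier_vec (fst V)" for g g' u
    unfolding repD(3)[OF R that(1,2)] using assoc_mult_mat_vec[OF c[OF that(1)] c[OF that(2)] that(3)] .
  have cv: "snd V g *\<^sub>v u \<in> carrier_vec (fst V)" if "g \<in> carrier G" "u \<in> carrier_vec (fst V)" for g u
    using mult_mat_vec_carrier[OF c[OF that(1)] that(2)] .
  have pown: "snd V (el (int k) False) *\<^sub>v v = w ^ k \<cdot>\<^sub>v v" for k
  proof (induction k)
    case 0
    show ?case using v(1) repD(2)[OF R] by (simp add: el_one)
  next
    case (Suc k)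
    have "el (int (Suc k)) False = x \<otimes> el (int k) False"
      using el_mult[of 1 False "int k" False] by (simp add: el_one)
    then have "snd V (el (int (Suc k)) False) *\<^sub>v v = snd V x *\<^sub>v (w ^ k \<cdot>\<^sub>v v)"
      using mv[OF xG el_closed v(1)] Suc by simp
    also have "\<dots> = w ^ k \<cdot>\<^sub>v (w \<cdot>\<^sub>v v)" using mult_mat_vec[OF c[OF xG] v(1)] v(3) by simp
    finally show ?case by (simp add: smult_smult_assoc mult.commute)
  qed
  have veq: "a = b" if "a \<cdot>\<^sub>v v = b \<cdot>\<^sub>v v" for a b
  proof -
    obtain i where i: "i < fst V" "v $ i \<noteq> 0" using v(1,2) by (metis carrier_vecD eq_vecI index_zero_vec(1,2))
    have "(a \<cdot>\<^sub>v v) $ i = (b \<cdot>\<^sub>v v) $ i" using that by simp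
    then show ?thesis using i v(1) by simp
  qed
  have "el (int M) False = el 0 False" by (simp add: el_eq)
  then have wM: "w ^ M = 1" using veq[of "w ^ M" 1] pown[of M] pown[of 0] by simp
  \<comment> \<open>x^N acts as -1 on the block; this is checked at each root of unity.\<close>
  have "delta (el (int N) False) \<star> en N = (\<lambda>g. - 1 * en N g)"
  proof (rule fourier_eqI)
    show "(\<lambda>g. - 1 * en N g) \<in> group_alg G" by (rule group_alg_closed(4)[OF en_closed])
    fix u :: complex assume u: "u ^ M = 1"
    have "U (\<lambda>g. - 1 * en N g) u = - U (en N) u" "W (\<lambda>g. - 1 * en N g) u = - W (en N) u"
      by (simp_all add: U_def W_def of_rat_minus sum_negf)
    then show "U (delta (el (int N) False) \<star> en N) u = U (\<lambda>g. - 1 * en N g) u"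
      "W (delta (el (int N) False) \<star> en N) u = W (\<lambda>g. - 1 * en N g) u"
      unfolding UW_mult[OF u] UW_delta[OF u] UW_en[OF u NM] by auto
  qed simp
  then have "snd V (el (int N) False) * 1\<^sub>m (fst V) = of_rat (-1) \<cdot>\<^sub>m 1\<^sub>m (fst V)"
    using ract_mult[OF R, of "delta (el (int N) False)" "en N"] ract_delta[OF R el_closed] ract_scale[of V "-1" "en N"] e by simp
  then have "snd V (el (int N) False) = of_rat (-1) \<cdot>\<^sub>m 1\<^sub>m (fst V)"
    unfolding right_mult_one_mat[OF c[OF el_closed]] .
  then have "snd V (el (int N) False) *\<^sub>v v = - 1 \<cdot>\<^sub>v v"
    using v(1) by (intro eq_vecI) (auto simp: of_rat_minus scalar_prod_smult_left)
  then have wN: "w ^ N = -1" using veq pown[of N] by metis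
  have w0: "w \<noteq> 0" by (rule root_nz[OF wM])
  have ne: "w \<noteq> 1 / w"
  proof
    assume "w = 1 / w"
    then have "w * w = 1 / w * w" by (rule arg_cong)
    then have "w ^ 2 = 1" using w0 by (simp add: power2_eq_square)
    then have "w ^ N = 1" using N2(2) by (auto simp: power_mult elim!: evenE)
    then show False using wN by simp
  qed
  have pow: "snd V (el m False) *\<^sub>v v = w powi m \<cdot>\<^sub>v v" for m
  proof -
    have "el m False = el (int (nat (m mod int M))) False" using hM(3) by (simp add: el_eq)
    then have "snd V (el m False) *\<^sub>v v = w powi int (nat (m mod int M)) \<cdot>\<^sub>v v"
      using pown[of "nat (m mod int M)"] unfolding power_int_of_nat by argo
    also have "w powi int (nat (m mod int M)) = w powi m" by (rule powi_period[OF wM]) (use hM(3) in simp)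
    finally show ?thesis .
  qed
  define v' where "v' = snd V y *\<^sub>v v"
  have fy: "fu w y = 0" "fv w y = 1" "fu (1 / w) y = 0" "fv (1 / w) y = 1"
    using fuv[OF wM, of 0 True] fuv[OF powi_half(4)[OF wM], of 0 True] by (simp_all add: el_one)
  have v'c: "v' \<in> carrier_vec (fst V)" unfolding v'_def by (rule cv[OF yG v(1)])
  have z0: "0 \<cdot>\<^sub>v u = 0\<^sub>v (fst V)" if "u \<in> carrier_vec (fst V)" for u :: "complex vec" using that by (intro eq_vecI) auto
  have g1: "snd V g *\<^sub>v v = fu w g \<cdot>\<^sub>v v + fv (1 / w) g \<cdot>\<^sub>v v'" if g: "g \<in> carrier G" for g
  proof -
    obtain m b where g: "g = el m b" using el_exhaust[OF g] by auto
    show ?thesis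
    proof (cases b)
      case True
      have "el m True = y \<otimes> el (- m) False" using el_mult[of 0 True "- m" False] by (simp add: el_one)
      then have "snd V (el m True) *\<^sub>v v = snd V y *\<^sub>v (w powi (- m) \<cdot>\<^sub>v v)" using mv[OF yG el_closed v(1)] pow by simp
      also have "\<dots> = w powi (- m) \<cdot>\<^sub>v v'" unfolding v'_def using mult_mat_vec[OF c[OF yG] v(1)] by simp
      finally show ?thesis unfolding g using True fuv[OF wM] fuv[OF powi_half(4)[OF wM]] inv_powi v(1) v'c z0[OF v(1)] by simp
    next
      case False
      then show ?thesis unfolding g using pow fuv[OF wM] fuv[OF powi_half(4)[OF wM]] v(1) v'c z0[OF v'c] by simp
    qed
  qed
  have g2: "snd V g *\<^sub>v v' = (w ^ h * fv w g) \<cdot>\<^sub>v v + fu (1 / w) g \<cdot>\<^sub>v v'" if g: "g \<in> carrier G" for g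
  proof -
    have "snd V g *\<^sub>v v' = snd V (g \<otimes> y) *\<^sub>v v" unfolding v'_def using mv[OF g yG v(1)] by simp
    also have "\<dots> = fu w (g \<otimes> y) \<cdot>\<^sub>v v + fv (1 / w) (g \<otimes> y) \<cdot>\<^sub>v v'" using g yG by (intro g1) simp
    also have "fu w (g \<otimes> y) = w ^ h * fv w g"
      unfolding fuv_mult[OF wM g yG] fy by simp
    also have "fv (1 / w) (g \<otimes> y) = fu (1 / w) g"
      unfolding fuv_mult[OF powi_half(4)[OF wM] g yG] using fy by simp
    finally show ?thesis .
  qed
  define A where "A = mat (fst V) 2 (\<lambda>(i, j). if j = 0 then v $ i else v' $ i)"
  have Ac: "A \<in> carrier_mat (fst V) 2" by (simp add: A_def)
  have "intertwiner G (rho w) V A"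
    unfolding intertwiner_def
  proof (intro conjI ballI)
    show "A \<in> carrier_mat (fst V) (fst (rho w))" using Ac by (simp add: rho_def)
    fix g assume g: "g \<in> carrier G"
    show "A * snd (rho w) g = snd V g * A"
    proof (rule eq_matI)
      fix i j assume "i < dim_row (snd V g * A)" "j < dim_col (snd V g * A)"
      then have ij: "i < fst V" "j < 2" using c[OF g] Ac by auto
      have "(A * snd (rho w) g) $$ (i, j) = (\<Sum>l<2. A $$ (i, l) * snd (rho w) g $$ (l, j))"
        by (rule mat_mult_index[OF Ac _ ij]) (simp add: rho_def)
      also have "\<dots> = v $ i * snd (rho w) g $$ (0, j) + v' $ i * snd (rho w) g $$ (1, j)"
        using ij by (simp add: A_def numeral_2_eq_2)
      also have "\<dots> = (snd V g *\<^sub>v col A j) $ i"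
      proof (cases "j = 0")
        case True
        then have "col A j = v" using v(1) by (intro eq_vecI) (auto simp: A_def)
        then show ?thesis unfolding \<open>col A j = v\<close> g1[OF g] using True ij v(1) v'c by (simp add: rho_def mult.commute)
      next
        case False
        then have "col A j = v'" using v'c ij by (intro eq_vecI) (auto simp: A_def)
        then show ?thesis unfolding \<open>col A j = v'\<close> g2[OF g] using False ij v(1) v'c by (simp add: rho_def less_2_cases_iff mult.commute)
      qed
      also have "\<dots> = (snd V g * A) $$ (i, j)" using ij c[OF g] Ac by auto
      finally show "(A * snd (rho w) g) $$ (i, j) = (snd V g * A) $$ (i, j)" .
    qed (use c[OF g] Ac in \<open>auto simp: rho_def\<close>)
  qed
  moreover have "A \<noteq> 0\<^sub>m (fst V) (fst (rho w))"
  proof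
    assume A0: "A = 0\<^sub>m (fst V) (fst (rho w))"
    have "v $ i = 0" if "i < fst V" for i
    proof -
      have "A $$ (i, 0) = v $ i" using that by (simp add: A_def)
      then show ?thesis using A0 that by (simp add: rho_def)
    qed
    then have "v = 0\<^sub>v (fst V)" using v(1) by (intro eq_vecI) auto
    then show False using v(2) by simp
  qed
  ultimately have "fst (rho w) = fst V" "\<And>g. g \<in> carrier G \<Longrightarrow> character (rho w) g = character V g"
    using schur_character[OF rho_irreducible[OF wM ne] V] by blast+
  then show ?thesis using wN wM unfolding rho_character by (auto simp: rho_def)
qed

text \<open>The degree is 2 and the order of G is 2 M, so the coefficient at x^j is the trace of w^j
  + w^(-j) divided by M. By the trace formula this is 2N/M on multiples of 2N minus N/M on multiples
  of N, the two averages in \<open>en\<close>.\<close>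

lemma central_idempotent_en:
  fixes V :: "('a, complex) rep"
  assumes d: "fst V = 2" and w: "w ^ N = -1" "w ^ M = 1" and chi: "\<And>g. g \<in> carrier G \<Longrightarrow> character V g = fu w g + fu (1 / w) g"
    and N: "N = 2 ^ s" "s \<ge> 1" "2 * N dvd M"
  shows "central_idempotent G V = en N"
proof (rule ga_eqI)
  note w' = powi_half(4)[OF w(2)]
  have NM: "N dvd M" using N(3) dvd_mult_right by blast
  have N0: "N > 0" using N by simp
  have val: "character V (el m b) = (if b then 0 else w powi m + w powi (- m))" for m b
    using chi[OF el_closed] fuv[OF w(2)] fuv[OF w'] inv_powi by simp
  define S where "S = character V ` carrier G"
  have K: "character_field G V = \<Inter>{K. complex_subfield K \<and> S \<subseteq> K}" by (simp add: character_field_def S_def)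
  have powi_nat: "w powi (- int j) = 1 / w ^ j" for j by (simp add: power_int_minus divide_inverse)
  have S1: "s = 0 \<or> (\<exists>j::nat. s = w ^ j + 1 / w ^ j)" if s: "s \<in> S" for s
  proof -
    obtain p where p: "s = character V (el (int (fst p)) (snd p))" using s unfolding S_def carrier_el by auto
    show ?thesis unfolding p val powi_nat by auto
  qed
  have S2: "w ^ j + 1 / w ^ j \<in> S" for j
  proof -
    have "character V (el (int j) False) = w ^ j + 1 / w ^ j" unfolding val powi_nat by simp
    then show ?thesis unfolding S_def by (metis el_closed imageI)
  qed
  note tr = field_trace_cyclotomic[OF K N(2,1) w(1) S1 S2]
  show "central_idempotent G V \<in> group_alg G" by (simp add: central_idempotent_def group_alg_def)
  fix g assume g: "g \<in> carrier G"
  then obtain j b where gj: "g = el (int j) b" unfolding carrier_el by auto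
  have K1: "character V (inv g) = (if b then 0 else w ^ j + 1 / w ^ j)"
    unfolding gj by (cases b) (simp_all add: el_inv val powi_nat add.commute)
  have cv: "central_idempotent G V g = 2 / of_nat (2 * M) * field_trace (character_field G V) (character V (inv g))"
    using g by (simp add: central_idempotent_def d Coset.order_def card_G)
  have e1: "en N g = (if \<not> b \<and> 2 * N dvd j then of_nat (2 * N) / of_nat M else 0) - (if \<not> b \<and> N dvd j then of_nat N / of_nat M else 0)"
  proof -
    obtain k where k: "M = 2 * N * k" using N(3) by blast
    have k0: "k > 0" using k hM(3) by (cases k) auto
    have d1: "M div (2 * N) = k" unfolding k using N0 by (intro nonzero_mult_div_cancel_left) simp
    have "M = N * (2 * k)" unfolding k by simp
    then have d2: "M div N = 2 * k" using N0 by simp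
    have i: "int (2 * N) dvd int j \<longleftrightarrow> 2 * N dvd j" "int N dvd int j \<longleftrightarrow> N dvd j" by (rule int_dvd_int_iff)+
    have q1: "(1::rat) / of_nat k = of_nat (2 * N) / of_nat M" unfolding k using N0 k0 by simp
    have q2: "(1::rat) / of_nat (2 * k) = of_nat N / of_nat M" unfolding k using N0 k0 by simp
    show ?thesis
      unfolding en_def avg_def gj fun_diff_def el_kk[OF N(3)] el_kk[OF NM] card_kk[OF N(3)] card_kk[OF NM] d1 d2 i q1 q2 ..
  qed
  have dN: "2 * N dvd j \<Longrightarrow> N dvd j" by (rule dvd_mult_right)
  have M0: "(of_nat M :: rat) \<noteq> 0" using hM(3) by simp
  have t: "field_trace (character_field G V) (character V (inv g)) = (if b then 0 else field_trace (character_field G V) (w ^ j + 1 / w ^ j))"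
    unfolding K1 using tr(2) by simp
  show "central_idempotent G V g = en N g"
    unfolding cv t e1 using tr(1)[of j] dN M0 by (cases b; cases "2 * N dvd j"; cases "N dvd j") (simp_all add: field_simps)
qed (rule en_closed)

end

section \<open>Primitive idempotents, and the blocks of the quaternion group\<close>

context quat
begin

lemma cnj_fu: assumes w: "w ^ M = 1" and g: "g \<in> carrier G" shows "cnj (fu w g) = fu (1 / w) g"
proof -
  obtain m b where e: "g = el m b" using el_exhaust[OF g] by auto
  have "cnj (w powi m) = (1 / w) powi m" unfolding root_cnj[OF w] by (simp add: power_int_def)
  then show ?thesis unfolding e fuv[OF w] fuv[OF powi_half(4)[OF w]] by simp
qed

text \<open>The sum is the trace of the matrix of a at w, because complex conjugation exchanges w
  and 1/w.\<close>

lemma sum_character: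
  assumes w: "w ^ M = 1" and chi: "\<And>g. g \<in> carrier G \<Longrightarrow> character V g = fu w g + fu (1 / w) g"
  shows "(\<Sum>g\<in>carrier G. of_rat (a g) * cnj (character V g)) = U a w + U a (1 / w)"
proof -
  have "(\<Sum>g\<in>carrier G. of_rat (a g) * cnj (character V g)) = (\<Sum>g\<in>carrier G. of_rat (a g) * fu w g + of_rat (a g) * fu (1 / w) g)"
    using cnj_fu[OF w] cnj_fu[OF powi_half(4)[OF w]] by (intro sum.cong) (auto simp: chi algebra_simps)
  then show ?thesis by (simp add: U_def sum.distrib)
qed

lemma exists_root: assumes "N > 0" shows "\<exists>z::complex. z ^ N = -1"
proof -
  have "cis (pi / real N) ^ N = -1" using assms by (simp add: DeMoivre)
  then show ?thesis by blast
qed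

text \<open>The conjugate of \<open>fn N\<close> by x^(N/2). Conjugation multiplies the off-diagonal
  entry by w^N = -1, so at these roots the result is the complementary projection.\<close>

definition twist :: "nat \<Rightarrow> 'a \<Rightarrow> rat" where
  "twist N = delta (el (int (N div 2)) False) \<star> (fn N \<star> delta (el (- int (N div 2)) False))"

lemma UW_twist:
  assumes w: "w ^ M = 1" and N: "2 * N dvd M" "even N"
  shows "U (twist N) w = (if w ^ N = -1 then 1 / 2 else 0)" "W (twist N) w = (if w ^ N = -1 then - 1 / 2 else 0)"
proof -
  note w' = powi_half(4)[OF w] and w0 = root_nz[OF w]
  define j where "j = N div 2"
  have Nj: "N = 2 * j" using N(2) by (simp add: j_def)
  have p: "w powi int j * w powi - int j = 1" "w powi int j * (w powi int j) = w ^ N"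
    using w0 by (simp_all add: power_int_minus Nj power_add[symmetric] mult_2)
  have U1: "U (fn N \<star> delta (el (- int j) False)) w = U (fn N) w * w powi - int j"
    "W (fn N \<star> delta (el (- int j) False)) w = W (fn N) w * w powi int j"
    unfolding UW_mult[OF w] UW_delta[OF w] UW_delta[OF w'] inv_powi by simp_all
  have "U (twist N) w = (w powi int j * w powi - int j) * U (fn N) w"
    unfolding twist_def j_def[symmetric] UW_mult(1)[OF w, of "delta (el (int j) False)"] UW_delta[OF w] U1 by simp
  then show "U (twist N) w = (if w ^ N = -1 then 1 / 2 else 0)" unfolding p UW_fn[OF w N(1)] by simp
  have "W (twist N) w = (w powi int j * (w powi int j)) * W (fn N) w"
    unfolding twist_def j_def[symmetric] UW_mult(2)[OF w, of "delta (el (int j) False)"] UW_delta[OF w] U1 by simp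
  then show "W (twist N) w = (if w ^ N = -1 then - 1 / 2 else 0)" unfolding p UW_fn[OF w N(1)] by simp
qed

lemma twist_closed: "twist N \<in> group_alg G"
  by (simp add: twist_def)

lemma fn_twist: "2 * N dvd M \<Longrightarrow> even N \<Longrightarrow> fn N + twist N = en N"
  by (rule fourier_eqI) (auto simp: UW_linear UW_twist UW_fn UW_en en_closed fn_closed twist_closed intro!: group_alg_closed)

context
  fixes N s :: nat
  assumes N: "N = 2 ^ s" "s \<ge> 1" and Nh: "2 * N dvd h"
begin

lemma NM: "2 * N dvd M" by (rule dvd_h_M[OF Nh])

lemma evN: "even N" "N \<ge> 2" "N > 0"
proof -
  have "2 ^ 1 \<le> (2::nat) ^ s" using N(2) by (intro power_increasing) auto
  then show "N \<ge> 2" "N > 0" unfolding N(1) by simp_all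
  show "even N" using N by simp
qed

lemma root_h: "w ^ N = -1 \<Longrightarrow> w ^ h = (1::complex)"
proof -
  assume w: "w ^ N = -1"
  obtain k where "h = 2 * N * k" using Nh by blast
  then show "w ^ h = 1" using w by (simp add: power_mult mult.commute[of 2 N])
qed

lemma twist_props: "twist N \<star> twist N = twist N" "en N \<star> twist N = twist N" "fn N \<star> twist N = 0" "twist N \<star> fn N = 0"
proof -
  note c = UW_twist[OF _ NM evN(1)] UW_fn[OF _ NM]
  have tc: "twist N \<in> group_alg G" by (simp add: twist_def)
  show "twist N \<star> twist N = twist N"
    by (rule fourier_eqI) (auto simp: tc UW_mult c powi_half(4) inv_root root_h)
  show "en N \<star> twist N = twist N"
    by (rule fourier_eqI) (auto simp: tc en_left NM c)
  show "fn N \<star> twist N = 0"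
    by (rule fourier_eqI) (auto simp: UW_mult c powi_half(4) inv_root root_h UW_zero group_alg_closed)
  show "twist N \<star> fn N = 0"
    by (rule fourier_eqI) (auto simp: UW_mult c powi_half(4) inv_root root_h UW_zero group_alg_closed)
qed

lemma fn_minimal: "minimal_left (fn N)" and twist_minimal: "minimal_left (twist N)"
proof -
  obtain z :: complex where z: "z ^ N = -1" using exists_root[OF evN(3)] by blast
  note zM = zM[OF N(1) NM z]
  show "minimal_left (fn N)"
    by (rule dihedral_minimal_left[OF N(1) NM z Nh fn_closed fn_idem[OF Nh] en_fn[OF NM], where t = 1])
      (use UW_fn[OF zM NM] z in auto)
  show "minimal_left (twist N)"
    by (rule dihedral_minimal_left[OF N(1) NM z Nh _ twist_props(1,2), where t = "-1"])
      (use UW_twist[OF zM NM evN(1)] z in \<open>auto simp: twist_def\<close>)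
qed

lemma nonzero_idem: "fn N \<noteq> 0" "twist N \<noteq> 0"
proof -
  obtain z :: complex where z: "z ^ N = -1" using exists_root[OF evN(3)] by blast
  note zM = zM[OF N(1) NM z]
  show "fn N \<noteq> 0" using UW_fn(1)[OF zM NM] z UW_zero(1)[of z] by auto
  show "twist N \<noteq> 0" using UW_twist(1)[OF zM NM evN(1)] z UW_zero(1)[of z] by auto
qed

lemma fn_primitive: "primitive_idempotent G (fn N)" and twist_primitive: "primitive_idempotent G (twist N)"
proof -
  show "primitive_idempotent G (fn N)"
    by (rule minimal_left_primitive[OF fn_minimal])
      (use fn_idem[OF Nh] fn_closed nonzero_idem in \<open>auto simp: ga_idempotent_def zero_fun_def\<close>)
  show "primitive_idempotent G (twist N)"
    by (rule minimal_left_primitive[OF twist_minimal])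
      (use twist_props(1) nonzero_idem in \<open>auto simp: ga_idempotent_def zero_fun_def twist_def\<close>)
qed

text \<open>\<open>fn N\<close> belongs to the sign character of \<open>hh N\<close> with kernel
  \<open>hh (2 * N)\<close>. Its two diagonal entries 1/2 add up to the Schur index 1.\<close>

lemma block_dihedral: "block (en N) (fn N) 2 1"
  unfolding block_def
proof (intro conjI allI impI)
  show "central (en N)" "en N \<star> en N = en N" "en N \<star> fn N = fn N" "minimal_left (fn N)"
    using en_central[OF NM] en_idem[OF NM] en_fn[OF NM] fn_minimal by auto
  have Nd: "N dvd h" using Nh dvd_mult_right by blast
  have NdM: "N dvd M" by (rule dvd_h_M[OF Nd])
  have sub: "hh (2 * N) \<subseteq> hh N" unfolding hh_def by (auto intro: dvd_mult_right)
  have "M div N = 2 * (M div (2 * N))"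
  proof -
    obtain k where "M = 2 * N * k" using NM by blast
    then show ?thesis using evN(3) by (simp add: div_mult_self1_is_m mult.assoc mult.left_commute[of 2 N])
  qed
  then have card: "card (hh N) = 2 * card (hh (2 * N))" using card_hh[OF NdM] card_hh[OF NM] by simp
  show "\<exists>S lam. lchar S lam \<and> chi_idem S lam = fn N"
    using index_two_lchar[OF subgroup_hh[OF Nh] subgroup_hh[OF Nd] sub card] unfolding fn_def by blast
  fix V :: "('a, rat) rep" assume R: "representation G V" and z: "ract V (fn N) = 0\<^sub>m (fst V) (fst V)"
  \<comment> \<open>\<open>twist N\<close> is conjugate to \<open>fn N\<close>, so a representation
    that kills \<open>fn N\<close> kills both summands of \<open>en N\<close>.\<close>
  have "ract V (twist N) = 0\<^sub>m (fst V) (fst V)"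
    unfolding twist_def ract_mult[OF R] z
    by (simp add: left_mult_zero_mat[OF ract_carrier] right_mult_zero_mat[OF ract_carrier])
  then show "ract V (en N) = 0\<^sub>m (fst V) (fst V)"
    unfolding fn_twist[OF NM evN(1), symmetric] ract_add z by simp
next
  fix V :: "('a, complex) rep" assume V: "irreducible_rep G V" and e: "ract V (en N) = 1\<^sub>m (fst V)"
  obtain w where d: "fst V = 2" and w: "w ^ N = -1" "w ^ M = 1" and chi: "\<And>g. g \<in> carrier G \<Longrightarrow> character V g = fu w g + fu (1 / w) g"
    using classify[OF V NM e evN(2,1)] by blast
  show "fst V = 2" by fact
  show "central_idempotent G V = en N" by (rule central_idempotent_en[OF d w chi N NM])
  show "(\<Sum>g\<in>carrier G. of_rat (fn N g) * cnj (character V g)) = of_nat 1"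
    by (rule HOL.trans[OF sum_character[OF w(2) chi]])
      (simp_all add: UW_fn(1)[OF w(2) NM] UW_fn(1)[OF powi_half(4)[OF w(2)] NM] inv_root w(1))
qed

end

lemma h_power: "h = 2 ^ r" "r \<ge> 1" "2 * h dvd M" "even h" "h \<ge> 2"
proof -
  show "h = 2 ^ r" "r \<ge> 1" "2 * h dvd M" using r2 hM by (simp_all add: h_def)
  show "even h" by (rule hM(4))
  then show "h \<ge> 2" using hM(2) by (auto elim!: evenE)
qed

lemma faithful_idem: "minimal_left (en h)" "primitive_idempotent G (en h)"
proof -
  obtain z :: complex where z: "z ^ h = -1" using exists_root[OF hM(2)] by blast
  note zM = zM[OF h_power(1,3) z]
  show m: "minimal_left (en h)" by (rule faithful_minimal_left[OF h_power(1,3) z]) simp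
  have "en h \<noteq> 0" using UW_en(1)[OF zM h_power(3)] z UW_zero(1)[of z] by auto
  then show "primitive_idempotent G (en h)"
    using en_idem[OF h_power(3)] en_closed
    by (intro minimal_left_primitive[OF m]) (auto simp: ga_idempotent_def zero_fun_def)
qed

text \<open>The sign character of the central subgroup of order 2 already cuts out the whole block,
  so f = e. Both diagonal entries are 1 at the relevant roots, which gives the Schur index
  2.\<close>

lemma block_faithful: "block (en h) (en h) 2 2"
  unfolding block_def
proof (intro conjI allI impI)
  note NM = h_power(3)
  show "central (en h)" "en h \<star> en h = en h" "en h \<star> en h = en h" "minimal_left (en h)"
    using en_central[OF NM] en_idem[OF NM] faithful_idem by auto
  have hd: "h dvd M" using NM dvd_mult_right by blast
  have sub: "kk (2 * h) \<subseteq> kk h" unfolding kk_def by (auto intro: dvd_mult_right)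
  have card: "card (kk h) = 2 * card (kk (2 * h))" unfolding card_kk[OF NM] card_kk[OF hd] using hM(1,2) by simp
  show "\<exists>S lam. lchar S lam \<and> chi_idem S lam = en h"
    using index_two_lchar[OF subgroup_kk[OF NM] subgroup_kk[OF hd] sub card] unfolding en_def by blast
next
  note NM = h_power(3)
  fix V :: "('a, complex) rep" assume V: "irreducible_rep G V" and e: "ract V (en h) = 1\<^sub>m (fst V)"
  obtain w where d: "fst V = 2" and w: "w ^ h = -1" "w ^ M = 1" and chi: "\<And>g. g \<in> carrier G \<Longrightarrow> character V g = fu w g + fu (1 / w) g"
    using classify[OF V NM e h_power(5,4)] by blast
  show "fst V = 2" by fact
  show "central_idempotent G V = en h" by (rule central_idempotent_en[OF d w chi h_power(1,2,3)])
  show "(\<Sum>g\<in>carrier G. of_rat (en h g) * cnj (character V g)) = of_nat 2"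
    by (rule HOL.trans[OF sum_character[OF w(2) chi]])
      (simp_all add: UW_en(1)[OF w(2) NM] UW_en(1)[OF powi_half(4)[OF w(2)] NM] inv_root w(1))
qed

lemma block_linear:
  assumes "subgroup T G" "card (carrier G) = 2 * card T"
  shows "block (avg T - avg (carrier G)) (avg T - avg (carrier G)) 1 1"
    and "primitive_idempotent G (avg T - avg (carrier G))"
proof -
  note i = index_two_lchar[OF assms(1) subgroup_self subgroup.subset[OF assms(1)] assms(2)]
  show "block (avg T - avg (carrier G)) (avg T - avg (carrier G)) 1 1" using linear_block[OF i(1)] unfolding i(2) .
  have "(avg T - avg (carrier G)) \<one> \<noteq> 0"
    using assms subgroup.one_closed[OF assms(1)] card_G hM(3) by (auto simp: avg_def)
  then have "avg T - avg (carrier G) \<noteq> (\<lambda>_. 0)" by metis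
  then show "primitive_idempotent G (avg T - avg (carrier G))"
    using linear_minimal_left[OF i(1)] chi_idem_idem[OF i(1)] chi_idem_closed[OF i(1)] unfolding i(2)
    by (intro minimal_left_primitive) (simp_all add: ga_idempotent_def)
qed

lemma block_trivial: "block (avg (carrier G)) (avg (carrier G)) 1 1" "primitive_idempotent G (avg (carrier G))"
proof -
  note i = trivial_lchar
  show "block (avg (carrier G)) (avg (carrier G)) 1 1" using linear_block[OF i(1)] unfolding i(2) .
  have "avg (carrier G) \<one> \<noteq> 0" using card_G hM(3) by (simp add: avg_def)
  then have "avg (carrier G) \<noteq> (\<lambda>_. 0)" by metis
  then show "primitive_idempotent G (avg (carrier G))"
    using linear_minimal_left[OF i(1)] chi_idem_idem[OF i(1)] chi_idem_closed[OF i(1)] unfolding i(2)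
    by (intro minimal_left_primitive) (simp_all add: ga_idempotent_def)
qed

text \<open>The subgroup generated by x^2 and x y, written in the normal form for x and y.\<close>

definition tt :: "'a set" where
  "tt = {el m b | m b. even (m - of_bool b)}"

lemma dvd2: "(1::nat) dvd h" "2 dvd h" "1 dvd M" "2 dvd M"
  using hM(1,4) by simp_all

lemma hh1: "hh 1 = carrier G"
  unfolding hh_def using el_exhaust by auto

lemma el_tt: "el m b \<in> tt \<longleftrightarrow> even (m - of_bool b)"
proof
  assume "el m b \<in> tt"
  then obtain m' where m': "el m b = el m' b" "even (m' - of_bool b)" unfolding tt_def by (auto simp: el_eq)
  have "even m \<longleftrightarrow> even m'" using dvd_mod_M[of 2 m m'] m'(1) dvd2 by (simp add: el_eq)
  then show "even (m - of_bool b)" using m'(2) by simp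
next
  assume "even (m - of_bool b)"
  then show "el m b \<in> tt" unfolding tt_def by blast
qed

lemma avg_values:
  "avg (carrier G) (el m b) = 1 / (2 * of_nat M)" "avg (kk 1) (el m b) = (if b then 0 else 1 / of_nat M)"
  "avg (kk 2) (el m b) = (if \<not> b \<and> even m then 2 / of_nat M else 0)"
  "avg (hh 2) (el m b) = (if even m then 1 / of_nat M else 0)"
proof -
  have k1: "el m b \<in> kk 1 \<longleftrightarrow> \<not> b" and k2: "el m b \<in> kk 2 \<longleftrightarrow> \<not> b \<and> even m" and k3: "el m b \<in> hh 2 \<longleftrightarrow> even m"
    using el_kk[OF dvd2(3), of m b] el_kk[OF dvd2(4), of m b] el_hh[OF dvd2(4), of m b] by simp_all
  have M2: "M div 2 * 2 = M" using dvd2 by simp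
  then have r: "(of_nat (M div 2) :: rat) = of_nat M / 2" by (metis of_nat_mult of_nat_numeral nonzero_eq_divide_eq zero_neq_numeral)
  show "avg (carrier G) (el m b) = 1 / (2 * of_nat M)" by (simp add: avg_def card_G)
  show "avg (kk 1) (el m b) = (if b then 0 else 1 / of_nat M)" unfolding avg_def k1 card_kk[OF dvd2(3)] by simp
  show "avg (kk 2) (el m b) = (if \<not> b \<and> even m then 2 / of_nat M else 0)"
    unfolding avg_def k2 card_kk[OF dvd2(4)] r by simp
  show "avg (hh 2) (el m b) = (if even m then 1 / of_nat M else 0)"
    unfolding avg_def k3 card_hh[OF dvd2(4)] using M2 by (simp add: mult.commute)
qed

text \<open>The four characters of degree 1 are those of the quotient by the commutator subgroup
  \<open>kk 2\<close>; their idempotents sum to the average over it.\<close>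

lemma tt_decomp:
  assumes c: "card tt = M"
  shows "avg (carrier G) + (avg (kk 1) - avg (carrier G)) + (avg (hh 2) - avg (carrier G)) + (avg tt - avg (carrier G)) = avg (kk 2)"
proof (rule ga_eqI)
  have t: "tt \<subseteq> carrier G" by (auto simp: tt_def)
  show "avg (carrier G) + (avg (kk 1) - avg (carrier G)) + (avg (hh 2) - avg (carrier G)) + (avg tt - avg (carrier G)) \<in> group_alg G"
    "avg (kk 2) \<in> group_alg G"
    by (intro group_alg_closed(1,2,6) t kk_sub hh_sub subset_refl)+
  fix g assume "g \<in> carrier G"
  then obtain m b where g: "g = el m b" using el_exhaust by blast
  have "avg tt (el m b) = (if even (m - of_bool b) then 1 / of_nat M else 0)" unfolding avg_def el_tt c by simp
  then show "(avg (carrier G) + (avg (kk 1) - avg (carrier G)) + (avg (hh 2) - avg (carrier G)) + (avg tt - avg (carrier G))) g = avg (kk 2) g"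
    unfolding g plus_fun_def fun_diff_def avg_values using hM(3) by (cases b; cases "even m") (simp_all add: field_simps)
qed

lemma UW_linear_chars:
  assumes c: "card tt = M" and w: "w ^ M = 1"
  shows "U (avg (carrier G)) w = (if w = 1 then 1 / 2 else 0)" "W (avg (carrier G)) w = (if w = 1 then 1 / 2 else 0)"
    "U (avg (kk 1) - avg (carrier G)) w = (if w = 1 then 1 / 2 else 0)" "W (avg (kk 1) - avg (carrier G)) w = (if w = 1 then - 1 / 2 else 0)"
    "U (avg (hh 2) - avg (carrier G)) w = (if w = -1 then 1 / 2 else 0)" "W (avg (hh 2) - avg (carrier G)) w = (if w = -1 then 1 / 2 else 0)"
    "U (avg tt - avg (carrier G)) w = (if w = -1 then 1 / 2 else 0)" "W (avg tt - avg (carrier G)) w = (if w = -1 then - 1 / 2 else 0)"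
proof -
  have sq: "w ^ 2 = 1 \<longleftrightarrow> w = 1 \<or> w = -1" by (rule power2_eq_1_iff)
  note k = UW_kk[OF w dvd2(3)] UW_kk[OF w dvd2(4)] and hG = UW_hh[OF w dvd2(3), unfolded hh1] and h2 = UW_hh[OF w dvd2(4)]
  show 1: "U (avg (carrier G)) w = (if w = 1 then 1 / 2 else 0)" "W (avg (carrier G)) w = (if w = 1 then 1 / 2 else 0)"
    using hG by simp_all
  show 2: "U (avg (kk 1) - avg (carrier G)) w = (if w = 1 then 1 / 2 else 0)" "W (avg (kk 1) - avg (carrier G)) w = (if w = 1 then - 1 / 2 else 0)"
    unfolding UW_linear using k hG by simp_all
  show 3: "U (avg (hh 2) - avg (carrier G)) w = (if w = -1 then 1 / 2 else 0)" "W (avg (hh 2) - avg (carrier G)) w = (if w = -1 then 1 / 2 else 0)"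
    unfolding UW_linear using hG h2 sq by auto
  have key: "d = e - a - b - c" if "a + b + c + d = e" for a b c d e :: complex using that by auto
  \<comment> \<open>The values for \<open>tt\<close> are obtained by subtraction from the other
    three, so no sum over \<open>tt\<close> has to be evaluated.\<close>
  have 4: "U (avg (carrier G)) w + U (avg (kk 1) - avg (carrier G)) w + U (avg (hh 2) - avg (carrier G)) w + U (avg tt - avg (carrier G)) w = U (avg (kk 2)) w"
    "W (avg (carrier G)) w + W (avg (kk 1) - avg (carrier G)) w + W (avg (hh 2) - avg (carrier G)) w + W (avg tt - avg (carrier G)) w = W (avg (kk 2)) w"
    unfolding tt_decomp[OF c, symmetric] by (simp_all only: UW_linear)
  show "U (avg tt - avg (carrier G)) w = (if w = -1 then 1 / 2 else 0)" "W (avg tt - avg (carrier G)) w = (if w = -1 then - 1 / 2 else 0)"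
    using key[OF 4(1)] key[OF 4(2)] unfolding 1 2 3 k sq by simp_all
qed

end

lemma sorted_wrt_concat:
  "(\<And>xs. xs \<in> set xss \<Longrightarrow> sorted_wrt R xs) \<Longrightarrow> sorted_wrt (\<lambda>xs ys. \<forall>x\<in>set xs. \<forall>y\<in>set ys. R x y) xss \<Longrightarrow>
    sorted_wrt R (concat xss)"
  by (induction xss) (auto simp: sorted_wrt_append)

section \<open>Orthogonality and completeness of the idempotents\<close>

context quat
begin

text \<open>Numbered like the factors in the theorem: 0 to 3 are the characters of degree 1, 4 is
  the faithful block with N = h, and the dihedral blocks follow with N from 2^(r - 1) down to
  2.\<close>

definition ee :: "nat \<Rightarrow> 'a \<Rightarrow> rat" where
  "ee l = (if l = 0 then avg (carrier G) else if l = 1 then avg (kk 1) - avg (carrier G)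
     else if l = 2 then avg (hh 2) - avg (carrier G) else if l = 3 then avg tt - avg (carrier G)
     else en (2 ^ (r + 4 - l)))"

definition ff :: "nat \<Rightarrow> 'a \<Rightarrow> rat" where
  "ff l = (if l < 5 then ee l else fn (2 ^ (r + 4 - l)))"

lemma tt_sub: "tt \<subseteq> carrier G"
  by (auto simp: tt_def)

lemma ee_closed: "ee l \<in> group_alg G"
  unfolding ee_def
  by (auto intro!: group_alg_closed(2,6) subset_refl kk_sub hh_sub tt_sub en_closed)

lemma pow_dvd: "k \<le> r \<Longrightarrow> 2 * 2 ^ k dvd M" "k < r \<Longrightarrow> 2 * 2 ^ k dvd h"
  unfolding M_def h_def power_Suc[symmetric] by (rule le_imp_power_dvd, simp)+

lemma ee_supp:
  assumes c: "card tt = M" and w: "w ^ M = 1" and l: "l < r + 4"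
    and P: "\<not> (if l < 2 then w = 1 else if l < 4 then w = -1 else w ^ (2 ^ (r + 4 - l)) = -1)"
  shows "U (ee l) w = 0 \<and> W (ee l) w = 0"
proof -
  note u = UW_linear_chars[OF c w]
  consider "l = 0" | "l = 1" | "l = 2" | "l = 3" | "l \<ge> 4" by linarith
  then show ?thesis
  proof cases
    case 5
    then have "2 * 2 ^ (r + 4 - l) dvd M" by (intro pow_dvd) simp
    from UW_en[OF w this] show ?thesis using P 5 by (simp add: ee_def)
  qed (use P u in \<open>simp_all add: ee_def\<close>)
qed

text \<open>Different blocks have disjoint sets of roots, except that 0 and 1 meet at w = 1 and that
  2 and 3 meet at w = -1. Only these pairs are multiplied out.\<close>

lemma ee_orth:
  assumes c: "card tt = M" and kl: "k < r + 4" "l < r + 4" "k \<noteq> l"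
  shows "ee k \<star> ee l = 0"
proof (rule fourier_eqI)
  fix w :: complex assume w: "w ^ M = 1"
  note w' = powi_half(4)[OF w]
  define P where "P l w \<longleftrightarrow> (if l < 2 then w = 1 else if l < 4 then w = -1 else w ^ (2 ^ (r + 4 - l)) = -1)" for l and w :: complex
  have sk: "\<not> P l w \<Longrightarrow> w ^ M = 1 \<Longrightarrow> l < r + 4 \<Longrightarrow> U (ee l) w = 0 \<and> W (ee l) w = 0" for l w
    unfolding P_def by (rule ee_supp[OF c])
  have Pinv: "P l (1 / w) = P l w" for l
    using root_nz[OF w] unfolding P_def inv_root by (auto simp: divide_eq_eq) (metis minus_minus)
  have U0: "U 0 w = 0" "W 0 w = 0" by (rule UW_zero)+
  have m1: "(-1::complex) ^ h = 1" using hM(4) by simp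
  have "U (ee k \<star> ee l) w = 0 \<and> W (ee k \<star> ee l) w = 0"
  proof (cases "P k w \<and> P l w")
    case False
    show ?thesis
    proof (cases "P k w")
      case True
      then have "\<not> P l w" "\<not> P l (1 / w)" using False Pinv by simp_all
      then show ?thesis unfolding UW_mult[OF w] using sk[OF _ w kl(2)] sk[OF _ w' kl(2)] by simp
    next
      case False
      then show ?thesis unfolding UW_mult[OF w] using sk[OF False w kl(1)] by simp
    qed
  next
    case True
    have ev: "even ((2::nat) ^ (r + 4 - l))" if "l < r + 4" for l using that by simp
    \<comment> \<open>If w^(2^a) = -1, every later iterated square of w is 1.\<close>
    have diff: "\<not> (w ^ (2 ^ a) = -1 \<and> w ^ (2 ^ b) = -1)" if ab: "a < b" for a b :: nat
    proof
      assume a: "w ^ (2 ^ a) = -1 \<and> w ^ (2 ^ b) = -1"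
      obtain d where "b = Suc (a + d)" using ab less_iff_Suc_add by metis
      then have "w ^ (2 ^ b) = (w ^ (2 ^ a)) ^ (2 * 2 ^ d)" by (simp add: power_add power_mult[symmetric] mult_ac)
      then show False using a by simp
    qed
    \<comment> \<open>The roots 1 and -1 have even powers equal to 1, so no two-dimensional block
      contains them.\<close>
    have big: "\<not> (a < 4 \<and> 4 \<le> b \<and> b < r + 4 \<and> P a w \<and> P b w)" for a b
      unfolding P_def using ev[of b] by (auto split: if_splits)
    have "k < 4" "l < 4"
    proof -
      have "\<not> (k \<ge> 4 \<and> l \<ge> 4)"
      proof
        assume a: "k \<ge> 4 \<and> l \<ge> 4"
        then have "r + 4 - k < r + 4 - l \<or> r + 4 - l < r + 4 - k" using kl by linarith
        then show False using diff[of "r + 4 - k" "r + 4 - l"] diff[of "r + 4 - l" "r + 4 - k"] True a unfolding P_def by auto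
      qed
      then show "k < 4" "l < 4" using big[of k l] big[of l k] True kl by linarith+
    qed
    have E: "ee 0 = avg (carrier G)" "ee 1 = avg (kk 1) - avg (carrier G)" "ee 2 = avg (hh 2) - avg (carrier G)"
      "ee 3 = avg tt - avg (carrier G)" by (simp_all add: ee_def)
    note u = UW_linear_chars[OF c w]
    consider "k = 0 \<and> l = 1 \<and> w = 1" | "k = 1 \<and> l = 0 \<and> w = 1" | "k = 2 \<and> l = 3 \<and> w = -1" | "k = 3 \<and> l = 2 \<and> w = -1"
      using True \<open>k < 4\<close> \<open>l < 4\<close> kl(3) unfolding P_def by (auto simp: less_Suc_eq numeral_eq_Suc split: if_splits)
    then show ?thesis
    proof cases
      case 1
      then have k: "k = 0" "l = 1" "w = 1" "1 / w = w" by simp_all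
      show ?thesis unfolding UW_mult[OF w] k(1,2,4) E u using k(3) by simp
    next
      case 2
      then have k: "k = 1" "l = 0" "w = 1" "1 / w = w" by simp_all
      show ?thesis unfolding UW_mult[OF w] k(1,2,4) E u using k(3) by simp
    next
      case 3
      then have k: "k = 2" "l = 3" "w = -1" "1 / w = w" by simp_all
      show ?thesis unfolding UW_mult[OF w] k(1,2,4) E u using k(3) m1 by simp
    next
      case 4
      then have k: "k = 3" "l = 2" "w = -1" "1 / w = w" by simp_all
      show ?thesis unfolding UW_mult[OF w] k(1,2,4) E u using k(3) m1 by simp
    qed
  qed
  then show "U (ee k \<star> ee l) w = U 0 w" "W (ee k \<star> ee l) w = W 0 w" unfolding U0 by auto
qed (simp_all add: group_alg_closed)

lemma kk_M: "kk M = {\<one>}"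
proof
  show "kk M \<subseteq> {\<one>}"
  proof
    fix g assume "g \<in> kk M"
    then obtain m where m: "g = el m False" "int M dvd m" by (auto simp: kk_def)
    then have "el m False = el 0 False" unfolding el_eq by simp
    then show "g \<in> {\<one>}" using m(1) by (simp add: el_one)
  qed
  show "{\<one>} \<subseteq> kk M" unfolding kk_def el_one(1)[symmetric] by auto
qed

lemma avg_one: "avg {\<one>} = delta \<one>"
  by (auto simp: avg_def delta_def)

text \<open>The sum telescopes along the chain of cyclic subgroups, starting from the trivial group
  \<open>kk M\<close>.\<close>

lemma ee_sum_upto:
  assumes c: "card tt = M"
  shows "t \<le> r \<Longrightarrow> (\<Sum>l<4 + t. ee l) = avg (kk 2) + (avg (kk M) - avg (kk (2 ^ (Suc r - t))))"
proof (induction t)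
  case 0
  have "(\<Sum>l<4. ee l) = ee 0 + ee 1 + ee 2 + ee 3" by (simp add: numeral_eq_Suc)
  also have "\<dots> = avg (kk 2)" unfolding tt_decomp[OF c, symmetric] by (simp add: ee_def)
  finally show ?case by (simp add: M_def)
next
  case (Suc t)
  have e: "Suc r - t = Suc (r - t)" "Suc r - Suc t = r - t" "r + 4 - (4 + t) = r - t" using Suc.prems by auto
  have "(\<Sum>l<4 + Suc t. ee l) = (\<Sum>l<4 + t. ee l) + ee (4 + t)"
    by (subst add_Suc_right) (rule sum.lessThan_Suc)
  also have "ee (4 + t) = avg (kk (2 ^ (Suc r - t))) - avg (kk (2 ^ (Suc r - Suc t)))"
    unfolding ee_def e en_def by simp
  finally show ?case using Suc by simp
qed

lemma ee_sum:
  assumes c: "card tt = M"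
  shows "(\<Sum>l<r + 4. ee l) = delta \<one>"
proof -
  have "kk (2 ^ (Suc r - r)) = kk 2" by simp
  then show ?thesis using ee_sum_upto[OF c le_refl] unfolding kk_M avg_one by (simp add: add.commute)
qed

lemma tt_subgroup_hyp:
  assumes "subgroup tt G" "card tt = M" shows "card (carrier G) = 2 * card tt"
  using assms card_G by simp

lemma index_two: "card (carrier G) = 2 * card (kk 1)" "card (carrier G) = 2 * card (hh 2)"
proof -
  show "card (carrier G) = 2 * card (kk 1)" using card_kk[OF dvd2(3)] card_G by simp
  have "M = 2 * (M div 2)" using dvd2(4) by simp
  then show "card (carrier G) = 2 * card (hh 2)" using card_hh[OF dvd2(4)] card_G by simp
qed

lemma ee_block:
  assumes c: "card tt = M" "subgroup tt G" and l: "l < r + 4"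
  shows "block (ee l) (ff l) (if l < 4 then 1 else 2) (if l = 4 then 2 else 1)"
    "l < 5 \<Longrightarrow> primitive_idempotent G (ee l)"
proof -
  consider "l = 0" | "l = 1" | "l = 2" | "l = 3" | "l = 4" | "l \<ge> 5" by linarith
  then have "block (ee l) (ff l) (if l < 4 then 1 else 2) (if l = 4 then 2 else 1) \<and> (l < 5 \<longrightarrow> primitive_idempotent G (ee l))"
  proof cases
    case 1
    then show ?thesis using block_trivial by (simp add: ee_def ff_def)
  next
    case 2
    then show ?thesis using block_linear[OF subgroup_kk[OF dvd2(3)] index_two(1)] by (simp add: ee_def ff_def)
  next
    case 3
    then show ?thesis using block_linear[OF subgroup_hh[OF dvd2(2)] index_two(2)] by (simp add: ee_def ff_def)
  next
    case 4
    then show ?thesis using block_linear[OF c(2) tt_subgroup_hyp[OF c(2,1)]] by (simp add: ee_def ff_def)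
  next
    case 5
    then have "ee l = en h" by (simp add: ee_def h_def)
    then show ?thesis using 5 block_faithful faithful_idem by (simp add: ff_def)
  next
    case 6
    have "block (en (2 ^ (r + 4 - l))) (fn (2 ^ (r + 4 - l))) 2 1"
      using l 6 by (intro block_dihedral[OF HOL.refl] pow_dvd(2)) simp_all
    then show ?thesis using 6 by (simp add: ee_def ff_def)
  qed
  then show "block (ee l) (ff l) (if l < 4 then 1 else 2) (if l = 4 then 2 else 1)"
    "l < 5 \<Longrightarrow> primitive_idempotent G (ee l)" by auto
qed

theorem quat_irreps:
  assumes c: "card tt = M" "subgroup tt G"
  shows "\<exists>Ws. rational_irreps G Ws \<and> length Ws = r + 4 \<and>
    (\<forall>l<r + 4. \<forall>V. associated G (Ws ! l) V \<longrightarrow>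
      fst V = (if l < 4 then 1 else 2) \<and> central_idempotent G V = ee l \<and> schur_index G (Ws ! l) V = (if l = 4 then 2 else 1))"
proof -
  define bs where "bs = map (\<lambda>l. (ee l, ff l, (if l < 4 then 1 else 2)::nat, (if l = 4 then 2 else 1)::nat)) [0..<r + 4]"
  have len: "length bs = r + 4" by (simp add: bs_def)
  have nth: "bs ! l = (ee l, ff l, if l < 4 then 1 else 2, if l = 4 then 2 else 1)" if "l < r + 4" for l
    using that by (simp add: bs_def del: upt_Suc)
  have "map fst bs = map ee [0..<r + 4]" by (simp add: bs_def comp_def)
  then have s: "(\<Sum>e\<leftarrow>map fst bs. e) = delta \<one>"
    using ee_sum[OF c(1)] by (simp add: interv_sum_list_conv_sum_set_nat atLeast0LessThan del: upt_Suc)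
  have "\<exists>Ws. rational_irreps G Ws \<and> length Ws = length bs \<and>
    (\<forall>l<length Ws. \<forall>V. associated G (Ws ! l) V \<longrightarrow>
      (case bs ! l of (e, f, d, s) \<Rightarrow> fst V = d \<and> central_idempotent G V = e \<and> schur_index G (Ws ! l) V = s))"
  proof (rule blocks_rational_irreps)
    show "case bs ! l of (e, f, d, s) \<Rightarrow> block e f d s" if "l < length bs" for l
      using that ee_block(1)[OF c, of l] nth[of l] unfolding len by (simp split del: if_split)
    show "fst (bs ! k) \<star> fst (bs ! l) = 0" if "k < length bs" "l < length bs" "k \<noteq> l" for k l
      using that ee_orth[OF c(1), of k l] nth[of k] nth[of l] unfolding len by simp
  qed (rule s)
  then obtain Ws where W: "rational_irreps G Ws" "length Ws = r + 4" "\<And>l V. l < r + 4 \<Longrightarrow> associated G (Ws ! l) V \<Longrightarrow>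
      (case bs ! l of (e, f, d, s) \<Rightarrow> fst V = d \<and> central_idempotent G V = e \<and> schur_index G (Ws ! l) V = s)"
    unfolding len by auto
  have "fst V = (if l < 4 then 1 else 2) \<and> central_idempotent G V = ee l \<and> schur_index G (Ws ! l) V = (if l = 4 then 2 else 1)"
    if "l < r + 4" "associated G (Ws ! l) V" for l V
    using W(3)[OF that] unfolding nth[OF that(1)] by (simp split del: if_split)
  then show ?thesis using W(1,2) by blast
qed

text \<open>Abstracts the choice of primitive idempotents in the dihedral blocks, so that the
  choices belonging to y and to x y share all that follows.\<close>

definition splitting :: "(nat \<Rightarrow> ('a \<Rightarrow> rat) list) \<Rightarrow> bool" where
  "splitting fs \<longleftrightarrow> (\<forall>k. 1 \<le> k \<and> k < r \<longrightarrow>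
     (\<forall>f\<in>set (fs (2 ^ k)). primitive_idempotent G f \<and> en (2 ^ k) \<star> f = f \<and> f \<star> en (2 ^ k) = f) \<and>
     sorted_wrt (ga_orthogonal G) (fs (2 ^ k)) \<and> en (2 ^ k) = (\<lambda>g. \<Sum>f\<leftarrow>fs (2 ^ k). f g))"

lemma splitting_fn: "splitting (\<lambda>N. [fn N, twist N])"
  unfolding splitting_def
proof (intro allI impI)
  fix k assume k: "1 \<le> k \<and> k < r"
  define N :: nat where "N = 2 ^ k"
  have Nh: "2 * N dvd h" unfolding N_def by (rule pow_dvd(2)) (use k in simp)
  have evN: "even N" and k1: "k \<ge> 1" using k by (simp_all add: N_def)
  note t = twist_props[OF N_def k1 Nh] and NM = dvd_h_M[OF Nh]
  have r: "fn N \<star> en N = fn N" "twist N \<star> en N = twist N"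
    using en_commute[OF NM] en_fn[OF NM] t(2) by metis+
  have s: "en N = (\<lambda>g. \<Sum>f\<leftarrow>[fn N, twist N]. f g)"
    unfolding fn_twist[OF NM evN, symmetric] by (simp add: plus_fun_def)
  show "(\<forall>f\<in>set [fn (2 ^ k), twist (2 ^ k)]. primitive_idempotent G f \<and> en (2 ^ k) \<star> f = f \<and> f \<star> en (2 ^ k) = f) \<and>
     sorted_wrt (ga_orthogonal G) [fn (2 ^ k), twist (2 ^ k)] \<and> en (2 ^ k) = (\<lambda>g. \<Sum>f\<leftarrow>[fn (2 ^ k), twist (2 ^ k)]. f g)"
    unfolding N_def[symmetric]
    using t fn_primitive[OF N_def k1 Nh] twist_primitive[OF N_def k1 Nh] en_fn[OF NM] r s
    by (intro conjI) (simp_all add: ga_orthogonal_def zero_fun_def)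
qed

definition gl :: "(nat \<Rightarrow> ('a \<Rightarrow> rat) list) \<Rightarrow> nat \<Rightarrow> ('a \<Rightarrow> rat) list" where
  "gl fs l = (if l < 5 then [ee l] else fs (2 ^ (r + 4 - l)))"

context
  fixes fs
  assumes c: "card tt = M" "subgroup tt G" and fs: "splitting fs"
begin

lemma gl_props:
  assumes l: "l < r + 4"
  shows "f \<in> set (gl fs l) \<Longrightarrow> primitive_idempotent G f"
    "f \<in> set (gl fs l) \<Longrightarrow> ee l \<star> f = f \<and> f \<star> ee l = f"
    "sorted_wrt (ga_orthogonal G) (gl fs l)" "ee l = (\<lambda>g. \<Sum>f\<leftarrow>gl fs l. f g)"
proof -
  have "(\<forall>f\<in>set (gl fs l). primitive_idempotent G f \<and> ee l \<star> f = f \<and> f \<star> ee l = f) \<and>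
    sorted_wrt (ga_orthogonal G) (gl fs l) \<and> ee l = (\<lambda>g. \<Sum>f\<leftarrow>gl fs l. f g)"
  proof (cases "l < 5")
    case True
    then have "primitive_idempotent G (ee l)" using ee_block(2)[OF c l] by simp
    then show ?thesis using True by (auto simp: gl_def primitive_idempotent_def ga_idempotent_def)
  next
    case False
    define k where "k = r + 4 - l"
    have k: "1 \<le> k \<and> k < r" using False l by (auto simp: k_def)
    have g: "gl fs l = fs (2 ^ k)" "ee l = en (2 ^ k)" using False by (simp_all add: gl_def k_def ee_def)
    show ?thesis unfolding g using fs k unfolding splitting_def by blast
  qed
  then show "f \<in> set (gl fs l) \<Longrightarrow> primitive_idempotent G f"
    "f \<in> set (gl fs l) \<Longrightarrow> ee l \<star> f = f \<and> f \<star> ee l = f"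
    "sorted_wrt (ga_orthogonal G) (gl fs l)" "ee l = (\<lambda>g. \<Sum>f\<leftarrow>gl fs l. f g)" by blast+
qed

text \<open>Each idempotent absorbs the central idempotent of its own block, and central idempotents
  of different blocks multiply to zero.\<close>

lemma gl_orth:
  assumes kl: "k < r + 4" "l < r + 4" "k \<noteq> l"
    and f: "f \<in> set (gl fs k)" "f' \<in> set (gl fs l)"
  shows "f \<star> f' = 0"
proof -
  have "f \<star> f' = (f \<star> ee k) \<star> (ee l \<star> f')" using gl_props(2)[OF kl(1) f(1)] gl_props(2)[OF kl(2) f(2)] by simp
  also have "\<dots> = f \<star> ((ee k \<star> ee l) \<star> f')" by (simp add: ga_assoc)
  finally show ?thesis unfolding ee_orth[OF c(1) kl] by simp
qed

lemma gl_sorted: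
  shows "sorted_wrt (ga_orthogonal G) (concat (map (gl fs) [0..<r + 4]))"
proof (rule sorted_wrt_concat)
  show "sorted_wrt (ga_orthogonal G) xs" if "xs \<in> set (map (gl fs) [0..<r + 4])" for xs
    using that gl_props(3) by auto
  have "ga_orthogonal G f f'" if "k < l" "l < r + 4" "f \<in> set (gl fs k)" "f' \<in> set (gl fs l)" for k l f f'
    using gl_orth[of k l f f'] gl_orth[of l k f' f] that by (simp add: ga_orthogonal_def zero_fun_def)
  then show "sorted_wrt (\<lambda>xs ys. \<forall>x\<in>set xs. \<forall>y\<in>set ys. ga_orthogonal G x y) (map (gl fs) [0..<r + 4])"
    unfolding sorted_wrt_iff_nth_less by (simp del: upt_Suc)
qed

lemma gl_sum:
  shows "(\<Sum>f\<leftarrow>concat (map (gl fs) [0..<r + 4]). f) = delta \<one>"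
proof -
  have "ee l = sum_list (gl fs l)" if "l < r + 4" for l
  proof -
    have "(\<Sum>f\<leftarrow>fs. f g) = sum_list fs g" for fs :: "('a \<Rightarrow> rat) list" and g by (induction fs) auto
    then show ?thesis using gl_props(4)[OF that] by (simp add: fun_eq_iff)
  qed
  then have "(\<Sum>l<r + 4. sum_list (gl fs l)) = delta \<one>" using ee_sum[OF c(1)] by simp
  moreover have "sum_list (concat (map (gl fs) ls)) = (\<Sum>l\<leftarrow>ls. sum_list (gl fs l))" for ls by (induction ls) auto
  ultimately show ?thesis by (simp add: interv_sum_list_conv_sum_set_nat atLeast0LessThan del: upt_Suc)
qed

end

end

section \<open>The presentation\<close>

lemma word_eq_congr: "word_eq R u v \<Longrightarrow> word_eq R (a @ u @ b) (a @ v @ b)"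
proof (induction rule: word_eq.induct)
  case (cancel u c d v)
  show ?case using word_eq.cancel[of R "a @ u" c d "v @ b"] by simp
next
  case (relator w u v)
  show ?case using word_eq.relator[OF relator, of "a @ u" "v @ b"] by simp
qed (auto intro: word_eq.intros)

lemma word_class_eq: "word_class R u = word_class R v \<longleftrightarrow> word_eq R u v"
proof
  assume "word_class R u = word_class R v"
  moreover have "v \<in> word_class R v" by (simp add: word_class_def word_eq.refl)
  ultimately have "v \<in> word_class R u" by simp
  then show "word_eq R u v" by (simp add: word_class_def)
next
  assume uv: "word_eq R u v"
  show "word_class R u = word_class R v"
    unfolding word_class_def
  proof (rule Collect_cong)
    show "word_eq R u w = word_eq R v w" for w
      using word_eq.trans[OF uv, of w] word_eq.trans[OF word_eq.sym[OF uv], of w] by blast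
  qed
qed

lemma presented_group_mult:
  "word_class R u \<otimes>\<^bsub>presented_group R\<^esub> word_class R v = word_class R (u @ v)"
proof -
  have e: "word_class R (u' @ v') = word_class R (u @ v)" if "u' \<in> word_class R u" "v' \<in> word_class R v" for u' v'
  proof -
    have "word_eq R (u @ v) (u' @ v)" "word_eq R (u' @ v) (u' @ v')"
      using that word_eq_congr[of R u u' "[]" v] word_eq_congr[of R v v' u' "[]"] by (simp_all add: word_class_def)
    then show ?thesis unfolding word_class_eq by (blast intro: word_eq.trans word_eq.sym)
  qed
  have m: "u \<in> word_class R u" "v \<in> word_class R v" by (simp_all add: word_class_def word_eq.refl)
  have "(\<Union>u'\<in>word_class R u. \<Union>v'\<in>word_class R v. word_class R (u' @ v')) = word_class R (u @ v)"
  proof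
    show "(\<Union>u'\<in>word_class R u. \<Union>v'\<in>word_class R v. word_class R (u' @ v')) \<subseteq> word_class R (u @ v)"
      by (intro UN_least) (simp add: e)
    show "word_class R (u @ v) \<subseteq> (\<Union>u'\<in>word_class R u. \<Union>v'\<in>word_class R v. word_class R (u' @ v'))"
      using m by blast
  qed
  then show ?thesis by (simp add: presented_group_def)
qed

text \<open>Left multiplication by a letter on normal forms x^m y^b, written (m, b), with exponents
  modulo 2 k. The action separates normal forms, which shows that the presented group does not
  collapse. Since the inverse of y is x^k y, the shift by k occurs exactly when s = b.\<close>

fun letter_act :: "int \<Rightarrow> qgen \<times> bool \<Rightarrow> int \<times> bool \<Rightarrow> int \<times> bool" where
  "letter_act k (gen_x, s) (m, b) = ((if s then m + 1 else m - 1) mod (2 * k), b)"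
| "letter_act k (gen_y, s) (m, b) = ((if s = b then k - m else - m) mod (2 * k), \<not> b)"

definition word_act :: "int \<Rightarrow> (qgen \<times> bool) list \<Rightarrow> int \<times> bool \<Rightarrow> int \<times> bool" where
  "word_act k w = foldr (letter_act k) w"

lemma word_act_append: "word_act k (u @ v) s = word_act k u (word_act k v s)"
  by (simp add: word_act_def)

lemma word_act_replicate_x:
  "0 \<le> m \<Longrightarrow> m < 2 * k \<Longrightarrow> word_act k (replicate j (gen_x, True)) (m, b) = ((m + int j) mod (2 * k), b)"
  by (induction j) (simp_all add: word_act_def mod_add_left_eq mod_add_right_eq ac_simps)

lemma letter_act_bounds: "k > 0 \<Longrightarrow> fst (letter_act k l s) \<in> {0..<2 * k}"
  by (cases "(k, l, s)" rule: letter_act.cases) auto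

lemma word_act_bounds: "k > 0 \<Longrightarrow> fst s \<in> {0..<2 * k} \<Longrightarrow> fst (word_act k w s) \<in> {0..<2 * k}"
  by (cases w) (auto simp: word_act_def simp del: atLeastLessThan_iff intro: letter_act_bounds)

lemma word_act_cancel:
  assumes "0 \<le> m" "m < 2 * k" shows "letter_act k (a, c) (letter_act k (a, \<not> c) (m, b)) = (m, b)"
  using assms by (cases a; cases b; cases c) (auto simp: mod_simps)

text \<open>Cancelling pairs and relators act as the identity on normal forms, so the action is an
  invariant of the class of a word.\<close>

lemma word_act_eq:
  assumes n: "n \<ge> 2" and k: "k = 2 ^ (n - 2)"
  shows "word_eq (quat_relators n) u v \<Longrightarrow> fst s \<in> {0..<2 * k} \<Longrightarrow> word_act k u s = word_act k v s"
proof (induction arbitrary: s rule: word_eq.induct)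
  case (cancel u c d v)
  obtain m b where s: "word_act k v s = (m, b)" by (cases "word_act k v s")
  have "0 \<le> m" "m < 2 * k" using word_act_bounds[of k s v] cancel k s by auto
  then have "word_act k [(c, d), (c, \<not> d)] (m, b) = (m, b)" using word_act_cancel[of m k c d b] by (simp add: word_act_def)
  then show ?case unfolding word_act_append s by simp
next
  case (relator w u v)
  obtain m b where s: "word_act k v s = (m, b)" by (cases "word_act k v s")
  have m: "0 \<le> m" "m < 2 * k" using word_act_bounds[of k s v] relator k s by auto
  have M: "int (2 ^ (n - 1)) = 2 * k" "int (2 ^ (n - 2)) = k"
  proof -
    have "n - 1 = Suc (n - 2)" using n by simp
    then show "int (2 ^ (n - 1)) = 2 * k" by (simp add: k)
  qed (simp add: k)
  note X = word_act_replicate_x[OF m, of _ b]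
  have "word_act k w (m, b) = (m, b)"
    using relator(1) unfolding quat_relators_def
  proof (elim insertE emptyE)
    assume "w = replicate (2 ^ (n - 1)) (gen_x, True)"
    then show ?thesis using X[of "2 ^ (n - 1)"] M m by (simp del: of_nat_power)
  next
    assume w: "w = replicate 2 (gen_y, True) @ replicate (2 ^ (n - 2)) (gen_x, True)"
    have "word_act k w (m, b) = word_act k [(gen_y, True), (gen_y, True)] ((m + k) mod (2 * k), b)"
      unfolding w word_act_append X M by (simp add: numeral_2_eq_2)
    also have "\<dots> = (m, b)" using m by (cases b) (simp_all add: word_act_def mod_simps)
    finally show ?thesis .
  next
    assume "w = [(gen_y, True), (gen_x, True), (gen_y, False), (gen_x, True)]"
    then show ?thesis using m by (cases b) (simp_all add: word_act_def mod_simps)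
  qed
  then show ?case unfolding word_act_append s by simp
qed auto

text \<open>Normal forms exist because left multiplication by letters preserves them, and they are
  unique because a word acting on (0, False) returns its exponents.\<close>

lemma quat_of_presentation:
  fixes G (structure)
  assumes G: "group G" and fin: "finite (carrier G)" and n: "n \<ge> 4" and phi: "\<phi> \<in> iso (quat_group n) G"
  shows "quat G (\<phi> (quat_x n)) (\<phi> (quat_y n)) (n - 2)"
proof -
  interpret fin_group G by (rule fin_group.intro[OF G]) (simp add: fin_group_axioms_def fin)
  define R where "R = quat_relators n"
  define F where "F u = \<phi> (word_class R u)" for u
  define x where "x = \<phi> (quat_x n)"
  define y where "y = \<phi> (quat_y n)"
  define k :: nat where "k = 2 ^ (n - 2)"
  have Q: "carrier (quat_group n) = range (word_class R)" by (simp add: quat_group_def presented_group_def R_def)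
  have hom: "\<phi> \<in> hom (quat_group n) G" and bij: "bij_betw \<phi> (carrier (quat_group n)) (carrier G)"
    using phi by (auto simp: Group.iso_def)
  have F_mult: "F (u @ v) = F u \<otimes> F v" for u v
    using hom_mult[OF hom, of "word_class R u" "word_class R v"] presented_group_mult[of R u v]
    unfolding F_def Q by (simp add: quat_group_def R_def)
  have F_closed: "F u \<in> carrier G" for u using hom_in_carrier[OF hom, of "word_class R u"] unfolding F_def Q by simp
  have F_inj: "word_eq R u v" if "F u = F v" for u v
    using bij_betw_imp_inj_on[OF bij] that unfolding F_def Q inj_on_def word_class_eq[symmetric] by blast
  have F_surj: "\<exists>u. g = F u" if "g \<in> carrier G" for g
    using bij that unfolding bij_betw_def Q F_def by auto
  have F_eq: "F u = F v" if "word_eq R u v" for u v using that unfolding F_def word_class_eq[symmetric] by simp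
  have F_one: "F [] = \<one>" using F_mult[of "[]" "[]"] F_closed[of "[]"] by simp
  have F_rel: "F w = \<one>" if "w \<in> R" for w using F_eq[OF word_eq.relator[OF that, of "[]" "[]"]] F_one by simp
  have x: "x = F [(gen_x, True)]" and y: "y = F [(gen_y, True)]"
    by (simp_all add: x_def y_def quat_x_def quat_y_def F_def R_def)
  have xG: "x \<in> carrier G" and yG: "y \<in> carrier G" unfolding x y by (rule F_closed)+
  have F_inv: "F [(a, False)] = inv (F [(a, True)])" for a
  proof -
    have "F ([(a, False)] @ [(a, True)]) = \<one>" using F_eq[OF word_eq.cancel[of R "[]" a False "[]"]] F_one by simp
    then show ?thesis unfolding F_mult by (metis F_closed inv_equality)
  qed
  have F_rep: "F (replicate j (a, True)) = F [(a, True)] [^] j" for a j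
  proof (induction j)
    case (Suc j)
    have "F (replicate (Suc j) (a, True)) = F [(a, True)] \<otimes> F (replicate j (a, True))" using F_mult[of "[(a, True)]" "replicate j (a, True)"] by simp
    then show ?case unfolding nat_pow_Suc2[OF F_closed] Suc.IH .
  qed (simp add: F_one)
  have n1: "n - 1 = Suc (n - 2)" using n by simp
  have xM: "x [^] ((2::nat) ^ Suc (n - 2)) = \<one>"
    using F_rel[of "replicate (2 ^ (n - 1)) (gen_x, True)"] unfolding F_rep x n1[symmetric] by (simp add: R_def quat_relators_def)
  have xk: "x [^] k \<in> carrier G" using xG by simp
  have xkk: "x [^] k \<otimes> x [^] k = \<one>" using xM xG by (simp add: k_def nat_pow_mult mult_2)
  have "F (replicate 2 (gen_y, True) @ replicate (2 ^ (n - 2)) (gen_x, True)) = \<one>" by (rule F_rel) (simp add: R_def quat_relators_def)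
  then have "(y \<otimes> y) \<otimes> x [^] k = \<one>" unfolding F_mult F_rep x[symmetric] y[symmetric] k_def[symmetric] using yG by (simp add: numeral_2_eq_2)
  \<comment> \<open>The relator reads y^2 x^k = 1. As x^k is its own inverse, y^2 = x^k.\<close>
  then have "y \<otimes> y = inv (x [^] k)" using xk yG by (intro inv_equality[symmetric]) simp_all
  also have "\<dots> = x [^] k" using xkk xk by (intro inv_equality) simp_all
  finally have yy: "y \<otimes> y = x [^] k" .
  have "F [(gen_y, True), (gen_x, True), (gen_y, False), (gen_x, True)] = \<one>" by (rule F_rel) (simp add: R_def quat_relators_def)
  moreover have "F [(gen_y, True), (gen_x, True), (gen_y, False), (gen_x, True)] = y \<otimes> x \<otimes> inv y \<otimes> x"
    using F_mult[of "[(gen_y, True)]" "[(gen_x, True), (gen_y, False), (gen_x, True)]"] F_mult[of "[(gen_x, True)]" "[(gen_y, False), (gen_x, True)]"]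
      F_mult[of "[(gen_y, False)]" "[(gen_x, True)]"] xG yG
    unfolding append.simps F_inv x[symmetric] y[symmetric] by (simp add: m_assoc)
  ultimately have "(y \<otimes> x \<otimes> inv y) \<otimes> x = \<one>" by simp
  then have "y \<otimes> x \<otimes> inv y = inv x" using xG yG by (intro inv_equality[symmetric]) simp_all
  then have "inv x \<otimes> y = (y \<otimes> x \<otimes> inv y) \<otimes> y" by simp
  then have yx: "y \<otimes> x = inv x \<otimes> y" using xG yG by (simp add: m_assoc)
  note yp = inverting_pow[OF xG yG yx]
  define el where "el m b = x [^] (m::int) \<otimes> (if b then y else \<one>)" for m b
  have el_closed: "el m b \<in> carrier G" for m b using xG yG by (simp add: el_def)
  have x_el: "x [^] (j::int) \<otimes> el m b = el (j + m) b" for j m b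
    using xG yG by (simp add: el_def int_pow_mult m_assoc)
  have y_el: "y \<otimes> el m b = (if b then el (- m + int k) False else el (- m) True)" for m b
  proof -
    have "y \<otimes> el m b = (y \<otimes> x [^] m) \<otimes> (if b then y else \<one>)" using xG yG by (simp add: el_def m_assoc)
    also have "\<dots> = x [^] (- m) \<otimes> (y \<otimes> (if b then y else \<one>))" unfolding yp using xG yG by (simp add: m_assoc)
    also have "\<dots> = (if b then el (- m + int k) False else el (- m) True)"
    proof -
      have "x [^] (- m) \<otimes> x [^] k = x [^] (- m + int k)" unfolding int_pow_mult[OF xG] int_pow_int ..
      then show ?thesis using xG yG yy by (auto simp: el_def)
    qed
    finally show ?thesis .
  qed
  have yinv: "inv y = x [^] (int k) \<otimes> y"
  proof (rule inv_equality)
    show "x [^] int k \<otimes> y \<otimes> y = \<one>" using yy xkk xk yG by (simp add: m_assoc int_pow_int)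
  qed (use xG yG in auto)
  have letters: "\<exists>m' b'. F [l] \<otimes> el m b = el m' b'" for l m b
  proof -
    obtain a s where l: "l = (a, s)" by (cases l)
    have 1: "F [(gen_x, True)] \<otimes> el m b = el (1 + m) b" using x_el[of 1 m b] xG by (simp add: x[symmetric])
    have 2: "F [(gen_x, False)] \<otimes> el m b = el (- 1 + m) b" using x_el[of "-1" m b] xG by (simp add: F_inv x[symmetric] int_pow_neg)
    have 3: "F [(gen_y, True)] \<otimes> el m b = (if b then el (- m + int k) False else el (- m) True)" unfolding y[symmetric] by (rule y_el)
    have 4: "F [(gen_y, False)] \<otimes> el m b = x [^] int k \<otimes> (y \<otimes> el m b)"
      unfolding F_inv y[symmetric] yinv using xG yG el_closed by (simp add: m_assoc)
    have 5: "F [(gen_y, False)] \<otimes> el m b = (if b then el (int k + (- m + int k)) False else el (int k + - m) True)"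
      unfolding 4 y_el using x_el by auto
    show ?thesis using 1 2 3 5 unfolding l by (cases a; cases s; cases b) auto
  qed
  have surj: "\<exists>m b. F u = el m b" for u
  proof (induction u)
    case Nil
    show ?case using F_one by (intro exI[of _ 0] exI[of _ False]) (simp add: el_def)
  next
    case (Cons l u)
    then show ?case using F_mult[of "[l]" u] letters[of l] by auto
  qed
  have kM: "2 * int k = 2 ^ Suc (n - 2)" by (simp add: k_def)
  have k0: "2 * int k > 0" by (simp add: k_def)
  have xMi: "x [^] (2 * int k) = \<one>"
  proof -
    have "2 * int k = int (2 ^ Suc (n - 2))" by (simp add: k_def)
    then show ?thesis using xM by (simp only: int_pow_int)
  qed
  \<comment> \<open>A word for the normal form, with the exponent reduced so that only positive
    letters occur.\<close>
  define w where "w m b = replicate (nat (m mod (2 * int k))) (gen_x, True) @ (if b then [(gen_y, True)] else [])" for m b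
  have Fw: "F (w m b) = el m b" for m b
  proof -
    have "x [^] m = x [^] (m mod (2 * int k) + (2 * int k) * (m div (2 * int k)))" by simp
    also have "\<dots> = x [^] (m mod (2 * int k)) \<otimes> (x [^] (2 * int k)) [^] (m div (2 * int k))"
      unfolding int_pow_mult[OF xG] int_pow_pow[OF xG] ..
    also have "\<dots> = x [^] nat (m mod (2 * int k))"
      unfolding xMi using xG k0 by (simp add: int_pow_int[symmetric] del: int_pow_int)
    finally show ?thesis unfolding w_def F_mult F_rep el_def using F_one by (auto simp: x[symmetric] y[symmetric])
  qed
  have aw: "word_act (int k) (w m b) (0, False) = (m mod (2 * int k), b)" for m b
  proof -
    have "word_act (int k) (if b then [(gen_y, True)] else []) (0, False) = (0, b)" by (auto simp: word_act_def)
    then show ?thesis unfolding w_def word_act_append using word_act_replicate_x[of 0 "int k"] k0 by simp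
  qed
  have inj: "m mod 2 ^ Suc (n - 2) = m' mod 2 ^ Suc (n - 2) \<and> b = b'" if "el m b = el m' b'" for m b m' b'
  proof -
    have "word_eq (quat_relators n) (w m b) (w m' b')" using that F_inj unfolding Fw[symmetric] R_def by blast
    moreover have "int k = 2 ^ (n - 2)" by (simp add: k_def)
    ultimately have "word_act (int k) (w m b) (0, False) = word_act (int k) (w m' b') (0, False)"
      using n k0 by (intro word_act_eq) auto
    then show ?thesis unfolding aw kM by simp
  qed
  show ?thesis
    unfolding x_def[symmetric] y_def[symmetric]
  proof unfold_locales
    show "2 \<le> n - 2" using n by simp
    show "y \<otimes> y = x [^] ((2::nat) ^ (n - 2))" using yy by (simp add: k_def)
    show "\<exists>m b. g = x [^] (m::int) \<otimes> (if b then y else \<one>)" if "g \<in> carrier G" for g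
      using F_surj[OF that] surj unfolding el_def by blast
    show "m mod 2 ^ Suc (n - 2) = m' mod 2 ^ Suc (n - 2) \<and> b = b'"
      if "x [^] (m::int) \<otimes> (if b then y else \<one>) = x [^] (m'::int) \<otimes> (if b' then y else \<one>)" for m b m' b'
      using inj that unfolding el_def by blast
  qed (rule xG yG xM yx)+
qed

section \<open>Change of generators, and the subgroups of the theorem\<close>

context quat
begin

text \<open>Everything follows from x y x = y, which gives (x y)^2 = y^2 and shows that x y inverts
  x by conjugation.\<close>

lemma swap_generator: "quat G x (x \<otimes> y) r"
proof unfold_locales
  have e: "x [^] (m::int) \<otimes> (if b then x \<otimes> y else \<one>) = el (m + of_bool b) b" for m b
    using xG yG by (simp add: el_def int_pow_mult m_assoc)
  have iy: "x \<otimes> (inv x \<otimes> y) = y" "inv x \<otimes> (x \<otimes> y) = y" using xG yG by (simp_all add: m_assoc[symmetric])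
  show "2 \<le> r" "x \<in> carrier G" "x \<otimes> y \<in> carrier G" "x [^] ((2::nat) ^ Suc r) = \<one>" using r2 xG yG xM by auto
  have yxy: "(x \<otimes> y) \<otimes> x = y" using xG yG yx iy by (simp add: m_assoc)
  then show "(x \<otimes> y) \<otimes> x = inv x \<otimes> (x \<otimes> y)" unfolding iy .
  have "(x \<otimes> y) \<otimes> (x \<otimes> y) = ((x \<otimes> y) \<otimes> x) \<otimes> y" using xG yG by (simp add: m_assoc)
  then show "(x \<otimes> y) \<otimes> (x \<otimes> y) = x [^] ((2::nat) ^ r)" unfolding yxy yy .
  show "\<exists>m b. g = x [^] (m::int) \<otimes> (if b then x \<otimes> y else \<one>)" if g: "g \<in> carrier G" for g
  proof -
    obtain m b where "g = el m b" using el_exhaust[OF g] by blast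
    then show ?thesis unfolding e by (intro exI[of _ "m - of_bool b"] exI[of _ b]) simp
  qed
  show "m mod 2 ^ Suc r = m' mod 2 ^ Suc r \<and> b = b'"
    if "x [^] (m::int) \<otimes> (if b then x \<otimes> y else \<one>) = x [^] (m'::int) \<otimes> (if b' then x \<otimes> y else \<one>)" for m b m' b'
  proof -
    have "(m + of_bool b) mod int M = (m' + of_bool b') mod int M \<and> b = b'" using that unfolding e el_eq .
    then have "m mod int M = m' mod int M \<and> b = b'" by (auto simp: mod_eq_dvd_iff)
    moreover have "int M = 2 ^ Suc r" by (simp add: M_def)
    ultimately show ?thesis by (simp only:)
  qed
qed

lemma el_pow: "x [^] d = el (int d) False" "(x [^] d) [^] (k::int) = el (int d * k) False"
  using xG by (simp_all add: el_def int_pow_int int_pow_pow[symmetric])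

lemma generate_kk: "generate G {x [^] (d::nat)} = kk d"
proof -
  have "x [^] d \<in> carrier G" using xG by simp
  then show ?thesis unfolding generate_pow[OF \<open>x [^] d \<in> carrier G\<close>] el_pow(2) kk_def by auto
qed

lemma generate_hh: assumes d: "d dvd h" shows "generate G {x [^] (d::nat), y} = hh d"
proof
  have "el 0 True \<in> hh d" unfolding el_hh[OF dvd_h_M[OF d]] by simp
  then have "y \<in> hh d" unfolding el_one(3) .
  moreover have "x [^] d \<in> hh d" unfolding el_pow(1) el_hh[OF dvd_h_M[OF d]] by simp
  ultimately show "generate G {x [^] d, y} \<subseteq> hh d"
    by (intro generate_subgroup_incl[OF _ subgroup_hh[OF d]]) simp
  show "hh d \<subseteq> generate G {x [^] d, y}"
  proof
    fix g assume "g \<in> hh d"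
    then obtain m b where g: "g = el m b" "int d dvd m" by (auto simp: hh_def)
    have "kk d \<subseteq> generate G {x [^] d, y}" unfolding generate_kk[symmetric] by (rule mono_generate) simp
    moreover have "el m False \<in> kk d" using g(2) by (auto simp: kk_def)
    ultimately have m: "el m False \<in> generate G {x [^] d, y}" by blast
    have y: "y \<in> generate G {x [^] d, y}" by (rule generate.incl) simp
    have "el m True = el m False \<otimes> y" using el_mult[of m False 0 True] by (simp add: el_one)
    then show "g \<in> generate G {x [^] d, y}" unfolding g(1) using m generate.eng[OF m y] by (cases b) simp_all
  qed
qed

lemma K_sub_eq: "K_sub G x n i = kk (2 ^ (n - i))"
  unfolding K_sub_def by (rule generate_kk)

lemma H_sub_eq: "n = r + 2 \<Longrightarrow> j \<ge> 2 \<Longrightarrow> H_sub G x y n j = hh (2 ^ (n - j))"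
  unfolding H_sub_def by (rule generate_hh) (auto simp: h_def intro!: le_imp_power_dvd)

interpretation swap: quat G x "x \<otimes> y" r by (rule swap_generator)

lemma swap_el: "swap.el m b = el (m + of_bool b) b"
  unfolding swap.el_def el_def using xG yG by (simp add: int_pow_mult m_assoc)

lemma swap_kk: "swap.kk = kk"
  unfolding swap.kk_def kk_def swap_el by simp

text \<open>Cyclic subgroups do not involve y, so both pairs of generators have the same central
  idempotents in degree 2 and differ only in how the dihedral blocks are split.\<close>

lemma swap_en: "swap.en = en"
  unfolding swap.en_def en_def swap_kk ..

lemma swap_hh: "swap.hh 2 = tt"
  unfolding swap.hh_def tt_def swap_el
proof (intro equalityI subsetI)
  fix g assume "g \<in> {el (m + of_bool b) b | m b. int 2 dvd m}"
  then obtain m b where "g = el (m + of_bool b) b" "even m" by auto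
  then show "g \<in> {el m b | m b. even (m - of_bool b)}" by (intro CollectI exI[of _ "m + of_bool b"] exI[of _ b]) simp
next
  fix g assume "g \<in> {el m b | m b. even (m - of_bool b)}"
  then obtain m b where "g = el m b" "even (m - of_bool b)" by auto
  then show "g \<in> {el (m + of_bool b) b | m b. int 2 dvd m}" by (intro CollectI exI[of _ "m - of_bool b"] exI[of _ b]) simp
qed

text \<open>Read off from the subgroup \<open>hh 2\<close> for the generators x and x y.\<close>

lemma tt_props: "card tt = M" "subgroup tt G"
proof -
  show "subgroup tt G" unfolding swap_hh[symmetric] by (rule swap.subgroup_hh[OF swap.dvd2(2)])
  have "M = 2 * (M div 2)" using dvd2(4) by simp
  then show "card tt = M" using swap.card_hh[OF swap.dvd2(4)] unfolding swap_hh by simp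
qed

lemma swap_splitting: "splitting (\<lambda>N. [swap.fn N, swap.twist N])"
  using swap.splitting_fn unfolding swap.splitting_def splitting_def swap_en .

end

section \<open>The action on the torus\<close>

lemma isogenous_refl: assumes "fg_torus X" shows "X \<sim>\<^sub>i X"
proof -
  have "qiso X X (\<lambda>v. v)" by (simp add: qiso_def clin_def bij_betw_def)
  then show ?thesis using isogenous_iff_qiso[OF assms assms] by blast
qed

lemma isogenous_trans:
  assumes "fg_torus X" "fg_torus Y" "fg_torus Z" "X \<sim>\<^sub>i Y" "Y \<sim>\<^sub>i Z" shows "X \<sim>\<^sub>i Z"
proof -
  obtain f g where "qiso X Y f" "qiso Y Z g" 
    using assms(4,5) isogenous_iff_qiso[OF assms(1,2)] isogenous_iff_qiso[OF assms(2,3)] by blast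
  from qiso_trans[OF this] show ?thesis using isogenous_iff_qiso[OF assms(1,3)] by blast
qed

locale torus_action = polarized_torus A H + fin_group G
  for A :: "'v::complex_vs torus" and H and G :: "('v \<Rightarrow> 'v, 'b) monoid_scheme" (structure) +
  assumes act_hom: "g \<in> carrier G \<Longrightarrow> torus_hom A A g"
    and act_mult: "g \<in> carrier G \<Longrightarrow> k \<in> carrier G \<Longrightarrow> v \<in> cover A \<Longrightarrow> (g \<otimes> k) v = g (k v)"
    and act_one: "v \<in> cover A \<Longrightarrow> \<one> v = v"
begin

lemma act_clin: "g \<in> carrier G \<Longrightarrow> clin V g" and act_V: "g \<in> carrier G \<Longrightarrow> v \<in> V \<Longrightarrow> g v \<in> V"
  using act_hom[of g] by (auto simp: torus_hom_def clin_def)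

lemma act_Q: assumes g: "g \<in> carrier G" and v: "v \<in> Q" shows "g v \<in> Q"
proof -
  obtain m where m: "v \<in> V" "(m::int) \<noteq> 0" "of_int m *\<^sub>C v \<in> period_lat A" using v by (auto simp: rational_pts_def)
  have "g (of_int m *\<^sub>C v) \<in> period_lat A" using act_hom[OF g] m(3) by (auto simp: torus_hom_def)
  then show ?thesis using clin_scale[OF act_clin[OF g] m(1)] act_V[OF g m(1)] m(2) by (auto simp: rational_pts_def)
qed

lemma ga_clin: "clin V (ga_act G a)"
  unfolding clin_def ga_act_def
proof (intro conjI ballI allI)
  fix u v assume uv: "u \<in> V" "v \<in> V"
  show "(\<Sum>g\<in>carrier G. of_rat (a g) *\<^sub>C g (u + v)) = (\<Sum>g\<in>carrier G. of_rat (a g) *\<^sub>C g u) + (\<Sum>g\<in>carrier G. of_rat (a g) *\<^sub>C g v)"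
    unfolding sum.distrib[symmetric] using uv by (intro sum.cong) (auto simp: clin_add[OF act_clin] scaleC_add_right)
next
  fix c v assume v: "v \<in> V"
  show "(\<Sum>g\<in>carrier G. of_rat (a g) *\<^sub>C g (c *\<^sub>C v)) = c *\<^sub>C (\<Sum>g\<in>carrier G. of_rat (a g) *\<^sub>C g v)"
    unfolding cvs.scale_sum_right using v by (intro sum.cong) (auto simp: clin_scale[OF act_clin] scaleC_scaleC mult.commute)
qed

lemma ga_V: assumes v: "v \<in> V" shows "ga_act G a v \<in> V"
  unfolding ga_act_def
proof (rule cvs.subspace_sum[OF sV])
  show "of_rat (a g) *\<^sub>C g v \<in> V" if g: "g \<in> carrier G" for g by (rule V_closed(2)[OF act_V[OF g v]])
qed

lemma ga_Q: assumes v: "v \<in> Q" shows "ga_act G a v \<in> Q"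
  unfolding ga_act_def
proof (rule qvs.subspace_sum[OF Q_subspace])
  show "of_rat (a g) *\<^sub>C g v \<in> Q" if g: "g \<in> carrier G" for g by (rule qvs.subspace_scale[OF Q_subspace act_Q[OF g v]])
qed

lemma ga_comp: assumes v: "v \<in> V" shows "ga_act G (a \<star> b) v = ga_act G a (ga_act G b v)"
proof -
  have "ga_act G (a \<star> b) v = (\<Sum>h\<in>carrier G. \<Sum>k\<in>carrier G. (of_rat (a h) * of_rat (b k)) *\<^sub>C (h \<otimes> k) v)"
    unfolding ga_act_def by (rule ga_sum_vec[where F = "\<lambda>g. g v"])
  also have "\<dots> = (\<Sum>h\<in>carrier G. of_rat (a h) *\<^sub>C h (ga_act G b v))"
  proof (rule sum.cong[OF HOL.refl])
    fix h assume h: "h \<in> carrier G"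
    have "h (ga_act G b v) = (\<Sum>k\<in>carrier G. h (of_rat (b k) *\<^sub>C k v))"
      unfolding ga_act_def by (rule clin_sum[OF act_clin[OF h] sV]) (rule V_closed(2)[OF act_V[OF _ v]])
    also have "\<dots> = (\<Sum>k\<in>carrier G. of_rat (b k) *\<^sub>C h (k v))"
      by (rule sum.cong[OF HOL.refl]) (rule clin_scale[OF act_clin[OF h] act_V[OF _ v]])
    finally show "(\<Sum>k\<in>carrier G. (of_rat (a h) * of_rat (b k)) *\<^sub>C (h \<otimes> k) v) = of_rat (a h) *\<^sub>C h (ga_act G b v)"
      unfolding cvs.scale_sum_right using act_mult[OF h _ v] by (simp add: cvs.scale_sum_right scaleC_scaleC)
  qed
  finally show ?thesis by (simp add: ga_act_def)
qed

lemma ga_act_delta: assumes "g \<in> carrier G" shows "ga_act G (delta g) v = g v"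
proof -
  have "ga_act G (delta g) v = (\<Sum>k\<in>carrier G. if k = g then k v else 0)"
    unfolding ga_act_def delta_def by (intro sum.cong) (auto simp: scaleC_one)
  then show ?thesis using assms fin by simp
qed

lemma ga_act_add: "ga_act G (a + b) v = ga_act G a v + ga_act G b v"
  by (simp add: ga_act_def of_rat_add scaleC_add_left sum.distrib)

lemma ga_act_zero: "ga_act G 0 v = 0"
  by (simp add: ga_act_def)

lemma ga_act_scale: "ga_act G (\<lambda>g. c * a g) v = of_rat c *\<^sub>C ga_act G a v"
  by (simp add: ga_act_def of_rat_mult cvs.scale_sum_right scaleC_scaleC)

text \<open>A nonzero scalar moves to the argument, and V is stable under scalars. Hence neither
  clearing denominators nor normalizing p_K to an average changes an image.\<close>

lemma im_scale: assumes "c \<noteq> 0" shows "ga_act G (\<lambda>g. c * a g) ` V = ga_act G a ` V"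
proof -
  have s: "ga_act G (\<lambda>g. c * a g) v = ga_act G a (of_rat c *\<^sub>C v)" if "v \<in> V" for v
    unfolding ga_act_scale using clin_scale[OF ga_clin that] by simp
  have "ga_act G (\<lambda>g. c * a g) (of_rat (1 / c) *\<^sub>C v) = ga_act G a v" if "v \<in> V" for v
  proof -
    have "of_rat c * of_rat (1 / c) = (1 :: complex)" using assms by (simp add: of_rat_divide)
    then show ?thesis using s[OF V_closed(2)[OF that]] by (simp add: scaleC_scaleC scaleC_one)
  qed
  note t = this
  show ?thesis
  proof (intro equalityI image_subsetI)
    show "ga_act G (\<lambda>g. c * a g) v \<in> ga_act G a ` V" if v: "v \<in> V" for v
      unfolding s[OF v] by (rule imageI[OF V_closed(2)[OF v]])
    show "ga_act G a v \<in> ga_act G (\<lambda>g. c * a g) ` V" if v: "v \<in> V" for v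
      unfolding t[OF v, symmetric] by (rule imageI[OF V_closed(2)[OF v]])
  qed
qed

lemma clear_denom_pos: assumes a: "a \<in> group_alg G" shows "clear_denom a > 0"
proof -
  have "\<exists>m>0. \<forall>g\<in>S. of_nat m * a g \<in> \<int>" if "finite S" for S
    using that
  proof (induction S)
    case (insert s S)
    then obtain m where m: "m > 0" "\<forall>g\<in>S. of_nat m * a g \<in> \<int>" by auto
    obtain p q where pq: "quotient_of (a s) = (p, q)" by (cases "quotient_of (a s)")
    have q: "q > 0" "a s = of_int p / of_int q" using quotient_of_denom_pos[OF pq] quotient_of_div[OF pq] by auto
    have c: "(of_nat (nat q) :: rat) = of_int q" using q(1) by simp
    have "of_nat (m * nat q) * a g \<in> \<int>" if "g \<in> insert s S" for g
    proof (cases "g = s")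
      case True
      have "of_nat (m * nat q) * a s = of_nat m * of_int p" unfolding of_nat_mult c q(2) using q(1) by simp
      then show ?thesis unfolding True by (simp only: Ints_mult Ints_of_nat Ints_of_int)
    next
      case False
      then have "of_nat m * a g \<in> \<int>" using that m(2) by blast
      from Ints_mult[OF Ints_of_int[of q] this] show ?thesis unfolding of_nat_mult c by (simp add: mult_ac)
    qed
    then show ?case using m(1) q(1) by (intro exI[of _ "m * nat q"]) simp
  qed (auto intro: exI[of _ 1])
  from this[OF fin] obtain m where m: "m > 0" "\<forall>g\<in>carrier G. of_nat m * a g \<in> \<int>" by blast
  have "of_nat m * a g \<in> \<int>" for g using m(2) a by (cases "g \<in> carrier G") (auto simp: group_alg_def)
  then show ?thesis unfolding clear_denom_def using m(1) LeastI[of "\<lambda>m. m > 0 \<and> (\<forall>g. of_nat m * a g \<in> \<int>)" m] by blast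
qed

abbreviation "im a \<equiv> subt A (ga_act G a ` V)"

lemma ga_image_eq: "a \<in> group_alg G \<Longrightarrow> ga_image A G a = im a"
  unfolding ga_image_def torus_image_def subt_def using im_scale[of "of_nat (clear_denom a)" a] clear_denom_pos[of a] by simp

lemma sub_image_eq: assumes "subgroup K G" shows "sub_image A G K = im (avg K)"
proof -
  have "finite K" "K \<noteq> {}" using finite_subset[OF subgroup.subset[OF assms] fin] subgroup.one_closed[OF assms] by auto
  then have c: "(of_nat (card K) :: rat) \<noteq> 0" by simp
  then have "(\<lambda>g. if g \<in> K then 1 else 0) = (\<lambda>g. of_nat (card K) * avg K g)" by (auto simp: avg_def)
  then show ?thesis unfolding sub_image_def torus_image_def subt_def using im_scale[OF c, of "avg K"] by simp
qed

text \<open>Brings the Prym variety of A over A_Z into the pattern of a pair of nested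
  subgroups.\<close>

lemma sub_image_one: "sub_image A G {\<one>} = A"
proof -
  have "ga_act G (avg {\<one>}) v = v" if "v \<in> V" for v
  proof -
    have "avg {\<one>} = delta \<one>" by (auto simp: avg_def delta_def)
    then show ?thesis using ga_act_delta[OF one_closed] act_one[OF that] by simp
  qed
  then have "ga_act G (avg {\<one>}) ` V = V" by simp
  then show ?thesis
    unfolding sub_image_eq[OF triv_subgroup] subt_def using fg_torusD(2)[OF fgX] by (simp add: Int_absorb1)
qed

lemma good_im: "good (ga_act G a ` V)"
  by (rule good_image[OF ga_clin]) (auto intro: ga_V ga_Q)

lemma im_torus: "complex_torus (im a)" "fg_torus (im a)"
  using good_torus[OF good_im] complex_torus_fg by blast+

text \<open>On A_K the elements p_K - p_K' and p_K' act as complementary projections, so the image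
  of the first is an admissible complement. The one chosen by \<open>Prym\<close> is isogenous to it
  by \<open>complement_unique\<close>.\<close>

lemma Prym_isogenous:
  assumes K: "subgroup K G" "subgroup K' G" "K \<subseteq> K'"
  shows "im (avg K - avg K') \<sim>\<^sub>i Prym (sub_image A G K) (sub_image A G K')"
    and "complex_torus (Prym (sub_image A G K) (sub_image A G K'))"
proof -
  define S where "S = ga_act G (avg K) ` V"
  define e where "e = avg K - avg K'"
  define p where "p i = ga_act G (if i = (0::nat) then e else avg K')" for i
  define Y where "Y = im (avg K')"
  define E where "E = im e"
  note gS = good_im[of "avg K", folded S_def]
  note SV = goodD(2)[OF gS]
  obtain H' where H': "polarization (subt A S) H'"
    using good_abelian[OF gS] by (auto simp: abelian_subvariety_def abelian_variety_def)
  \<comment> \<open>A_K is polarized in its own right, so the theory of complements applies with A_K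
    in place of A.\<close>
  interpret S: polarized_torus "subt A S" H'
    by (unfold_locales) (rule good_torus[OF gS], rule H')
  note m = avg_mult[OF K] avg_idem[OF K(1)] avg_idem[OF K(2)]
  have left: "avg K \<star> (if i = (0::nat) then e else avg K') = (if i = 0 then e else avg K')" for i
    by (simp add: e_def ga_diff_right m)
  have right: "(if i = (0::nat) then e else avg K') \<star> avg K = (if i = 0 then e else avg K')" for i
    by (simp add: e_def ga_diff_left m)
  have fix_S: "ga_act G (avg K) v = v" if "v \<in> S" for v
  proof -
    obtain u where u: "u \<in> V" "v = ga_act G (avg K) u" using \<open>v \<in> S\<close> by (auto simp: S_def)
    show ?thesis unfolding u(2) using ga_comp[OF u(1), of "avg K" "avg K"] m by simp
  qed
  have pS: "p i v \<in> S" if "v \<in> V" for i v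
  proof -
    have "p i v = ga_act G (avg K) (p i v)" unfolding p_def ga_comp[OF that, symmetric] left ..
    then show ?thesis unfolding S_def by (rule image_eqI) (simp add: p_def ga_V[OF that])
  qed
  \<comment> \<open>Both elements absorb p_K on the right, so restricting them to the cover of A_K
    leaves their images unchanged.\<close>
  have pim: "p i ` S = p i ` V" for i
  proof
    show "p i ` V \<subseteq> p i ` S"
    proof
      fix w assume "w \<in> p i ` V"
      then obtain v where v: "v \<in> V" "w = p i v" by blast
      have "p i v = p i (ga_act G (avg K) v)" unfolding p_def ga_comp[OF v(1), symmetric] right ..
      then show "w \<in> p i ` S" unfolding v(2) by (rule image_eqI) (simp add: S_def v(1))
    qed
  qed (use SV in blast)
  have cl: "clin S (p i)" for i using ga_clin SV unfolding p_def clin_def by blast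
  have pSS: "p i ` S \<subseteq> S" for i using pS SV by blast
  have rS: "rational_pts (subt A S) = S \<inter> Q" by (rule rational_pts_subt[OF goodD(1)[OF gS] goodD(2)[OF gS]])
  have pQ: "p i ` rational_pts (subt A S) \<subseteq> rational_pts (subt A S)" for i
    unfolding rS using pSS[of i] ga_Q unfolding p_def by blast
  have sub: "subt (subt A S) U = subt A U" if "U \<subseteq> S" for U
    using that by (auto simp: subt_def)
  have sE: "subt (subt A S) (p 0 ` S) = E" "subt (subt A S) (p (Suc 0) ` S) = Y"
    unfolding sub[OF pSS] unfolding pim by (simp_all add: p_def E_def Y_def)
  have fg: "fg_torus E" "fg_torus Y" unfolding E_def Y_def by (rule im_torus)+
  have ab: "abelian_subvariety E (subt A S)"
    using S.good_abelian[OF S.good_image[of "p 0"]] cl pSS pQ unfolding sE(1)[symmetric] by simp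
  have "subt A S \<sim>\<^sub>i prod_torus [E, Y]"
  proof (rule S.idempotent_decomposition[of 2 p])
    show "clin (cover (subt A S)) (p i)" "p i ` cover (subt A S) \<subseteq> cover (subt A S)"
      "p i ` rational_pts (subt A S) \<subseteq> rational_pts (subt A S)" for i
      using cl pSS pQ by simp_all
    show "(\<Sum>i<2. p i v) = v" if "v \<in> cover (subt A S)" for v
      using fix_S[of v] that unfolding numeral_2_eq_2 p_def
      by (simp add: ga_act_add[symmetric] e_def)
    have z: "e \<star> avg K' = 0" "avg K' \<star> e = 0" by (simp_all add: e_def ga_diff_left ga_diff_right m)
    show "p i (p j v) = 0" if "i < 2" "j < 2" "i \<noteq> j" "v \<in> cover (subt A S)" for i j v
    proof -
      have "v \<in> V" using that(4) SV by auto
      then show ?thesis using that z unfolding p_def ga_comp[OF \<open>v \<in> V\<close>, symmetric]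
        by (auto simp: less_2_cases_iff ga_act_zero)
    qed
    show "fg_torus ([E, Y] ! i)" if "i < 2" for i using that fg by (auto simp: less_2_cases_iff)
    show "subt (subt A S) (p i ` cover (subt A S)) \<sim>\<^sub>i [E, Y] ! i" if "i < 2" for i
      using that sE isogenous_refl[OF fg(1)] isogenous_refl[OF fg(2)] by (auto simp: less_2_cases_iff)
  qed simp
  note decomp = this
  have "abelian_subvariety (Prym (subt A S) Y) (subt A S) \<and> subt A S \<sim>\<^sub>i prod_torus [Prym (subt A S) Y, Y]"
    unfolding Prym_def by (rule someI[of _ E]) (use ab decomp in blast)
  then have P: "complex_torus (Prym (subt A S) Y)" "subt A S \<sim>\<^sub>i prod_torus [Prym (subt A S) Y, Y]"
    by (auto simp: abelian_subvariety_def abelian_variety_def)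
  have "E \<sim>\<^sub>i Prym (subt A S) Y"
    by (rule S.complement_unique[OF _ P(1) _ decomp P(2)]) (auto simp: E_def Y_def im_torus)
  then show "im (avg K - avg K') \<sim>\<^sub>i Prym (sub_image A G K) (sub_image A G K')"
    and "complex_torus (Prym (sub_image A G K) (sub_image A G K'))"
    using P(1) unfolding sub_image_eq[OF K(1)] sub_image_eq[OF K(2)] S_def Y_def E_def e_def by simp_all
qed

text \<open>The automorphism g itself carries one image onto the other. It makes the two primitive
  pieces of a dihedral block isogenous.\<close>

lemma conjugate_image:
  assumes g: "g \<in> carrier G"
  shows "im a \<sim>\<^sub>i subt A (ga_act G (delta g \<star> (a \<star> delta (inv g))) ` V)"
proof -
  define U where "U = ga_act G a ` V"
  define U' where "U' = ga_act G (delta g \<star> (a \<star> delta (inv g))) ` V"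
  have gU: "good U" "good U'" unfolding U_def U'_def by (rule good_im)+
  note UV = goodD(2)[OF gU(1)] and UV' = goodD(2)[OF gU(2)]
  have inv: "(inv g) (g v) = v" "g ((inv g) v) = v" if "v \<in> V" for v
    using act_mult[OF inv_closed[OF g] g that] act_mult[OF g inv_closed[OF g] that] act_one[OF that] g by simp_all
  have act: "ga_act G (delta g \<star> (a \<star> delta (inv g))) v = g (ga_act G a ((inv g) v))" if "v \<in> V" for v
    using ga_comp[OF that] ga_act_delta[OF g] ga_act_delta[OF inv_closed[OF g]] by simp
  have im: "g ` U = U'"
  proof
    show "g ` U \<subseteq> U'"
    proof
      fix w assume "w \<in> g ` U"
      then obtain v where v: "v \<in> V" "w = g (ga_act G a v)" by (auto simp: U_def)
      then have "w = ga_act G (delta g \<star> (a \<star> delta (inv g))) (g v)" using act[OF act_V[OF g v(1)]] inv(1)[OF v(1)] by simp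
      then show "w \<in> U'" unfolding U'_def using act_V[OF g v(1)] by blast
    qed
    show "U' \<subseteq> g ` U"
    proof
      fix w assume "w \<in> U'"
      then obtain v where v: "v \<in> V" "w = g (ga_act G a ((inv g) v))" using act by (auto simp: U'_def)
      then show "w \<in> g ` U" unfolding U_def using act_V[OF inv_closed[OF g] v(1)] by blast
    qed
  qed
  have "qiso (subt A U) (subt A U') g"
    unfolding qiso_def subt_simps rational_pts_subt[OF goodD(1)[OF gU(1)] UV] rational_pts_subt[OF goodD(1)[OF gU(2)] UV']
  proof (intro conjI)
    show "clin U g" using act_clin[OF g] UV unfolding clin_def by blast
    show "bij_betw g U U'" unfolding bij_betw_def
    proof
      show "inj_on g U" by (rule inj_on_inverseI[of _ "inv g"]) (use inv(1) UV in blast)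
    qed (rule im)
    show "g ` (U \<inter> Q) = U' \<inter> Q"
    proof
      show "g ` (U \<inter> Q) \<subseteq> U' \<inter> Q" using im act_Q[OF g] by blast
      show "U' \<inter> Q \<subseteq> g ` (U \<inter> Q)"
      proof
        fix w assume w: "w \<in> U' \<inter> Q"
        then obtain u where u: "u \<in> U" "w = g u" using im by blast
        have "u = (inv g) w" using u UV inv(1) by auto
        then have "u \<in> Q" using act_Q[OF inv_closed[OF g]] w by simp
        then show "w \<in> g ` (U \<inter> Q)" using u by blast
      qed
    qed
  qed
  then show ?thesis
    using isogenous_iff_qiso[OF complex_torus_fg[OF good_torus[OF gU(1)]] complex_torus_fg[OF good_torus[OF gU(2)]]]
    unfolding U_def U'_def by blast
qed

lemma orthogonal_decomposition:
  assumes orth: "sorted_wrt (ga_orthogonal G) fs" and sum: "(\<Sum>f\<leftarrow>fs. f) = delta \<one>"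
    and Ys: "list_all2 (\<lambda>f Y. im f \<sim>\<^sub>i Y \<and> complex_torus Y) fs Ys"
  shows "A \<sim>\<^sub>i prod_torus Ys"
proof (rule idempotent_decomposition[of "length fs" "\<lambda>i. ga_act G (fs ! i)"])
  have s: "ga_act G (sum_list gs) v = (\<Sum>i<length gs. ga_act G (gs ! i) v)" for gs v
  proof (induction gs)
    case Nil
    show ?case unfolding sum_list.Nil ga_act_zero by simp
  next
    case (Cons g gs)
    show ?case
      unfolding sum_list.Cons ga_act_add Cons list.size(4) by (simp add: sum.lessThan_Suc_shift del: sum.lessThan_Suc)
  qed
  show "(\<Sum>i<length fs. ga_act G (fs ! i) v) = v" if "v \<in> V" for v
    using s[of fs v] sum ga_act_delta[OF one_closed, of v] act_one[OF that] by simp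
  show "ga_act G (fs ! i) (ga_act G (fs ! j) v) = 0" if "i < length fs" "j < length fs" "i \<noteq> j" "v \<in> V" for i j v
  proof -
    have "i < j \<or> j < i" using that(3) by linarith
    then have "fs ! i \<star> fs ! j = 0"
      using orth that(1,2) unfolding sorted_wrt_iff_nth_less ga_orthogonal_def zero_fun_def by blast
    then show ?thesis using ga_comp[OF that(4), of "fs ! i" "fs ! j"] by (simp add: ga_act_zero)
  qed
  show "length Ys = length fs" using Ys by (simp add: list_all2_lengthD)
  show "fg_torus (Ys ! i)" "im (fs ! i) \<sim>\<^sub>i Ys ! i" if "i < length fs" for i
    using list_all2_nthD[OF Ys that] complex_torus_fg by blast+
qed (auto intro: ga_V ga_Q ga_clin)

end

text \<open>The product of \<open>BijGroup\<close> is composition cut off outside the cover, so the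
  homomorphism property has to be carried along functions that agree on the cover only.\<close>

lemma group_aut_group:
  assumes X: "complex_torus (X :: 'v::complex_vs torus)" shows "group (aut_group X)" (is "group ?G")
proof (rule groupI)
  define V where "V = cover X"
  have sV: "cvs.subspace V" "period_lat X \<subseteq> V" using fg_torusD(1,2)[OF complex_torus_fg[OF X]] by (simp_all add: V_def)
  have cong: "torus_hom X X f" if f: "torus_hom X X g" and e: "\<And>v. v \<in> V \<Longrightarrow> f v = g v" for f g :: "'v \<Rightarrow> 'v"
    using f e sV(2) cvs.subspace_add[OF sV(1)] cvs.subspace_scale[OF sV(1)]
    unfolding torus_hom_def V_def[symmetric] by (auto simp: image_subset_iff subset_iff)
  have comp: "torus_hom X X (\<lambda>v. g (f v))" if "torus_hom X X f" "torus_hom X X g" for f g :: "'v \<Rightarrow> 'v"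
    using that unfolding torus_hom_def V_def[symmetric] by (auto simp: image_subset_iff)
  have idh: "torus_hom X X (\<lambda>v. v)" by (simp add: torus_hom_def)
  have carr: "f \<in> carrier ?G \<longleftrightarrow> f \<in> Bij V \<and> torus_hom X X f \<and> torus_hom X X (inv_into V f)" for f
    by (simp add: aut_group_def V_def)
  have mult: "f \<otimes>\<^bsub>?G\<^esub> g = compose V f g" if "f \<in> Bij V" "g \<in> Bij V" for f g
    using that by (simp add: aut_group_def BijGroup_def V_def)
  have one: "\<one>\<^bsub>?G\<^esub> = (\<lambda>v\<in>V. v)" by (simp add: aut_group_def BijGroup_def V_def)
  have bij: "bij_betw f V V" if "f \<in> Bij V" for f using that by (simp add: Bij_def)
  have inv_eq: "inv_into V f w = v" if "f \<in> Bij V" "v \<in> V" "f v = w" for f v w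
    using inv_into_f_eq[OF bij_betw_imp_inj_on[OF bij[OF that(1)]] that(2,3)] .
  have maps: "f v \<in> V" if "f \<in> Bij V" "v \<in> V" for f v using bij_betwE[OF bij[OF that(1)]] that(2) by blast
  have imaps: "inv_into V f v \<in> V" "f (inv_into V f v) = v" if "f \<in> Bij V" "v \<in> V" for f v
    using bij_betw_inv_into_right[OF bij[OF that(1)] that(2)] bij_betwE[OF bij_betw_inv_into[OF bij[OF that(1)]]] that(2) by blast+
  fix f g assume f: "f \<in> carrier ?G" and g: "g \<in> carrier ?G"
  note fB = f[unfolded carr] and gB = g[unfolded carr]
  have fg: "compose V f g \<in> Bij V" using compose_Bij fB gB by blast
  have "torus_hom X X (compose V f g)"
    by (rule cong[OF comp[of g f]]) (use fB gB in \<open>auto simp: compose_def\<close>)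
  moreover have "torus_hom X X (inv_into V (compose V f g))"
  proof (rule cong[OF comp[of "inv_into V f" "inv_into V g"]])
    fix v assume v: "v \<in> V"
    show "inv_into V (compose V f g) v = inv_into V g (inv_into V f v)"
    proof (rule inv_eq[OF fg])
      have i: "inv_into V f v \<in> V" "f (inv_into V f v) = v" using imaps fB v by blast+
      have j: "inv_into V g (inv_into V f v) \<in> V" "g (inv_into V g (inv_into V f v)) = inv_into V f v"
        using imaps gB i(1) by blast+
      show "inv_into V g (inv_into V f v) \<in> V" by (rule j)
      show "compose V f g (inv_into V g (inv_into V f v)) = v" using i j by (simp add: compose_def)
    qed
  qed (use fB gB in auto)
  ultimately show "f \<otimes>\<^bsub>?G\<^esub> g \<in> carrier ?G" using fg fB gB by (simp add: mult carr)
  define f' where "f' = (\<lambda>v\<in>V. inv_into V f v)"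
  have f'B: "f' \<in> Bij V" unfolding f'_def by (rule restrict_inv_into_Bij) (use fB in simp)
  have "torus_hom X X f'" by (rule cong[of "inv_into V f"]) (use fB in \<open>auto simp: f'_def\<close>)
  moreover have "torus_hom X X (inv_into V f')"
  proof (rule cong[of f])
    fix v assume v: "v \<in> V"
    show "inv_into V f' v = f v"
      by (rule inv_eq[OF f'B maps]) (use v fB maps inv_eq[of f v "f v"] in \<open>auto simp: f'_def\<close>)
  qed (use fB in auto)
  ultimately have "f' \<in> carrier ?G" using f'B by (simp add: carr)
  moreover have "f' \<otimes>\<^bsub>?G\<^esub> f = \<one>\<^bsub>?G\<^esub>"
    using Bij_compose_restrict_eq[of f V] fB f'B by (simp add: mult one f'_def)
  ultimately show "\<exists>y\<in>carrier ?G. y \<otimes>\<^bsub>?G\<^esub> f = \<one>\<^bsub>?G\<^esub>" by blast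
  show "\<one>\<^bsub>?G\<^esub> \<otimes>\<^bsub>?G\<^esub> f = f"
    using id_Bij[of V] fB maps by (auto simp: one mult compose_def Bij_def extensional_def)
  fix k assume k: "k \<in> carrier ?G"
  have gk: "compose V g k \<in> Bij V" using compose_Bij gB k carr by blast
  show "f \<otimes>\<^bsub>?G\<^esub> g \<otimes>\<^bsub>?G\<^esub> k = f \<otimes>\<^bsub>?G\<^esub> (g \<otimes>\<^bsub>?G\<^esub> k)"
    using fB gB k[unfolded carr] fg gk maps by (auto simp: mult compose_def)
next
  define V where "V = cover X"
  have sV: "cvs.subspace V" "period_lat X \<subseteq> V" using fg_torusD(1,2)[OF complex_torus_fg[OF X]] by (simp_all add: V_def)
  have i: "inv_into V (\<lambda>v\<in>V. v) v = v" if "v \<in> V" for v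
    by (rule inv_into_f_eq) (use that in \<open>auto simp: inj_on_def\<close>)
  have "torus_hom X X (\<lambda>v\<in>V. v)" "torus_hom X X (inv_into V (\<lambda>v\<in>V. v))"
    using sV i cvs.subspace_add[OF sV(1)] cvs.subspace_scale[OF sV(1)]
    unfolding torus_hom_def V_def[symmetric] by (auto simp: subset_iff)
  then show "\<one>\<^bsub>?G\<^esub> \<in> carrier ?G" using id_Bij[of V] by (simp add: aut_group_def BijGroup_def V_def)
qed

lemma list_all2_concat: "list_all2 (list_all2 P) xss yss \<Longrightarrow> list_all2 P (concat xss) (concat yss)"
  by (induction xss yss rule: list_all2_induct) (auto intro: list_all2_appendI)

locale quat_action = torus_action A H G + quat G x y r
  for A :: "'v::complex_vs torus" and H and G :: "('v \<Rightarrow> 'v, 'b) monoid_scheme" (structure) and x y and r :: nat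
begin

abbreviation "AA \<equiv> sub_image A G"

interpretation swap: quat G x "x \<otimes> y" r by (rule swap_generator)

text \<open>The factors of multiplicity one: four from the characters of degree 1, and the faithful
  one, whose degree 2 is cancelled by the Schur index 2.\<close>

definition linear_factors :: "'v torus list" where
  "linear_factors = [AA (carrier G), Prym (AA (kk 1)) (AA (carrier G)), Prym (AA (hh 2)) (AA (carrier G)),
     Prym (AA tt) (AA (carrier G)), Prym A (AA (kk h))]"

lemma linear_factors_isogenous:
  assumes "l < 5"
  shows "im (ee l) \<sim>\<^sub>i linear_factors ! l \<and> complex_torus (linear_factors ! l)"
proof -
  note P = Prym_isogenous
  consider "l = 0" | "l = 1" | "l = 2" | "l = 3" | "l = 4" using assms by linarith
  then show ?thesis
  proof cases
    case 1
    have "AA (carrier G) = im (avg (carrier G))" by (rule sub_image_eq[OF subgroup_self])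
    then show ?thesis using isogenous_refl[OF im_torus(2)] im_torus(1) by (simp add: 1 ee_def linear_factors_def)
  next
    case 2
    show ?thesis using P[OF subgroup_kk[OF dvd2(3)] subgroup_self kk_sub] by (simp add: 2 ee_def linear_factors_def)
  next
    case 3
    show ?thesis using P[OF subgroup_hh[OF dvd2(2)] subgroup_self hh_sub] by (simp add: 3 ee_def linear_factors_def)
  next
    case 4
    show ?thesis using P[OF tt_props(2) subgroup_self tt_sub] by (simp add: 4 ee_def linear_factors_def)
  next
    case 5
    have hM: "h dvd M" "M = 2 * h" "h = 2 ^ r" using hM(1) by (simp_all add: h_def)
    have sub: "kk M \<subseteq> kk h" unfolding kk_M using subgroup.one_closed[OF subgroup_kk[OF hM(1)]] by simp
    have e: "ee 4 = avg (kk M) - avg (kk h)" unfolding hM(2) by (simp add: ee_def en_def h_def)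
    show ?thesis
      using P[OF subgroup_kk subgroup_kk[OF hM(1)] sub] sub_image_one
      unfolding 5 e kk_M by (simp add: linear_factors_def)
  qed
qed

lemma nested: assumes "d dvd d'" shows "kk d' \<subseteq> kk d" "hh d' \<subseteq> hh d"
proof -
  have "int d dvd m" if "int d' dvd m" for m using dvd_trans[OF _ that, of "int d"] assms by simp
  then show "kk d' \<subseteq> kk d" "hh d' \<subseteq> hh d" unfolding kk_def hh_def by blast+
qed

lemma isotypical:
  "isotypical_decomposition A G (linear_factors @ map (\<lambda>j. Prym (AA (kk (2 ^ (r + 2 - j)))) (AA (kk (2 ^ (r + 2 - (j + 1)))))) [2..<r + 1])"
    (is "isotypical_decomposition A G ?Fs")
proof -
  define Fs where "Fs = ?Fs"
  have lenL: "length linear_factors = 5" by (simp add: linear_factors_def)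
  have len: "length Fs = r + 4" using r2 by (simp add: Fs_def lenL)
  have F: "im (ee l) \<sim>\<^sub>i Fs ! l \<and> complex_torus (Fs ! l)" if l: "l < r + 4" for l
  proof (cases "l < 5")
    case True
    then show ?thesis using linear_factors_isogenous by (simp add: Fs_def nth_append lenL)
  next
    case False
    define N :: nat where "N = 2 ^ (r + 4 - l)"
    have N: "2 * N dvd M" unfolding N_def by (rule pow_dvd(1)) (use False in simp)
    have Nd: "N dvd M" using N dvd_mult_right by blast
    \<comment> \<open>Block l belongs to the index i = l - 3 of the product, with N = 2^(n - i -
      1).\<close>
    have "r + 2 - (2 + (l - 5)) = Suc (r + 4 - l)" "r + 2 - (2 + (l - 5) + 1) = r + 4 - l" using False l by auto
    then have Fl: "Fs ! l = Prym (AA (kk (2 * N))) (AA (kk N))"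
      using False l by (simp add: Fs_def nth_append lenL N_def del: upt_Suc)
    have "ee l = avg (kk (2 * N)) - avg (kk N)" using False by (simp add: ee_def en_def N_def)
    then show ?thesis unfolding Fl using Prym_isogenous[OF subgroup_kk[OF N] subgroup_kk[OF Nd] nested(1)] by simp
  qed
  have so: "sorted_wrt (ga_orthogonal G) (map ee [0..<r + 4])"
    unfolding sorted_wrt_iff_nth_less using ee_orth[OF tt_props(1)]
    by (auto simp: ga_orthogonal_def zero_fun_def simp del: upt_Suc)
  have su: "(\<Sum>f\<leftarrow>map ee [0..<r + 4]. f) = delta \<one>"
    using ee_sum[OF tt_props(1)] by (simp add: interv_sum_list_conv_sum_set_nat atLeast0LessThan del: upt_Suc)
  have "list_all2 (\<lambda>f Y. im f \<sim>\<^sub>i Y \<and> complex_torus Y) (map ee [0..<r + 4]) Fs"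
    unfolding list_all2_conv_all_nth using F len by (simp del: upt_Suc)
  then have "A \<sim>\<^sub>i prod_torus Fs" by (rule orthogonal_decomposition[OF so su])
  moreover obtain Ws where W: "rational_irreps G Ws" "length Ws = r + 4" "\<forall>l<r + 4. \<forall>V. associated G (Ws ! l) V \<longrightarrow>
      fst V = (if l < 4 then 1 else 2) \<and> central_idempotent G V = ee l \<and> schur_index G (Ws ! l) V = (if l = 4 then 2 else 1)"
    using quat_irreps[OF tt_props] by blast
  have "ga_image A G (central_idempotent G V) \<sim>\<^sub>i Fs ! l" if "l < r + 4" "associated G (Ws ! l) V" for l V
  proof -
    have "central_idempotent G V = ee l" using W(3) that by blast
    then show ?thesis using F[OF that(1)] ga_image_eq[OF ee_closed] by simp
  qed
  ultimately show ?thesis unfolding isotypical_decomposition_def Fs_def[symmetric] using W(1,2) len by auto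
qed

text \<open>Serves both choices of primitive idempotents. The block with N = 2^k has index j = r + 1
  - k, because n - j = k + 1 is then the exponent of 2 N in the larger average of
  \<open>en\<close>.\<close>

lemma group_algebra:
  assumes sp: "splitting fs"
    and B: "\<And>k f. 1 \<le> k \<Longrightarrow> k < r \<Longrightarrow> f \<in> set (fs (2 ^ k)) \<Longrightarrow> im f \<sim>\<^sub>i B (r + 1 - k)"
    and Bt: "\<And>j. 2 \<le> j \<Longrightarrow> j < r + 1 \<Longrightarrow> complex_torus (B j)" and two: "\<And>N. length (fs N) = 2"
  shows "group_algebra_decomposition A G (map (\<lambda>F. (F, 1)) linear_factors @ map (\<lambda>j. (B j, 2)) [2..<r + 1])"
    (is "group_algebra_decomposition A G ?Bs")
proof -
  define Bs where "Bs = ?Bs"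
  have lenL: "length linear_factors = 5" by (simp add: linear_factors_def)
  have len: "length Bs = r + 4" using r2 by (simp add: Bs_def lenL)
  have F: "length (gl fs l) = snd (Bs ! l) \<and> snd (Bs ! l) * (if l = 4 then 2 else 1) = (if l < 4 then 1 else 2) \<and>
      (\<forall>f\<in>set (gl fs l). im f \<sim>\<^sub>i fst (Bs ! l)) \<and> complex_torus (fst (Bs ! l))" if l: "l < r + 4" for l
  proof (cases "l < 5")
    case True
    then have "Bs ! l = (linear_factors ! l, 1)" by (simp add: Bs_def nth_append lenL)
    then show ?thesis using linear_factors_isogenous[OF True] True by (simp add: gl_def)
  next
    case False
    define k where "k = r + 4 - l"
    have k: "1 \<le> k" "k < r" "r + 1 - k = 2 + (l - 5)" "2 \<le> r + 1 - k" "r + 1 - k < r + 1" using False l by (auto simp: k_def)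
    have "Bs ! l = (B (r + 1 - k), 2)" using False l unfolding k(3) by (simp add: Bs_def nth_append lenL del: upt_Suc)
    then show ?thesis using False B[OF k(1,2)] Bt[OF k(4,5)] two by (simp add: gl_def k_def[symmetric])
  qed
  let ?P = "\<lambda>f Y. im f \<sim>\<^sub>i Y \<and> complex_torus Y"
  have "list_all2 (list_all2 ?P) (map (gl fs) [0..<r + 4]) (map (\<lambda>(B, m). replicate m B) Bs)"
    unfolding list_all2_conv_all_nth using F len by (auto simp: split_def simp del: upt_Suc)
  then have "list_all2 ?P (concat (map (gl fs) [0..<r + 4])) (concat (map (\<lambda>(B, m). replicate m B) Bs))"
    by (rule list_all2_concat)
  then have "A \<sim>\<^sub>i prod_torus (concat (map (\<lambda>(B, m). replicate m B) Bs))"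
    by (rule orthogonal_decomposition[OF gl_sorted[OF tt_props sp] gl_sum[OF tt_props sp]])
  moreover obtain Ws where W: "rational_irreps G Ws" "length Ws = r + 4" "\<forall>l<r + 4. \<forall>V. associated G (Ws ! l) V \<longrightarrow>
      fst V = (if l < 4 then 1 else 2) \<and> central_idempotent G V = ee l \<and> schur_index G (Ws ! l) V = (if l = 4 then 2 else 1)"
    using quat_irreps[OF tt_props] by blast
  have "snd (Bs ! l) * schur_index G (Ws ! l) V = fst V \<and>
      (\<exists>fs. length fs = snd (Bs ! l) \<and> (\<forall>f\<in>set fs. primitive_idempotent G f) \<and>
        (\<forall>i<length fs. \<forall>j<length fs. i \<noteq> j \<longrightarrow> ga_orthogonal G (fs ! i) (fs ! j)) \<and>
        central_idempotent G V = (\<lambda>g. \<Sum>f\<leftarrow>fs. f g) \<and> (\<forall>f\<in>set fs. ga_image A G f \<sim>\<^sub>i fst (Bs ! l)))"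
    if l: "l < r + 4" "associated G (Ws ! l) V" for l V
  proof (intro conjI exI[of _ "gl fs l"])
    note g = gl_props[OF tt_props sp l(1)]
    have w: "fst V = (if l < 4 then 1 else 2)" "central_idempotent G V = ee l" "schur_index G (Ws ! l) V = (if l = 4 then 2 else 1)"
      using W(3) l by blast+
    show "snd (Bs ! l) * schur_index G (Ws ! l) V = fst V" unfolding w using F[OF l(1)] by blast
    show "length (gl fs l) = snd (Bs ! l)" using F[OF l(1)] by blast
    show "\<forall>f\<in>set (gl fs l). primitive_idempotent G f" using g(1) by blast
    show "central_idempotent G V = (\<lambda>g. \<Sum>f\<leftarrow>gl fs l. f g)" unfolding w by (rule g(4))
    show "\<forall>i<length (gl fs l). \<forall>j<length (gl fs l). i \<noteq> j \<longrightarrow> ga_orthogonal G (gl fs l ! i) (gl fs l ! j)"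
    proof (intro allI impI)
      fix i j assume ij: "i < length (gl fs l)" "j < length (gl fs l)" "i \<noteq> j"
      have "i < j \<or> j < i" using ij(3) by linarith
      then show "ga_orthogonal G (gl fs l ! i) (gl fs l ! j)"
        using g(3) ij(1,2) unfolding sorted_wrt_iff_nth_less ga_orthogonal_def by blast
    qed
    show "\<forall>f\<in>set (gl fs l). ga_image A G f \<sim>\<^sub>i fst (Bs ! l)"
    proof
      fix f assume f: "f \<in> set (gl fs l)"
      have "f \<in> group_alg G" using g(1)[OF f] by (simp add: primitive_idempotent_def ga_idempotent_def)
      then show "ga_image A G f \<sim>\<^sub>i fst (Bs ! l)" using F[OF l(1)] f by (simp add: ga_image_eq)
    qed
  qed
  ultimately show ?thesis unfolding group_algebra_decomposition_def Bs_def[symmetric] using W(1,2) len by auto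
qed

text \<open>\<open>fn\<close> is by definition the difference of averages for this Prym variety, and
  conjugation by x^(N/2) carries its image to that of \<open>twist\<close>.\<close>

lemma fn_Prym:
  assumes k: "1 \<le> k" "k < r" and f: "f = fn (2 ^ k) \<or> f = twist (2 ^ k)"
  shows "im f \<sim>\<^sub>i Prym (AA (hh (2 * 2 ^ k))) (AA (hh (2 ^ k)))"
    and "complex_torus (Prym (AA (hh (2 * 2 ^ k))) (AA (hh (2 ^ k))))"
proof -
  define N :: nat where "N = 2 ^ k"
  have N: "2 * N dvd h" unfolding N_def by (rule pow_dvd(2)[OF k(2)])
  have Nd: "N dvd h" using N dvd_mult_right by blast
  note P = Prym_isogenous[OF subgroup_hh[OF N] subgroup_hh[OF Nd] nested(2), folded fn_def]
  have dN: "N dvd 2 * N" by simp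
  define g where "g = el (int (N div 2)) False"
  have g: "g \<in> carrier G" "inv g = el (- int (N div 2)) False" by (simp_all add: g_def el_inv)
  have t: "twist N = delta g \<star> (fn N \<star> delta (inv g))" unfolding twist_def g(2) unfolding g_def ..
  show ct: "complex_torus (Prym (AA (hh (2 * 2 ^ k))) (AA (hh (2 ^ k))))" using P(2)[OF dN] by (simp add: N_def)
  have fP: "im (fn N) \<sim>\<^sub>i Prym (AA (hh (2 * N))) (AA (hh N))" by (rule P(1)[OF dN])
  have tf: "im (twist N) \<sim>\<^sub>i im (fn N)"
    using conjugate_image[OF inv_closed[OF g(1)], of "twist N"] ga_assoc delta_mult
  proof -
    have "delta (inv g) \<star> (twist N \<star> delta (inv (inv g))) = (delta (inv g) \<star> delta g) \<star> (fn N \<star> (delta (inv g) \<star> delta g))"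
      unfolding t using g(1) by (simp add: ga_assoc)
    also have "\<dots> = fn N" using g(1) by (simp add: delta_mult delta_one fn_closed)
    finally show ?thesis using conjugate_image[OF inv_closed[OF g(1)], of "twist N"] by simp
  qed
  show "im f \<sim>\<^sub>i Prym (AA (hh (2 * 2 ^ k))) (AA (hh (2 ^ k)))"
    using f fP isogenous_trans[OF im_torus(2) im_torus(2) complex_torus_fg[OF ct] tf[unfolded N_def] fP[unfolded N_def]]
    unfolding N_def by blast
qed

lemma group_algebra_H:
  assumes sp: "splitting (\<lambda>N. [fn N, twist N])"
  shows "group_algebra_decomposition A G (map (\<lambda>F. (F, 1)) linear_factors @
    map (\<lambda>j. (Prym (AA (hh (2 ^ (r + 2 - j)))) (AA (hh (2 ^ (r + 2 - (j + 1))))), 2)) [2..<r + 1])"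
proof (rule group_algebra[OF sp])
  show "im f \<sim>\<^sub>i Prym (AA (hh (2 ^ (r + 2 - (r + 1 - k))))) (AA (hh (2 ^ (r + 2 - (r + 1 - k + 1)))))"
    if "1 \<le> k" "k < r" "f \<in> set [fn (2 ^ k), twist (2 ^ k)]" for k f
  proof -
    have "r + 2 - (r + 1 - k) = Suc k" "r + 2 - (r + 1 - k + 1) = k" using that by auto
    then show ?thesis using fn_Prym(1)[OF that(1,2), of f] that(3) by simp
  qed
  show "complex_torus (Prym (AA (hh (2 ^ (r + 2 - j)))) (AA (hh (2 ^ (r + 2 - (j + 1))))))" if "2 \<le> j" "j < r + 1" for j
  proof -
    have k: "1 \<le> r + 1 - j" "r + 1 - j < r" "r + 2 - j = Suc (r + 1 - j)" "r + 2 - (j + 1) = r + 1 - j" using that by auto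
    show ?thesis unfolding k(3,4) power_Suc using fn_Prym(2)[OF k(1,2) disjI1[OF HOL.refl]] by simp
  qed
qed simp

end

context quat_action
begin

interpretation swap: quat_action A H G x "x \<otimes> y" r
  by (intro quat_action.intro swap_generator) unfold_locales

text \<open>The factors of multiplicity one stay those of the original generators; only the
  splitting of the dihedral blocks comes from x and x y.\<close>

lemma group_algebra_Ht:
  "group_algebra_decomposition A G (map (\<lambda>F. (F, 1)) linear_factors @
    map (\<lambda>j. (Prym (AA (quat.hh G x (x \<otimes> y) (2 ^ (r + 2 - j)))) (AA (quat.hh G x (x \<otimes> y) (2 ^ (r + 2 - (j + 1))))), 2)) [2..<r + 1])"
proof (rule group_algebra[OF swap_splitting])
  show "im f \<sim>\<^sub>i Prym (AA (swap.hh (2 ^ (r + 2 - (r + 1 - k))))) (AA (swap.hh (2 ^ (r + 2 - (r + 1 - k + 1)))))"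
    if "1 \<le> k" "k < r" "f \<in> set [swap.fn (2 ^ k), swap.twist (2 ^ k)]" for k f
  proof -
    have "r + 2 - (r + 1 - k) = Suc k" "r + 2 - (r + 1 - k + 1) = k" using that by auto
    then show ?thesis using swap.fn_Prym(1)[OF that(1,2), of f] that(3) by simp
  qed
  show "complex_torus (Prym (AA (swap.hh (2 ^ (r + 2 - j)))) (AA (swap.hh (2 ^ (r + 2 - (j + 1))))))" if "2 \<le> j" "j < r + 1" for j
  proof -
    have k: "1 \<le> r + 1 - j" "r + 1 - j < r" "r + 2 - j = Suc (r + 1 - j)" "r + 2 - (j + 1) = r + 1 - j" using that by auto
    show ?thesis unfolding k(3,4) power_Suc using swap.fn_Prym(2)[OF k(1,2) disjI1[OF HOL.refl]] by simp
  qed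
qed simp

lemma swap_H_sub: "n = r + 2 \<Longrightarrow> j \<ge> 2 \<Longrightarrow> Ht_sub G x y n j = swap.hh (2 ^ (n - j))"
  using swap.H_sub_eq[of n j] unfolding H_sub_def Ht_sub_def by simp

text \<open>Translates the subgroups of the theorem, numbered by the exponent of 2 in the order of
  the group, into \<open>kk\<close> and \<open>hh\<close>, which are indexed by a power of
  x.\<close>

lemma decompositions:
  assumes n: "n = r + 2"
  defines "K \<equiv> K_sub G x n" and "HH \<equiv> H_sub G x y n" and "Ht \<equiv> Ht_sub G x y n"
  shows "isotypical_decomposition A G
      ([AA (carrier G), Prym (AA (K n)) (AA (carrier G)), Prym (AA (HH (n - 1))) (AA (carrier G)),
        Prym (AA (Ht (n - 1))) (AA (carrier G)), Prym A (AA (K 2))]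
       @ map (\<lambda>i. Prym (AA (K i)) (AA (K (i + 1)))) [2..<n - 1])" (is ?A)
    and "group_algebra_decomposition A G
      ([(AA (carrier G), 1), (Prym (AA (K n)) (AA (carrier G)), 1), (Prym (AA (HH (n - 1))) (AA (carrier G)), 1),
        (Prym (AA (Ht (n - 1))) (AA (carrier G)), 1), (Prym A (AA (K 2)), 1)]
       @ map (\<lambda>j. (Prym (AA (HH j)) (AA (HH (j + 1))), 2)) [2..<n - 1])" (is ?B)
    and "group_algebra_decomposition A G
      ([(AA (carrier G), 1), (Prym (AA (K n)) (AA (carrier G)), 1), (Prym (AA (HH (n - 1))) (AA (carrier G)), 1),
        (Prym (AA (Ht (n - 1))) (AA (carrier G)), 1), (Prym A (AA (K 2)), 1)]
       @ map (\<lambda>j. (Prym (AA (Ht j)) (AA (Ht (j + 1))), 2)) [2..<n - 1])" (is ?C)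
proof -
  have r1: "n - 1 \<ge> 2" "n - (n - 1) = 1" "n - n = 0" "n - 2 = r" "n - 1 = r + 1" using n r2 by auto
  have K: "K i = kk (2 ^ (n - i))" for i unfolding K_def by (rule K_sub_eq)
  have HH: "HH j = hh (2 ^ (n - j))" if "j \<ge> 2" for j unfolding HH_def by (rule H_sub_eq[OF n that])
  have Ht: "Ht j = swap.hh (2 ^ (n - j))" if "j \<ge> 2" for j unfolding Ht_def by (rule swap_H_sub[OF n that])
  have L: "[AA (carrier G), Prym (AA (K n)) (AA (carrier G)), Prym (AA (HH (n - 1))) (AA (carrier G)),
        Prym (AA (Ht (n - 1))) (AA (carrier G)), Prym A (AA (K 2))] = linear_factors"
    unfolding K HH[OF r1(1)] Ht[OF r1(1)] r1(2,3,4) power_0 power_one_right swap_hh linear_factors_def h_def ..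
  have L': "[(AA (carrier G), 1), (Prym (AA (K n)) (AA (carrier G)), 1), (Prym (AA (HH (n - 1))) (AA (carrier G)), 1),
        (Prym (AA (Ht (n - 1))) (AA (carrier G)), 1), (Prym A (AA (K 2)), 1)] = map (\<lambda>F. (F, 1::nat)) linear_factors"
    unfolding L[symmetric] by simp
  show ?A
    using isotypical unfolding L unfolding K r1(5) unfolding n .
  have m1: "map (\<lambda>j. (Prym (AA (HH j)) (AA (HH (j + 1))), 2::nat)) [2..<n - 1] =
      map (\<lambda>j. (Prym (AA (hh (2 ^ (r + 2 - j)))) (AA (hh (2 ^ (r + 2 - (j + 1))))), 2)) [2..<r + 1]"
    unfolding r1(5)
  proof (rule map_cong[OF HOL.refl])
    fix j assume "j \<in> set [2..<r + 1]"
    then have "j \<ge> 2" by (simp del: upt_Suc)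
    then show "(Prym (AA (HH j)) (AA (HH (j + 1))), 2::nat) =
        (Prym (AA (hh (2 ^ (r + 2 - j)))) (AA (hh (2 ^ (r + 2 - (j + 1))))), 2)"
      by (simp add: HH n)
  qed
  have m2: "map (\<lambda>j. (Prym (AA (Ht j)) (AA (Ht (j + 1))), 2::nat)) [2..<n - 1] =
      map (\<lambda>j. (Prym (AA (swap.hh (2 ^ (r + 2 - j)))) (AA (swap.hh (2 ^ (r + 2 - (j + 1))))), 2)) [2..<r + 1]"
    unfolding r1(5)
  proof (rule map_cong[OF HOL.refl])
    fix j assume "j \<in> set [2..<r + 1]"
    then have "j \<ge> 2" by (simp del: upt_Suc)
    then show "(Prym (AA (Ht j)) (AA (Ht (j + 1))), 2::nat) =
        (Prym (AA (swap.hh (2 ^ (r + 2 - j)))) (AA (swap.hh (2 ^ (r + 2 - (j + 1))))), 2)"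
      by (simp add: Ht n)
  qed
  show ?B
    unfolding L' m1 by (rule group_algebra_H[OF splitting_fn])
  show ?C
    unfolding L' m2 by (rule group_algebra_Ht)
qed

end

theorem theorem1:
  fixes n :: nat
    and A :: "'v::complex_vs torus"
    and \<G> :: "('v \<Rightarrow> 'v) set"
    and \<phi> :: "(qgen \<times> bool) list set \<Rightarrow> ('v \<Rightarrow> 'v)"
  defines "G \<equiv> (aut_group A) \<lparr>carrier := \<G>\<rparr>"
  defines "x \<equiv> \<phi> (quat_x n)"
    and "y \<equiv> \<phi> (quat_y n)"
  defines "K \<equiv> K_sub G x n"
    and "H \<equiv> H_sub G x y n"
    and "Ht \<equiv> Ht_sub G x y n"
  defines "AA \<equiv> sub_image A G"
  assumes "n \<ge> 4"
    and "abelian_variety A"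
    and "subgroup \<G> (aut_group A)" and "finite \<G>"
    and "\<phi> \<in> iso (quat_group n) G"
  shows "isotypical_decomposition A G
      ([AA (carrier G),
        Prym (AA (K n)) (AA (carrier G)),
        Prym (AA (H (n - 1))) (AA (carrier G)),
        Prym (AA (Ht (n - 1))) (AA (carrier G)),
        Prym A (AA (K 2))]
       @ map (\<lambda>i. Prym (AA (K i)) (AA (K (i + 1)))) [2..<n - 1]) \<and>
    group_algebra_decomposition A G
      ([(AA (carrier G), 1),
        (Prym (AA (K n)) (AA (carrier G)), 1),
        (Prym (AA (H (n - 1))) (AA (carrier G)), 1),
        (Prym (AA (Ht (n - 1))) (AA (carrier G)), 1),
        (Prym A (AA (K 2)), 1)]
       @ map (\<lambda>j. (Prym (AA (H j)) (AA (H (j + 1))), 2)) [2..<n - 1]) \<and>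
    group_algebra_decomposition A G
      ([(AA (carrier G), 1),
        (Prym (AA (K n)) (AA (carrier G)), 1),
        (Prym (AA (H (n - 1))) (AA (carrier G)), 1),
        (Prym (AA (Ht (n - 1))) (AA (carrier G)), 1),
        (Prym A (AA (K 2)), 1)]
       @ map (\<lambda>j. (Prym (AA (Ht j)) (AA (Ht (j + 1))), 2)) [2..<n - 1])"
proof -
  obtain P where P: "complex_torus A" "polarization A P" using assms(9) by (auto simp: abelian_variety_def)
  have sub: "\<G> \<subseteq> carrier (aut_group A)" by (rule subgroup.subset[OF assms(10)])
  have carr: "carrier G = \<G>" by (simp add: G_def)
  have grp: "group G" unfolding G_def by (rule subgroup.subgroup_is_group[OF assms(10) group_aut_group[OF P(1)]])
  have Bij: "g \<in> Bij (cover A)" "torus_hom A A g" if "g \<in> carrier G" for g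
    using that sub unfolding carr by (auto simp: aut_group_def)
  have q: "quat G x y (n - 2)"
    unfolding x_def y_def using quat_of_presentation[OF grp _ assms(8,12)] assms(11) carr by simp
  have "quat_action A P G x y (n - 2)"
  proof (intro quat_action.intro torus_action.intro torus_action_axioms.intro q)
    show "polarized_torus A P" by (rule polarized_torus.intro[OF P])
    show "fin_group G" by (rule quat.axioms(1)[OF q])
    show "torus_hom A A g" if "g \<in> carrier G" for g by (rule Bij(2)[OF that])
    show "(g \<otimes>\<^bsub>G\<^esub> k) v = g (k v)" if "g \<in> carrier G" "k \<in> carrier G" "v \<in> cover A" for g k v
      using Bij(1)[OF that(1)] Bij(1)[OF that(2)] that(3) by (simp add: G_def aut_group_def BijGroup_def compose_def)
    show "\<one>\<^bsub>G\<^esub> v = v" if "v \<in> cover A" for v using that by (simp add: G_def aut_group_def BijGroup_def)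
  qed
  moreover have "n = n - 2 + 2" using assms(8) by simp
  ultimately show ?thesis
    unfolding K_def H_def Ht_def AA_def using quat_action.decompositions[of A P G x y "n - 2" n] by blast
qed

end
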